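(* Suppose the dyadic array satisfies the sampling scheme described in the context. Let $\mathcal F$ be a pointwise measurable VC-type class of measurable real functions of a dyadic observation, with envelope $F$ satisfying $PF^2<\infty$. Then $$\mathbb G_n=\{\sqrt n(\mathbb P_nf-Pf):f\in\mathcal F\}\rightsquigarrow\mathbb G=\{\mathbb G(f):f\in\mathcal F\}\quad\text{in }\ell^\infty(\mathcal F),$$ where $\mathbb G$ is a centered tight Gaussian process with covariance $$E[\mathbb G(f)\mathbb G(g)]=4\operatorname{Cov}\big(E[f(Z_{12})\mid U_1],E[g(Z_{12})\mid U_1]\big),\qquad f,g\in\mathcal F.$$
   Context: Sampling: node variables $(U_i)_{i\ge1}$ are i.i.d., dyad variables $(U_{ij})_{i<j}$ are i.i.d., and all of these are mutually independent. For $i<j$, $Z_{ij}=(Y_{ij},X_{ij}')'=\tau(U_i,U_j,U_{ij})$ with $\tau$ measurable and symmetric in its first two arguments, $Y_{ij}$ real and $X_{ij}\in\mathcal X\subset\mathbb R^d$ a compact rectangle. One observes $Z_{ij}$, $1\le i<j\le n$; $N_n=n(n-1)/2$; $\mathbb P_nf=N_n^{-1}\sum_{i<j}f(Z_{ij})$; $Pf=E[f(Z_{12})]$. $\mathcal F$ is VC type with envelope $F$ if $|f|\le F$ for all $f\in\mathcal F$ and there are finite constants $A,v$ with $\sup_Q N(\epsilon\|F\|_{Q,2},\mathcal F,L_2(Q))\le (A/\epsilon)^v$ for all $0<\epsilon\le1$, the supremum being over probability measures $Q$ (with $0<\|F\|_{Q,2}<\infty$), $\|f\|_{Q,2}=(Q|f|^2)^{1/2}$,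 $N$ denoting covering numbers. $\mathcal F$ is pointwise measurable if it has a countable subclass such that each $f\in\mathcal F$ is a pointwise limit of a sequence from it. $\ell^\infty(\mathcal F)$ is the space of bounded real functions on $\mathcal F$ with sup norm; $\rightsquigarrow$ is weak convergence (Hoffmann-Jørgensen sense). *)

theory Defs
  imports "HOL-Probability.Probability"
begin

section \<open>Dyadic sampling\<close>

text \<open>Values of one dyadic observation \<open>(Y, X)\<close>: the measurable space \<open>\<real> \<times> [lo, hi]\<close>,
  where \<^term>\<open>cbox lo hi\<close> is the compact rectangle.\<close>

definition obs_space :: "(real^'d) \<Rightarrow> (real^'d) \<Rightarrow> (real \<times> (real^'d)) measure" where
  "obs_space lo hi = restrict_space borel (UNIV \<times> cbox lo hi)"

text \<open>Node variables \<open>U i\<close> are used for \<open>i \<ge> 1\<close> and dyad variables \<open>V i j\<close> for \<open>1 \<le> i < j\<close>.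
  The two families may take values in different types, so their joint independence is
  expressed through the generated families of events rather than through
  \<^const>\<open>prob_space.indep_vars\<close>, which wants a single value type.\<close>

definition dyad_index :: "(nat \<times> nat) set" where
  "dyad_index = {(i, j). 1 \<le> i \<and> i < j}"

definition variable_events ::
  "'w measure \<Rightarrow> 'u measure \<Rightarrow> 'v measure \<Rightarrow> (nat \<Rightarrow> 'w \<Rightarrow> 'u) \<Rightarrow> (nat \<Rightarrow> nat \<Rightarrow> 'w \<Rightarrow> 'v)
     \<Rightarrow> nat + nat \<times> nat \<Rightarrow> 'w set set" where
  "variable_events M SU SV U V k =
     (case k of
        Inl i \<Rightarrow> {U i -` A \<inter> space M | A. A \<in> sets SU}
      | Inr (i, j) \<Rightarrow> {V i j -` A \<inter> space M | A. A \<in> sets SV})"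

definition dyadic_sampling ::
  "'w measure \<Rightarrow> 'u measure \<Rightarrow> 'v measure \<Rightarrow> (nat \<Rightarrow> 'w \<Rightarrow> 'u) \<Rightarrow> (nat \<Rightarrow> nat \<Rightarrow> 'w \<Rightarrow> 'v)
     \<Rightarrow> ('u \<Rightarrow> 'u \<Rightarrow> 'v \<Rightarrow> real \<times> (real^'d)) \<Rightarrow> (real^'d) \<Rightarrow> (real^'d) \<Rightarrow> bool" where
  "dyadic_sampling M SU SV U V \<tau> lo hi \<longleftrightarrow>
     prob_space M \<and>
     (\<forall>i\<ge>1. U i \<in> measurable M SU) \<and>
     (\<forall>(i, j)\<in>dyad_index. V i j \<in> measurable M SV) \<and>
     (\<forall>i\<ge>1. distr M SU (U i) = distr M SU (U 1)) \<and>
     (\<forall>(i, j)\<in>dyad_index. distr M SV (V i j) = distr M SV (V 1 2)) \<and>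
     prob_space.indep_sets M (variable_events M SU SV U V) (Inl ` {1..} \<union> Inr ` dyad_index) \<and>
     (\<lambda>(u, u', v). \<tau> u u' v) \<in> measurable (SU \<Otimes>\<^sub>M SU \<Otimes>\<^sub>M SV) (obs_space lo hi) \<and>
     (\<forall>u\<in>space SU. \<forall>u'\<in>space SU. \<forall>v\<in>space SV. \<tau> u u' v = \<tau> u' u v)"

definition dyad_obs ::
  "(nat \<Rightarrow> 'w \<Rightarrow> 'u) \<Rightarrow> (nat \<Rightarrow> nat \<Rightarrow> 'w \<Rightarrow> 'v) \<Rightarrow> ('u \<Rightarrow> 'u \<Rightarrow> 'v \<Rightarrow> 'z)
     \<Rightarrow> nat \<Rightarrow> nat \<Rightarrow> 'w \<Rightarrow> 'z" where
  "dyad_obs U V \<tau> i j \<omega> = \<tau> (U i \<omega>) (U j \<omega>) (V i j \<omega>)"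

definition dyadic_mean :: "(nat \<Rightarrow> nat \<Rightarrow> 'w \<Rightarrow> 'z) \<Rightarrow> nat \<Rightarrow> ('z \<Rightarrow> real) \<Rightarrow> 'w \<Rightarrow> real" where
  "dyadic_mean Z n f \<omega> =
     (\<Sum>(i, j) | 1 \<le> i \<and> i < j \<and> j \<le> n. f (Z i j \<omega>)) / (real n * (real n - 1) / 2)"

definition pop_mean :: "'w measure \<Rightarrow> (nat \<Rightarrow> nat \<Rightarrow> 'w \<Rightarrow> 'z) \<Rightarrow> ('z \<Rightarrow> real) \<Rightarrow> real" where
  "pop_mean M Z f = (\<integral>\<omega>. f (Z 1 2 \<omega>) \<partial>M)"

definition dyadic_process ::
  "'w measure \<Rightarrow> (nat \<Rightarrow> nat \<Rightarrow> 'w \<Rightarrow> 'z) \<Rightarrow> ('z \<Rightarrow> real) set \<Rightarrow> nat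
     \<Rightarrow> 'w \<Rightarrow> ('z \<Rightarrow> real) \<Rightarrow> real" where
  "dyadic_process M Z \<F> n \<omega> = (\<lambda>f\<in>\<F>. sqrt (real n) * (dyadic_mean Z n f \<omega> - pop_mean M Z f))"

definition covariance :: "'w measure \<Rightarrow> ('w \<Rightarrow> real) \<Rightarrow> ('w \<Rightarrow> real) \<Rightarrow> real" where
  "covariance M X Y =
     (\<integral>\<omega>. (X \<omega> - (\<integral>\<omega>'. X \<omega>' \<partial>M)) * (Y \<omega> - (\<integral>\<omega>'. Y \<omega>' \<partial>M)) \<partial>M)"

text \<open>Conditional expectation given the sub-\<open>\<sigma>\<close>-algebra generated by \<open>T\<close>.\<close>

definition cond_exp_given ::
  "'w measure \<Rightarrow> 'u measure \<Rightarrow> ('w \<Rightarrow> 'u) \<Rightarrow> ('w \<Rightarrow> real) \<Rightarrow> 'w \<Rightarrow> real" where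
  "cond_exp_given M SU T X = real_cond_exp M (vimage_algebra (space M) T SU) X"


section \<open>Function classes\<close>

definition pointwise_measurable_class :: "'z measure \<Rightarrow> ('z \<Rightarrow> real) set \<Rightarrow> bool" where
  "pointwise_measurable_class S \<F> \<longleftrightarrow>
     (\<exists>\<G>\<subseteq>\<F>. countable \<G> \<and>
        (\<forall>f\<in>\<F>. \<exists>g :: nat \<Rightarrow> 'z \<Rightarrow> real.
           range g \<subseteq> \<G> \<and> (\<forall>z\<in>space S. (\<lambda>m. g m z) \<longlonglongrightarrow> f z)))"

definition L2_funs :: "'z measure \<Rightarrow> ('z \<Rightarrow> real) set" where
  "L2_funs Q = {g \<in> borel_measurable Q. integrable Q (\<lambda>z. (g z)\<^sup>2)}"

definition L2_norm :: "'z measure \<Rightarrow> ('z \<Rightarrow> real) \<Rightarrow> real" where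
  "L2_norm Q g = sqrt (\<integral>z. \<bar>g z\<bar>\<^sup>2 \<partial>Q)"

text \<open>The least number of open \<open>L\<^sub>2(Q)\<close>-balls of radius \<open>r\<close> that cover \<open>\<F>\<close>, \<open>\<infinity>\<close> if there is
  no finite cover. The centres need not belong to \<open>\<F>\<close>.\<close>

definition L2_covering_number :: "real \<Rightarrow> ('z \<Rightarrow> real) set \<Rightarrow> 'z measure \<Rightarrow> enat" where
  "L2_covering_number r \<F> Q =
     Inf {enat (card C) | C. finite C \<and> C \<subseteq> L2_funs Q \<and>
            (\<forall>f\<in>\<F>. \<exists>c\<in>C. L2_norm Q (\<lambda>z. f z - c z) < r)}"

text \<open>As the Bochner integral of a non-integrable function is \<open>0\<close>, the condition
  \<open>\<parallel>F\<parallel>\<^sub>Q < \<infinity>\<close> has to be the explicit \<^term>\<open>F \<in> L2_funs Q\<close>. The condition \<open>A > 0\<close> makes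
  the real power meaningful.\<close>

definition VC_type :: "'z measure \<Rightarrow> ('z \<Rightarrow> real) set \<Rightarrow> ('z \<Rightarrow> real) \<Rightarrow> bool" where
  "VC_type S \<F> F \<longleftrightarrow>
     F \<in> borel_measurable S \<and>
     (\<forall>f\<in>\<F>. \<forall>z\<in>space S. \<bar>f z\<bar> \<le> F z) \<and>
     (\<exists>A v :: real. 0 < A \<and>
        (\<forall>\<epsilon>. 0 < \<epsilon> \<and> \<epsilon> \<le> 1 \<longrightarrow>
           (SUP Q \<in> {Q. prob_space Q \<and> sets Q = sets S \<and> F \<in> L2_funs Q \<and> 0 < L2_norm Q F}.
              ereal_of_enat (L2_covering_number (\<epsilon> * L2_norm Q F) \<F> Q))
           \<le> ereal ((A / \<epsilon>) powr v)))"


section \<open>Weak convergence of possibly non-measurable maps\<close>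

text \<open>Bounded real functions on \<open>T\<close>, represented as functions that are \<^const>\<open>undefined\<close>
  outside \<open>T\<close>, with the supremum metric.\<close>

definition linf :: "'t set \<Rightarrow> ('t \<Rightarrow> real) metric" where
  "linf T = funspace T euclidean_metric"

definition borel_of_metric :: "'b metric \<Rightarrow> 'b measure" where
  "borel_of_metric m = sigma (mspace m) {S. openin (mtopology_of m) S}"

text \<open>Outer expectation. It is only used for bounded functions on a probability space, for
  which restricting the measurable majorants to integrable ones does not change the infimum.\<close>

definition outer_expectation :: "'w measure \<Rightarrow> ('w \<Rightarrow> real) \<Rightarrow> real" where
  "outer_expectation M T =
     Inf {\<integral>\<omega>. W \<omega> \<partial>M | W. integrable M W \<and> (\<forall>\<omega>\<in>space M. T \<omega> \<le> W \<omega>)}"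

definition HJ_weakly_converges ::
  "'b metric \<Rightarrow> 'w measure \<Rightarrow> (nat \<Rightarrow> 'w \<Rightarrow> 'b) \<Rightarrow> 'o measure \<Rightarrow> ('o \<Rightarrow> 'b) \<Rightarrow> bool" where
  "HJ_weakly_converges m M X N G \<longleftrightarrow>
     (\<forall>n. \<forall>\<omega>\<in>space M. X n \<omega> \<in> mspace m) \<and>
     G \<in> measurable N (borel_of_metric m) \<and>
     (\<forall>h :: 'b \<Rightarrow> real.
        continuous_map (mtopology_of m) euclideanreal h \<and> bounded (h ` mspace m) \<longrightarrow>
        (\<lambda>n. outer_expectation M (\<lambda>\<omega>. h (X n \<omega>))) \<longlonglongrightarrow> (\<integral>\<omega>. h (G \<omega>) \<partial>N))"


section \<open>Tight Gaussian processes\<close>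

definition tight_random_element :: "'b metric \<Rightarrow> 'o measure \<Rightarrow> ('o \<Rightarrow> 'b) \<Rightarrow> bool" where
  "tight_random_element m N G \<longleftrightarrow>
     G \<in> measurable N (borel_of_metric m) \<and>
     (\<forall>\<epsilon>>0. \<exists>K. compactin (mtopology_of m) K \<and>
        measure N (G -` K \<inter> space N) \<ge> 1 - \<epsilon>)"

text \<open>Point masses are normal laws with variance \<open>0\<close>.\<close>

definition normal_law :: "real measure \<Rightarrow> bool" where
  "normal_law L \<longleftrightarrow>
     (\<exists>\<mu>. L = return borel \<mu>) \<or>
     (\<exists>\<mu> \<sigma>. 0 < \<sigma> \<and> L = density lborel (\<lambda>x. ennreal (normal_density \<mu> \<sigma> x)))"

text \<open>A random vector is Gaussian if all linear combinations of its coordinates are normal.\<close>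

definition gaussian_process :: "'t set \<Rightarrow> 'o measure \<Rightarrow> ('o \<Rightarrow> 't \<Rightarrow> real) \<Rightarrow> bool" where
  "gaussian_process T N G \<longleftrightarrow>
     (\<forall>t\<in>T. (\<lambda>\<omega>. G \<omega> t) \<in> borel_measurable N) \<and>
     (\<forall>J c. finite J \<and> J \<subseteq> T \<longrightarrow> normal_law (distr N borel (\<lambda>\<omega>. \<Sum>t\<in>J. c t * G \<omega> t)))"

definition centered_process :: "'t set \<Rightarrow> 'o measure \<Rightarrow> ('o \<Rightarrow> 't \<Rightarrow> real) \<Rightarrow> bool" where
  "centered_process T N G \<longleftrightarrow> (\<forall>t\<in>T. (\<integral>\<omega>. G \<omega> t \<partial>N) = 0)"

end

theory Submission
  imports Defs
begin

text \<open>Hoeffding's projection writes \<open>sqrt n (P\<^sub>n f - P f)\<close> as \<open>2 / sqrt n\<close> times the sum of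
  \<open>E[f(Z\<^sub>1\<^sub>2) | U\<^sub>a] - P f\<close> over \<open>a \<le> n\<close>, plus a normalized sum of pairwise uncorrelated degenerate
  terms, whose second moment is \<open>O(1/n)\<close>. The classical central limit theorem for the first part
  therefore gives the finite-dimensional limits.

  For equicontinuity, the residue of \<open>i + j\<close> modulo \<open>n\<close> splits the dyads \<open>{i, j}\<close> into \<open>n\<close>
  matchings, and the observations on a matching are i.i.d. Symmetrization and chaining bound the
  increments over each matching by \<open>\<epsilon> sqrt n + B\<close>, and multiplying by
  \<open>n sqrt n / N\<^sub>n = O(1 / sqrt n)\<close> leaves a bound of order \<open>\<epsilon>\<close>.

  The limit is built from an i.i.d. normal sequence by a Cholesky factorization of the covariance
  along a countable union of finite nets. It is the uniform limit of its values on the nets, at a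
  geometric rate on Borel sets \<open>E k\<close> of probability close to 1, and hence continuous on them; inner
  regularity then gives tightness. Bounded Lipschitz test functions compare the process with its
  limit through the nets.\<close>

subsection \<open>Finite-dimensional convergence from characteristic functions\<close>

text \<open>Three obstacles shape the argument. The space of bounded functions is not separable in
  general and the process need not be measurable as a map into it. Everything is therefore reduced
  to finitely many coordinates, and an integrable majorant \<open>W\<close> of the approximation
  error stands in for a supremum that may fail to be measurable. The chaining radius of the
  increments is an empirical distance, hence random, and bounding its mean takes a second
  symmetrization, for squares. Only a second moment of the envelope is at hand, so the squares are
  cut off where the envelope exceeds \<open>K\<close>: the truncated part costs
  \<open>K * sqrt m\<close> against \<open>m\<close> observations and is of lower order, and the
  rest is a tail of the second moment. Dyads with a common node are dependent. The matchings lose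
  nothing against the rate, which is that of the \<open>n\<close> nodes and not that of the dyads.
  The polynomial covering bound is used only in the weaker form
  \<open>exp (C0 / \<epsilon>)\<close>: the square root of \<open>C0 / \<epsilon>\<close> is still
  integrable at 0, which is all that chaining needs.\<close>

inductive_set trig :: "nat \<Rightarrow> ((nat \<Rightarrow> real) \<Rightarrow> real) set" for k :: nat where
  cos: "(\<lambda>x. cos (\<Sum>i<k. c i * x i)) \<in> trig k"
| sin: "(\<lambda>x. sin (\<Sum>i<k. c i * x i)) \<in> trig k"
| scale: "f \<in> trig k \<Longrightarrow> (\<lambda>x. a * f x) \<in> trig k"
| add: "f \<in> trig k \<Longrightarrow> g \<in> trig k \<Longrightarrow> (\<lambda>x. f x + g x) \<in> trig k"

lemma trig_const: "(\<lambda>_. a) \<in> trig k"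
proof -
  have "(\<lambda>x. a * cos (\<Sum>i<k. 0 * x i)) \<in> trig k"
    by (rule trig.scale[OF trig.cos])
  then show ?thesis by simp
qed

lemma trig_uminus: "f \<in> trig k \<Longrightarrow> (\<lambda>x. - f x) \<in> trig k"
  using trig.scale[of f k "-1"] by simp

lemma trig_diff: "f \<in> trig k \<Longrightarrow> g \<in> trig k \<Longrightarrow> (\<lambda>x. f x - g x) \<in> trig k"
  using trig.add[of f k "\<lambda>x. - g x"] trig_uminus[of g k] by simp

lemma trig_linear_shift:
  fixes c d :: "nat \<Rightarrow> real"
  shows "(\<Sum>i<k. (c i + d i) * x i) = (\<Sum>i<k. c i * x i) + (\<Sum>i<k. d i * x i)"
    and "(\<Sum>i<k. (c i - d i) * x i) = (\<Sum>i<k. c i * x i) - (\<Sum>i<k. d i * x i)"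
  by (simp_all add: ring_distribs sum.distrib sum_subtractf)

lemma trig_mult_cos:
  assumes "g \<in> trig k"
  shows "(\<lambda>x. cos (\<Sum>i<k. c i * x i) * g x) \<in> trig k"
  using assms
proof induction
  case (cos d)
  have "(\<lambda>x. cos (\<Sum>i<k. c i * x i) * cos (\<Sum>i<k. d i * x i)) =
    (\<lambda>x. (1/2) * (cos (\<Sum>i<k. (c i - d i) * x i) + cos (\<Sum>i<k. (c i + d i) * x i)))"
    by (rule ext, subst cos_times_cos) (simp add: trig_linear_shift)
  then show ?case by (simp only: trig.intros)
next
  case (sin d)
  have "(\<lambda>x. cos (\<Sum>i<k. c i * x i) * sin (\<Sum>i<k. d i * x i)) =
    (\<lambda>x. (1/2) * (sin (\<Sum>i<k. (c i + d i) * x i) - sin (\<Sum>i<k. (c i - d i) * x i)))"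
    by (rule ext, subst cos_times_sin) (simp add: trig_linear_shift)
  then show ?case by (simp only: trig.intros trig_diff)
next
  case (scale f a)
  then show ?case using trig.scale[of "\<lambda>x. cos (\<Sum>i<k. c i * x i) * f x" k a]
    by (simp add: mult.left_commute)
next
  case (add f g)
  then show ?case using trig.add by (simp add: distrib_left)
qed

lemma trig_mult_sin:
  assumes "g \<in> trig k"
  shows "(\<lambda>x. sin (\<Sum>i<k. c i * x i) * g x) \<in> trig k"
  using assms
proof induction
  case (cos d)
  have "(\<lambda>x. sin (\<Sum>i<k. c i * x i) * cos (\<Sum>i<k. d i * x i)) =
    (\<lambda>x. (1/2) * (sin (\<Sum>i<k. (c i + d i) * x i) + sin (\<Sum>i<k. (c i - d i) * x i)))"
    by (rule ext, subst sin_times_cos) (simp add: trig_linear_shift)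
  then show ?case by (simp only: trig.intros)
next
  case (sin d)
  have "(\<lambda>x. sin (\<Sum>i<k. c i * x i) * sin (\<Sum>i<k. d i * x i)) =
    (\<lambda>x. (1/2) * (cos (\<Sum>i<k. (c i - d i) * x i) - cos (\<Sum>i<k. (c i + d i) * x i)))"
    by (rule ext, subst sin_times_sin) (simp add: trig_linear_shift)
  then show ?case by (simp only: trig.intros trig_diff)
next
  case (scale f a)
  then show ?case using trig.scale[of "\<lambda>x. sin (\<Sum>i<k. c i * x i) * f x" k a]
    by (simp add: mult.left_commute)
next
  case (add f g)
  then show ?case using trig.add by (simp add: distrib_left)
qed

text \<open>Together with \<open>trig_const\<close> this makes \<open>trig k\<close> an algebra.
  Products reduce to sums by the product-to-sum identities, which is why convergence of expectations
  has to be assumed for single cosines and sines only.\<close>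

lemma trig_mult: "f \<in> trig k \<Longrightarrow> g \<in> trig k \<Longrightarrow> (\<lambda>x. f x * g x) \<in> trig k"
proof (induction rule: trig.induct)
  case (scale f a)
  then show ?case using trig.scale[of "\<lambda>x. f x * g x" k a] by (simp add: mult.assoc)
next
  case (add f h)
  then show ?case using trig.add[of "\<lambda>x. f x * g x" k "\<lambda>x. h x * g x"] by (simp add: distrib_right)
qed (auto intro: trig_mult_cos trig_mult_sin)

lemma trig_continuous: "f \<in> trig k \<Longrightarrow> continuous_on UNIV f"
proof (induction rule: trig.induct)
  case (cos c)
  show ?case by (intro continuous_intros continuous_on_product_coordinates)
next
  case (sin c)
  show ?case by (intro continuous_intros continuous_on_product_coordinates)
qed (intro continuous_intros; assumption)+

lemma trig_bounded: "f \<in> trig k \<Longrightarrow> \<exists>B\<ge>0. \<forall>x. \<bar>f x\<bar> \<le> B"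
proof (induction rule: trig.induct)
  case (scale f a)
  then obtain B where "B \<ge> 0" "\<forall>x. \<bar>f x\<bar> \<le> B" by blast
  then show ?case by (intro exI[of _ "\<bar>a\<bar> * B"]) (auto simp: abs_mult mult_left_mono)
next
  case (add f g)
  then obtain B C where "B \<ge> 0" "\<forall>x. \<bar>f x\<bar> \<le> B" "C \<ge> 0" "\<forall>x. \<bar>g x\<bar> \<le> C" by blast
  then show ?case
    by (intro exI[of _ "B + C"]) (auto intro!: order_trans[OF abs_triangle_ineq] add_mono)
qed (auto intro!: exI[of _ 1])

text \<open>This lets \<open>trig_approx\<close> apply a polynomial cutoff without leaving the
  algebra.\<close>

lemma trig_compose_polynomial:
  assumes "real_polynomial_function (p :: real \<Rightarrow> real)" and g: "g \<in> trig k"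
  shows "(\<lambda>x. p (g x)) \<in> trig k"
  using assms(1)
proof induction
  case (linear f)
  then have "f y = f 1 * y" for y
    by (metis mult.commute mult.left_neutral real_bounded_linear)
  then have "(\<lambda>x. f (g x)) = (\<lambda>x. f 1 * g x)" by blast
  then show ?case using trig.scale[OF g] by simp
qed (auto intro: trig_const trig.add trig_mult)

lemma trig_separates:
  assumes "i < k" "x i \<noteq> y i"
  shows "\<exists>f\<in>trig k. f x \<noteq> f y"
proof -
  \<comment> \<open>This frequency makes the two phases differ by exactly 1. If cosine and sine
    agreed at both, the addition theorem would give \<open>cos 1 = 1\<close>, impossible since 1
    lies strictly between 0 and pi.\<close>
  define \<theta> where "\<theta> = 1 / (x i - y i)"
  have sum_eq: "(\<Sum>j<k. (if j = i then \<theta> else 0) * z j) = \<theta> * z i" for z :: "nat \<Rightarrow> real"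
    using assms(1) by (subst sum.remove[of _ i]) auto
  have diff: "\<theta> * x i = \<theta> * y i + 1"
    unfolding \<theta>_def using assms(2) by (simp add: field_simps)
  show ?thesis
  proof (rule ccontr)
    assume "\<not> ?thesis"
    then have eq: "\<And>f. f \<in> trig k \<Longrightarrow> f x = f y" by blast
    have c: "cos (\<theta> * y i + 1) = cos (\<theta> * y i)"
      using eq[OF trig.cos[of "\<lambda>j. if j = i then \<theta> else 0" k]] by (simp only: sum_eq diff)
    have s: "sin (\<theta> * y i + 1) = sin (\<theta> * y i)"
      using eq[OF trig.sin[of "\<lambda>j. if j = i then \<theta> else 0" k]] by (simp only: sum_eq diff)
    have "cos (1 :: real) = cos ((\<theta> * y i + 1) - \<theta> * y i)" by simp
    also have "\<dots> = 1" unfolding cos_diff c s using sin_cos_squared_add3 by (metis add.commute)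
    finally have "cos (1::real) = cos 0" by simp
    then show False using cos_inj_pi[of 1 0] pi_gt3 by simp
  qed
qed

text \<open>Stone-Weierstrass controls the approximant only on \<open>K\<close>, whereas the tail
  estimate needs a bound everywhere. Composing with a polynomial close to the clamp at
  \<open>B\<close> restores such a bound.\<close>

lemma trig_approx:
  fixes \<phi> :: "(nat \<Rightarrow> real) \<Rightarrow> real"
  assumes K: "compact K" and sup: "\<And>x i. x \<in> K \<Longrightarrow> i \<ge> k \<Longrightarrow> x i = 0"
    and \<phi>: "continuous_on UNIV \<phi>" "\<And>x. \<bar>\<phi> x\<bar> \<le> B" and e: "0 < e"
  shows "\<exists>g\<in>trig k. (\<forall>x\<in>K. \<bar>\<phi> x - g x\<bar> \<le> e) \<and> (\<forall>x. \<bar>g x\<bar> \<le> B + e)"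
proof -
  interpret R: function_ring_on "trig k" K
  proof
    show "\<exists>f\<in>trig k. f x \<noteq> f y" if xy: "x \<in> K" "y \<in> K" "x \<noteq> y" for x y
    proof -
      obtain i where "x i \<noteq> y i" using xy(3) by blast
      moreover have "i < k" using sup[OF xy(1)] sup[OF xy(2)] calculation by (metis not_le)
      ultimately show ?thesis using trig_separates by blast
    qed
  qed (auto intro: K trig.add trig_mult trig_const continuous_on_subset[OF trig_continuous])
  obtain g where g: "g \<in> trig k" "\<And>x. x \<in> K \<Longrightarrow> \<bar>\<phi> x - g x\<bar> < e/2"
    using R.Stone_Weierstrass_basic[of \<phi> "e/2"] continuous_on_subset[OF \<phi>(1)] e by (meson half_gt_zero subset_UNIV)
  \<comment> \<open>A trigonometric sum is globally bounded, so the clamp has to be approximated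
    only on \<open>{-C..C}\<close>.\<close>
  obtain C where C: "C \<ge> 0" "\<And>x. \<bar>g x\<bar> \<le> C" using trig_bounded[OF g(1)] by blast
  define clamp where "clamp = (\<lambda>t::real. max (-B) (min B t))"
  have "continuous_on {-C..C} clamp" unfolding clamp_def by (intro continuous_intros)
  then obtain p where p: "real_polynomial_function p" "\<And>t. t \<in> {-C..C} \<Longrightarrow> \<bar>clamp t - p t\<bar> < e/2"
    using Stone_Weierstrass_real_polynomial_function[of "{-C..C}" clamp "e/2"] e by auto
  have B: "B \<ge> 0" using \<phi>(2)[of undefined] by linarith
  have near: "\<bar>clamp (g x) - p (g x)\<bar> < e/2" for x
    using p(2)[of "g x"] C(2)[of x] by (simp add: abs_le_iff)
  show ?thesis
  proof (intro bexI[of _ "\<lambda>x. p (g x)"] conjI ballI allI)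
    fix x assume x: "x \<in> K"
    have "\<bar>\<phi> x - clamp (g x)\<bar> \<le> \<bar>\<phi> x - g x\<bar>"
      using \<phi>(2)[of x] unfolding clamp_def max_def min_def by (smt (verit))
    then show "\<bar>\<phi> x - p (g x)\<bar> \<le> e" using near[of x] g(2)[OF x] by linarith
  next
    fix x
    have "\<bar>clamp (g x)\<bar> \<le> B" using B unfolding clamp_def by auto
    then show "\<bar>p (g x)\<bar> \<le> B + e" using near[of x] e by linarith
  next
    show "(\<lambda>x. p (g x)) \<in> trig k" by (rule trig_compose_polynomial[OF p(1) g(1)])
  qed
qed

lemma compact_box_nat:
  "compact {x :: nat \<Rightarrow> real. (\<forall>i<k. \<bar>x i\<bar> \<le> R) \<and> (\<forall>i\<ge>k. x i = 0)}"
proof -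
  have "compactin (product_topology (\<lambda>i::nat. euclidean :: real topology) UNIV) (Pi\<^sub>E UNIV (\<lambda>i. if i < k then {-R..R} else {0}))"
    by (subst compactin_PiE) auto
  moreover have "Pi\<^sub>E UNIV (\<lambda>i. if i < k then {-R..R} else {0}) = {x :: nat \<Rightarrow> real. (\<forall>i<k. \<bar>x i\<bar> \<le> R) \<and> (\<forall>i\<ge>k. x i = 0)}"
    by (auto simp: PiE_iff abs_le_iff split: if_splits) (metis minus_le_iff not_le)+
  ultimately show ?thesis
    by (simp add: euclidean_product_topology)
qed

lemma (in prob_space) tail_prob_small:
  fixes Y :: "'a \<Rightarrow> real"
  assumes [measurable]: "Y \<in> borel_measurable M" and e: "0 < e"
  shows "\<exists>R0. \<forall>R\<ge>R0. prob {x \<in> space M. R < \<bar>Y x\<bar>} < e"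
proof -
  define A where "A = (\<lambda>n. {x \<in> space M. real n < \<bar>Y x\<bar>})"
  have [measurable]: "A n \<in> sets M" for n unfolding A_def by measurable
  have "(\<lambda>n. prob (A n)) \<longlonglongrightarrow> prob (\<Inter>n. A n)"
    by (rule finite_Lim_measure_decseq) (auto simp: A_def decseq_def)
  moreover have "(\<Inter>n. A n) = {}"
  proof -
    have "\<omega> \<notin> (\<Inter>n. A n)" for \<omega>
    proof -
      obtain n where "\<bar>Y \<omega>\<bar> < real n" using reals_Archimedean2 by blast
      then show ?thesis unfolding A_def by (auto intro!: exI[of _ n])
    qed
    then show ?thesis by blast
  qed
  ultimately have "eventually (\<lambda>n. prob (A n) < e) sequentially"
    using e by (intro order_tendstoD(2)[of "\<lambda>n. prob (A n)" 0]) auto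
  then obtain n where n: "prob (A n) < e" using eventually_sequentially by auto
  have "prob {x \<in> space M. R < \<bar>Y x\<bar>} < e" if "R \<ge> real n" for R
  proof -
    have "prob {x \<in> space M. R < \<bar>Y x\<bar>} \<le> prob (A n)"
      using that by (intro finite_measure_mono) (auto simp: A_def)
    then show ?thesis using n by simp
  qed
  then show ?thesis by blast
qed

lemma (in prob_space) chebyshev_tail:
  fixes Y :: "'a \<Rightarrow> real"
  assumes [measurable]: "Y \<in> borel_measurable M" and int: "integrable M (\<lambda>x. (Y x)\<^sup>2)"
    and B: "expectation (\<lambda>x. (Y x)\<^sup>2) \<le> B" and R: "0 < R"
  shows "prob {x \<in> space M. R < \<bar>Y x\<bar>} \<le> B / R\<^sup>2"
proof -
  have "prob {x \<in> space M. R < \<bar>Y x\<bar>} \<le> prob {x \<in> space M. R\<^sup>2 \<le> (Y x)\<^sup>2}"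
    using R by (intro finite_measure_mono) (auto simp: abs_le_square_iff[symmetric])
  also have "\<dots> \<le> expectation (\<lambda>x. (Y x)\<^sup>2) / R\<^sup>2"
    using R by (intro integral_Markov_inequality_measure[OF int, of "space M"]) auto
  also have "\<dots> \<le> B / R\<^sup>2" using B by (intro divide_right_mono) auto
  finally show ?thesis .
qed

lemma (in prob_space) expectation_diff_outside:
  fixes f g :: "'a \<Rightarrow> real"
  assumes [measurable]: "f \<in> borel_measurable M" "g \<in> borel_measurable M" "A \<in> sets M"
    and on: "\<And>x. x \<in> space M \<Longrightarrow> x \<notin> A \<Longrightarrow> \<bar>f x - g x\<bar> \<le> e"
    and bd: "\<And>x. x \<in> space M \<Longrightarrow> \<bar>f x\<bar> \<le> B" "\<And>x. x \<in> space M \<Longrightarrow> \<bar>g x\<bar> \<le> B" and e: "0 \<le> e"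
  shows "\<bar>expectation f - expectation g\<bar> \<le> e + 2 * B * prob A"
proof -
  have i: "integrable M f" "integrable M g"
    using bd by (auto intro!: integrable_const_bound[where B=B] AE_I2)
  have "\<bar>expectation f - expectation g\<bar> = \<bar>expectation (\<lambda>x. f x - g x)\<bar>"
    using i by (simp add: Bochner_Integration.integral_diff)
  also have "\<dots> \<le> expectation (\<lambda>x. \<bar>f x - g x\<bar>)" by (rule integral_abs_bound)
  also have "\<dots> \<le> expectation (\<lambda>x. e + 2 * B * indicator A x)"
  proof (rule integral_mono)
    show "integrable M (\<lambda>x. \<bar>f x - g x\<bar>)" using i by auto
    show "integrable M (\<lambda>x. e + 2 * B * indicator A x)"
      by (intro Bochner_Integration.integrable_add integrable_mult_right) (auto simp: emeasure_eq_measure)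
    show "\<bar>f x - g x\<bar> \<le> e + 2 * B * indicator A x" if "x \<in> space M" for x
      using on[OF that] bd(1)[OF that] bd(2)[OF that] e by (cases "x \<in> A") auto
  qed
  also have "\<dots> = e + 2 * B * prob A"
    by (subst Bochner_Integration.integral_add) (auto simp: emeasure_eq_measure prob_space)
  finally show ?thesis .
qed

lemma trig_expectation_converges:
  fixes X :: "nat \<Rightarrow> 'w \<Rightarrow> nat \<Rightarrow> real" and Y :: "'o \<Rightarrow> nat \<Rightarrow> real"
  assumes M: "prob_space M" and N: "prob_space N"
    and X[measurable]: "\<And>n. X n \<in> borel_measurable M" and Y[measurable]: "Y \<in> borel_measurable N"
    and cos: "\<And>c. (\<lambda>n. \<integral>\<omega>. cos (\<Sum>i<k. c i * X n \<omega> i) \<partial>M) \<longlonglongrightarrow> (\<integral>\<omega>. cos (\<Sum>i<k. c i * Y \<omega> i) \<partial>N)"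
    and sin: "\<And>c. (\<lambda>n. \<integral>\<omega>. sin (\<Sum>i<k. c i * X n \<omega> i) \<partial>M) \<longlonglongrightarrow> (\<integral>\<omega>. sin (\<Sum>i<k. c i * Y \<omega> i) \<partial>N)"
    and g: "g \<in> trig k"
  shows "(\<lambda>n. \<integral>\<omega>. g (X n \<omega>) \<partial>M) \<longlonglongrightarrow> (\<integral>\<omega>. g (Y \<omega>) \<partial>N)"
proof -
  interpret M: prob_space M by fact
  interpret N: prob_space N by fact
  have m: "g \<in> borel_measurable borel" if "g \<in> trig k" for g
    using trig_continuous[OF that] by (rule borel_measurable_continuous_onI)
  have int: "integrable M (\<lambda>\<omega>. g (X n \<omega>))" "integrable N (\<lambda>\<omega>. g (Y \<omega>))" if g: "g \<in> trig k" for g n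
  proof -
    obtain B where "\<forall>x. \<bar>g x\<bar> \<le> B" using trig_bounded[OF g] by blast
    then show "integrable M (\<lambda>\<omega>. g (X n \<omega>))" "integrable N (\<lambda>\<omega>. g (Y \<omega>))"
      using m[OF g] by (auto intro!: M.integrable_const_bound[where B=B] N.integrable_const_bound[where B=B]
          measurable_compose[OF X] measurable_compose[OF Y])
  qed
  show ?thesis
    using g
  proof induction
    case (scale f a)
    then show ?case by (auto intro!: tendsto_intros)
  next
    case (add f g)
    then show ?case using int[OF add.hyps(1)] int[OF add.hyps(2)] by (auto intro!: tendsto_intros)
  qed (use cos sin in auto)
qed

text \<open>A continuity theorem in several dimensions: Chebyshev gives tightness uniformly in
  \<open>n\<close>, and on a compact box \<open>\<phi>\<close> is close to a trigonometric sum,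
  whose expectations converge. Vectors are sequences vanishing from \<open>k\<close> on, so that one
  type serves all dimensions.\<close>

lemma weak_convergence_finite_dim:
  fixes X :: "nat \<Rightarrow> 'w \<Rightarrow> nat \<Rightarrow> real" and Y :: "'o \<Rightarrow> nat \<Rightarrow> real"
  assumes M: "prob_space M" and N: "prob_space N"
    and X[measurable]: "\<And>n. X n \<in> borel_measurable M" and Y[measurable]: "Y \<in> borel_measurable N"
    and supp: "\<And>n \<omega> i. k \<le> i \<Longrightarrow> X n \<omega> i = 0" "\<And>\<omega> i. k \<le> i \<Longrightarrow> Y \<omega> i = 0"
    and sq: "\<And>i. i < k \<Longrightarrow> \<exists>B. eventually (\<lambda>n. integrable M (\<lambda>\<omega>. (X n \<omega> i)\<^sup>2) \<and> (\<integral>\<omega>. (X n \<omega> i)\<^sup>2 \<partial>M) \<le> B) sequentially"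
    and cos: "\<And>c. (\<lambda>n. \<integral>\<omega>. cos (\<Sum>i<k. c i * X n \<omega> i) \<partial>M) \<longlonglongrightarrow> (\<integral>\<omega>. cos (\<Sum>i<k. c i * Y \<omega> i) \<partial>N)"
    and sin: "\<And>c. (\<lambda>n. \<integral>\<omega>. sin (\<Sum>i<k. c i * X n \<omega> i) \<partial>M) \<longlonglongrightarrow> (\<integral>\<omega>. sin (\<Sum>i<k. c i * Y \<omega> i) \<partial>N)"
    and \<phi>: "continuous_on UNIV \<phi>" "\<And>x. \<bar>\<phi> x :: real\<bar> \<le> B"
  shows "(\<lambda>n. \<integral>\<omega>. \<phi> (X n \<omega>) \<partial>M) \<longlonglongrightarrow> (\<integral>\<omega>. \<phi> (Y \<omega>) \<partial>N)"
proof (rule LIMSEQ_I)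
  fix e0 :: real assume e0: "0 < e0"
  interpret M: prob_space M by fact
  interpret N: prob_space N by fact
  have B: "B \<ge> 0" using \<phi>(2)[of undefined] by linarith
  have Xi[measurable]: "(\<lambda>\<omega>. X n \<omega> i) \<in> borel_measurable M" and Yi[measurable]: "(\<lambda>\<omega>. Y \<omega> i) \<in> borel_measurable N" for n i
    by (auto intro: measurable_product_then_coordinatewise)
  define e where "e = min 1 (e0 / 5)"
  have e: "0 < e" "e \<le> 1" "5 * e \<le> e0" using e0 unfolding e_def by auto
  \<comment> \<open>A union bound over the \<open>k\<close> coordinates leaves an exceptional event
    of probability at most \<open>k * p\<close>, which by \<open>kp\<close> costs at most another
    \<open>e\<close>.\<close>
  define p where "p = e / (2 * (B + 1)) / (real k + 1)"
  have p: "0 < p" unfolding p_def using e B by auto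
  have "\<forall>i. \<exists>C. i < k \<longrightarrow> eventually (\<lambda>n. integrable M (\<lambda>\<omega>. (X n \<omega> i)\<^sup>2) \<and> (\<integral>\<omega>. (X n \<omega> i)\<^sup>2 \<partial>M) \<le> C) sequentially"
    using sq by blast
  from choice[OF this] obtain C where C: "\<And>i. i < k \<Longrightarrow> eventually (\<lambda>n. integrable M (\<lambda>\<omega>. (X n \<omega> i)\<^sup>2) \<and> (\<integral>\<omega>. (X n \<omega> i)\<^sup>2 \<partial>M) \<le> C i) sequentially"
    by blast
  have "\<forall>i. \<exists>Q. \<forall>R\<ge>Q. N.prob {x \<in> space N. R < \<bar>Y x i\<bar>} < p"
    using N.tail_prob_small[OF Yi p] by blast
  from choice[OF this] obtain Q where Q: "\<And>i R. R \<ge> Q i \<Longrightarrow> N.prob {x \<in> space N. R < \<bar>Y x i\<bar>} < p" by blast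
  \<comment> \<open>Large enough for the tails of the limit (\<open>RQ\<close>) and, through
    Chebyshev, for those of \<open>X n\<close> (\<open>RC\<close>); the summand 1 gives
    \<open>R \<le> R\<^sup>2\<close>.\<close>
  define R where "R = 1 + (\<Sum>i<k. \<bar>Q i\<bar>) + (\<Sum>i<k. \<bar>C i\<bar> / p)"
  have R1: "R \<ge> 1" unfolding R_def using p by (auto intro!: add_nonneg_nonneg sum_nonneg)
  have RQ: "R \<ge> Q i" if "i < k" for i
  proof -
    have "\<bar>Q i\<bar> \<le> (\<Sum>i<k. \<bar>Q i\<bar>)" using that by (intro member_le_sum) auto
    moreover have "0 \<le> (\<Sum>i<k. \<bar>C i\<bar> / p)" using p by (intro sum_nonneg) auto
    ultimately show ?thesis unfolding R_def by linarith
  qed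
  have RC: "C i / R\<^sup>2 \<le> p" if "i < k" for i
  proof -
    have "\<bar>C i\<bar> / p \<le> (\<Sum>i<k. \<bar>C i\<bar> / p)" using that p by (intro member_le_sum[of i "{..<k}" "\<lambda>i. \<bar>C i\<bar> / p"]) auto
    moreover have "0 \<le> (\<Sum>i<k. \<bar>Q i\<bar>)" by (intro sum_nonneg) auto
    ultimately have "\<bar>C i\<bar> / p \<le> R" unfolding R_def by linarith
    also have "R \<le> R\<^sup>2" using R1 by (simp add: power2_eq_square)
    finally have "\<bar>C i\<bar> \<le> p * R\<^sup>2" using p by (simp add: field_simps)
    then have "C i \<le> p * R\<^sup>2" by linarith
    then show ?thesis using R1 by (simp add: field_simps)
  qed
  define K where "K = {x :: nat \<Rightarrow> real. (\<forall>i<k. \<bar>x i\<bar> \<le> R) \<and> (\<forall>i\<ge>k. x i = 0)}"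
  have K: "compact K" "\<And>x i. x \<in> K \<Longrightarrow> i \<ge> k \<Longrightarrow> x i = 0"
    unfolding K_def by (rule compact_box_nat) blast
  obtain g where g: "g \<in> trig k" "\<And>x. x \<in> K \<Longrightarrow> \<bar>\<phi> x - g x\<bar> \<le> e" "\<And>x. \<bar>g x\<bar> \<le> B + e"
  proof -
    have "\<exists>g\<in>trig k. (\<forall>x\<in>K. \<bar>\<phi> x - g x\<bar> \<le> e) \<and> (\<forall>x. \<bar>g x\<bar> \<le> B + e)"
      by (rule trig_approx[OF K(1)]) (fact K(2) \<phi> e(1))+
    then show thesis using that by blast
  qed
  have [measurable]: "g \<in> borel_measurable borel" "\<phi> \<in> borel_measurable borel"
    using trig_continuous[OF g(1)] \<phi>(1) by (auto intro: borel_measurable_continuous_onI)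
  have gB: "\<bar>g x\<bar> \<le> B + 1" "\<bar>\<phi> x\<bar> \<le> B + 1" for x using g(3)[of x] \<phi>(2)[of x] e(2) by linarith+
  have kp: "e + 2 * (B + 1) * (real k * p) \<le> 2 * e"
  proof -
    have "real k * p \<le> (real k + 1) * p" using p by (simp add: mult_right_mono)
    also have "(real k + 1) * p = e / (2 * (B + 1))"
      unfolding p_def by (subst times_divide_eq_right, rule nonzero_mult_div_cancel_left) linarith
    finally have "2 * (B + 1) * (real k * p) \<le> 2 * (B+1) * (e / (2 * (B + 1)))"
      using B by (intro mult_left_mono) auto
    then show ?thesis using B by simp
  qed
  have YN: "\<bar>(\<integral>\<omega>. \<phi> (Y \<omega>) \<partial>N) - (\<integral>\<omega>. g (Y \<omega>) \<partial>N)\<bar> \<le> 2 * e"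
  proof -
    let ?A = "\<Union>i<k. {x \<in> space N. R < \<bar>Y x i\<bar>}"
    have "N.prob ?A \<le> (\<Sum>i<k. N.prob {x \<in> space N. R < \<bar>Y x i\<bar>})"
      by (intro N.finite_measure_subadditive_finite) auto
    also have "\<dots> \<le> (\<Sum>i<k. p)" using Q[OF RQ] by (intro sum_mono less_imp_le) auto
    finally have A: "N.prob ?A \<le> real k * p" by simp
    have "\<bar>(\<integral>\<omega>. \<phi> (Y \<omega>) \<partial>N) - (\<integral>\<omega>. g (Y \<omega>) \<partial>N)\<bar> \<le> e + 2 * (B + 1) * N.prob ?A"
      by (rule N.expectation_diff_outside) (use supp e gB g(2) in \<open>auto simp: K_def not_less\<close>)
    also have "\<dots> \<le> e + 2 * (B + 1) * (real k * p)" using A B by (intro add_left_mono mult_left_mono) auto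
    finally show ?thesis using kp by simp
  qed
  have "eventually (\<lambda>n. \<forall>i\<in>{..<k}. integrable M (\<lambda>\<omega>. (X n \<omega> i)\<^sup>2) \<and> (\<integral>\<omega>. (X n \<omega> i)\<^sup>2 \<partial>M) \<le> C i) sequentially"
    using C by (intro eventually_ball_finite) auto
  then have XN: "eventually (\<lambda>n. \<bar>(\<integral>\<omega>. \<phi> (X n \<omega>) \<partial>M) - (\<integral>\<omega>. g (X n \<omega>) \<partial>M)\<bar> \<le> 2 * e) sequentially"
  proof eventually_elim
    fix n assume n: "\<forall>i\<in>{..<k}. integrable M (\<lambda>\<omega>. (X n \<omega> i)\<^sup>2) \<and> (\<integral>\<omega>. (X n \<omega> i)\<^sup>2 \<partial>M) \<le> C i"
    let ?A = "\<Union>i<k. {x \<in> space M. R < \<bar>X n x i\<bar>}"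
    have "M.prob ?A \<le> (\<Sum>i<k. M.prob {x \<in> space M. R < \<bar>X n x i\<bar>})"
      by (intro M.finite_measure_subadditive_finite) auto
    also have "\<dots> \<le> (\<Sum>i<k. p)"
    proof (rule sum_mono)
      fix i assume i: "i \<in> {..<k}"
      have "M.prob {x \<in> space M. R < \<bar>X n x i\<bar>} \<le> C i / R\<^sup>2"
        using n i R1 by (intro M.chebyshev_tail) auto
      then show "M.prob {x \<in> space M. R < \<bar>X n x i\<bar>} \<le> p" using RC[of i] i by auto
    qed
    finally have A: "M.prob ?A \<le> real k * p" by simp
    have "\<bar>(\<integral>\<omega>. \<phi> (X n \<omega>) \<partial>M) - (\<integral>\<omega>. g (X n \<omega>) \<partial>M)\<bar> \<le> e + 2 * (B + 1) * M.prob ?A"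
      by (rule M.expectation_diff_outside) (use supp e gB g(2) in \<open>auto simp: K_def not_less\<close>)
    also have "\<dots> \<le> e + 2 * (B + 1) * (real k * p)" using A B by (intro add_left_mono mult_left_mono) auto
    finally show "\<bar>(\<integral>\<omega>. \<phi> (X n \<omega>) \<partial>M) - (\<integral>\<omega>. g (X n \<omega>) \<partial>M)\<bar> \<le> 2 * e" using kp by simp
  qed
  have "(\<lambda>n. \<integral>\<omega>. g (X n \<omega>) \<partial>M) \<longlonglongrightarrow> (\<integral>\<omega>. g (Y \<omega>) \<partial>N)"
    by (rule trig_expectation_converges[OF M N X Y cos sin g(1)])
  then have "eventually (\<lambda>n. \<bar>(\<integral>\<omega>. g (X n \<omega>) \<partial>M) - (\<integral>\<omega>. g (Y \<omega>) \<partial>N)\<bar> < e/2) sequentially"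
    using e(1) by (auto simp: dist_real_def dest!: tendstoD[of _ _ sequentially "e/2"])
  then have "eventually (\<lambda>n. \<bar>(\<integral>\<omega>. \<phi> (X n \<omega>) \<partial>M) - (\<integral>\<omega>. \<phi> (Y \<omega>) \<partial>N)\<bar> < 5 * e) sequentially"
    using XN by eventually_elim (use YN e(1) in linarith)
  then show "\<exists>n0. \<forall>n\<ge>n0. norm ((\<integral>\<omega>. \<phi> (X n \<omega>) \<partial>M) - (\<integral>\<omega>. \<phi> (Y \<omega>) \<partial>N)) < e0"
    unfolding eventually_sequentially using e by (auto intro: less_le_trans)
qed

subsection \<open>Gaussian sequences\<close>

definition psd :: "(nat \<Rightarrow> nat \<Rightarrow> real) \<Rightarrow> bool" where
  "psd K \<longleftrightarrow> (\<forall>i j. K i j = K j i) \<and> (\<forall>n c. 0 \<le> (\<Sum>i<n. \<Sum>j<n. c i * c j * K i j))"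

lemma psdD: "psd K \<Longrightarrow> 0 \<le> (\<Sum>i<n. \<Sum>j<n. c i * c j * K i j)"
  and psd_sym: "psd K \<Longrightarrow> K i j = K j i"
  unfolding psd_def by blast+

text \<open>The form as a quadratic polynomial in one coefficient; both \<open>psd_null\<close> and
  \<open>psd_schur\<close> argue by a suitable choice of \<open>l\<close>.\<close>

lemma quadratic_form_shift:
  fixes K :: "nat \<Rightarrow> nat \<Rightarrow> real"
  assumes sym: "\<And>i j. K i j = K j i" and m: "m < n"
  shows "(\<Sum>i<n. \<Sum>j<n. (c i + (if i = m then l else 0)) * (c j + (if j = m then l else 0)) * K i j) =
    (\<Sum>i<n. \<Sum>j<n. c i * c j * K i j) + 2 * l * (\<Sum>i<n. c i * K i m) + l\<^sup>2 * K m m"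
proof -
  have inner: "(\<Sum>j<n. (c j + (if j = m then l else 0)) * K i j) = (\<Sum>j<n. c j * K i j) + l * K i m" for i
  proof -
    have "(\<Sum>j<n. (c j + (if j = m then l else 0)) * K i j) = (\<Sum>j<n. c j * K i j + (if j = m then l * K i j else 0))"
      by (intro sum.cong) (auto simp: distrib_right)
    then show ?thesis using m by (simp add: sum.distrib)
  qed
  have "(\<Sum>i<n. \<Sum>j<n. (c i + (if i = m then l else 0)) * (c j + (if j = m then l else 0)) * K i j)
    = (\<Sum>i<n. (c i + (if i = m then l else 0)) * ((\<Sum>j<n. c j * K i j) + l * K i m))"
    by (simp add: inner[symmetric] sum_distrib_left mult.assoc)
  also have "\<dots> = (\<Sum>i<n. c i * (\<Sum>j<n. c j * K i j) + l * (c i * K i m) +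
      (if i = m then l * ((\<Sum>j<n. c j * K i j) + l * K i m) else 0))"
    by (intro sum.cong) (auto simp: algebra_simps)
  also have "\<dots> = (\<Sum>i<n. c i * (\<Sum>j<n. c j * K i j)) + l * (\<Sum>i<n. c i * K i m) + l * ((\<Sum>j<n. c j * K m j) + l * K m m)"
    using m by (simp add: sum.distrib sum_distrib_left)
  also have "(\<Sum>j<n. c j * K m j) = (\<Sum>j<n. c j * K j m)" using sym by metis
  finally show ?thesis by (simp add: sum_distrib_left algebra_simps power2_eq_square)
qed

lemma psd_diag: "psd K \<Longrightarrow> 0 \<le> K m m"
  using psdD[of K "\<lambda>i. 0 + (if i = m then 1 else 0)" "Suc m"]
    quadratic_form_shift[of K m "Suc m" "\<lambda>_. 0" 1] psd_sym[of K] by simp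

text \<open>With a vanishing diagonal entry the form at the \<open>i\<close>-th unit vector plus
  \<open>l\<close> times the \<open>m\<close>-th one is affine in \<open>l\<close>; a nonzero slope
  would make it negative somewhere.\<close>

lemma psd_null: assumes "psd K" "K m m = 0" shows "K i m = 0"
proof -
  have sym: "\<And>i j. K i j = K j i" using assms(1) unfolding psd_def by blast
  define n where "n = Suc (max i m)"
  define c where "c = (\<lambda>j. if j = i then 1 else 0 :: real)"
  have c: "(\<Sum>j<n. c j * K j m) = K i m" "(\<Sum>i'<n. \<Sum>j<n. c i' * c j * K i' j) = K i i"
  proof -
    have i: "i < n" unfolding n_def by simp
    have "(\<Sum>j<n. c j * K j m) = (\<Sum>j<n. if j = i then K j m else 0)" for m
      unfolding c_def by (intro sum.cong) auto
    then have eq: "(\<Sum>j<n. c j * K j m) = K i m" for m using i by simp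
    then show "(\<Sum>j<n. c j * K j m) = K i m" .
    have "(\<Sum>j<n. c i' * c j * K i' j) = c i' * (\<Sum>j<n. c j * K j i')" for i'
      by (simp only: sum_distrib_left mult.assoc sym[of i'])
    then have "(\<Sum>i'<n. \<Sum>j<n. c i' * c j * K i' j) = (\<Sum>i'<n. c i' * (\<Sum>j<n. c j * K j i'))"
      by simp
    also have "\<dots> = (\<Sum>j<n. c j * K i j)" by (simp only: eq)
    also have "\<dots> = (\<Sum>j<n. c j * K j i)" by (intro sum.cong refl arg_cong2[where f="(*)"] sym)
    finally show "(\<Sum>i'<n. \<Sum>j<n. c i' * c j * K i' j) = K i i" using eq by simp
  qed
  have pos: "0 \<le> K i i + 2 * l * K i m" for l
  proof -
    have "0 \<le> (\<Sum>i<n. \<Sum>j<n. (c i + (if i = m then l else 0)) * (c j + (if j = m then l else 0)) * K i j)"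
      by (rule psdD[OF assms(1)])
    also have "\<dots> = K i i + 2 * l * K i m"
    proof -
      have mn: "m < n" unfolding n_def by simp
      show ?thesis
        unfolding quadratic_form_shift[of K m n c l, OF sym mn] c assms(2) by simp
    qed
    finally show ?thesis .
  qed
  show ?thesis
  proof (rule ccontr)
    assume ne: "K i m \<noteq> 0"
    \<comment> \<open>At this \<open>l\<close> the affine function takes the value -1.\<close>
    have "K i i + 2 * (- (K i i + 1) / (2 * K i m)) * K i m = -1" using ne by (simp add: field_simps)
    then show False using pos[of "- (K i i + 1) / (2 * K i m)"] by linarith
  qed
qed

text \<open>Choosing the \<open>m\<close>-th coefficient optimally completes the square, so each
  value of the new form is a value of the old one. A zero pivot changes nothing, as division by 0
  gives 0.\<close>

lemma psd_schur:
  assumes "psd K"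
  shows "psd (\<lambda>i j. K i j - K i m * K m j / K m m)"
proof (cases "K m m = 0")
  case True then show ?thesis using assms by simp
next
  case False
  have sym: "\<And>i j. K i j = K j i" using assms(1) unfolding psd_def by blast
  have d: "K m m > 0" using psd_diag[OF assms, of m] False by simp
  show ?thesis
    unfolding psd_def
  proof (intro conjI allI)
    show "K i j - K i m * K m j / K m m = K j i - K j m * K m i / K m m" for i j
      using sym[of i j] sym[of i m] sym[of j m] by (simp add: mult.commute)
  next
    fix n :: nat and c0 :: "nat \<Rightarrow> real"
    \<comment> \<open>The vector is padded with zeros up to \<open>N\<close>, because the shift in
      coordinate \<open>m\<close> requires \<open>m < N\<close>.\<close>
    define c where "c = (\<lambda>i. if i < n then c0 i else 0)"
    define N where "N = max n (Suc m)"
    have ext: "(\<Sum>i<n. \<Sum>j<n. c0 i * c0 j * L i j) = (\<Sum>i<N. \<Sum>j<N. c i * c j * L i j)" for L :: "nat \<Rightarrow> nat \<Rightarrow> real"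
    proof -
      have "(\<Sum>i<N. \<Sum>j<N. c i * c j * L i j) = (\<Sum>i<n. \<Sum>j<N. c i * c j * L i j)"
        by (rule sum.mono_neutral_right) (auto simp: N_def c_def)
      also have "\<dots> = (\<Sum>i<n. \<Sum>j<n. c i * c j * L i j)"
        by (intro sum.cong refl sum.mono_neutral_right) (auto simp: N_def c_def)
      finally show ?thesis by (simp add: c_def)
    qed
    define b where "b = (\<Sum>i<N. c i * K i m)"
    have "0 \<le> (\<Sum>i<N. \<Sum>j<N. (c i + (if i = m then - b / K m m else 0)) * (c j + (if j = m then - b / K m m else 0)) * K i j)"
      by (rule psdD[OF assms(1)])
    also have "\<dots> = (\<Sum>i<N. \<Sum>j<N. c i * c j * K i j) - b\<^sup>2 / K m m"
    proof -
      have mN: "m < N" unfolding N_def by simp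
      have "x + 2 * (- b / K m m) * b + (- b / K m m)\<^sup>2 * K m m = x - b\<^sup>2 / K m m" for x
        using d by (simp add: power2_eq_square)
      then show ?thesis
        by (simp only: quadratic_form_shift[of K m N c "- b / K m m", OF sym mN] b_def[symmetric])
    qed
    also have "b\<^sup>2 / K m m = (\<Sum>i<N. \<Sum>j<N. c i * c j * (K i m * K m j / K m m))"
    proof -
      have "b\<^sup>2 = (\<Sum>i<N. \<Sum>j<N. (c i * K i m) * (c j * K j m))"
        unfolding b_def power2_eq_square by (rule sum_product)
      moreover have "(c i * K i m) * (c j * K j m) / K m m = c i * c j * (K i m * K m j / K m m)" for i j
        by (simp add: sym[of m j])
      ultimately show ?thesis by (simp only: sum_divide_distrib)
    qed
    finally show "0 \<le> (\<Sum>i<n. \<Sum>j<n. c0 i * c0 j * (K i j - K i m * K m j / K m m))"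
      by (simp only: ext sum_subtractf right_diff_distrib)
  qed
qed

text \<open>Successive Schur complements, that is, symmetric Gaussian elimination.\<close>

fun schur :: "(nat \<Rightarrow> nat \<Rightarrow> real) \<Rightarrow> nat \<Rightarrow> nat \<Rightarrow> nat \<Rightarrow> real" where
  "schur K 0 i j = K i j"
| "schur K (Suc m) i j = schur K m i j - schur K m i m * schur K m m j / schur K m m m"

text \<open>The columns of \<open>a\<close> are the pivot columns divided by the square roots of the
  pivots; a zero pivot has a zero column, so dividing by 0 is harmless. Rows with index less than
  \<open>n\<close> are exhausted after \<open>n\<close> eliminations. The same \<open>a\<close>
  serves every \<open>n > i\<close>, which forces it to be lower triangular
  (\<open>a_upper\<close>).\<close>

lemma cholesky:
  assumes "psd K"
  shows "\<exists>a. \<forall>i j n. i < n \<longrightarrow> K i j = (\<Sum>l<n. a i l * a j l)"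
proof -
  have P: "psd (schur K m)" for m
  proof (induction m)
    case 0
    have "schur K 0 = K" by (intro ext) simp
    then show ?case using assms by simp
  next
    case (Suc m)
    have "schur K (Suc m) = (\<lambda>i j. schur K m i j - schur K m i m * schur K m m j / schur K m m m)"
      by (intro ext) simp
    then show ?case using psd_schur[OF Suc] by simp
  qed
  have sym: "schur K m i j = schur K m j i" for m i j using P[of m] unfolding psd_def by blast
  have zero: "schur K n i l = 0" if "l < n" for n i l
    using that
  proof (induction n arbitrary: i)
    case (Suc n)
    show ?case
    proof (cases "l = n")
      case True
      then show ?thesis using psd_null[OF P[of n], of n i] by auto
    next
      case False
      then show ?thesis using Suc by simp
    qed
  qed simp
  define a where "a = (\<lambda>i m. schur K m i m / sqrt (schur K m m m))"
  have dec: "K i j = (\<Sum>l<n. a i l * a j l) + schur K n i j" for i j n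
  proof (induction n)
    case (Suc n)
    have "a i n * a j n = schur K n i n * schur K n n j / schur K n n n"
      unfolding a_def using psd_diag[OF P[of n], of n] sym[of n n j] by (simp add: real_sqrt_mult_self)
    then show ?case using Suc by simp
  qed simp
  have "K i j = (\<Sum>l<n. a i l * a j l)" if "i < n" for i j n
    using dec[of i j n] zero[OF that, of j] sym[of n i j] by simp
  then show ?thesis by blast
qed

text \<open>The source of randomness of the limit. Its underlying space is Polish and its measurable
  sets are the Borel sets, so that inner regularity by compact sets is available.\<close>

definition iid_normal :: "(nat \<Rightarrow> real) measure" where
  "iid_normal = PiM UNIV (\<lambda>_. std_normal_distribution)"

lemma prob_space_iid_normal: "prob_space iid_normal"
  unfolding iid_normal_def by (intro prob_space_PiM prob_space_normal_density) simp

lemma sets_iid_normal [measurable_cong]: "sets iid_normal = sets borel"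
proof -
  have "sets iid_normal = sets (PiM UNIV (\<lambda>_::nat. borel :: real measure))"
    unfolding iid_normal_def by (rule sets_PiM_cong) auto
  then show ?thesis by (simp add: sets_PiM_equal_borel)
qed

lemma space_iid_normal [simp]: "space iid_normal = UNIV"
  using sets_eq_imp_space_eq[OF sets_iid_normal] by simp

lemma distr_coordinate_iid_normal: "distr iid_normal borel (\<lambda>\<xi>. \<xi> i) = std_normal_distribution"
proof -
  have "distr iid_normal borel (\<lambda>\<xi>. \<xi> i) = distr iid_normal std_normal_distribution (\<lambda>\<xi>. \<xi> i)"
    by (rule distr_cong) auto
  also have "\<dots> = std_normal_distribution"
    unfolding iid_normal_def by (rule distr_PiM_component) (auto intro: prob_space_normal_density)
  finally show ?thesis .
qed

lemma indep_vars_iid_normal: "prob_space.indep_vars iid_normal (\<lambda>_. borel) (\<lambda>i \<xi>. \<xi> i) UNIV"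
proof -
  interpret prob_space iid_normal by (rule prob_space_iid_normal)
  have "distr iid_normal (\<Pi>\<^sub>M i\<in>UNIV. borel) (\<lambda>x. \<lambda>i\<in>UNIV. x i) = distr iid_normal iid_normal (\<lambda>x. x)"
    by (rule distr_cong) (auto simp: sets_iid_normal sets_PiM_equal_borel)
  also have "\<dots> = (\<Pi>\<^sub>M i\<in>UNIV. distr iid_normal borel (\<lambda>\<xi>. \<xi> i))"
    unfolding distr_coordinate_iid_normal by (simp add: distr_id2 iid_normal_def)
  finally show ?thesis
    by (subst indep_vars_iff_distr_eq_PiM) auto
qed

lemma iid_normal_linear_char:
  "(\<integral>\<xi>. iexp (\<Sum>l<n. b l * \<xi> l) \<partial>iid_normal) = complex_of_real (exp (- (\<Sum>l<n. (b l)\<^sup>2) / 2))"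
proof -
  interpret prob_space iid_normal by (rule prob_space_iid_normal)
  have ind: "indep_vars (\<lambda>_. borel) (\<lambda>l \<xi>. b l * \<xi> l) {..<n}"
    by (rule indep_vars_subset[OF indep_vars_compose2[OF indep_vars_iid_normal, of "\<lambda>l x. b l * x" "\<lambda>_. borel"]]) auto
  have one: "char (distr iid_normal borel (\<lambda>\<xi>. b l * \<xi> l)) 1 = exp (- (b l)\<^sup>2 / 2)" for l
  proof -
    have "char (distr iid_normal borel (\<lambda>\<xi>. b l * \<xi> l)) 1 = (\<integral>\<xi>. iexp (b l * \<xi> l) \<partial>iid_normal)"
      unfolding char_def by (subst integral_distr) auto
    also have "\<dots> = char (distr iid_normal borel (\<lambda>\<xi>. \<xi> l)) (b l)"
      unfolding char_def by (subst integral_distr) auto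
    finally show ?thesis
      by (simp add: distr_coordinate_iid_normal char_std_normal_distribution exp_of_real[symmetric])
  qed
  have "(\<integral>\<xi>. iexp (\<Sum>l<n. b l * \<xi> l) \<partial>iid_normal) = char (distr iid_normal borel (\<lambda>\<xi>. \<Sum>l<n. b l * \<xi> l)) 1"
    unfolding char_def by (subst integral_distr) auto
  also have "\<dots> = (\<Prod>l<n. complex_of_real (exp (- (b l)\<^sup>2 / 2)))"
    by (subst char_distr_sum[OF ind]) (simp add: one exp_of_real[symmetric])
  also have "\<dots> = complex_of_real (exp (\<Sum>l<n. - (b l)\<^sup>2 / 2))"
    by (simp add: exp_sum)
  also have "(\<Sum>l<n. - (b l)\<^sup>2 / 2) = - (\<Sum>l<n. (b l)\<^sup>2) / 2"
    by (simp add: sum_divide_distrib sum_negf)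
  finally show ?thesis .
qed

section \<open>Normal laws identified by their characteristic functions\<close>

lemma integral_iexp:
  assumes "prob_space M" and [measurable]: "f \<in> borel_measurable M"
  shows "(\<integral>\<omega>. iexp (f \<omega>) \<partial>M) = Complex (\<integral>\<omega>. cos (f \<omega>) \<partial>M) (\<integral>\<omega>. sin (f \<omega>) \<partial>M)"
proof -
  interpret prob_space M by fact
  have i: "integrable M (\<lambda>\<omega>. iexp (f \<omega>))"
    by (rule integrable_const_bound[where B=1]) auto
  have "Re (\<integral>\<omega>. iexp (f \<omega>) \<partial>M) = (\<integral>\<omega>. cos (f \<omega>) \<partial>M)"
    using i by (subst integral_Re[symmetric]) (auto simp: Re_exp intro!: Bochner_Integration.integral_cong)
  moreover have "Im (\<integral>\<omega>. iexp (f \<omega>) \<partial>M) = (\<integral>\<omega>. sin (f \<omega>) \<partial>M)"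
    using i by (subst integral_Im[symmetric]) (auto simp: Im_exp intro!: Bochner_Integration.integral_cong)
  ultimately show ?thesis by (simp add: complex_eq_iff)
qed

lemma iid_normal_linear_cos_sin:
  shows "(\<integral>\<xi>. cos (\<Sum>l<n. b l * \<xi> l) \<partial>iid_normal) = exp (- (\<Sum>l<n. (b l)\<^sup>2) / 2)"
    and "(\<integral>\<xi>. sin (\<Sum>l<n. b l * \<xi> l) \<partial>iid_normal) = 0"
proof -
  have [measurable]: "(\<lambda>\<xi>. \<Sum>l<n. b l * \<xi> l) \<in> borel_measurable iid_normal" by measurable
  have "Complex (\<integral>\<xi>. cos (\<Sum>l<n. b l * \<xi> l) \<partial>iid_normal) (\<integral>\<xi>. sin (\<Sum>l<n. b l * \<xi> l) \<partial>iid_normal)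
      = complex_of_real (exp (- (\<Sum>l<n. (b l)\<^sup>2) / 2))"
    unfolding iid_normal_linear_char[symmetric] by (rule integral_iexp[symmetric, OF prob_space_iid_normal]) measurable
  then show "(\<integral>\<xi>. cos (\<Sum>l<n. b l * \<xi> l) \<partial>iid_normal) = exp (- (\<Sum>l<n. (b l)\<^sup>2) / 2)"
    "(\<integral>\<xi>. sin (\<Sum>l<n. b l * \<xi> l) \<partial>iid_normal) = 0"
    unfolding complex_eq_iff complex.sel Re_complex_of_real Im_complex_of_real by blast+
qed

text \<open>Uniqueness of characteristic functions, with hypotheses in the real form in which they
  are known for the limit process. \<open>v = 0\<close> is a separate case because a normal density
  needs a positive spread.\<close>

lemma normal_law_of_char:
  assumes "prob_space N" and X[measurable]: "X \<in> borel_measurable N" and "0 \<le> v"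
    and cos: "\<And>s. (\<integral>\<omega>. cos (s * X \<omega>) \<partial>N) = exp (- s\<^sup>2 * v / 2)"
    and sin: "\<And>s. (\<integral>\<omega>. sin (s * X \<omega>) \<partial>N) = 0"
  shows "distr N borel X = (if v = 0 then return borel 0 else density lborel (\<lambda>x. ennreal (normal_density 0 (sqrt v) x)))"
    (is "_ = ?L")
proof -
  interpret prob_space N by fact
  have rd: "real_distribution (distr N borel X)"
    by (auto simp: real_distribution_def real_distribution_axioms_def intro: prob_space_distr)
  have ch: "char (distr N borel X) s = complex_of_real (exp (- s\<^sup>2 * v / 2))" for s
  proof -
    have "char (distr N borel X) s = (\<integral>\<omega>. iexp (s * X \<omega>) \<partial>N)"
      unfolding char_def by (subst integral_distr) auto
    also have "\<dots> = Complex (\<integral>\<omega>. cos (s * X \<omega>) \<partial>N) (\<integral>\<omega>. sin (s * X \<omega>) \<partial>N)"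
      by (rule integral_iexp[OF assms(1)]) measurable
    finally show ?thesis unfolding cos sin by (simp only: complex_of_real_def)
  qed
  show ?thesis
  proof (cases "v = 0")
    case True
    have "real_distribution (return borel (0::real))"
      by (auto simp: real_distribution_def real_distribution_axioms_def intro: prob_space_return)
    moreover have "char (return borel (0::real)) s = 1" for s unfolding char_def by (subst integral_return) auto
    ultimately show ?thesis using True ch rd by (auto intro!: Levy_uniqueness)
  next
    case False
    then have v: "0 < v" using assms by simp
    define Z where "Z = (\<lambda>x. 0 + sqrt v * (x :: real))"
    have d: "distr std_normal_distribution borel Z = density lborel (\<lambda>x. ennreal (normal_density 0 (sqrt v) x))"
    proof -
      interpret S: prob_space std_normal_distribution by (rule prob_space_normal_density) simp
      have "distributed std_normal_distribution lborel (\<lambda>x. x) (\<lambda>x. ennreal (normal_density 0 1 x))"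
        by (auto simp: distributed_def intro!: distr_id2)
      from S.normal_density_affine[OF this, of "sqrt v" 0] v
      have "distr std_normal_distribution lborel Z = density lborel (\<lambda>x. ennreal (normal_density 0 (sqrt v) x))"
        unfolding Z_def distributed_def by simp
      moreover have "distr std_normal_distribution borel Z = distr std_normal_distribution lborel Z"
        by (rule distr_cong) auto
      ultimately show ?thesis by simp
    qed
    have "char (distr std_normal_distribution borel Z) s = complex_of_real (exp (- s\<^sup>2 * v / 2))" for s
    proof -
      have "char (distr std_normal_distribution borel Z) s = char std_normal_distribution (s * sqrt v)"
        unfolding char_def Z_def by (subst integral_distr) (auto simp: mult.assoc)
      then show ?thesis using v by (simp add: char_std_normal_distribution power_mult_distrib)
    qed
    moreover have "real_distribution (distr std_normal_distribution borel Z)"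
      unfolding Z_def by (auto simp: real_distribution_def real_distribution_axioms_def intro!: prob_space.prob_space_distr prob_space_normal_density)
    ultimately have "distr N borel X = distr std_normal_distribution borel Z"
      using ch rd by (intro Levy_uniqueness) auto
    then show ?thesis using d False by simp
  qed
qed

text \<open>The moments are read off the identified law; differentiating the characteristic function
  would first require the integrability asserted here.\<close>

lemma moments_of_normal_char:
  assumes "prob_space N" and X[measurable]: "X \<in> borel_measurable N" and v: "0 \<le> v"
    and cos: "\<And>s. (\<integral>\<omega>. cos (s * X \<omega>) \<partial>N) = exp (- s\<^sup>2 * v / 2)"
    and sin: "\<And>s. (\<integral>\<omega>. sin (s * X \<omega>) \<partial>N) = 0"
  shows "normal_law (distr N borel X)" "integrable N (\<lambda>\<omega>. (X \<omega>)\<^sup>2)"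
    "(\<integral>\<omega>. X \<omega> \<partial>N) = 0" "(\<integral>\<omega>. (X \<omega>)\<^sup>2 \<partial>N) = v"
proof -
  note d = normal_law_of_char[OF assms]
  have d0: "distr N borel X = return borel 0" if "v = 0" using d that by simp
  have d1: "distr N borel X = density lborel (\<lambda>x. ennreal (normal_density 0 (sqrt v) x))" if "v \<noteq> 0" using d that by simp
  show "normal_law (distr N borel X)"
  proof (cases "v = 0")
    case True
    then show ?thesis unfolding normal_law_def d0[OF True]
      by (intro disjI1 exI[of _ 0] refl)
  next
    case False
    then have "0 < sqrt v" using v by simp
    then show ?thesis unfolding normal_law_def d1[OF False]
      by (intro disjI2 exI[of _ 0] exI[of _ "sqrt v"] conjI refl)
  qed
  have 1: "(\<integral>\<omega>. X \<omega> \<partial>N) = (\<integral>x. x \<partial>distr N borel X)" by (subst integral_distr) auto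
  have 2: "(\<integral>\<omega>. (X \<omega>)\<^sup>2 \<partial>N) = (\<integral>x. x\<^sup>2 \<partial>distr N borel X)" by (subst integral_distr) auto
  have 3: "integrable N (\<lambda>\<omega>. (X \<omega>)\<^sup>2) \<longleftrightarrow> integrable (distr N borel X) (\<lambda>x. x\<^sup>2)" by (subst integrable_distr_eq) auto
  have "integrable N (\<lambda>\<omega>. (X \<omega>)\<^sup>2) \<and> (\<integral>\<omega>. X \<omega> \<partial>N) = 0 \<and> (\<integral>\<omega>. (X \<omega>)\<^sup>2 \<partial>N) = v"
  proof (cases "v = 0")
    case True
    have "prob_space (return borel (0::real))" by (rule prob_space_return) simp
    then interpret R: prob_space "return borel (0::real)" .
    have "integrable (return borel (0::real)) (\<lambda>x. x\<^sup>2)"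
      by (rule R.integrable_const_bound[where B=0]) (auto simp: AE_return)
    then show ?thesis
      unfolding 1 2 3 d0[OF True] by (simp add: integral_return True)
  next
    case False
    then have s: "0 < sqrt v" using v by simp
    have "integrable lborel (\<lambda>x. normal_density 0 (sqrt v) x * (x - 0)^2)"
      using integrable_normal_moment[OF s, of 0 2] by simp
    moreover have "(\<integral>x. normal_density 0 (sqrt v) x * x \<partial>lborel) = 0"
      using integral_normal_moment_odd[OF s, of 0 0] by simp
    moreover have "(\<integral>x. normal_density 0 (sqrt v) x * x^2 \<partial>lborel) = v"
      using integral_normal_moment_even[OF s, of 0 1] v by (simp add: fact_numeral)
    ultimately show ?thesis
      unfolding 1 2 3 d1[OF False] by (simp add: integral_density integrable_density)
  qed
  then show "integrable N (\<lambda>\<omega>. (X \<omega>)\<^sup>2)" "(\<integral>\<omega>. X \<omega> \<partial>N) = 0" "(\<integral>\<omega>. (X \<omega>)\<^sup>2 \<partial>N) = v"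
    by blast+
qed

subsection \<open>Weak convergence of possibly non-measurable maps\<close>

lemma mspace_linf: "x \<in> mspace (linf T) \<longleftrightarrow> x \<in> extensional T \<and> (\<exists>B. \<forall>t\<in>T. \<bar>x t\<bar> \<le> B)"
  unfolding linf_def mspace_funspace
  by (auto simp: Met_TC.fspace_def bounded_iff)

lemma mdist_linf_le:
  assumes "x \<in> mspace (linf T)" "y \<in> mspace (linf T)" "0 \<le> a"
  shows "mdist (linf T) x y \<le> a \<longleftrightarrow> (\<forall>t\<in>T. \<bar>x t - y t\<bar> \<le> a)"
proof (cases "T = {}")
  case True
  then show ?thesis using assms(3) unfolding linf_def mdist_funspace
    by (simp add: Metric_space.fdist_empty[OF Metric_space_mspace_mdist])
next
  case False
  then show ?thesis
    using funspace_mdist_le[of x T euclidean_metric y a] assms unfolding linf_def by (simp add: dist_real_def)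
qed

lemma sets_borel_of_metric_openin: "openin (mtopology_of m) S \<Longrightarrow> S \<in> sets (borel_of_metric m)"
  and space_borel_of_metric: "space (borel_of_metric m) = mspace m"
proof -
  have sub: "{S. openin (mtopology_of m) S} \<subseteq> Pow (mspace m)"
    using openin_subset by fastforce
  then show "space (borel_of_metric m) = mspace m"
    unfolding borel_of_metric_def by (rule space_measure_of)
  show "S \<in> sets (borel_of_metric m)" if "openin (mtopology_of m) S"
    unfolding borel_of_metric_def using that sub by (auto intro: sigma_sets.Basic)
qed

lemma sets_borel_of_metric_closedin:
  assumes "closedin (mtopology_of m) S" shows "S \<in> sets (borel_of_metric m)"
proof -
  have "mspace m - S \<in> sets (borel_of_metric m)"
    using assms by (intro sets_borel_of_metric_openin) (simp add: closedin_def)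
  then have "space (borel_of_metric m) - (mspace m - S) \<in> sets (borel_of_metric m)" by (rule sets.compl_sets)
  moreover have "S \<subseteq> mspace m" using closedin_subset[OF assms] by simp
  ultimately show ?thesis by (simp add: space_borel_of_metric double_diff)
qed

lemma measurable_borel_of_metricI:
  assumes "\<And>\<omega>. \<omega> \<in> space N \<Longrightarrow> G \<omega> \<in> mspace m"
    and "\<And>S. openin (mtopology_of m) S \<Longrightarrow> G -` S \<inter> space N \<in> sets N"
  shows "G \<in> measurable N (borel_of_metric m)"
  unfolding borel_of_metric_def
  using openin_subset assms by (intro measurable_measure_of) fastforce+

lemma borel_measurable_of_continuous_map:
  assumes "continuous_map (mtopology_of m) euclideanreal h"
  shows "h \<in> borel_measurable (borel_of_metric m)"
proof (rule borel_measurableI)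
  fix S :: "real set" assume "open S"
  then have "openin (mtopology_of m) {x \<in> mspace m. h x \<in> S}"
    using assms openin_continuous_map_preimage[of "mtopology_of m" euclideanreal h S] by simp
  moreover have "h -` S \<inter> space (borel_of_metric m) = {x \<in> mspace m. h x \<in> S}"
    by (auto simp: space_borel_of_metric)
  ultimately show "h -` S \<inter> space (borel_of_metric m) \<in> sets (borel_of_metric m)"
    using sets_borel_of_metric_openin by metis
qed

section \<open>Lipschitz test functions and outer expectations\<close>

definition lipschitz_metric :: "'b metric \<Rightarrow> real \<Rightarrow> ('b \<Rightarrow> real) \<Rightarrow> bool" where
  "lipschitz_metric m L h \<longleftrightarrow> (\<forall>x\<in>mspace m. \<forall>y\<in>mspace m. \<bar>h x - h y\<bar> \<le> L * mdist m x y)"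

lemma lipschitz_metric_continuous:
  assumes "lipschitz_metric m L h"
  shows "continuous_map (mtopology_of m) euclideanreal h"
proof -
  have "Lipschitz_continuous_map m euclidean_metric h"
    using assms unfolding lipschitz_metric_def Lipschitz_continuous_map_def
    by (auto simp: dist_real_def)
  then show ?thesis
    using Lipschitz_continuous_imp_continuous_map[of m euclidean_metric h] by simp
qed

text \<open>Infimal convolution of \<open>h\<close> with \<open>k\<close> times the metric: it is
  \<open>k\<close>-Lipschitz, stays below \<open>h\<close>, and converges to \<open>h\<close> by
  continuity.\<close>

lemma lipschitz_approx_below:
  fixes m :: "'b metric"
  assumes h: "continuous_map (mtopology_of m) euclideanreal h" and B: "\<And>x. x \<in> mspace m \<Longrightarrow> \<bar>h x\<bar> \<le> B"
  shows "\<exists>l :: nat \<Rightarrow> 'b \<Rightarrow> real. \<forall>k. lipschitz_metric m (real k) (l k) \<and>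
    (\<forall>x\<in>mspace m. \<bar>l k x\<bar> \<le> B \<and> l k x \<le> h x) \<and> (\<forall>x\<in>mspace m. (\<lambda>k. l k x) \<longlonglongrightarrow> h x)"
proof -
  interpret Metric_space "mspace m" "mdist m" by (rule Metric_space_mspace_mdist)
  define l where "l = (\<lambda>k x. INF y\<in>mspace m. h y + real k * mdist m x y)"
  have bdd: "bdd_below ((\<lambda>y. h y + real k * mdist m x y) ` mspace m)" for k :: nat and x
  proof (rule bdd_belowI2)
    show "-B \<le> h y + real k * mdist m x y" if "y \<in> mspace m" for y
    proof -
      have "0 \<le> real k * mdist m x y" by simp
      then show ?thesis using B[OF that] by linarith
    qed
  qed
  have up: "l k x \<le> h y + real k * mdist m x y" if "y \<in> mspace m" for k x y
    unfolding l_def by (rule cINF_lower[OF bdd that])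
  have low: "c \<le> l k x" if "x \<in> mspace m" "\<And>y. y \<in> mspace m \<Longrightarrow> c \<le> h y + real k * mdist m x y" for c k x
    unfolding l_def using that by (intro cINF_greatest) auto
  have le: "l k x \<le> h x" if "x \<in> mspace m" for k x using up[OF that, of k x] that by simp
  have ge: "-B \<le> l k x" if "x \<in> mspace m" for k x
  proof (rule low[OF that])
    show "-B \<le> h y + real k * mdist m x y" if "y \<in> mspace m" for y
    proof -
      have "0 \<le> real k * mdist m x y" by simp
      then show ?thesis using B[OF that] by linarith
    qed
  qed
  have half: "l k x - real k * mdist m x y \<le> l k y" if "x \<in> mspace m" "y \<in> mspace m" for k x y
  proof (rule low[OF that(2)])
    fix z assume z: "z \<in> mspace m"
    have "mdist m x z \<le> mdist m x y + mdist m y z" using triangle that z by blast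
    then have "real k * mdist m x z \<le> real k * mdist m x y + real k * mdist m y z"
      by (metis distrib_left mult_left_mono of_nat_0_le_iff)
    then show "l k x - real k * mdist m x y \<le> h z + real k * mdist m y z" using up[OF z, of k x] by linarith
  qed
  have lip: "lipschitz_metric m (real k) (l k)" for k
    unfolding lipschitz_metric_def
  proof (intro ballI)
    fix x y assume xy: "x \<in> mspace m" "y \<in> mspace m"
    show "\<bar>l k x - l k y\<bar> \<le> real k * mdist m x y"
      using half[OF xy, of k] half[OF xy(2,1), of k] commute[of x y] by (simp add: abs_le_iff)
  qed
  have conv: "(\<lambda>k. l k x) \<longlonglongrightarrow> h x" if x: "x \<in> mspace m" for x
  proof (rule LIMSEQ_I)
    fix e :: real assume e: "0 < e"
    have "\<forall>e>0. \<exists>d>0. \<forall>y. y \<in> mspace m \<and> mdist m x y < d \<longrightarrow> dist (h x) (h y) < e"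
      using h x metric_continuous_map[OF Met_TC.Metric_space_axioms, of h]
      by (simp add: mtopology_of_def)
    then obtain d where d: "d > 0" "\<And>y. y \<in> mspace m \<Longrightarrow> mdist m x y < d \<Longrightarrow> \<bar>h x - h y\<bar> < e/2"
      using e by (metis dist_real_def half_gt_zero)
    \<comment> \<open>From \<open>k0\<close> on a point at distance at least \<open>d\<close> pays a
      penalty of at least \<open>2 * B\<close> and cannot undercut \<open>h x\<close>.\<close>
    obtain k0 :: nat where k0: "2 * B / d < real k0" using reals_Archimedean2 by blast
    have "h x - e/2 \<le> l k x" if k: "k \<ge> k0" for k
    proof (rule low[OF x])
      fix y assume y: "y \<in> mspace m"
      show "h x - e/2 \<le> h y + real k * mdist m x y"
      proof (cases "mdist m x y < d")
        case True
        have "0 \<le> real k * mdist m x y" by simp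
        then show ?thesis using d(2)[OF y True] by linarith
      next
        case False
        have "2 * B / d < real k" using k0 k by simp
        then have "2 * B \<le> real k * d" using d(1) by (simp add: divide_less_eq)
        also have "\<dots> \<le> real k * mdist m x y" using False by (intro mult_left_mono) auto
        finally show ?thesis using B[OF x] B[OF y] e by (simp add: abs_le_iff)
      qed
    qed
    then have "norm (l k x - h x) < e" if k: "k \<ge> k0" for k
      using le[OF x, of k] k e by fastforce
    then show "\<exists>no. \<forall>k\<ge>no. norm (l k x - h x) < e" by blast
  qed
  show ?thesis
  proof (intro exI[of _ l] allI conjI ballI)
    fix k x assume "x \<in> mspace m"
    then show "\<bar>l k x\<bar> \<le> B" using ge[of x k] le[of x k] B[of x] by (simp add: abs_le_iff)
  qed (use lip le conv in auto)
qed

text \<open>The lower bound \<open>c\<close> keeps the set of integrals bounded below, without which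
  the real infimum would carry no information.\<close>

lemma outer_expectation_le:
  assumes "prob_space M" "integrable M W" "\<And>\<omega>. \<omega> \<in> space M \<Longrightarrow> T \<omega> \<le> W \<omega>" "\<And>\<omega>. \<omega> \<in> space M \<Longrightarrow> c \<le> T \<omega>"
  shows "outer_expectation M T \<le> (\<integral>\<omega>. W \<omega> \<partial>M)"
proof -
  interpret prob_space M by fact
  have "c \<le> (\<integral>\<omega>. V \<omega> \<partial>M)" if "integrable M V" "\<And>\<omega>. \<omega> \<in> space M \<Longrightarrow> T \<omega> \<le> V \<omega>" for V
  proof -
    have "(\<integral>\<omega>. c \<partial>M) \<le> (\<integral>\<omega>. V \<omega> \<partial>M)"
      using that assms(4) by (intro integral_mono) (auto intro: order_trans)
    then show ?thesis by (simp add: prob_space)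
  qed
  then show ?thesis
    unfolding outer_expectation_def using assms by (intro cInf_lower bdd_belowI[of _ c]) auto
qed

text \<open>The upper bound \<open>c\<close> is itself an integrable majorant, so that the infimum
  is taken over a nonempty set.\<close>

lemma outer_expectation_ge:
  assumes "prob_space M" "\<And>\<omega>. \<omega> \<in> space M \<Longrightarrow> T \<omega> \<le> c"
    and "\<And>W. integrable M W \<Longrightarrow> (\<And>\<omega>. \<omega> \<in> space M \<Longrightarrow> T \<omega> \<le> W \<omega>) \<Longrightarrow> b \<le> (\<integral>\<omega>. W \<omega> \<partial>M)"
  shows "b \<le> outer_expectation M T"
proof -
  interpret prob_space M by fact
  have "integrable M (\<lambda>_. c)" by simp
  then show ?thesis
    unfolding outer_expectation_def using assms(2,3) by (intro cInf_greatest) blast+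
qed

lemma outer_expectation_mono:
  assumes "prob_space M" "\<And>\<omega>. \<omega> \<in> space M \<Longrightarrow> T \<omega> \<le> T' \<omega>" "\<And>\<omega>. \<omega> \<in> space M \<Longrightarrow> c \<le> T \<omega>"
    "\<And>\<omega>. \<omega> \<in> space M \<Longrightarrow> T' \<omega> \<le> d"
  shows "outer_expectation M T \<le> outer_expectation M T'"
proof (rule outer_expectation_ge[OF assms(1,4)])
  fix W assume W: "integrable M W" "\<And>\<omega>. \<omega> \<in> space M \<Longrightarrow> T' \<omega> \<le> W \<omega>"
  then show "outer_expectation M T \<le> (\<integral>\<omega>. W \<omega> \<partial>M)"
    using assms(2,3) by (intro outer_expectation_le[OF assms(1), of W T c]) (auto intro: order_trans)
qed

text \<open>Lipschitz minorants of \<open>h\<close> bound the outer expectations from below,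
  Lipschitz majorants from above. The majorants are negated minorants of \<open>- h\<close>; the
  outer expectation itself is not odd, so the second half cannot be had by negating the
  first.\<close>

lemma HJ_weakly_converges_lipschitz:
  fixes m :: "'b metric"
  assumes M: "prob_space M" and N: "prob_space N"
    and X: "\<And>n \<omega>. \<omega> \<in> space M \<Longrightarrow> X n \<omega> \<in> mspace m"
    and G: "G \<in> measurable N (borel_of_metric m)"
    and lip: "\<And>h L B. lipschitz_metric m L h \<Longrightarrow> (\<And>x. x \<in> mspace m \<Longrightarrow> \<bar>h x\<bar> \<le> B) \<Longrightarrow>
      (\<lambda>n. outer_expectation M (\<lambda>\<omega>. h (X n \<omega>))) \<longlonglongrightarrow> (\<integral>\<omega>. h (G \<omega>) \<partial>N)"
  shows "HJ_weakly_converges m M X N G"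
  unfolding HJ_weakly_converges_def
proof (intro conjI allI impI ballI G X)
  fix h :: "'b \<Rightarrow> real"
  assume "continuous_map (mtopology_of m) euclideanreal h \<and> bounded (h ` mspace m)"
  then obtain B where h: "continuous_map (mtopology_of m) euclideanreal h" and B: "\<And>x. x \<in> mspace m \<Longrightarrow> \<bar>h x\<bar> \<le> B"
    unfolding bounded_iff by auto
  interpret M: prob_space M by fact
  interpret N: prob_space N by fact
  have Gm: "G \<omega> \<in> mspace m" if "\<omega> \<in> space N" for \<omega>
    using measurable_space[OF G that] by (simp add: space_borel_of_metric)
  have lims: "(\<lambda>k. \<integral>\<omega>. l k (G \<omega>) \<partial>N) \<longlonglongrightarrow> (\<integral>\<omega>. g (G \<omega>) \<partial>N)"
    if "\<And>k. lipschitz_metric m (real k) (l k)" "\<And>k x. x \<in> mspace m \<Longrightarrow> \<bar>l k x\<bar> \<le> B"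
      "\<And>x. x \<in> mspace m \<Longrightarrow> (\<lambda>k. l k x) \<longlonglongrightarrow> g x" "continuous_map (mtopology_of m) euclideanreal g" for l :: "nat \<Rightarrow> 'b \<Rightarrow> real" and g
  proof (rule integral_dominated_convergence[where w="\<lambda>_. B"])
    show "(\<lambda>\<omega>. l k (G \<omega>)) \<in> borel_measurable N" for k
      using measurable_compose[OF G borel_measurable_of_continuous_map[OF lipschitz_metric_continuous[OF that(1)]]] .
    show "(\<lambda>\<omega>. g (G \<omega>)) \<in> borel_measurable N"
      using measurable_compose[OF G borel_measurable_of_continuous_map[OF that(4)]] .
  qed (use that Gm in auto)
  let ?E = "\<lambda>n. outer_expectation M (\<lambda>\<omega>. h (X n \<omega>))"
  let ?I = "\<integral>\<omega>. h (G \<omega>) \<partial>N"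
  have lower: "eventually (\<lambda>n. ?I - e < ?E n) sequentially" if e: "0 < e" for e
  proof -
    obtain l :: "nat \<Rightarrow> 'b \<Rightarrow> real" where l: "\<And>k. lipschitz_metric m (real k) (l k)"
      "\<And>k x. x \<in> mspace m \<Longrightarrow> \<bar>l k x\<bar> \<le> B" "\<And>k x. x \<in> mspace m \<Longrightarrow> l k x \<le> h x"
      "\<And>x. x \<in> mspace m \<Longrightarrow> (\<lambda>k. l k x) \<longlonglongrightarrow> h x"
      using lipschitz_approx_below[of m h B] h B by metis
    have "eventually (\<lambda>k. ?I - e < (\<integral>\<omega>. l k (G \<omega>) \<partial>N)) sequentially"
      using order_tendstoD(1)[OF lims[OF l(1,2,4) h], of "?I - e"] e by simp
    then obtain k where k: "?I - e < (\<integral>\<omega>. l k (G \<omega>) \<partial>N)" using eventually_sequentially by auto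
    have ev: "eventually (\<lambda>n. ?I - e < outer_expectation M (\<lambda>\<omega>. l k (X n \<omega>))) sequentially"
      using order_tendstoD(1)[OF lip[OF l(1,2)] k] .
    have le: "outer_expectation M (\<lambda>\<omega>. l k (X n \<omega>)) \<le> ?E n" for n
      using l(2,3) B X by (intro outer_expectation_mono[OF M, where c="-B" and d=B]) (auto simp: abs_le_iff minus_le_iff)
    show ?thesis using ev by eventually_elim (rule less_le_trans[OF _ le])
  qed
  have upper: "eventually (\<lambda>n. ?E n < ?I + e) sequentially" if e: "0 < e" for e
  proof -
    have h': "continuous_map (mtopology_of m) euclideanreal (\<lambda>x. - h x)" using h by (intro continuous_map_minus)
    obtain l :: "nat \<Rightarrow> 'b \<Rightarrow> real" where l: "\<And>k. lipschitz_metric m (real k) (l k)"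
      "\<And>k x. x \<in> mspace m \<Longrightarrow> \<bar>l k x\<bar> \<le> B" "\<And>k x. x \<in> mspace m \<Longrightarrow> l k x \<le> - h x"
      "\<And>x. x \<in> mspace m \<Longrightarrow> (\<lambda>k. l k x) \<longlonglongrightarrow> - h x"
      using lipschitz_approx_below[of m "\<lambda>x. - h x" B] h' B by (metis abs_minus)
    have l1: "lipschitz_metric m (real k) (\<lambda>x. - l k x)" for k
      using l(1)[of k] unfolding lipschitz_metric_def by (metis abs_minus_commute minus_diff_minus abs_minus)
    have l4: "(\<lambda>k. - l k x) \<longlonglongrightarrow> h x" if "x \<in> mspace m" for x
      using tendsto_minus[OF l(4)[OF that]] by simp
    have "eventually (\<lambda>k. (\<integral>\<omega>. - l k (G \<omega>) \<partial>N) < ?I + e) sequentially"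
      using order_tendstoD(2)[OF lims[of "\<lambda>k x. - l k x", OF l1 _ l4 h], of "?I + e"] e l(2) by simp
    then obtain k where k: "(\<integral>\<omega>. - l k (G \<omega>) \<partial>N) < ?I + e" using eventually_sequentially by auto
    have ev: "eventually (\<lambda>n. outer_expectation M (\<lambda>\<omega>. - l k (X n \<omega>)) < ?I + e) sequentially"
    proof -
      have "(\<lambda>n. outer_expectation M (\<lambda>\<omega>. - l k (X n \<omega>))) \<longlonglongrightarrow> (\<integral>\<omega>. - l k (G \<omega>) \<partial>N)"
        by (rule lip[where B=B, OF l1]) (simp add: l(2))
      then show ?thesis using k by (rule order_tendstoD(2))
    qed
    have le: "?E n \<le> outer_expectation M (\<lambda>\<omega>. - l k (X n \<omega>))" for n
      using l(2,3) B X by (intro outer_expectation_mono[OF M, where c="-B" and d=B]) (auto simp: abs_le_iff minus_le_iff le_minus_iff)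
    show ?thesis using ev by eventually_elim (rule le_less_trans[OF le])
  qed
  show "?E \<longlonglongrightarrow> ?I"
  proof (rule order_tendstoI)
    fix a assume "a < ?I" then show "eventually (\<lambda>n. a < ?E n) sequentially" using lower[of "?I - a"] by simp
  next
    fix a assume "?I < a" then show "eventually (\<lambda>n. ?E n < a) sequentially" using upper[of "a - ?I"] by simp
  qed
qed

text \<open>The target need not be separable, so tightness is not automatic. A compact subset of
  some \<open>E k\<close> carries almost all of the mass, and its image is compact because
  \<open>G\<close> is continuous there. The constant value off the union makes \<open>G\<close>
  measurable as a whole.\<close>

lemma tight_of_locally_continuous:
  fixes G :: "'p::polish_space \<Rightarrow> 'b" and N :: "'p measure"
  assumes N: "prob_space N" and sN: "sets N = sets borel"
    and E: "\<And>k::nat. E k \<in> sets borel" "incseq E" "AE \<xi> in N. \<xi> \<in> (\<Union>k. E k)"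
    and cont: "\<And>k. continuous_map (top_of_set (E k)) (mtopology_of m) G"
    and off: "\<And>\<xi>. \<xi> \<notin> (\<Union>k. E k) \<Longrightarrow> G \<xi> = c" and c: "c \<in> mspace m"
  shows "tight_random_element m N G"
proof -
  interpret prob_space N by fact
  have sp: "space N = UNIV" using sets_eq_imp_space_eq[OF sN] by simp
  have mem: "G \<xi> \<in> mspace m" for \<xi>
  proof (cases "\<xi> \<in> (\<Union>k. E k)")
    case True
    then obtain k where "\<xi> \<in> E k" by blast
    then show ?thesis using continuous_map_funspace[OF cont[of k]] by auto
  qed (simp add: off c)
  have meas: "G \<in> measurable N (borel_of_metric m)"
  proof (rule measurable_borel_of_metricI)
    fix S assume S: "openin (mtopology_of m) S"
    have "{\<xi> \<in> E k. G \<xi> \<in> S} \<in> sets borel" for k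
    proof -
      have "openin (top_of_set (E k)) {\<xi> \<in> E k. G \<xi> \<in> S}"
        using openin_continuous_map_preimage[OF cont[of k] S] by simp
      then obtain U where "open U" "{\<xi> \<in> E k. G \<xi> \<in> S} = E k \<inter> U" by (auto simp: openin_open)
      then show ?thesis using E(1) by simp
    qed
    moreover have "G -` S \<inter> space N = (\<Union>k. {\<xi> \<in> E k. G \<xi> \<in> S}) \<union> (if c \<in> S then - (\<Union>k. E k) else {})"
      using off by (auto simp: sp)
    ultimately show "G -` S \<inter> space N \<in> sets N" unfolding sN using E(1) by auto
  qed (rule mem)
  have "\<exists>K. compactin (mtopology_of m) K \<and> 1 - \<epsilon> \<le> measure N (G -` K \<inter> space N)" if e: "0 < \<epsilon>" for \<epsilon>
  proof -
    have "(\<lambda>k. prob (E k)) \<longlonglongrightarrow> prob (\<Union>k. E k)"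
      using E by (intro finite_Lim_measure_incseq) (auto simp: sN)
    moreover have "prob (\<Union>k. E k) = 1" using E by (subst prob_eq_1) (auto simp: sN)
    ultimately have "eventually (\<lambda>k. 1 - \<epsilon>/2 < prob (E k)) sequentially"
      using e order_tendstoD(1)[of "\<lambda>k. prob (E k)" 1 sequentially "1 - \<epsilon>/2"] by simp
    then obtain k where k: "1 - \<epsilon>/2 < prob (E k)" using eventually_sequentially by auto
    have "\<exists>C. C \<subseteq> E k \<and> compact C \<and> 1 - \<epsilon> < prob C"
    proof (rule ccontr)
      assume n: "\<not> ?thesis"
      have "emeasure N (E k) = (SUP C \<in> {C. C \<subseteq> E k \<and> compact C}. emeasure N C)"
        by (rule inner_regular) (use sN E emeasure_space_1 in auto)
      also have "\<dots> \<le> ennreal (1 - \<epsilon>)"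
        using n by (intro SUP_least) (auto simp: emeasure_eq_measure not_less intro!: ennreal_leI)
      finally have "prob (E k) \<le> max 0 (1 - \<epsilon>)"
        by (simp add: emeasure_eq_measure) (metis ennreal_le_iff2 max.coboundedI1 max.coboundedI2 measure_nonneg max.commute order_trans linorder_le_cases)
      \<comment> \<open>This excludes a negative \<open>1 - \<epsilon>\<close>, for which the bound
        by the maximum would not contradict \<open>k\<close>.\<close>
      moreover have "{} \<subseteq> E k \<and> compact ({} :: 'p set) \<and> prob {} = 0" by simp
      then have "\<not> 1 - \<epsilon> < 0" using n by metis
      ultimately show False using k e by simp
    qed
    then obtain C where C: "C \<subseteq> E k" "compact C" "1 - \<epsilon> < prob C" by blast
    have "compactin (mtopology_of m) (G ` C)"
      by (rule image_compactin[OF _ cont[of k]]) (use C in \<open>auto simp: compactin_subtopology\<close>)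
    moreover have "prob C \<le> prob (G -` (G ` C) \<inter> space N)"
    proof (rule finite_measure_mono)
      have "closedin (mtopology_of m) (G ` C)"
        using calculation Metric_space.Hausdorff_space_mtopology[OF Metric_space_mspace_mdist, of m]
        unfolding mtopology_of_def by (rule compactin_imp_closedin[rotated])
      then show "G -` (G ` C) \<inter> space N \<in> events"
        using measurable_sets[OF meas] sets_borel_of_metric_closedin by blast
    qed (use sp in auto)
    ultimately show ?thesis using C(3) by (intro exI[of _ "G ` C"]) auto
  qed
  then show ?thesis unfolding tight_random_element_def using meas by blast
qed

subsection \<open>Tight Gaussian limits\<close>

lemma geometric_increments_limit:
  fixes u :: "nat \<Rightarrow> real"
  assumes inc: "\<And>m. k \<le> m \<Longrightarrow> \<bar>u (Suc m) - u m\<bar> \<le> (1/2) ^ m"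
  shows "convergent u" "k \<le> m \<Longrightarrow> \<bar>u m - lim u\<bar> \<le> 2 * (1/2) ^ m"
proof -
  \<comment> \<open>The exact difference of two geometric terms is kept on the right, since the
    induction closes only in this form.\<close>
  have tail: "\<bar>u (m + j) - u m\<bar> \<le> 2 * (1/2) ^ m - 2 * (1/2) ^ (m + j)" if "k \<le> m" for m j
  proof (induction j)
    case (Suc j)
    have "\<bar>u (m + Suc j) - u m\<bar> \<le> \<bar>u (Suc (m + j)) - u (m + j)\<bar> + \<bar>u (m + j) - u m\<bar>" by simp
    also have "\<dots> \<le> (1/2) ^ (m + j) + (2 * (1/2) ^ m - 2 * (1/2) ^ (m + j))"
      using inc[of "m + j"] that Suc by linarith
    finally show ?case by simp
  qed simp
  have tail': "\<bar>u n - u m\<bar> \<le> 2 * (1/2) ^ m" if "k \<le> m" "m \<le> n" for m n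
  proof -
    have "\<bar>u n - u m\<bar> \<le> 2 * (1/2) ^ m - 2 * (1/2) ^ n" using tail[OF that(1), of "n - m"] that(2) by simp
    moreover have "0 \<le> 2 * (1/2 :: real) ^ n" by simp
    ultimately show ?thesis by linarith
  qed
  have z: "(\<lambda>m. 2 * (1/2 :: real) ^ m) \<longlonglongrightarrow> 0"
    using tendsto_mult_right_zero[OF LIMSEQ_power_zero[of "1/2 :: real"], of 2] by simp
  have "Cauchy u"
  proof (rule metric_CauchyI)
    fix e :: real assume e: "0 < e"
    have "eventually (\<lambda>m. 2 * (1/2 :: real) ^ m < e/2) sequentially" using order_tendstoD(2)[OF z, of "e/2"] e by simp
    then obtain m0 where m0: "\<And>m. m \<ge> m0 \<Longrightarrow> 2 * (1/2 :: real) ^ m < e/2" unfolding eventually_sequentially by blast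
    define q where "q = max m0 k"
    have "dist (u m) (u n) < e" if "m \<ge> q" "n \<ge> q" for m n
      using tail'[of q m] tail'[of q n] that m0[of q] unfolding q_def dist_real_def by linarith
    then show "\<exists>q. \<forall>m\<ge>q. \<forall>n\<ge>q. dist (u m) (u n) < e" by blast
  qed
  then show cv: "convergent u" by (rule Cauchy_convergent)
  show "\<bar>u m - lim u\<bar> \<le> 2 * (1/2) ^ m" if "k \<le> m"
  proof (rule LIMSEQ_le_const2)
    show "(\<lambda>n. \<bar>u m - u n\<bar>) \<longlonglongrightarrow> \<bar>u m - lim u\<bar>"
      using cv by (intro tendsto_intros) (simp add: convergent_LIMSEQ_iff)
    show "\<exists>N. \<forall>n\<ge>N. \<bar>u m - u n\<bar> \<le> 2 * (1/2) ^ m"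
      using tail'[OF that] by (auto simp: abs_minus_commute)
  qed
qed

text \<open>All that the limit theorem needs to know about the process. Finite nets are given by
  maps \<open>\<pi>\<close> instead of a semimetric on \<open>T\<close>, and their error by an
  integrable majorant, since the supremum over \<open>T\<close> need not be measurable. Convergence
  of characteristic functions is required along arbitrary sequences in \<open>T\<close>, repetitions
  included.\<close>

locale approx_process = prob_space M for M :: "'w measure" +
  fixes T :: "'t set" and X :: "nat \<Rightarrow> 'w \<Rightarrow> 't \<Rightarrow> real" and Kov :: "'t \<Rightarrow> 't \<Rightarrow> real"
  assumes X_mem: "\<And>n \<omega>. \<omega> \<in> space M \<Longrightarrow> X n \<omega> \<in> mspace (linf T)"
    and X_meas[measurable]: "\<And>n t. t \<in> T \<Longrightarrow> (\<lambda>\<omega>. X n \<omega> t) \<in> borel_measurable M"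
    and X_sq: "\<And>t. t \<in> T \<Longrightarrow> \<exists>B. eventually (\<lambda>n. integrable M (\<lambda>\<omega>. (X n \<omega> t)\<^sup>2) \<and> (\<integral>\<omega>. (X n \<omega> t)\<^sup>2 \<partial>M) \<le> B) sequentially"
    and approx: "\<And>\<epsilon>. 0 < \<epsilon> \<Longrightarrow> \<exists>\<pi>. \<pi> ` T \<subseteq> T \<and> finite (\<pi> ` T) \<and>
      eventually (\<lambda>n. \<exists>W. integrable M W \<and> (\<integral>\<omega>. W \<omega> \<partial>M) \<le> \<epsilon> \<and>
        (\<forall>\<omega>\<in>space M. \<forall>t\<in>T. \<bar>X n \<omega> t - X n \<omega> (\<pi> t)\<bar> \<le> W \<omega>)) sequentially"
    and Kov_psd: "\<And>e :: nat \<Rightarrow> 't. range e \<subseteq> T \<Longrightarrow> psd (\<lambda>i j. Kov (e i) (e j))"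
    and X_cos: "\<And>(e :: nat \<Rightarrow> 't) c k. range e \<subseteq> T \<Longrightarrow>
      (\<lambda>n. \<integral>\<omega>. cos (\<Sum>i<k. c i * X n \<omega> (e i)) \<partial>M) \<longlonglongrightarrow> exp (- (\<Sum>i<k. \<Sum>j<k. c i * c j * Kov (e i) (e j)) / 2)"
    and X_sin: "\<And>(e :: nat \<Rightarrow> 't) c k. range e \<subseteq> T \<Longrightarrow>
      (\<lambda>n. \<integral>\<omega>. sin (\<Sum>i<k. c i * X n \<omega> (e i)) \<partial>M) \<longlonglongrightarrow> 0"
    and T_nonempty: "T \<noteq> {}"
begin

text \<open>The rate \<open>(1/4) ^ m\<close> is dictated by \<open>AE_E\<close>: Markov's
  inequality at the threshold \<open>(1/2) ^ m\<close> must leave summable probabilities.\<close>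

lemma ex_approximations:
  "\<exists>\<pi>. \<forall>m. \<pi> m ` T \<subseteq> T \<and> finite (\<pi> m ` T) \<and>
      eventually (\<lambda>n. \<exists>W. integrable M W \<and> (\<integral>\<omega>. W \<omega> \<partial>M) \<le> (1/4) ^ m \<and>
        (\<forall>\<omega>\<in>space M. \<forall>t\<in>T. \<bar>X n \<omega> t - X n \<omega> (\<pi> m t)\<bar> \<le> W \<omega>)) sequentially"
  by (rule choice, rule allI, rule approx) simp

definition \<pi> :: "nat \<Rightarrow> 't \<Rightarrow> 't" where
  "\<pi> = (SOME \<pi>. \<forall>m. \<pi> m ` T \<subseteq> T \<and> finite (\<pi> m ` T) \<and>
      eventually (\<lambda>n. \<exists>W. integrable M W \<and> (\<integral>\<omega>. W \<omega> \<partial>M) \<le> (1/4) ^ m \<and>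
        (\<forall>\<omega>\<in>space M. \<forall>t\<in>T. \<bar>X n \<omega> t - X n \<omega> (\<pi> m t)\<bar> \<le> W \<omega>)) sequentially)"

lemma \<pi>:
  shows \<pi>_in: "t \<in> T \<Longrightarrow> \<pi> m t \<in> T" and \<pi>_finite: "finite (\<pi> m ` T)"
    and \<pi>_approx: "eventually (\<lambda>n. \<exists>W. integrable M W \<and> (\<integral>\<omega>. W \<omega> \<partial>M) \<le> (1/4) ^ m \<and>
        (\<forall>\<omega>\<in>space M. \<forall>t\<in>T. \<bar>X n \<omega> t - X n \<omega> (\<pi> m t)\<bar> \<le> W \<omega>)) sequentially"
  using someI_ex[OF ex_approximations, folded \<pi>_def] by blast+

definition T0 :: "'t set" where "T0 = (\<Union>m. \<pi> m ` T)"
text \<open>If \<open>T0\<close> is finite the enumeration repeats points; the kernel along it is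
  still positive semidefinite, so the factorization is unaffected.\<close>

definition e :: "nat \<Rightarrow> 't" where "e = from_nat_into T0"
definition idx :: "'t \<Rightarrow> nat" where "idx t = to_nat_on T0 t"

lemma T0_countable: "countable T0" unfolding T0_def using \<pi>_finite by (auto intro: countable_finite)
lemma T0_sub: "T0 \<subseteq> T" unfolding T0_def using \<pi>_in by auto
lemma T0_ne: "T0 \<noteq> {}" unfolding T0_def using T_nonempty by auto
lemma \<pi>_T0: "t \<in> T \<Longrightarrow> \<pi> m t \<in> T0" unfolding T0_def by auto
lemma e_in: "e i \<in> T" using from_nat_into[OF T0_ne, of i] T0_sub unfolding e_def by auto
lemma e_idx: "t \<in> T0 \<Longrightarrow> e (idx t) = t" unfolding e_def idx_def using T0_countable by simp

lemma ex_cholesky: "\<exists>a. \<forall>i j n. i < n \<longrightarrow> Kov (e i) (e j) = (\<Sum>l<n. a i l * a j l)"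
  by (rule cholesky, rule Kov_psd) (use e_in in auto)

definition a :: "nat \<Rightarrow> nat \<Rightarrow> real" where
  "a = (SOME a. \<forall>i j n. i < n \<longrightarrow> Kov (e i) (e j) = (\<Sum>l<n. a i l * a j l))"

lemma a: "i < n \<Longrightarrow> Kov (e i) (e j) = (\<Sum>l<n. a i l * a j l)"
  using someI_ex[OF ex_cholesky, folded a_def] by blast

text \<open>The diagonal entry is represented both with \<open>l\<close> and with
  \<open>Suc l\<close> terms, so the additional square vanishes.\<close>

lemma a_upper: "i < l \<Longrightarrow> a i l = 0"
  using a[of i l i] a[of i "Suc l" i] by simp

text \<open>A normal sequence with covariance \<open>Kov (e i) (e j)\<close>. Its members are finite
  combinations of coordinates, hence continuous functions of the noise; the construction of the
  limit rests on this continuity.\<close>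

definition y :: "nat \<Rightarrow> (nat \<Rightarrow> real) \<Rightarrow> real" where
  "y i \<xi> = (\<Sum>l<Suc i. a i l * \<xi> l)"

lemma y_eq: "i < n \<Longrightarrow> y i \<xi> = (\<Sum>l<n. a i l * \<xi> l)"
  unfolding y_def by (rule sum.mono_neutral_left) (auto simp: a_upper)

lemma y_continuous: "continuous_on UNIV (y i)"
  unfolding y_def by (intro continuous_intros continuous_on_product_coordinates)

lemma y_measurable [measurable]: "y i \<in> borel_measurable iid_normal" "y i \<in> borel_measurable borel"
proof -
  show "y i \<in> borel_measurable borel" using y_continuous by (rule borel_measurable_continuous_onI)
  then show "y i \<in> borel_measurable iid_normal" using sets_iid_normal by (simp cong: measurable_cong_sets)
qed

text \<open>The index map \<open>f\<close> is not assumed injective, because different points may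
  share a projection.\<close>

lemma y_char:
  fixes k :: nat
  shows "(\<integral>\<xi>. cos (\<Sum>i<k. c i * y (f i) \<xi>) \<partial>iid_normal) = exp (- (\<Sum>i<k. \<Sum>j<k. c i * c j * Kov (e (f i)) (e (f j))) / 2)"
    and "(\<integral>\<xi>. sin (\<Sum>i<k. c i * y (f i) \<xi>) \<partial>iid_normal) = 0"
proof -
  \<comment> \<open>A common number of coordinates, beyond every index in use.\<close>
  define n where "n = Suc (\<Sum>i<k. f i)"
  have fn: "f i < n" if "i < k" for i
  proof -
    have "f i \<le> (\<Sum>i<k. f i)" by (rule member_le_sum) (use that in auto)
    then show ?thesis unfolding n_def by simp
  qed
  define b where "b = (\<lambda>l. \<Sum>i<k. c i * a (f i) l)"
  have lin: "(\<Sum>i<k. c i * y (f i) \<xi>) = (\<Sum>l<n. b l * \<xi> l)" for \<xi>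
  proof -
    have "(\<Sum>i<k. c i * y (f i) \<xi>) = (\<Sum>i<k. \<Sum>l<n. c i * a (f i) l * \<xi> l)"
    proof (intro sum.cong refl)
      fix i assume "i \<in> {..<k}"
      then have "f i < n" using fn by simp
      then show "c i * y (f i) \<xi> = (\<Sum>l<n. c i * a (f i) l * \<xi> l)"
        by (simp only: y_eq[of "f i" n] sum_distrib_left mult.assoc)
    qed
    also have "\<dots> = (\<Sum>l<n. b l * \<xi> l)" unfolding b_def by (subst sum.swap) (simp add: sum_distrib_right)
    finally show ?thesis .
  qed
  have "(\<Sum>l<n. (b l)\<^sup>2) = (\<Sum>l<n. \<Sum>i<k. \<Sum>j<k. c i * c j * (a (f i) l * a (f j) l))"
    unfolding b_def power2_eq_square sum_product by (intro sum.cong refl) (simp add: ac_simps)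
  also have "\<dots> = (\<Sum>i<k. \<Sum>l<n. \<Sum>j<k. c i * c j * (a (f i) l * a (f j) l))"
    by (rule sum.swap)
  also have "\<dots> = (\<Sum>i<k. \<Sum>j<k. \<Sum>l<n. c i * c j * (a (f i) l * a (f j) l))"
    by (intro sum.cong refl sum.swap)
  also have "\<dots> = (\<Sum>i<k. \<Sum>j<k. c i * c j * Kov (e (f i)) (e (f j)))"
  proof (intro sum.cong refl)
    fix i j assume "i \<in> {..<k}"
    then have "f i < n" using fn by simp
    then show "(\<Sum>l<n. c i * c j * (a (f i) l * a (f j) l)) = c i * c j * Kov (e (f i)) (e (f j))"
      by (simp only: a[of "f i" n "f j"] sum_distrib_left)
  qed
  finally have sq: "(\<Sum>l<n. (b l)\<^sup>2) = (\<Sum>i<k. \<Sum>j<k. c i * c j * Kov (e (f i)) (e (f j)))" .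
  show "(\<integral>\<xi>. cos (\<Sum>i<k. c i * y (f i) \<xi>) \<partial>iid_normal) = exp (- (\<Sum>i<k. \<Sum>j<k. c i * c j * Kov (e (f i)) (e (f j))) / 2)"
    unfolding lin iid_normal_linear_cos_sin(1) sq ..
  show "(\<integral>\<xi>. sin (\<Sum>i<k. c i * y (f i) \<xi>) \<partial>iid_normal) = 0"
    unfolding lin by (rule iid_normal_linear_cos_sin(2))
qed

definition trunc_seq :: "nat \<Rightarrow> (nat \<Rightarrow> real) \<Rightarrow> nat \<Rightarrow> real" where
  "trunc_seq k x i = (if i < k then x i else 0)"

lemma fidi_convergence:
  assumes "continuous_on UNIV \<phi>" "\<And>x. \<bar>\<phi> x :: real\<bar> \<le> B"
  shows "(\<lambda>n. \<integral>\<omega>. \<phi> (trunc_seq k (\<lambda>i. X n \<omega> (e i))) \<partial>M) \<longlonglongrightarrow> (\<integral>\<xi>. \<phi> (trunc_seq k (\<lambda>i. y i \<xi>)) \<partial>iid_normal)"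
proof (rule weak_convergence_finite_dim[where k=k and B=B and \<phi>=\<phi> and X="\<lambda>n \<omega>. trunc_seq k (\<lambda>i. X n \<omega> (e i))" and Y="\<lambda>\<xi>. trunc_seq k (\<lambda>i. y i \<xi>)"])
  have s: "(\<Sum>i<k. c i * trunc_seq k x i) = (\<Sum>i<k. c i * x i)" for c x unfolding trunc_seq_def by simp
  show "(\<lambda>\<omega>. trunc_seq k (\<lambda>i. X n \<omega> (e i))) \<in> borel_measurable M" for n
    unfolding trunc_seq_def using e_in by (intro measurable_coordinatewise_then_product) auto
  show "(\<lambda>\<xi>. trunc_seq k (\<lambda>i. y i \<xi>)) \<in> borel_measurable iid_normal"
    unfolding trunc_seq_def by (intro measurable_coordinatewise_then_product) auto
  show "\<exists>B. eventually (\<lambda>n. integrable M (\<lambda>\<omega>. (trunc_seq k (\<lambda>i. X n \<omega> (e i)) i)\<^sup>2) \<and> (\<integral>\<omega>. (trunc_seq k (\<lambda>i. X n \<omega> (e i)) i)\<^sup>2 \<partial>M) \<le> B) sequentially" if "i < k" for i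
    using X_sq[OF e_in[of i]] that unfolding trunc_seq_def by simp
  have r: "range e \<subseteq> T" using e_in by auto
  show "(\<lambda>n. \<integral>\<omega>. cos (\<Sum>i<k. c i * trunc_seq k (\<lambda>i. X n \<omega> (e i)) i) \<partial>M) \<longlonglongrightarrow> (\<integral>\<xi>. cos (\<Sum>i<k. c i * trunc_seq k (\<lambda>i. y i \<xi>) i) \<partial>iid_normal)" for c
    unfolding s y_char(1)[of c "\<lambda>i. i"] by (rule X_cos[OF r])
  show "(\<lambda>n. \<integral>\<omega>. sin (\<Sum>i<k. c i * trunc_seq k (\<lambda>i. X n \<omega> (e i)) i) \<partial>M) \<longlonglongrightarrow> (\<integral>\<xi>. sin (\<Sum>i<k. c i * trunc_seq k (\<lambda>i. y i \<xi>) i) \<partial>iid_normal)" for c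
    unfolding s y_char(2)[of c "\<lambda>i. i"] by (rule X_sin[OF r])
qed (use assms prob_space_axioms prob_space_iid_normal in \<open>auto simp: trunc_seq_def\<close>)

definition Y :: "'t \<Rightarrow> (nat \<Rightarrow> real) \<Rightarrow> real" where "Y t \<xi> = y (idx t) \<xi>"

lemma Y_continuous: "continuous_on UNIV (Y t)" unfolding Y_def by (rule y_continuous)

text \<open>Maximizing over pairs of projections instead of points of \<open>T\<close> leaves a
  finite maximum, hence a continuous function of the noise.\<close>

definition \<Delta> :: "nat \<Rightarrow> (nat \<Rightarrow> real) \<Rightarrow> real" where
  "\<Delta> m \<xi> = Max (insert 0 ((\<lambda>(s, t). \<bar>Y s \<xi> - Y t \<xi>\<bar>) ` ((\<lambda>t. (\<pi> (Suc m) t, \<pi> m t)) ` T)))"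

lemma pairs_finite: "finite ((\<lambda>t. (\<pi> (Suc m) t, \<pi> m t)) ` T)"
  by (rule finite_subset[of _ "(\<pi> (Suc m) ` T) \<times> (\<pi> m ` T)"]) (use \<pi>_finite in auto)

lemma continuous_on_Max_insert:
  fixes f :: "'i \<Rightarrow> 'x::topological_space \<Rightarrow> real"
  assumes "finite P" "\<And>p. p \<in> P \<Longrightarrow> continuous_on S (f p)"
  shows "continuous_on S (\<lambda>x. Max (insert 0 ((\<lambda>p. f p x) ` P)))"
  using assms
proof (induction P rule: finite_induct)
  case (insert p P)
  have "Max (insert 0 ((\<lambda>p. f p x) ` insert p P)) = max (f p x) (Max (insert 0 ((\<lambda>p. f p x) ` P)))" for x
    using insert.hyps(1) by (cases "P = {}") (simp_all add: max.left_commute max.commute)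
  then show ?case using insert by (auto intro!: continuous_intros)
qed simp

lemma \<Delta>_continuous: "continuous_on UNIV (\<Delta> m)"
  unfolding \<Delta>_def
  by (rule continuous_on_Max_insert[OF pairs_finite]) (auto intro!: continuous_intros Y_continuous)

lemma \<Delta>_nonneg: "0 \<le> \<Delta> m \<xi>" unfolding \<Delta>_def using pairs_finite by (intro Max_ge) auto

lemma \<Delta>_ge: "t \<in> T \<Longrightarrow> \<bar>Y (\<pi> (Suc m) t) \<xi> - Y (\<pi> m t) \<xi>\<bar> \<le> \<Delta> m \<xi>"
  unfolding \<Delta>_def using pairs_finite by (intro Max_ge) auto

lemma \<Delta>_measurable [measurable]: "\<Delta> m \<in> borel_measurable borel" "\<Delta> m \<in> borel_measurable iid_normal"
proof -
  show "\<Delta> m \<in> borel_measurable borel" using \<Delta>_continuous by (rule borel_measurable_continuous_onI)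
  then show "\<Delta> m \<in> borel_measurable iid_normal" using sets_iid_normal by (simp cong: measurable_cong_sets)
qed

text \<open>The bound is inherited from \<open>X n\<close>: both projections of \<open>t\<close> are
  within their majorants of \<open>t\<close>, and finite-dimensional convergence carries the
  estimate over to the limit. The cap at 1 makes the functional bounded, and the factor 2 covers
  \<open>(1/4) ^ m + (1/4) ^ Suc m\<close>.\<close>

lemma \<Delta>_expectation: "(\<integral>\<xi>. min 1 (\<Delta> m \<xi>) \<partial>iid_normal) \<le> 2 * (1/4) ^ m"
proof -
  define P where "P = (\<lambda>t. (\<pi> (Suc m) t, \<pi> m t)) ` T"
  have P: "finite P" unfolding P_def by (rule pairs_finite)
  define k where "k = Suc (\<Sum>(s,t)\<in>P. idx s + idx t)"
  have ltk: "idx s < k" "idx t < k" if "(s, t) \<in> P" for s t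
  proof -
    have "(\<lambda>(s,t). idx s + idx t) (s, t) \<le> (\<Sum>(s,t)\<in>P. idx s + idx t)" using that P by (intro member_le_sum) auto
    then show "idx s < k" "idx t < k" unfolding k_def by auto
  qed
  define \<phi> where "\<phi> = (\<lambda>x :: nat \<Rightarrow> real. min 1 (Max (insert 0 ((\<lambda>p. \<bar>x (idx (fst p)) - x (idx (snd p))\<bar>) ` P))))"
  have cont: "continuous_on UNIV \<phi>"
    unfolding \<phi>_def by (intro continuous_on_min continuous_on_const continuous_on_Max_insert[OF P] continuous_intros continuous_on_product_coordinates)
  have nn: "0 \<le> \<phi> x" for x unfolding \<phi>_def using P by (auto intro!: Max_ge)
  have bd: "\<bar>\<phi> x\<bar> \<le> 1" for x using nn[of x] unfolding \<phi>_def by auto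
  have \<Delta>\<phi>: "min 1 (\<Delta> m \<xi>) = \<phi> (trunc_seq k (\<lambda>i. y i \<xi>))" for \<xi>
    unfolding \<Delta>_def \<phi>_def P_def[symmetric]
    by (intro arg_cong2[where f=min] refl arg_cong[where f=Max] arg_cong[where f="insert 0"] image_cong)
       (auto simp: trunc_seq_def Y_def ltk)
  have X\<phi>: "eventually (\<lambda>n. (\<integral>\<omega>. \<phi> (trunc_seq k (\<lambda>i. X n \<omega> (e i))) \<partial>M) \<le> 2 * (1/4) ^ m) sequentially"
    using \<pi>_approx[of m] \<pi>_approx[of "Suc m"]
  proof eventually_elim
    fix n
    assume "\<exists>W. integrable M W \<and> (\<integral>\<omega>. W \<omega> \<partial>M) \<le> (1/4) ^ m \<and> (\<forall>\<omega>\<in>space M. \<forall>t\<in>T. \<bar>X n \<omega> t - X n \<omega> (\<pi> m t)\<bar> \<le> W \<omega>)"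
      and "\<exists>W. integrable M W \<and> (\<integral>\<omega>. W \<omega> \<partial>M) \<le> (1/4) ^ Suc m \<and> (\<forall>\<omega>\<in>space M. \<forall>t\<in>T. \<bar>X n \<omega> t - X n \<omega> (\<pi> (Suc m) t)\<bar> \<le> W \<omega>)"
    then obtain W W' where W: "integrable M W" "(\<integral>\<omega>. W \<omega> \<partial>M) \<le> (1/4) ^ m" "\<And>\<omega> t. \<omega> \<in> space M \<Longrightarrow> t \<in> T \<Longrightarrow> \<bar>X n \<omega> t - X n \<omega> (\<pi> m t)\<bar> \<le> W \<omega>"
      and W': "integrable M W'" "(\<integral>\<omega>. W' \<omega> \<partial>M) \<le> (1/4) ^ Suc m" "\<And>\<omega> t. \<omega> \<in> space M \<Longrightarrow> t \<in> T \<Longrightarrow> \<bar>X n \<omega> t - X n \<omega> (\<pi> (Suc m) t)\<bar> \<le> W' \<omega>"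
      by blast
    have "(\<integral>\<omega>. \<phi> (trunc_seq k (\<lambda>i. X n \<omega> (e i))) \<partial>M) \<le> (\<integral>\<omega>. W \<omega> + W' \<omega> \<partial>M)"
    proof (rule integral_mono)
      have "(\<lambda>\<omega>. trunc_seq k (\<lambda>i. X n \<omega> (e i))) \<in> borel_measurable M"
        unfolding trunc_seq_def using e_in by (intro measurable_coordinatewise_then_product) auto
      then have "(\<lambda>\<omega>. \<phi> (trunc_seq k (\<lambda>i. X n \<omega> (e i)))) \<in> borel_measurable M"
        using borel_measurable_continuous_onI[OF cont] by (rule measurable_compose)
      then show "integrable M (\<lambda>\<omega>. \<phi> (trunc_seq k (\<lambda>i. X n \<omega> (e i))))"
        using bd by (intro integrable_const_bound[where B=1]) auto
      show "integrable M (\<lambda>\<omega>. W \<omega> + W' \<omega>)" using W W' by simp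
      fix \<omega> assume \<omega>: "\<omega> \<in> space M"
      \<comment> \<open>A point of \<open>T\<close> is needed to see that the majorants are
        nonnegative.\<close>
      obtain t0 where t0: "t0 \<in> T" using T_nonempty by blast
      have "Max (insert 0 ((\<lambda>p. \<bar>trunc_seq k (\<lambda>i. X n \<omega> (e i)) (idx (fst p)) - trunc_seq k (\<lambda>i. X n \<omega> (e i)) (idx (snd p))\<bar>) ` P)) \<le> W \<omega> + W' \<omega>"
      proof (rule Max.boundedI)
        fix v assume "v \<in> insert 0 ((\<lambda>p. \<bar>trunc_seq k (\<lambda>i. X n \<omega> (e i)) (idx (fst p)) - trunc_seq k (\<lambda>i. X n \<omega> (e i)) (idx (snd p))\<bar>) ` P)"
        then consider "v = 0" | p where "p \<in> P" "v = \<bar>trunc_seq k (\<lambda>i. X n \<omega> (e i)) (idx (fst p)) - trunc_seq k (\<lambda>i. X n \<omega> (e i)) (idx (snd p))\<bar>"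
          by blast
        then show "v \<le> W \<omega> + W' \<omega>"
        proof cases
          case 1
          then show ?thesis using W(3)[OF \<omega> t0] W'(3)[OF \<omega> t0] by linarith
        next
          case 2
          then obtain t where t: "t \<in> T" "p = (\<pi> (Suc m) t, \<pi> m t)" unfolding P_def by blast
          have "v = \<bar>X n \<omega> (\<pi> (Suc m) t) - X n \<omega> (\<pi> m t)\<bar>"
            using 2 ltk[of "\<pi> (Suc m) t" "\<pi> m t"] t unfolding trunc_seq_def by (simp add: e_idx \<pi>_T0)
          then show ?thesis using W(3)[OF \<omega> t(1)] W'(3)[OF \<omega> t(1)] by linarith
        qed
      qed (use P in auto)
      then show "\<phi> (trunc_seq k (\<lambda>i. X n \<omega> (e i))) \<le> W \<omega> + W' \<omega>" unfolding \<phi>_def by simp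
    qed
    also have "\<dots> = (\<integral>\<omega>. W \<omega> \<partial>M) + (\<integral>\<omega>. W' \<omega> \<partial>M)" using W W' by simp
    also have "\<dots> \<le> 2 * (1/4) ^ m"
    proof -
      have "0 \<le> (1/4 :: real) ^ m" "(1/4 :: real) ^ Suc m = (1/4) * (1/4) ^ m" by simp_all
      then show ?thesis using W(2) W'(2) by linarith
    qed
    finally show "(\<integral>\<omega>. \<phi> (trunc_seq k (\<lambda>i. X n \<omega> (e i))) \<partial>M) \<le> 2 * (1/4) ^ m" .
  qed
  show ?thesis
    unfolding \<Delta>\<phi> by (rule tendsto_upperbound[OF fidi_convergence[OF cont bd] X\<phi>]) simp
qed

definition E :: "nat \<Rightarrow> (nat \<Rightarrow> real) set" where "E k = {\<xi>. \<forall>m\<ge>k. \<Delta> m \<xi> \<le> (1/2) ^ m}"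

lemma E_borel: "E k \<in> sets borel"
proof -
  have "E k = (\<Inter>m\<in>{k..}. {\<xi> \<in> space borel. \<Delta> m \<xi> \<le> (1/2) ^ m})" unfolding E_def by auto
  also have "\<dots> \<in> sets borel" by (intro sets.countable_INT'') auto
  finally show ?thesis .
qed

lemma E_incseq: "incseq E" unfolding E_def incseq_def by auto

text \<open>Borel-Cantelli: the exceptional probabilities are at most
  \<open>2 * (1/4) ^ m / (1/2) ^ m\<close>.\<close>

lemma AE_E: "AE \<xi> in iid_normal. \<xi> \<in> (\<Union>k. E k)"
proof -
  interpret N: prob_space iid_normal by (rule prob_space_iid_normal)
  define A where "A m = {\<xi> \<in> space iid_normal. (1/2) ^ m \<le> min 1 (\<Delta> m \<xi>)}" for m
  have A[measurable]: "A m \<in> sets iid_normal" for m unfolding A_def by measurable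
  have pA: "N.prob (A m) \<le> 2 * (1/2) ^ m" for m
  proof -
    have "integrable iid_normal (\<lambda>\<xi>. min 1 (\<Delta> m \<xi>))"
      using \<Delta>_nonneg[of m] by (intro N.integrable_const_bound[where B=1]) (auto simp: abs_le_iff min_def)
    then have "N.prob (A m) \<le> (\<integral>\<xi>. min 1 (\<Delta> m \<xi>) \<partial>iid_normal) / (1/2) ^ m"
      unfolding A_def using \<Delta>_nonneg by (intro integral_Markov_inequality_measure[where A="space iid_normal"]) (auto)
    also have "\<dots> \<le> 2 * (1/4) ^ m / (1/2) ^ m" using \<Delta>_expectation by (intro divide_right_mono) auto
    also have "\<dots> = 2 * (1/2) ^ m"
    proof -
      have "(1/4 :: real) ^ m = (1/2) ^ m * (1/2) ^ m" by (simp flip: power_mult_distrib)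
      then show ?thesis by simp
    qed
    finally show ?thesis .
  qed
  have "summable (\<lambda>m. 2 * (1/2::real) ^ m)" by (rule summable_mult[OF summable_geometric]) simp
  then have "summable (\<lambda>m. N.prob (A m))"
    by (rule summable_comparison_test'[where N=0]) (use pA in simp)
  then have "AE \<xi> in iid_normal. eventually (\<lambda>m. \<xi> \<in> space iid_normal - A m) sequentially"
    by (intro borel_cantelli_AE1[OF A]) (simp_all add: N.emeasure_eq_measure)
  then show ?thesis
  proof eventually_elim
    fix \<xi> assume "eventually (\<lambda>m. \<xi> \<in> space iid_normal - A m) sequentially"
    then obtain k where k: "\<And>m. m \<ge> k \<Longrightarrow> \<xi> \<notin> A m" unfolding eventually_sequentially by auto
    have "\<Delta> m \<xi> \<le> (1/2) ^ m" if "m \<ge> k" for m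
    proof -
      \<comment> \<open>The cap at 1 is harmless because the threshold never exceeds 1.\<close>
      have "(1/2 :: real) ^ m \<le> 1" by (simp add: power_le_one)
      then show ?thesis using k[OF that] unfolding A_def by (auto simp: not_le min_def split: if_splits)
    qed
    then show "\<xi> \<in> (\<Union>k. E k)" unfolding E_def by blast
  qed
qed

definition Gm :: "nat \<Rightarrow> (nat \<Rightarrow> real) \<Rightarrow> 't \<Rightarrow> real" where
  "Gm m \<xi> = (\<lambda>t\<in>T. Y (\<pi> m t) \<xi>)"

text \<open>Off the union the limit may fail to exist; a constant there keeps the map
  measurable.\<close>

definition G0 :: "(nat \<Rightarrow> real) \<Rightarrow> 't \<Rightarrow> real" where
  "G0 \<xi> = (if \<xi> \<in> (\<Union>k. E k) then (\<lambda>t\<in>T. lim (\<lambda>m. Y (\<pi> m t) \<xi>)) else (\<lambda>t\<in>T. 0))"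

lemma Gm_mem: "Gm m \<xi> \<in> mspace (linf T)"
proof -
  have "\<forall>t\<in>T. \<bar>Gm m \<xi> t\<bar> \<le> (\<Sum>s\<in>\<pi> m ` T. \<bar>Y s \<xi>\<bar>)"
    unfolding Gm_def using \<pi>_finite by (auto intro!: member_le_sum)
  then show ?thesis unfolding mspace_linf Gm_def by auto
qed

lemma Y_limit:
  assumes "\<xi> \<in> E k" "t \<in> T"
  shows "(\<lambda>m. Y (\<pi> m t) \<xi>) \<longlonglongrightarrow> G0 \<xi> t" "k \<le> m \<Longrightarrow> \<bar>Y (\<pi> m t) \<xi> - G0 \<xi> t\<bar> \<le> 2 * (1/2) ^ m"
proof -
  have inc: "\<bar>Y (\<pi> (Suc m) t) \<xi> - Y (\<pi> m t) \<xi>\<bar> \<le> (1/2) ^ m" if "k \<le> m" for m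
    using \<Delta>_ge[OF assms(2), of m \<xi>] assms(1) that unfolding E_def by (auto intro: order_trans)
  have G: "G0 \<xi> t = lim (\<lambda>m. Y (\<pi> m t) \<xi>)" unfolding G0_def using assms by auto
  note l = geometric_increments_limit[of k "\<lambda>m. Y (\<pi> m t) \<xi>", OF inc]
  show "(\<lambda>m. Y (\<pi> m t) \<xi>) \<longlonglongrightarrow> G0 \<xi> t" unfolding G using l(1) by (simp add: convergent_LIMSEQ_iff)
  show "k \<le> m \<Longrightarrow> \<bar>Y (\<pi> m t) \<xi> - G0 \<xi> t\<bar> \<le> 2 * (1/2) ^ m" unfolding G by (rule l(2))
qed

lemma G0_mem: "G0 \<xi> \<in> mspace (linf T)"
proof (cases "\<xi> \<in> (\<Union>k. E k)")
  case True
  then obtain k where k: "\<xi> \<in> E k" by blast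
  obtain B where B: "\<And>t. t \<in> T \<Longrightarrow> \<bar>Gm k \<xi> t\<bar> \<le> B" using Gm_mem[of k \<xi>] unfolding mspace_linf by blast
  have "\<bar>G0 \<xi> t\<bar> \<le> B + 2 * (1/2) ^ k" if "t \<in> T" for t
    using Y_limit(2)[OF k that, of k] B[OF that] that unfolding Gm_def by simp
  moreover have "G0 \<xi> \<in> extensional T" unfolding G0_def by simp
  ultimately show ?thesis unfolding mspace_linf by blast
next
  case False
  then show ?thesis unfolding G0_def mspace_linf by auto
qed

lemma Gm_G0_dist:
  assumes "\<xi> \<in> E k" "k \<le> m"
  shows "mdist (linf T) (Gm m \<xi>) (G0 \<xi>) \<le> 2 * (1/2) ^ m"
  using Y_limit(2)[OF assms(1) _ assms(2)]
  by (subst mdist_linf_le[OF Gm_mem G0_mem]) (auto simp: Gm_def)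

text \<open>All values of \<open>Gm m\<close> come from finitely many coordinates, so the sup
  distance is dominated by a finite sum of continuous functions.\<close>

lemma Gm_continuous: "continuous_map (top_of_set S) (mtopology_of (linf T)) (Gm m)"
proof -
  interpret Metric_space "mspace (linf T)" "mdist (linf T)" by (rule Metric_space_mspace_mdist)
  show ?thesis
    unfolding mtopology_of_def continuous_map_to_metric
  proof (intro ballI allI impI)
    fix \<xi> and \<epsilon> :: real assume \<xi>: "\<xi> \<in> topspace (top_of_set S)" and \<epsilon>: "0 < \<epsilon>"
    define D where "D = (\<lambda>\<zeta>. \<Sum>s\<in>\<pi> m ` T. \<bar>Y s \<xi> - Y s \<zeta>\<bar>)"
    have "continuous_on UNIV D"
      unfolding D_def by (intro continuous_intros Y_continuous)
    then have op: "open {\<zeta>. D \<zeta> < \<epsilon>/2}" using open_Collect_less[of D "\<lambda>_. \<epsilon>/2"] by simp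
    have "D \<xi> = 0" unfolding D_def by simp
    have "mdist (linf T) (Gm m \<xi>) (Gm m \<zeta>) \<le> D \<zeta>" for \<zeta>
      unfolding D_def using \<pi>_finite
      by (subst mdist_linf_le[OF Gm_mem Gm_mem]) (auto simp: Gm_def sum_nonneg intro!: member_le_sum)
    then have "mdist (linf T) (Gm m \<xi>) (Gm m \<zeta>) < \<epsilon>" if "D \<zeta> < \<epsilon>/2" for \<zeta>
    proof -
      have "\<epsilon>/2 < \<epsilon>" using \<epsilon> by simp
      then show ?thesis using that \<open>\<And>\<zeta>. mdist (linf T) (Gm m \<xi>) (Gm m \<zeta>) \<le> D \<zeta>\<close>[of \<zeta>] by linarith
    qed
    then have "Gm m \<zeta> \<in> mball (Gm m \<xi>) \<epsilon>" if "D \<zeta> < \<epsilon>/2" for \<zeta>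
      using that by (simp add: in_mball Gm_mem)
    then show "\<exists>U. openin (top_of_set S) U \<and> \<xi> \<in> U \<and> (\<forall>\<zeta>\<in>U. Gm m \<zeta> \<in> mball (Gm m \<xi>) \<epsilon>)"
      using op \<xi> \<epsilon> \<open>D \<xi> = 0\<close> by (intro exI[of _ "S \<inter> {\<zeta>. D \<zeta> < \<epsilon>/2}"]) (auto simp: openin_open)
  qed
qed

lemma half_power_small: "0 < \<epsilon> \<Longrightarrow> eventually (\<lambda>m. 2 * (1/2 :: real) ^ m < \<epsilon>) sequentially"
  using order_tendstoD(2)[OF tendsto_mult_right_zero[OF LIMSEQ_power_zero[of "1/2 :: real"], of 2], of \<epsilon>] by simp

lemma G0_continuous: "continuous_map (top_of_set (E k)) (mtopology_of (linf T)) G0"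
proof -
  interpret Metric_space "mspace (linf T)" "mdist (linf T)" by (rule Metric_space_mspace_mdist)
  show ?thesis
    unfolding mtopology_of_def
  proof (rule continuous_map_uniform_limit_alt[where f=Gm and F=sequentially])
    show "\<forall>\<^sub>F m in sequentially. continuous_map (top_of_set (E k)) mtopology (Gm m)"
      using Gm_continuous unfolding mtopology_of_def by simp
    show "G0 \<in> topspace (top_of_set (E k)) \<rightarrow> mspace (linf T)" using G0_mem by simp
    fix \<epsilon> :: real assume "0 < \<epsilon>"
    from half_power_small[OF this] eventually_ge_at_top[of k]
    show "\<forall>\<^sub>F m in sequentially. \<forall>\<xi>\<in>topspace (top_of_set (E k)). mdist (linf T) (Gm m \<xi>) (G0 \<xi>) < \<epsilon>"
      by eventually_elim (auto intro: le_less_trans[OF Gm_G0_dist])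
  qed simp
qed

lemma G0_tight: "tight_random_element (linf T) iid_normal G0"
  by (rule tight_of_locally_continuous[where E=E and c="\<lambda>t\<in>T. 0"])
    (use E_borel E_incseq AE_E G0_continuous G0_mem in \<open>auto simp: prob_space_iid_normal sets_iid_normal G0_def mspace_linf\<close>)

lemma G0_measurable: "G0 \<in> measurable iid_normal (borel_of_metric (linf T))"
  using G0_tight unfolding tight_random_element_def by blast

end

section \<open>The law of the limit and convergence towards it\<close>

lemma abs_cos_diff_le: "\<bar>cos x - cos y\<bar> \<le> \<bar>x - y :: real\<bar>"
proof -
  have "\<bar>cos x - cos y\<bar> = 2 * (\<bar>sin ((x + y) / 2)\<bar> * \<bar>sin ((y - x) / 2)\<bar>)"
    by (subst cos_diff_cos) (simp add: abs_mult)
  also have "\<dots> \<le> 2 * (1 * \<bar>(y - x) / 2\<bar>)"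
    by (intro mult_left_mono mult_mono abs_sin_le_one abs_sin_x_le_abs_x) auto
  finally show ?thesis by (simp add: abs_minus_commute)
qed

lemma lipschitz_eval:
  assumes "t \<in> T" shows "lipschitz_metric (linf T) 1 (\<lambda>x. x t)"
  unfolding lipschitz_metric_def
proof (intro ballI)
  fix x y assume xy: "x \<in> mspace (linf T)" "y \<in> mspace (linf T)"
  have nn: "0 \<le> mdist (linf T) x y" by (simp add: Metric_space.nonneg[OF Metric_space_mspace_mdist])
  show "\<bar>x t - y t\<bar> \<le> 1 * mdist (linf T) x y"
    using mdist_linf_le[OF xy nn] assms by simp
qed

context approx_process
begin

lemma range_\<pi>_finite_sum: "t \<in> T \<Longrightarrow> g (\<pi> m t) \<le> (\<Sum>s\<in>\<pi> m ` T. g s)" if "\<And>s. 0 \<le> (g s :: real)"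
  using \<pi>_finite that by (intro member_le_sum) simp_all

lemma Y_char:
  fixes f :: "nat \<Rightarrow> 't" and k :: nat
  assumes f: "range f \<subseteq> T"
  shows "(\<integral>\<xi>. cos (\<Sum>i<k. c i * Y (\<pi> m (f i)) \<xi>) \<partial>iid_normal) = exp (- (\<Sum>i<k. \<Sum>j<k. c i * c j * Kov (\<pi> m (f i)) (\<pi> m (f j))) / 2)"
    and "(\<integral>\<xi>. sin (\<Sum>i<k. c i * Y (\<pi> m (f i)) \<xi>) \<partial>iid_normal) = 0"
proof -
  have e: "e (idx (\<pi> m (f i))) = \<pi> m (f i)" for i using f by (intro e_idx \<pi>_T0) auto
  show "(\<integral>\<xi>. cos (\<Sum>i<k. c i * Y (\<pi> m (f i)) \<xi>) \<partial>iid_normal) = exp (- (\<Sum>i<k. \<Sum>j<k. c i * c j * Kov (\<pi> m (f i)) (\<pi> m (f j))) / 2)"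
    unfolding Y_def using y_char(1)[of c "\<lambda>i. idx (\<pi> m (f i))" k] unfolding e .
  show "(\<integral>\<xi>. sin (\<Sum>i<k. c i * Y (\<pi> m (f i)) \<xi>) \<partial>iid_normal) = 0"
    unfolding Y_def by (rule y_char(2))
qed

lemma Y_measurable [measurable]: "Y t \<in> borel_measurable iid_normal"
proof -
  have "Y t = y (idx t)" by (intro ext) (simp add: Y_def)
  then show ?thesis using y_measurable(1) by metis
qed

lemma G0_eval_measurable [measurable]: "t \<in> T \<Longrightarrow> (\<lambda>\<xi>. G0 \<xi> t) \<in> borel_measurable iid_normal"
  using measurable_compose[OF G0_measurable borel_measurable_of_continuous_map[OF lipschitz_metric_continuous[OF lipschitz_eval]]] .

lemma AE_Y_limit:
  "AE \<xi> in iid_normal. \<forall>t\<in>T. (\<lambda>m. Y (\<pi> m t) \<xi>) \<longlonglongrightarrow> G0 \<xi> t"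
  using AE_E by eventually_elim (blast intro: Y_limit(1))

text \<open>Continuity of \<open>Kov\<close> along the nets is not among the assumptions; it is
  recovered from the process. Cosine is 1-Lipschitz, so moving each point to its projection changes
  the expected cosines of \<open>X n\<close> by at most \<open>C * (1/4) ^ m\<close> for large
  \<open>n\<close>, and this bound survives the limit in \<open>n\<close>.\<close>

lemma Kov_\<pi>_limit:
  fixes f :: "nat \<Rightarrow> 't" and k :: nat
  assumes f: "range f \<subseteq> T"
  shows "(\<lambda>m. exp (- (\<Sum>i<k. \<Sum>j<k. c i * c j * Kov (\<pi> m (f i)) (\<pi> m (f j))) / 2)) \<longlonglongrightarrow>
    exp (- (\<Sum>i<k. \<Sum>j<k. c i * c j * Kov (f i) (f j)) / 2)" (is "?S \<longlonglongrightarrow> ?L")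
proof -
  define C where "C = (\<Sum>i<k. \<bar>c i\<bar>)"
  have fT: "f i \<in> T" for i using f by auto
  have bound: "\<bar>?S m - ?L\<bar> \<le> C * (1/4) ^ m" for m
  proof -
    have r: "range (\<lambda>i. \<pi> m (f i)) \<subseteq> T" using fT \<pi>_in by auto
    have lim: "(\<lambda>n. \<bar>(\<integral>\<omega>. cos (\<Sum>i<k. c i * X n \<omega> (\<pi> m (f i))) \<partial>M) - (\<integral>\<omega>. cos (\<Sum>i<k. c i * X n \<omega> (f i)) \<partial>M)\<bar>) \<longlonglongrightarrow> \<bar>?S m - ?L\<bar>"
      by (intro tendsto_intros X_cos[OF r] X_cos[OF f])
    have "eventually (\<lambda>n. \<bar>(\<integral>\<omega>. cos (\<Sum>i<k. c i * X n \<omega> (\<pi> m (f i))) \<partial>M) - (\<integral>\<omega>. cos (\<Sum>i<k. c i * X n \<omega> (f i)) \<partial>M)\<bar> \<le> C * (1/4) ^ m) sequentially"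
      using \<pi>_approx[of m]
    proof eventually_elim
      fix n assume "\<exists>W. integrable M W \<and> (\<integral>\<omega>. W \<omega> \<partial>M) \<le> (1/4) ^ m \<and> (\<forall>\<omega>\<in>space M. \<forall>t\<in>T. \<bar>X n \<omega> t - X n \<omega> (\<pi> m t)\<bar> \<le> W \<omega>)"
      then obtain W where W: "integrable M W" "(\<integral>\<omega>. W \<omega> \<partial>M) \<le> (1/4) ^ m" "\<And>\<omega> t. \<omega> \<in> space M \<Longrightarrow> t \<in> T \<Longrightarrow> \<bar>X n \<omega> t - X n \<omega> (\<pi> m t)\<bar> \<le> W \<omega>"
        by blast
      have m1: "(\<lambda>\<omega>. cos (\<Sum>i<k. c i * X n \<omega> (g i))) \<in> borel_measurable M" if "\<And>i. g i \<in> T" for g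
        using that by measurable
      have i1: "integrable M (\<lambda>\<omega>. cos (\<Sum>i<k. c i * X n \<omega> (g i)))" if "\<And>i. g i \<in> T" for g
        by (rule integrable_const_bound[where B=1]) (use m1[OF that] in simp_all)
      have ip: "integrable M (\<lambda>\<omega>. cos (\<Sum>i<k. c i * X n \<omega> (\<pi> m (f i))))" "integrable M (\<lambda>\<omega>. cos (\<Sum>i<k. c i * X n \<omega> (f i)))"
        using i1[of "\<lambda>i. \<pi> m (f i)"] i1[of f] fT \<pi>_in by simp_all
      have "\<bar>(\<integral>\<omega>. cos (\<Sum>i<k. c i * X n \<omega> (\<pi> m (f i))) \<partial>M) - (\<integral>\<omega>. cos (\<Sum>i<k. c i * X n \<omega> (f i)) \<partial>M)\<bar>
        = \<bar>\<integral>\<omega>. cos (\<Sum>i<k. c i * X n \<omega> (\<pi> m (f i))) - cos (\<Sum>i<k. c i * X n \<omega> (f i)) \<partial>M\<bar>"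
        using ip by simp
      also have "\<dots> \<le> (\<integral>\<omega>. \<bar>cos (\<Sum>i<k. c i * X n \<omega> (\<pi> m (f i))) - cos (\<Sum>i<k. c i * X n \<omega> (f i))\<bar> \<partial>M)"
        by (rule integral_abs_bound)
      also have "\<dots> \<le> (\<integral>\<omega>. C * W \<omega> \<partial>M)"
      proof (rule integral_mono)
        show "integrable M (\<lambda>\<omega>. \<bar>cos (\<Sum>i<k. c i * X n \<omega> (\<pi> m (f i))) - cos (\<Sum>i<k. c i * X n \<omega> (f i))\<bar>)"
          using ip by simp
        show "integrable M (\<lambda>\<omega>. C * W \<omega>)" using W by simp
        fix \<omega> assume \<omega>: "\<omega> \<in> space M"
        have "\<bar>cos (\<Sum>i<k. c i * X n \<omega> (\<pi> m (f i))) - cos (\<Sum>i<k. c i * X n \<omega> (f i))\<bar>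
          \<le> \<bar>(\<Sum>i<k. c i * X n \<omega> (\<pi> m (f i))) - (\<Sum>i<k. c i * X n \<omega> (f i))\<bar>" by (rule abs_cos_diff_le)
        also have "\<dots> = \<bar>\<Sum>i<k. c i * (X n \<omega> (\<pi> m (f i)) - X n \<omega> (f i))\<bar>"
          by (simp add: sum_subtractf right_diff_distrib)
        also have "\<dots> \<le> (\<Sum>i<k. \<bar>c i\<bar> * W \<omega>)"
        proof (rule order_trans[OF sum_abs sum_mono])
          fix i
          have "\<bar>X n \<omega> (\<pi> m (f i)) - X n \<omega> (f i)\<bar> \<le> W \<omega>" using W(3)[OF \<omega> fT, of i] by (simp add: abs_minus_commute)
          then show "\<bar>c i * (X n \<omega> (\<pi> m (f i)) - X n \<omega> (f i))\<bar> \<le> \<bar>c i\<bar> * W \<omega>"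
            unfolding abs_mult by (rule mult_left_mono) simp
        qed
        also have "\<dots> = C * W \<omega>" unfolding C_def by (simp add: sum_distrib_right)
        finally show "\<bar>cos (\<Sum>i<k. c i * X n \<omega> (\<pi> m (f i))) - cos (\<Sum>i<k. c i * X n \<omega> (f i))\<bar> \<le> C * W \<omega>" .
      qed
      also have "\<dots> = C * (\<integral>\<omega>. W \<omega> \<partial>M)" by simp
      also have "\<dots> \<le> C * (1/4) ^ m" using W(2) by (intro mult_left_mono) (simp_all add: C_def sum_nonneg)
      finally show "\<bar>(\<integral>\<omega>. cos (\<Sum>i<k. c i * X n \<omega> (\<pi> m (f i))) \<partial>M) - (\<integral>\<omega>. cos (\<Sum>i<k. c i * X n \<omega> (f i)) \<partial>M)\<bar> \<le> C * (1/4) ^ m" .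
    qed
    then show ?thesis by (rule tendsto_upperbound[OF lim]) simp
  qed
  have "(\<lambda>m. C * (1/4 :: real) ^ m) \<longlonglongrightarrow> 0"
    by (rule tendsto_mult_right_zero[OF LIMSEQ_power_zero]) simp
  then have "(\<lambda>m. ?S m - ?L) \<longlonglongrightarrow> 0"
    by (rule Lim_null_comparison[rotated]) (simp only: real_norm_def bound eventually_True)
  then show ?thesis by (rule LIM_zero_cancel)
qed

text \<open>The law is obtained along projections for every point alike, including those of
  \<open>T0\<close>, where the limit is not compared with \<open>y\<close> directly.\<close>

lemma G0_char:
  fixes f :: "nat \<Rightarrow> 't" and k :: nat
  assumes f: "range f \<subseteq> T"
  shows "(\<integral>\<xi>. cos (\<Sum>i<k. c i * G0 \<xi> (f i)) \<partial>iid_normal) = exp (- (\<Sum>i<k. \<Sum>j<k. c i * c j * Kov (f i) (f j)) / 2)" (is ?C)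
    and "(\<integral>\<xi>. sin (\<Sum>i<k. c i * G0 \<xi> (f i)) \<partial>iid_normal) = 0" (is ?S)
proof -
  interpret N: prob_space iid_normal by (rule prob_space_iid_normal)
  have fT: "f i \<in> T" for i using f by auto
  have ae: "AE \<xi> in iid_normal. (\<lambda>m. \<Sum>i<k. c i * Y (\<pi> m (f i)) \<xi>) \<longlonglongrightarrow> (\<Sum>i<k. c i * G0 \<xi> (f i))"
    using AE_Y_limit by eventually_elim (intro tendsto_intros, use fT in blast)
  have [measurable]: "(\<lambda>\<xi>. \<Sum>i<k. c i * G0 \<xi> (f i)) \<in> borel_measurable iid_normal"
    using fT by measurable
  have "(\<lambda>m. \<integral>\<xi>. cos (\<Sum>i<k. c i * Y (\<pi> m (f i)) \<xi>) \<partial>iid_normal) \<longlonglongrightarrow> (\<integral>\<xi>. cos (\<Sum>i<k. c i * G0 \<xi> (f i)) \<partial>iid_normal)"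
  proof (rule integral_dominated_convergence[where w="\<lambda>_. 1"])
    show "AE \<xi> in iid_normal. (\<lambda>m. cos (\<Sum>i<k. c i * Y (\<pi> m (f i)) \<xi>)) \<longlonglongrightarrow> cos (\<Sum>i<k. c i * G0 \<xi> (f i))"
      using ae by eventually_elim (rule tendsto_cos)
  qed simp_all
  then show ?C unfolding Y_char(1)[OF f] using Kov_\<pi>_limit[OF f] by (rule LIMSEQ_unique)
  have "(\<lambda>m. \<integral>\<xi>. sin (\<Sum>i<k. c i * Y (\<pi> m (f i)) \<xi>) \<partial>iid_normal) \<longlonglongrightarrow> (\<integral>\<xi>. sin (\<Sum>i<k. c i * G0 \<xi> (f i)) \<partial>iid_normal)"
  proof (rule integral_dominated_convergence[where w="\<lambda>_. 1"])
    show "AE \<xi> in iid_normal. (\<lambda>m. sin (\<Sum>i<k. c i * Y (\<pi> m (f i)) \<xi>)) \<longlonglongrightarrow> sin (\<Sum>i<k. c i * G0 \<xi> (f i))"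
      using ae by eventually_elim (rule tendsto_sin)
  qed simp_all
  then show ?S unfolding Y_char(2)[OF f] by (rule LIMSEQ_unique) simp
qed

text \<open>Scaling the coefficients by \<open>s\<close> gives the characteristic function of the
  combination at \<open>s\<close>, which identifies its law.\<close>

lemma G0_moments:
  fixes f :: "nat \<Rightarrow> 't" and k :: nat
  assumes f: "range f \<subseteq> T"
  shows "normal_law (distr iid_normal borel (\<lambda>\<xi>. \<Sum>i<k. c i * G0 \<xi> (f i)))"
    and "integrable iid_normal (\<lambda>\<xi>. (\<Sum>i<k. c i * G0 \<xi> (f i))\<^sup>2)"
    and "(\<integral>\<xi>. (\<Sum>i<k. c i * G0 \<xi> (f i)) \<partial>iid_normal) = 0"
    and "(\<integral>\<xi>. (\<Sum>i<k. c i * G0 \<xi> (f i))\<^sup>2 \<partial>iid_normal) = (\<Sum>i<k. \<Sum>j<k. c i * c j * Kov (f i) (f j))"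
proof -
  define V where "V = (\<Sum>i<k. \<Sum>j<k. c i * c j * Kov (f i) (f j))"
  have V: "0 \<le> V" unfolding V_def by (rule psdD[OF Kov_psd[OF f]])
  have fT: "f i \<in> T" for i using f by auto
  have [measurable]: "(\<lambda>\<xi>. \<Sum>i<k. c i * G0 \<xi> (f i)) \<in> borel_measurable iid_normal"
    using fT by measurable
  have scale: "(\<Sum>i<k. \<Sum>j<k. (s * c i) * (s * c j) * Kov (f i) (f j)) = s\<^sup>2 * V" for s
    unfolding V_def sum_distrib_left by (intro sum.cong refl) (simp add: power2_eq_square)
  have sm: "s * (\<Sum>i<k. c i * G0 \<xi> (f i)) = (\<Sum>i<k. (s * c i) * G0 \<xi> (f i))" for s \<xi>
    by (simp add: sum_distrib_left mult.assoc)
  have cs: "(\<integral>\<xi>. cos (s * (\<Sum>i<k. c i * G0 \<xi> (f i))) \<partial>iid_normal) = exp (- s\<^sup>2 * V / 2)" for s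
    unfolding sm G0_char(1)[OF f] scale by simp
  have sn: "(\<integral>\<xi>. sin (s * (\<Sum>i<k. c i * G0 \<xi> (f i))) \<partial>iid_normal) = 0" for s
    unfolding sm by (rule G0_char(2)[OF f])
  note m = moments_of_normal_char[OF prob_space_iid_normal _ V cs sn]
  show "normal_law (distr iid_normal borel (\<lambda>\<xi>. \<Sum>i<k. c i * G0 \<xi> (f i)))"
    "integrable iid_normal (\<lambda>\<xi>. (\<Sum>i<k. c i * G0 \<xi> (f i))\<^sup>2)"
    "(\<integral>\<xi>. (\<Sum>i<k. c i * G0 \<xi> (f i)) \<partial>iid_normal) = 0"
    "(\<integral>\<xi>. (\<Sum>i<k. c i * G0 \<xi> (f i))\<^sup>2 \<partial>iid_normal) = (\<Sum>i<k. \<Sum>j<k. c i * c j * Kov (f i) (f j))"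
    unfolding V_def[symmetric] by (rule m, measurable)+
qed

lemma G0_mean: "t \<in> T \<Longrightarrow> (\<integral>\<xi>. G0 \<xi> t \<partial>iid_normal) = 0"
  using G0_moments(3)[of "\<lambda>_. t" "\<lambda>_. 1" 1] by simp

text \<open>Polarization: the squares of the sum and of the difference have known means by
  \<open>G0_moments\<close>.\<close>

lemma G0_cov:
  assumes s: "s \<in> T" and t: "t \<in> T"
  shows "(\<integral>\<xi>. G0 \<xi> s * G0 \<xi> t \<partial>iid_normal) = Kov s t"
proof -
  define f where "f = (\<lambda>i::nat. if i = 0 then s else t)"
  have f: "range f \<subseteq> T" unfolding f_def using s t by auto
  have two: "(\<Sum>i<2. g i) = g 0 + g (1::nat)" for g :: "nat \<Rightarrow> real" by (simp add: numeral_2_eq_2)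
  have sym: "Kov t s = Kov s t" using psd_sym[OF Kov_psd[OF f], of 1 0] unfolding f_def by simp
  have p: "integrable iid_normal (\<lambda>\<xi>. (G0 \<xi> s + G0 \<xi> t)\<^sup>2)" "(\<integral>\<xi>. (G0 \<xi> s + G0 \<xi> t)\<^sup>2 \<partial>iid_normal) = Kov s s + 2 * Kov s t + Kov t t"
    using G0_moments(2,4)[OF f, where c="\<lambda>_. 1" and k=2] unfolding two f_def by (simp_all add: sym)
  have q: "integrable iid_normal (\<lambda>\<xi>. (G0 \<xi> s - G0 \<xi> t)\<^sup>2)" "(\<integral>\<xi>. (G0 \<xi> s - G0 \<xi> t)\<^sup>2 \<partial>iid_normal) = Kov s s - 2 * Kov s t + Kov t t"
    using G0_moments(2,4)[OF f, where c="\<lambda>i. if i = 0 then 1 else -1" and k=2] unfolding two f_def by (simp_all add: sym)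
  have "(\<integral>\<xi>. G0 \<xi> s * G0 \<xi> t \<partial>iid_normal) = (\<integral>\<xi>. ((G0 \<xi> s + G0 \<xi> t)\<^sup>2 - (G0 \<xi> s - G0 \<xi> t)\<^sup>2) / 4 \<partial>iid_normal)"
    by (intro Bochner_Integration.integral_cong refl) (simp add: power2_eq_square algebra_simps)
  also have "\<dots> = Kov s t" using p q by simp
  finally show ?thesis .
qed

text \<open>Three comparisons: the process with its projection to a net, where the majorant turns
  outer expectations into integrals; the projection with \<open>Gm m\<close>, by finite-dimensional
  convergence; and \<open>Gm m\<close> with \<open>G0\<close>, by the geometric rate on
  \<open>E k\<close>.\<close>

lemma lipschitz_limit:
  assumes lip: "lipschitz_metric (linf T) L h" and B: "\<And>x. x \<in> mspace (linf T) \<Longrightarrow> \<bar>h x\<bar> \<le> B"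
  shows "(\<lambda>n. outer_expectation M (\<lambda>\<omega>. h (X n \<omega>))) \<longlonglongrightarrow> (\<integral>\<xi>. h (G0 \<xi>) \<partial>iid_normal)"
proof -
  interpret N: prob_space iid_normal by (rule prob_space_iid_normal)
  define C where "C = \<bar>L\<bar>"
  have hL: "\<bar>h x - h z\<bar> \<le> C * a" if "x \<in> mspace (linf T)" "z \<in> mspace (linf T)" "0 \<le> a" "\<And>t. t \<in> T \<Longrightarrow> \<bar>x t - z t\<bar> \<le> a" for x z a
  proof -
    have d: "mdist (linf T) x z \<le> a" "0 \<le> mdist (linf T) x z"
      using mdist_linf_le[OF that(1,2,3)] that(4) by (simp_all add: Metric_space.nonneg[OF Metric_space_mspace_mdist])
    have "\<bar>h x - h z\<bar> \<le> L * mdist (linf T) x z" using lip that(1,2) unfolding lipschitz_metric_def by blast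
    also have "\<dots> \<le> C * mdist (linf T) x z" unfolding C_def using d(2) by (intro mult_right_mono) simp_all
    also have "\<dots> \<le> C * a" using d(1) unfolding C_def by (intro mult_left_mono) simp_all
    finally show ?thesis .
  qed
  have hm: "h \<in> borel_measurable (borel_of_metric (linf T))"
    using lip by (intro borel_measurable_of_continuous_map lipschitz_metric_continuous)
  \<comment> \<open>Factoring through sequences makes the composition with \<open>h\<close> a
    continuous function of finitely many coordinates, hence measurable.\<close>
  define proj where "proj = (\<lambda>m (x :: nat \<Rightarrow> real). \<lambda>t\<in>T. x (idx (\<pi> m t)))"
  have proj_mem: "proj m x \<in> mspace (linf T)" for m x
  proof -
    have "\<forall>t\<in>T. \<bar>proj m x t\<bar> \<le> (\<Sum>s\<in>\<pi> m ` T. \<bar>x (idx s)\<bar>)"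
      unfolding proj_def using range_\<pi>_finite_sum[of "\<lambda>s. \<bar>x (idx s)\<bar>"] by simp
    then show ?thesis unfolding mspace_linf proj_def by auto
  qed
  have cont: "continuous_on UNIV (\<lambda>x. h (proj m x))" for m
    unfolding continuous_on_def
  proof
    fix x :: "nat \<Rightarrow> real"
    define D where "D = (\<lambda>z. C * (\<Sum>s\<in>\<pi> m ` T. \<bar>z (idx s) - x (idx s)\<bar>))"
    have "continuous_on UNIV D"
      unfolding D_def by (intro continuous_intros continuous_on_product_coordinates)
    then have "(D \<longlongrightarrow> D x) (at x)" unfolding continuous_on_def by blast
    then have D: "(D \<longlongrightarrow> 0) (at x)" unfolding D_def by simp
    have bd: "norm (h (proj m z) - h (proj m x)) \<le> D z" for z
      unfolding D_def real_norm_def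
    proof (rule hL[OF proj_mem proj_mem])
      show "\<bar>proj m z t - proj m x t\<bar> \<le> (\<Sum>s\<in>\<pi> m ` T. \<bar>z (idx s) - x (idx s)\<bar>)" if "t \<in> T" for t
        unfolding proj_def using that range_\<pi>_finite_sum[of "\<lambda>s. \<bar>z (idx s) - x (idx s)\<bar>" t m] by simp
    qed (simp add: sum_nonneg)
    have "((\<lambda>z. h (proj m z) - h (proj m x)) \<longlongrightarrow> 0) (at x)"
      by (rule Lim_null_comparison[OF _ D]) (simp only: bd eventually_True)
    then show "((\<lambda>x. h (proj m x)) \<longlongrightarrow> h (proj m x)) (at x)" by (rule LIM_zero_cancel)
  qed
  define k where "k = (\<lambda>m. Suc (\<Sum>s\<in>\<pi> m ` T. idx s))"
  have idx_k: "idx (\<pi> m t) < k m" if "t \<in> T" for m t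
  proof -
    have "idx (\<pi> m t) \<le> (\<Sum>s\<in>\<pi> m ` T. idx s)" using \<pi>_finite that by (intro member_le_sum) simp_all
    then show ?thesis unfolding k_def by simp
  qed
  define \<phi> where "\<phi> = (\<lambda>m x. h (proj m x))"
  have \<phi>Y: "\<phi> m (trunc_seq (k m) (\<lambda>i. y i \<xi>)) = h (Gm m \<xi>)" for m \<xi>
    unfolding \<phi>_def proj_def Gm_def by (rule arg_cong[where f=h], rule restrict_ext) (simp add: trunc_seq_def idx_k Y_def)
  have \<phi>X: "\<phi> m (trunc_seq (k m) (\<lambda>i. X n \<omega> (e i))) = h (\<lambda>t\<in>T. X n \<omega> (\<pi> m t))" for m n \<omega>
    unfolding \<phi>_def proj_def by (rule arg_cong[where f=h], rule restrict_ext) (simp add: trunc_seq_def idx_k e_idx \<pi>_T0)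
  have step1: "(\<lambda>n. \<integral>\<omega>. h (\<lambda>t\<in>T. X n \<omega> (\<pi> m t)) \<partial>M) \<longlonglongrightarrow> (\<integral>\<xi>. h (Gm m \<xi>) \<partial>iid_normal)" for m
    unfolding \<phi>X[symmetric] \<phi>Y[symmetric] unfolding \<phi>_def
    by (rule fidi_convergence[OF cont, where B=B]) (rule B[OF proj_mem])
  have Xm_meas: "(\<lambda>\<omega>. h (\<lambda>t\<in>T. X n \<omega> (\<pi> m t))) \<in> borel_measurable M" for n m
  proof -
    have "(\<lambda>\<omega>. trunc_seq (k m) (\<lambda>i. X n \<omega> (e i))) \<in> borel_measurable M"
      unfolding trunc_seq_def using e_in by (intro measurable_coordinatewise_then_product) simp
    then have "(\<lambda>\<omega>. \<phi> m (trunc_seq (k m) (\<lambda>i. X n \<omega> (e i)))) \<in> borel_measurable M"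
      unfolding \<phi>_def using borel_measurable_continuous_onI[OF cont] by (rule measurable_compose)
    then show ?thesis unfolding \<phi>X .
  qed
  have Xm_mem: "(\<lambda>t\<in>T. X n \<omega> (\<pi> m t)) \<in> mspace (linf T)" if w: "\<omega> \<in> space M" for n \<omega> m
  proof -
    obtain b where "\<And>t. t \<in> T \<Longrightarrow> \<bar>X n \<omega> t\<bar> \<le> b" using X_mem[OF w, of n] unfolding mspace_linf by blast
    then have "\<forall>t\<in>T. \<bar>(\<lambda>t\<in>T. X n \<omega> (\<pi> m t)) t\<bar> \<le> b" using \<pi>_in by simp
    then show ?thesis unfolding mspace_linf by auto
  qed
  have step2: "eventually (\<lambda>n. \<bar>outer_expectation M (\<lambda>\<omega>. h (X n \<omega>)) - (\<integral>\<omega>. h (\<lambda>t\<in>T. X n \<omega> (\<pi> m t)) \<partial>M)\<bar> \<le> C * (1/4) ^ m) sequentially" for m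
    using \<pi>_approx[of m]
  proof eventually_elim
    fix n assume "\<exists>W. integrable M W \<and> (\<integral>\<omega>. W \<omega> \<partial>M) \<le> (1/4) ^ m \<and> (\<forall>\<omega>\<in>space M. \<forall>t\<in>T. \<bar>X n \<omega> t - X n \<omega> (\<pi> m t)\<bar> \<le> W \<omega>)"
    then obtain W where W: "integrable M W" "(\<integral>\<omega>. W \<omega> \<partial>M) \<le> (1/4) ^ m" "\<And>\<omega> t. \<omega> \<in> space M \<Longrightarrow> t \<in> T \<Longrightarrow> \<bar>X n \<omega> t - X n \<omega> (\<pi> m t)\<bar> \<le> W \<omega>"
      by blast
    let ?g = "\<lambda>\<omega>. h (\<lambda>t\<in>T. X n \<omega> (\<pi> m t))"
    obtain t0 where t0: "t0 \<in> T" using T_nonempty by blast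
    have near: "\<bar>h (X n \<omega>) - ?g \<omega>\<bar> \<le> C * W \<omega>" if \<omega>: "\<omega> \<in> space M" for \<omega>
    proof (rule hL[OF X_mem[OF \<omega>] Xm_mem[OF \<omega>]])
      show "0 \<le> W \<omega>" using W(3)[OF \<omega> t0] by linarith
    qed (simp add: W(3)[OF \<omega>])
    have gi: "integrable M ?g"
      by (rule integrable_const_bound[where B=B]) (use Xm_meas B Xm_mem in simp_all)
    have CW: "(\<integral>\<omega>. C * W \<omega> \<partial>M) \<le> C * (1/4) ^ m"
      using W(2) by (simp add: C_def mult_left_mono)
    have "outer_expectation M (\<lambda>\<omega>. h (X n \<omega>)) \<le> (\<integral>\<omega>. ?g \<omega> + C * W \<omega> \<partial>M)"
    proof (rule outer_expectation_le[OF prob_space_axioms, where c="-B"])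
      show "integrable M (\<lambda>\<omega>. ?g \<omega> + C * W \<omega>)" using gi W by simp
      show "h (X n \<omega>) \<le> ?g \<omega> + C * W \<omega>" if "\<omega> \<in> space M" for \<omega> using near[OF that] by linarith
      show "- B \<le> h (X n \<omega>)" if "\<omega> \<in> space M" for \<omega> using B[OF X_mem[OF that], of n] by linarith
    qed
    then have up: "outer_expectation M (\<lambda>\<omega>. h (X n \<omega>)) \<le> (\<integral>\<omega>. ?g \<omega> \<partial>M) + C * (1/4) ^ m"
      using CW gi W(1) by simp
    have "(\<integral>\<omega>. ?g \<omega> \<partial>M) - C * (1/4) ^ m \<le> outer_expectation M (\<lambda>\<omega>. h (X n \<omega>))"
    proof (rule outer_expectation_ge[OF prob_space_axioms, where c=B])
      show "h (X n \<omega>) \<le> B" if "\<omega> \<in> space M" for \<omega> using B[OF X_mem[OF that], of n] by linarith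
      \<comment> \<open>Any majorant of \<open>h (X n \<omega>)\<close> dominates the projected
        functional up to \<open>C * W\<close>, so its integral cannot fall below the bound.\<close>
      fix W2 assume W2: "integrable M W2" "\<And>\<omega>. \<omega> \<in> space M \<Longrightarrow> h (X n \<omega>) \<le> W2 \<omega>"
      have "(\<integral>\<omega>. ?g \<omega> - C * W \<omega> \<partial>M) \<le> (\<integral>\<omega>. W2 \<omega> \<partial>M)"
      proof (rule integral_mono)
        show "integrable M (\<lambda>\<omega>. ?g \<omega> - C * W \<omega>)" using gi W by simp
        show "?g \<omega> - C * W \<omega> \<le> W2 \<omega>" if "\<omega> \<in> space M" for \<omega> using near[OF that] W2(2)[OF that] by linarith
      qed (rule W2(1))
      then show "(\<integral>\<omega>. ?g \<omega> \<partial>M) - C * (1/4) ^ m \<le> (\<integral>\<omega>. W2 \<omega> \<partial>M)"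
        using CW gi W(1) by simp
    qed
    then show "\<bar>outer_expectation M (\<lambda>\<omega>. h (X n \<omega>)) - (\<integral>\<omega>. ?g \<omega> \<partial>M)\<bar> \<le> C * (1/4) ^ m"
      using up by linarith
  qed
  have step3: "(\<lambda>m. \<integral>\<xi>. h (Gm m \<xi>) \<partial>iid_normal) \<longlonglongrightarrow> (\<integral>\<xi>. h (G0 \<xi>) \<partial>iid_normal)"
  proof (rule integral_dominated_convergence[where w="\<lambda>_. B"])
    show "(\<lambda>\<xi>. h (G0 \<xi>)) \<in> borel_measurable iid_normal" by (rule measurable_compose[OF G0_measurable hm])
    show "(\<lambda>\<xi>. h (Gm m \<xi>)) \<in> borel_measurable iid_normal" for m
    proof -
      have "(\<lambda>\<xi>. trunc_seq (k m) (\<lambda>i. y i \<xi>)) \<in> borel_measurable iid_normal"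
        unfolding trunc_seq_def by (intro measurable_coordinatewise_then_product) simp
      then have "(\<lambda>\<xi>. \<phi> m (trunc_seq (k m) (\<lambda>i. y i \<xi>))) \<in> borel_measurable iid_normal"
        unfolding \<phi>_def using borel_measurable_continuous_onI[OF cont] by (rule measurable_compose)
      then show ?thesis unfolding \<phi>Y .
    qed
    show "AE \<xi> in iid_normal. (\<lambda>m. h (Gm m \<xi>)) \<longlonglongrightarrow> h (G0 \<xi>)"
      using AE_E
    proof eventually_elim
      fix \<xi> assume "\<xi> \<in> (\<Union>k. E k)"
      then obtain k where k: "\<xi> \<in> E k" by blast
      have "eventually (\<lambda>m. norm (h (Gm m \<xi>) - h (G0 \<xi>)) \<le> C * (2 * (1/2) ^ m)) sequentially"
        using eventually_ge_at_top[of k]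
      proof eventually_elim
        fix m assume "k \<le> m"
        then show "norm (h (Gm m \<xi>) - h (G0 \<xi>)) \<le> C * (2 * (1/2) ^ m)"
          unfolding real_norm_def using Y_limit(2)[OF k]
          by (intro hL[OF Gm_mem G0_mem]) (simp_all add: Gm_def)
      qed
      moreover have "(\<lambda>m. C * (2 * (1/2 :: real) ^ m)) \<longlonglongrightarrow> 0"
        by (intro tendsto_mult_right_zero LIMSEQ_power_zero) simp
      ultimately have "(\<lambda>m. h (Gm m \<xi>) - h (G0 \<xi>)) \<longlonglongrightarrow> 0" by (rule Lim_null_comparison)
      then show "(\<lambda>m. h (Gm m \<xi>)) \<longlonglongrightarrow> h (G0 \<xi>)" by (rule LIM_zero_cancel)
    qed
    show "AE \<xi> in iid_normal. norm (h (Gm m \<xi>)) \<le> B" for m using B[OF Gm_mem] by simp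
  qed simp
  show ?thesis
  proof (rule LIMSEQ_I)
    fix \<epsilon> :: real assume \<epsilon>: "0 < \<epsilon>"
    have "(\<lambda>m. C * (1/4 :: real) ^ m) \<longlonglongrightarrow> 0" by (intro tendsto_mult_right_zero LIMSEQ_power_zero) simp
    then have "eventually (\<lambda>m. C * (1/4 :: real) ^ m < \<epsilon>/3) sequentially" using \<epsilon> order_tendstoD(2)[of _ 0 sequentially "\<epsilon>/3"] by simp
    moreover have "eventually (\<lambda>m. dist (\<integral>\<xi>. h (Gm m \<xi>) \<partial>iid_normal) (\<integral>\<xi>. h (G0 \<xi>) \<partial>iid_normal) < \<epsilon>/3) sequentially"
      using \<epsilon> by (intro tendstoD[OF step3]) simp
    ultimately have "eventually (\<lambda>m. C * (1/4 :: real) ^ m < \<epsilon>/3 \<and> dist (\<integral>\<xi>. h (Gm m \<xi>) \<partial>iid_normal) (\<integral>\<xi>. h (G0 \<xi>) \<partial>iid_normal) < \<epsilon>/3) sequentially"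
      by (rule eventually_conj)
    then obtain m where m: "C * (1/4 :: real) ^ m < \<epsilon>/3" "dist (\<integral>\<xi>. h (Gm m \<xi>) \<partial>iid_normal) (\<integral>\<xi>. h (G0 \<xi>) \<partial>iid_normal) < \<epsilon>/3"
      unfolding eventually_sequentially by blast
    have "eventually (\<lambda>n. dist (\<integral>\<omega>. h (\<lambda>t\<in>T. X n \<omega> (\<pi> m t)) \<partial>M) (\<integral>\<xi>. h (Gm m \<xi>) \<partial>iid_normal) < \<epsilon>/3) sequentially"
      using \<epsilon> by (intro tendstoD[OF step1]) simp
    then have "eventually (\<lambda>n. norm (outer_expectation M (\<lambda>\<omega>. h (X n \<omega>)) - (\<integral>\<xi>. h (G0 \<xi>) \<partial>iid_normal)) < \<epsilon>) sequentially"
      using step2[of m]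
      by eventually_elim (use m in \<open>unfold dist_real_def real_norm_def, linarith\<close>)
    then show "\<exists>no. \<forall>n\<ge>no. norm (outer_expectation M (\<lambda>\<omega>. h (X n \<omega>)) - (\<integral>\<xi>. h (G0 \<xi>) \<partial>iid_normal)) < \<epsilon>"
      unfolding eventually_sequentially .
  qed
qed

text \<open>The law of \<open>G0\<close> is transported to the function space, with the identity as
  random element, so that the type of the probability space does not depend on how the limit was
  built.\<close>

theorem tight_gaussian_limit:
  "\<exists>(N :: ('t \<Rightarrow> real) measure) G. prob_space N \<and> tight_random_element (linf T) N G \<and>
    gaussian_process T N G \<and> centered_process T N G \<and>
    (\<forall>s\<in>T. \<forall>t\<in>T. (\<integral>\<omega>. G \<omega> s * G \<omega> t \<partial>N) = Kov s t) \<and>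
    HJ_weakly_converges (linf T) M X N G"
proof -
  interpret I: prob_space iid_normal by (rule prob_space_iid_normal)
  let ?N = "distr iid_normal (borel_of_metric (linf T)) G0"
  let ?G = "\<lambda>x :: 't \<Rightarrow> real. x"
  note G0m[measurable] = G0_measurable
  have eval: "(\<lambda>x. x t) \<in> borel_measurable (borel_of_metric (linf T))" if "t \<in> T" for t
    by (rule borel_measurable_of_continuous_map[OF lipschitz_metric_continuous[OF lipschitz_eval[OF that]]])
  have N: "prob_space ?N" by (rule I.prob_space_distr) measurable
  have id: "?G \<in> measurable ?N (borel_of_metric (linf T))" by simp
  have "tight_random_element (linf T) ?N ?G"
    unfolding tight_random_element_def
  proof (intro conjI id allI impI)
    fix \<epsilon> :: real assume "0 < \<epsilon>"
    then obtain K where K: "compactin (mtopology_of (linf T)) K" "1 - \<epsilon> \<le> measure iid_normal (G0 -` K \<inter> space iid_normal)"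
      using G0_tight unfolding tight_random_element_def by blast
    \<comment> \<open>Compact sets are closed in a metric space, hence measurable, so their mass can
      be transported.\<close>
    have "closedin (mtopology_of (linf T)) K"
      using K(1) Metric_space.Hausdorff_space_mtopology[OF Metric_space_mspace_mdist, of "linf T"]
      unfolding mtopology_of_def by (rule compactin_imp_closedin[rotated])
    then have "K \<in> sets (borel_of_metric (linf T))" by (rule sets_borel_of_metric_closedin)
    moreover from this have "?G -` K \<inter> space ?N = K" using sets.sets_into_space by auto
    ultimately have "measure ?N (?G -` K \<inter> space ?N) = measure iid_normal (G0 -` K \<inter> space iid_normal)"
      by (simp add: measure_distr)
    then show "\<exists>K. compactin (mtopology_of (linf T)) K \<and> 1 - \<epsilon> \<le> measure ?N (?G -` K \<inter> space ?N)"
      using K by (intro exI[of _ K]) simp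
  qed
  moreover have "gaussian_process T ?N ?G"
    unfolding gaussian_process_def
  proof (intro conjI ballI allI impI)
    fix t assume "t \<in> T" then show "(\<lambda>\<omega>. ?G \<omega> t) \<in> borel_measurable ?N" using eval by simp
  next
    fix J and c :: "'t \<Rightarrow> real" assume J: "finite J \<and> J \<subseteq> T"
    then obtain g where g: "bij_betw g {0..<card J} J" using ex_bij_betw_nat_finite by blast
    obtain t0 where t0: "t0 \<in> T" using T_nonempty by blast
    \<comment> \<open>Indices from \<open>card J\<close> on are filled with a point of
      \<open>T\<close>, as \<open>G0_moments\<close> wants a sequence with values in
      \<open>T\<close>.\<close>
    define f where "f = (\<lambda>i. if i < card J then g i else t0)"
    have gJ: "g i \<in> J" if "i < card J" for i using bij_betwE[OF g] that by simp
    have f: "range f \<subseteq> T" unfolding f_def using gJ J t0 by auto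
    have eq: "(\<Sum>t\<in>J. c t * x t) = (\<Sum>i<card J. c (f i) * x (f i))" for x :: "'t \<Rightarrow> real"
    proof -
      have "(\<Sum>t\<in>J. c t * x t) = (\<Sum>i\<in>{0..<card J}. c (g i) * x (g i))"
        by (rule sum.reindex_bij_betw[OF g, symmetric])
      also have "\<dots> = (\<Sum>i<card J. c (f i) * x (f i))"
        by (rule sum.cong) (simp_all add: f_def lessThan_atLeast0)
      finally show ?thesis .
    qed
    have [measurable]: "(\<lambda>x. \<Sum>t\<in>J. c t * x t) \<in> borel_measurable (borel_of_metric (linf T))"
      using eval J by (intro borel_measurable_sum borel_measurable_times) auto
    have "distr ?N borel (\<lambda>\<omega>. \<Sum>t\<in>J. c t * ?G \<omega> t) = distr iid_normal borel (\<lambda>\<xi>. \<Sum>t\<in>J. c t * G0 \<xi> t)"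
      by (subst distr_distr) (simp_all add: comp_def)
    then show "normal_law (distr ?N borel (\<lambda>\<omega>. \<Sum>t\<in>J. c t * ?G \<omega> t))"
      using G0_moments(1)[OF f, where c="\<lambda>i. c (f i)" and k="card J"] by (simp only: eq)
  qed
  moreover have "centered_process T ?N ?G"
    unfolding centered_process_def
  proof
    fix t assume t: "t \<in> T"
    show "(\<integral>\<omega>. ?G \<omega> t \<partial>?N) = 0" using G0_mean[OF t] eval[OF t] by (simp add: integral_distr)
  qed
  moreover have "\<forall>s\<in>T. \<forall>t\<in>T. (\<integral>\<omega>. ?G \<omega> s * ?G \<omega> t \<partial>?N) = Kov s t"
  proof (intro ballI)
    fix s t assume st: "s \<in> T" "t \<in> T"
    have "(\<lambda>x. x s * x t) \<in> borel_measurable (borel_of_metric (linf T))"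
      using eval[OF st(1)] eval[OF st(2)] by (rule borel_measurable_times)
    then show "(\<integral>\<omega>. ?G \<omega> s * ?G \<omega> t \<partial>?N) = Kov s t" using G0_cov[OF st] by (simp add: integral_distr)
  qed
  moreover have "HJ_weakly_converges (linf T) M X ?N ?G"
  proof (rule HJ_weakly_converges_lipschitz[OF prob_space_axioms N X_mem id])
    fix h L B assume h: "lipschitz_metric (linf T) L h" "\<And>x. x \<in> mspace (linf T) \<Longrightarrow> \<bar>h x\<bar> \<le> B"
    have "h \<in> borel_measurable (borel_of_metric (linf T))"
      using h(1) by (intro borel_measurable_of_continuous_map lipschitz_metric_continuous)
    then show "(\<lambda>n. outer_expectation M (\<lambda>\<omega>. h (X n \<omega>))) \<longlonglongrightarrow> (\<integral>\<omega>. h (?G \<omega>) \<partial>?N)"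
      using lipschitz_limit[OF h] by (simp add: integral_distr)
  qed
  ultimately show ?thesis using N by blast
qed

end

subsection \<open>Rademacher averages and chaining\<close>

text \<open>Finite index sets keep all maxima measurable; infinite families are reached only through
  limits, at the very end.\<close>

definition fmax :: "'j set \<Rightarrow> ('j \<Rightarrow> real) \<Rightarrow> real" where
  "fmax J a = Max (insert 0 ((\<lambda>j. \<bar>a j\<bar>) ` J))"

lemma fmax_nonneg: "finite J \<Longrightarrow> 0 \<le> fmax J a"
  unfolding fmax_def by (intro Max_ge) simp_all

lemma fmax_ge: "finite J \<Longrightarrow> j \<in> J \<Longrightarrow> \<bar>a j\<bar> \<le> fmax J a"
  unfolding fmax_def by (intro Max_ge) simp_all

lemma fmax_le: "finite J \<Longrightarrow> 0 \<le> b \<Longrightarrow> (\<And>j. j \<in> J \<Longrightarrow> \<bar>a j\<bar> \<le> b) \<Longrightarrow> fmax J a \<le> b"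
  unfolding fmax_def by (intro Max.boundedI) auto

lemma fmax_cong: "(\<And>j. j \<in> J \<Longrightarrow> \<bar>a j\<bar> = \<bar>b j\<bar>) \<Longrightarrow> fmax J a = fmax J b"
  unfolding fmax_def by (intro arg_cong[where f=Max] arg_cong[where f="insert 0"] image_cong) simp_all

lemma fmax_image: "fmax (f ` J) a = fmax J (\<lambda>j. a (f j))"
  unfolding fmax_def by (simp add: image_image)

lemma fmax_add:
  assumes "finite J" shows "fmax J (\<lambda>j. a j + b j) \<le> fmax J a + fmax J b"
proof (rule fmax_le[OF assms])
  show "\<bar>a j + b j\<bar> \<le> fmax J a + fmax J b" if "j \<in> J" for j
    using fmax_ge[OF assms that, of a] fmax_ge[OF assms that, of b] by linarith
qed (simp add: fmax_nonneg assms)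

lemma fmax_sum:
  assumes "finite J" "finite I" shows "fmax J (\<lambda>j. \<Sum>i\<in>I. a i j) \<le> (\<Sum>i\<in>I. fmax J (a i))"
proof (rule fmax_le[OF assms(1)])
  show "\<bar>\<Sum>i\<in>I. a i j\<bar> \<le> (\<Sum>i\<in>I. fmax J (a i))" if "j \<in> J" for j
    by (rule order_trans[OF sum_abs sum_mono]) (rule fmax_ge[OF assms(1) that])
qed (simp add: fmax_nonneg assms sum_nonneg)

lemma fmax_scale:
  assumes "finite J" shows "fmax J (\<lambda>j. c * a j) \<le> \<bar>c\<bar> * fmax J a"
proof (rule fmax_le[OF assms])
  show "\<bar>c * a j\<bar> \<le> \<bar>c\<bar> * fmax J a" if "j \<in> J" for j
    unfolding abs_mult using fmax_ge[OF assms that] by (rule mult_left_mono) simp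
qed (simp add: fmax_nonneg assms)

lemma fmax_le_sum: "finite J \<Longrightarrow> fmax J a \<le> (\<Sum>j\<in>J. \<bar>a j\<bar>)"
  by (rule fmax_le) (auto intro: sum_nonneg member_le_sum)

lemma fmax_measurable [measurable (raw)]:
  assumes "finite J" "\<And>j. j \<in> J \<Longrightarrow> a j \<in> borel_measurable M"
  shows "(\<lambda>x. fmax J (\<lambda>j. a j x)) \<in> borel_measurable M"
proof -
  have eq: "fmax J (\<lambda>j. a j x) = Max ((\<lambda>f. f x) ` insert (\<lambda>x. 0) ((\<lambda>j x. \<bar>a j x\<bar>) ` J))" for x
    unfolding fmax_def by (simp add: image_image)
  show ?thesis unfolding eq using assms by (intro borel_measurable_Max) auto
qed

lemma fmax_integrable:
  assumes "finite J" "\<And>j. j \<in> J \<Longrightarrow> integrable M (a j)"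
  shows "integrable M (\<lambda>x. fmax J (\<lambda>j. a j x))"
proof (rule Bochner_Integration.integrable_bound)
  show "integrable M (\<lambda>x. \<Sum>j\<in>J. \<bar>a j x\<bar>)" using assms by simp
  show "(\<lambda>x. fmax J (\<lambda>j. a j x)) \<in> borel_measurable M"
    using assms by (intro fmax_measurable) (auto intro: borel_measurable_integrable)
  show "AE x in M. norm (fmax J (\<lambda>j. a j x)) \<le> norm (\<Sum>j\<in>J. \<bar>a j x\<bar>)"
    using fmax_le_sum[OF assms(1)] fmax_nonneg[OF assms(1)] by (intro AE_I2) (simp add: sum_nonneg)
qed

definition signs :: "'i set \<Rightarrow> ('i \<Rightarrow> real) set" where
  "signs I = PiE I (\<lambda>_. {-1, 1})"

text \<open>Expectation over independent uniform signs, written as a finite average so that no sign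
  variables have to be added to the probability space.\<close>

definition radem :: "'i set \<Rightarrow> (('i \<Rightarrow> real) \<Rightarrow> real) \<Rightarrow> real" where
  "radem I h = (\<Sum>s\<in>signs I. h s) / 2 ^ card I"

lemma signs_finite: "finite I \<Longrightarrow> finite (signs I)"
  unfolding signs_def by (intro finite_PiE) simp_all

lemma signs_card: "finite I \<Longrightarrow> card (signs I) = 2 ^ card I"
  unfolding signs_def by (simp add: card_PiE numeral_2_eq_2)

lemma signs_cases: "s \<in> signs I \<Longrightarrow> i \<in> I \<Longrightarrow> s i = -1 \<or> s i = 1"
  unfolding signs_def by (auto simp: PiE_iff)

lemma radem_const: "finite I \<Longrightarrow> radem I (\<lambda>_. c) = c"
  unfolding radem_def by (simp add: signs_card)

lemma radem_mono: "(\<And>s. s \<in> signs I \<Longrightarrow> h s \<le> g s) \<Longrightarrow> radem I h \<le> radem I g"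
  unfolding radem_def by (intro divide_right_mono sum_mono) simp_all

lemma radem_add: "radem I (\<lambda>s. h s + g s) = radem I h + radem I g"
  unfolding radem_def by (simp add: sum.distrib add_divide_distrib)

lemma radem_cmult: "radem I (\<lambda>s. c * h s) = c * radem I h"
  unfolding radem_def by (simp add: sum_distrib_left)

lemma radem_sum: "radem I (\<lambda>s. \<Sum>j\<in>J. h j s) = (\<Sum>j\<in>J. radem I (h j))"
  unfolding radem_def by (subst sum.swap) (simp add: sum_divide_distrib)

lemma exp_radem_le:
  assumes "finite I" shows "exp (radem I h) \<le> radem I (\<lambda>s. exp (h s))"
proof -
  have ne: "signs I \<noteq> {}" using signs_card[OF assms] by auto
  have w: "(\<Sum>s\<in>signs I. 1 / 2 ^ card I :: real) = 1" using signs_card[OF assms] by simp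
  have "exp (\<Sum>s\<in>signs I. (1 / 2 ^ card I) *\<^sub>R h s) \<le> (\<Sum>s\<in>signs I. (1 / 2 ^ card I) * exp (h s))"
    by (rule convex_on_sum[OF signs_finite[OF assms] ne exp_convex w]) simp_all
  then show ?thesis unfolding radem_def by (simp add: sum_divide_distrib)
qed

text \<open>The power series are compared term by term, using
  \<open>2 ^ n * fact n \<le> fact (2 * n)\<close>.\<close>

lemma cosh_le_exp_half_square: "cosh (x :: real) \<le> exp (x\<^sup>2 / 2)"
proof -
  have c: "(\<lambda>n. if even n then x ^ n /\<^sub>R fact n else 0) sums cosh x" by (rule cosh_converges)
  have "(\<lambda>n. (if even (2 * n) then x ^ (2 * n) /\<^sub>R fact (2 * n) else 0)) sums cosh x"
  proof (rule iffD2[OF sums_mono_reindex c])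
    show "strict_mono (\<lambda>n::nat. 2 * n)" by (simp add: strict_mono_def)
    show "(if even n then x ^ n /\<^sub>R fact n else 0) = 0" if "n \<notin> range (\<lambda>n::nat. 2 * n)" for n
      using that by (metis evenE rangeI)
  qed
  then have c2: "(\<lambda>n. x ^ (2 * n) / fact (2 * n)) sums cosh x" by (simp add: divide_inverse mult.commute)
  have e: "(\<lambda>n. (x\<^sup>2 / 2) ^ n /\<^sub>R fact n) sums exp (x\<^sup>2 / 2)" by (rule exp_converges)
  have f: "2 ^ n * fact n \<le> (fact (2 * n) :: real)" for n
  proof (induction n)
    case (Suc n)
    have "(2::real) ^ Suc n * fact (Suc n) = (2 * (real n + 1)) * (2 ^ n * fact n)" by (simp add: algebra_simps)
    also have "\<dots> \<le> ((2 * real n + 2) * (2 * real n + 1)) * fact (2 * n)"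
    proof (rule mult_mono)
      show "2 * (real n + 1) \<le> (2 * real n + 2) * (2 * real n + 1)" by (simp add: algebra_simps)
    qed (use Suc in simp_all)
    also have "\<dots> = fact (2 * Suc n)" by (simp add: algebra_simps)
    finally show ?case .
  qed simp
  show ?thesis
  proof (rule sums_le[OF _ c2 e])
    fix n
    have "x ^ (2 * n) / fact (2 * n) \<le> x ^ (2 * n) / (2 ^ n * fact n)"
      by (rule divide_left_mono[OF f]) simp_all
    also have "\<dots> = (x\<^sup>2 / 2) ^ n / fact n" by (simp only: power_mult power_divide divide_divide_eq_left)
    also have "\<dots> = (x\<^sup>2 / 2) ^ n /\<^sub>R fact n" by (simp only: real_scaleR_def divide_inverse mult.commute)
    finally show "x ^ (2 * n) / fact (2 * n) \<le> (x\<^sup>2 / 2) ^ n /\<^sub>R fact n" .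
  qed
qed

text \<open>The average over signs factorizes into hyperbolic cosines.\<close>

lemma radem_exp_linear:
  assumes "finite I"
  shows "radem I (\<lambda>s. exp (\<Sum>i\<in>I. s i * a i)) \<le> exp ((\<Sum>i\<in>I. (a i)\<^sup>2) / 2)"
proof -
  have "(\<Sum>s\<in>signs I. exp (\<Sum>i\<in>I. s i * a i)) = (\<Prod>i\<in>I. \<Sum>y\<in>{-1, 1}. exp (y * a i))"
    unfolding signs_def by (subst prod_sum_PiE) (simp_all add: assms exp_sum)
  also have "\<dots> = (\<Prod>i\<in>I. 2 * cosh (a i))" by (intro prod.cong) (simp_all add: cosh_def)
  also have "\<dots> = 2 ^ card I * (\<Prod>i\<in>I. cosh (a i))" by (simp add: prod.distrib)
  finally have "radem I (\<lambda>s. exp (\<Sum>i\<in>I. s i * a i)) = (\<Prod>i\<in>I. cosh (a i))" unfolding radem_def by simp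
  also have "\<dots> \<le> (\<Prod>i\<in>I. exp ((a i)\<^sup>2 / 2))" by (intro prod_mono) (simp add: cosh_le_exp_half_square)
  also have "\<dots> = exp (\<Sum>i\<in>I. (a i)\<^sup>2 / 2)" by (rule exp_sum[OF assms, symmetric])
  also have "(\<Sum>i\<in>I. (a i)\<^sup>2 / 2) = (\<Sum>i\<in>I. (a i)\<^sup>2) / 2" by (rule sum_divide_distrib[symmetric])
  finally show ?thesis .
qed

text \<open>Jensen's inequality for the exponential of \<open>l\<close> times the maximum, which is
  then replaced by the sum of all \<open>2 * card J\<close> exponentials. \<open>L\<close> may be
  any nonnegative upper bound for the logarithm of that number.\<close>

lemma radem_fmax_exp:
  assumes I: "finite I" and J: "finite J" and l: "0 < l" and L: "2 * real (card J) \<le> exp L" "0 \<le> L"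
    and a: "\<And>j. j \<in> J \<Longrightarrow> (\<Sum>i\<in>I. (a j i)\<^sup>2) \<le> \<sigma>\<^sup>2"
  shows "radem I (\<lambda>s. fmax J (\<lambda>j. \<Sum>i\<in>I. s i * a j i)) \<le> L / l + l * \<sigma>\<^sup>2 / 2"
proof (cases "J = {}")
  case True
  have "0 \<le> L / l + l * \<sigma>\<^sup>2 / 2" using l L(2) by simp
  then show ?thesis using True by (simp add: fmax_def radem_const[OF I])
next
  case False
  define S where "S = (\<lambda>j s. \<Sum>i\<in>I. s i * a j i)"
  have point: "exp (l * fmax J (\<lambda>j. S j s)) \<le> (\<Sum>j\<in>J. exp (l * S j s) + exp (- (l * S j s)))" for s
  proof -
    have "fmax J (\<lambda>j. S j s) \<in> insert 0 ((\<lambda>j. \<bar>S j s\<bar>) ` J)" unfolding fmax_def using J by (intro Max_in) simp_all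
    then obtain j where j: "j \<in> J" "fmax J (\<lambda>j. S j s) \<le> \<bar>S j s\<bar>" using False by fastforce
    have "exp (l * fmax J (\<lambda>j. S j s)) \<le> exp (l * \<bar>S j s\<bar>)" using j(2) l by simp
    also have "\<dots> \<le> exp (l * S j s) + exp (- (l * S j s))"
      by (cases "S j s \<ge> 0") (simp_all add: add_increasing add_increasing2)
    also have "\<dots> \<le> (\<Sum>j\<in>J. exp (l * S j s) + exp (- (l * S j s)))"
      by (rule member_le_sum[OF j(1) _ J]) (simp add: add_nonneg_nonneg)
    finally show ?thesis .
  qed
  have one: "radem I (\<lambda>s. exp (c * S j s)) \<le> exp (l\<^sup>2 * \<sigma>\<^sup>2 / 2)" if "j \<in> J" "c\<^sup>2 = l\<^sup>2" for j c
  proof -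
    have "radem I (\<lambda>s. exp (c * S j s)) = radem I (\<lambda>s. exp (\<Sum>i\<in>I. s i * (c * a j i)))"
      unfolding S_def by (simp add: sum_distrib_left mult_ac)
    also have "\<dots> \<le> exp ((\<Sum>i\<in>I. (c * a j i)\<^sup>2) / 2)" by (rule radem_exp_linear[OF I])
    also have "(\<Sum>i\<in>I. (c * a j i)\<^sup>2) = l\<^sup>2 * (\<Sum>i\<in>I. (a j i)\<^sup>2)"
      by (simp add: power_mult_distrib that(2) sum_distrib_left)
    also have "exp (l\<^sup>2 * (\<Sum>i\<in>I. (a j i)\<^sup>2) / 2) \<le> exp (l\<^sup>2 * \<sigma>\<^sup>2 / 2)"
      using a[OF that(1)] by (simp add: mult_left_mono)
    finally show ?thesis .
  qed
  have "exp (l * radem I (\<lambda>s. fmax J (\<lambda>j. S j s))) \<le> radem I (\<lambda>s. exp (l * fmax J (\<lambda>j. S j s)))"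
    using exp_radem_le[OF I] by (simp add: radem_cmult[symmetric])
  also have "\<dots> \<le> radem I (\<lambda>s. \<Sum>j\<in>J. exp (l * S j s) + exp (- (l * S j s)))"
    by (rule radem_mono[OF point])
  also have "\<dots> = (\<Sum>j\<in>J. radem I (\<lambda>s. exp (l * S j s)) + radem I (\<lambda>s. exp (- l * S j s)))"
    by (simp add: radem_sum radem_add)
  also have "\<dots> \<le> (\<Sum>j\<in>J. exp (l\<^sup>2 * \<sigma>\<^sup>2 / 2) + exp (l\<^sup>2 * \<sigma>\<^sup>2 / 2))"
    by (intro sum_mono add_mono one) simp_all
  also have "\<dots> = (2 * real (card J)) * exp (l\<^sup>2 * \<sigma>\<^sup>2 / 2)" by simp
  also have "\<dots> \<le> exp L * exp (l\<^sup>2 * \<sigma>\<^sup>2 / 2)" using L by (intro mult_right_mono) simp_all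
  also have "\<dots> = exp (L + l\<^sup>2 * \<sigma>\<^sup>2 / 2)" by (simp add: exp_add)
  finally have "l * radem I (\<lambda>s. fmax J (\<lambda>j. S j s)) \<le> L + l\<^sup>2 * \<sigma>\<^sup>2 / 2" by simp
  then have "radem I (\<lambda>s. fmax J (\<lambda>j. S j s)) \<le> (L + l\<^sup>2 * \<sigma>\<^sup>2 / 2) / l"
    using l by (simp add: pos_le_divide_eq mult.commute)
  also have "\<dots> = L / l + l * \<sigma>\<^sup>2 / 2" using l by (simp add: add_divide_distrib power2_eq_square)
  finally show ?thesis unfolding S_def .
qed

lemma radem_fmax:
  assumes I: "finite I" and J: "finite J" and L: "2 * real (card J) \<le> exp L" "0 < L" and \<sigma>: "0 \<le> \<sigma>"
    and a: "\<And>j. j \<in> J \<Longrightarrow> (\<Sum>i\<in>I. (a j i)\<^sup>2) \<le> \<sigma>\<^sup>2"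
  shows "radem I (\<lambda>s. fmax J (\<lambda>j. \<Sum>i\<in>I. s i * a j i)) \<le> \<sigma> * sqrt (2 * L)"
proof (cases "\<sigma> = 0")
  case True
  have "a j i = 0" if "j \<in> J" "i \<in> I" for j i
  proof -
    have "(\<Sum>i\<in>I. (a j i)\<^sup>2) = 0" using a[OF that(1)] True by (intro antisym) (simp_all add: sum_nonneg)
    then show ?thesis using that(2) I by (simp add: sum_nonneg_eq_0_iff)
  qed
  then have "fmax J (\<lambda>j. \<Sum>i\<in>I. s i * a j i) \<le> 0" for s by (intro fmax_le[OF J]) simp_all
  then have "radem I (\<lambda>s. fmax J (\<lambda>j. \<Sum>i\<in>I. s i * a j i)) \<le> radem I (\<lambda>_. 0)" by (intro radem_mono)
  then show ?thesis using True by (simp add: radem_const[OF I])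
next
  case False
  then have \<sigma>p: "0 < \<sigma>" using \<sigma> by simp
  define q where "q = sqrt (2 * L)"
  have q: "0 < q" "q * q = 2 * L" unfolding q_def using L by simp_all
  \<comment> \<open>The choice \<open>l = sqrt (2 * L) / \<sigma>\<close> balances the two terms of
    \<open>radem_fmax_exp\<close>.\<close>
  have "radem I (\<lambda>s. fmax J (\<lambda>j. \<Sum>i\<in>I. s i * a j i)) \<le> L / (q / \<sigma>) + (q / \<sigma>) * \<sigma>\<^sup>2 / 2"
    using q \<sigma>p L by (intro radem_fmax_exp[OF I J _ L(1) _ a]) simp_all
  also have "(q / \<sigma>) * \<sigma>\<^sup>2 / 2 = q * \<sigma> / 2" using \<sigma>p by (simp add: power2_eq_square)
  also have "L / (q / \<sigma>) = q * \<sigma> / 2"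
  proof -
    have "L = q * q / 2" using q by simp
    moreover have "(q * q / 2) / (q / \<sigma>) = q * \<sigma> / 2" using q(1) \<sigma>p by simp
    ultimately show ?thesis by (simp only:)
  qed
  also have "q * \<sigma> / 2 + q * \<sigma> / 2 = \<sigma> * sqrt (2 * L)" unfolding q_def by simp
  finally show ?thesis .
qed

text \<open>With entropy \<open>H / r\<close> at scale \<open>r\<close>, the link between the scales \<open>D / 4 ^ k\<close> and
  \<open>D / 4 ^ Suc k\<close> costs a multiple of \<open>sqrt (H * D) / 2 ^ k\<close>, a geometric series.\<close>

lemma chaining:
  fixes t :: "'j \<Rightarrow> 'i \<Rightarrow> real"
  assumes I: "finite I" and J: "finite J" and D: "0 \<le> D" "D \<le> H"
    and tD: "\<And>j. j \<in> J \<Longrightarrow> L2_set (t j) I \<le> D"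
    and cover: "\<And>r. 0 < r \<Longrightarrow> r \<le> D \<Longrightarrow> \<exists>\<kappa>. \<kappa> ` J \<subseteq> J \<and> real (card (\<kappa> ` J)) \<le> exp (H / r) \<and>
      (\<forall>j\<in>J. L2_set (\<lambda>i. t j i - t (\<kappa> j) i) I \<le> r)"
  shows "radem I (\<lambda>s. fmax J (\<lambda>j. \<Sum>i\<in>I. s i * t j i)) \<le> 11 * sqrt (H * D)"
proof (cases "D = 0")
  case True
  have "t j i = 0" if "j \<in> J" "i \<in> I" for j i
  proof -
    have "L2_set (t j) I = 0" using tD[OF that(1)] True by (intro antisym) simp_all
    then show ?thesis using L2_set_eq_0_iff[OF I, of "t j"] that(2) by blast
  qed
  then have "fmax J (\<lambda>j. \<Sum>i\<in>I. s i * t j i) \<le> 0" for s by (intro fmax_le[OF J]) simp_all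
  then have "radem I (\<lambda>s. fmax J (\<lambda>j. \<Sum>i\<in>I. s i * t j i)) \<le> radem I (\<lambda>_. 0)" by (intro radem_mono)
  then show ?thesis using True by (simp add: radem_const[OF I])
next
  case False
  then have Dp: "0 < D" using D by simp
  define r where "r = (\<lambda>k. D / 4 ^ k)"
  have r: "0 < r k" "r k \<le> D" for k
    unfolding r_def using Dp by (simp_all add: divide_le_eq)
  have "\<forall>k. \<exists>\<kappa>. \<kappa> ` J \<subseteq> J \<and> real (card (\<kappa> ` J)) \<le> exp (H / r k) \<and>
      (\<forall>j\<in>J. L2_set (\<lambda>i. t j i - t (\<kappa> j) i) I \<le> r k)"
    using cover r by blast
  from choice[OF this] obtain \<kappa> where \<kappa>J: "\<And>k. \<kappa> k ` J \<subseteq> J"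
    and \<kappa>c: "\<And>k. real (card (\<kappa> k ` J)) \<le> exp (H / r k)"
    and \<kappa>d: "\<And>k j. j \<in> J \<Longrightarrow> L2_set (\<lambda>i. t j i - t (\<kappa> k j) i) I \<le> r k"
    by blast
  define S where "S = (\<lambda>j s. \<Sum>i\<in>I. s i * t j i)"
  define h where "h = sqrt (H * D)"
  have HD: "1 \<le> H / D" using D Dp by simp
  have h: "0 \<le> h" unfolding h_def using D by simp
  have e2: "2 \<le> exp (1::real)" using exp_ge_add_one_self[of 1] by simp
  have sq: "(\<Sum>i\<in>I. (x i)\<^sup>2) \<le> b\<^sup>2" if "L2_set x I \<le> b" for x b
  proof -
    have "(L2_set x I)\<^sup>2 \<le> b\<^sup>2" using that by (intro power_mono) simp_all
    then show ?thesis unfolding L2_set_def by (simp add: sum_nonneg)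
  qed
  have sqrt_in: "c * sqrt y = sqrt (c\<^sup>2 * y)" if "0 \<le> c" for c y
    using that by (simp only: real_sqrt_mult real_sqrt_abs abs_of_nonneg)
  have base: "radem I (\<lambda>s. fmax J (\<lambda>j. S (\<kappa> 0 j) s)) \<le> 2 * h"
  proof -
    have "radem I (\<lambda>s. fmax (\<kappa> 0 ` J) (\<lambda>j. \<Sum>i\<in>I. s i * t j i)) \<le> D * sqrt (2 * (2 * (H / D)))"
    proof (rule radem_fmax[OF I])
      have "2 * real (card (\<kappa> 0 ` J)) \<le> exp 1 * exp (H / r 0)" using \<kappa>c[of 0] e2 by (intro mult_mono) simp_all
      also have "\<dots> = exp (1 + H / D)" by (simp add: exp_add r_def)
      also have "\<dots> \<le> exp (2 * (H / D))" using HD by simp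
      finally show "2 * real (card (\<kappa> 0 ` J)) \<le> exp (2 * (H / D))" .
      show "(\<Sum>i\<in>I. (t j i)\<^sup>2) \<le> D\<^sup>2" if "j \<in> \<kappa> 0 ` J" for j
        using that \<kappa>J[of 0] by (intro sq tD) blast
    qed (use J D HD in simp_all)
    also have "D * sqrt (2 * (2 * (H / D))) = 2 * h"
    proof -
      have "D * sqrt (2 * (2 * (H / D))) = sqrt (D\<^sup>2 * (4 * (H / D)))" using sqrt_in[OF D(1), of "4 * (H / D)"] by simp
      also have "D\<^sup>2 * (4 * (H / D)) = 2\<^sup>2 * (H * D)" using Dp by (simp add: power2_eq_square)
      finally show ?thesis unfolding h_def by (simp only: real_sqrt_mult real_sqrt_abs abs_numeral)
    qed
    finally show ?thesis unfolding S_def fmax_image .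
  qed
  have step: "radem I (\<lambda>s. fmax J (\<lambda>j. S (\<kappa> (Suc k) j) s - S (\<kappa> k j) s)) \<le> 9 * h * (1/2) ^ Suc k" for k
  proof -
    define P where "P = (\<lambda>j. (\<kappa> (Suc k) j, \<kappa> k j)) ` J"
    have P: "finite P" unfolding P_def using J by simp
    define q where "q = (4::real) ^ Suc k"
    have q: "4 \<le> q" "q = 4 * 4 ^ k" unfolding q_def by simp_all
    \<comment> \<open>\<open>L\<close> has to bound 1, which pays for the factor 2, plus the two
      entropies \<open>q * (H / D)\<close> and \<open>q / 4 * (H / D)\<close>. The 1 is at most
      another \<open>q / 4 * (H / D)\<close>.\<close>
    define L where "L = 3 / 2 * q * (H / D)"
    have L: "0 < L" unfolding L_def using q(1) HD by (intro mult_pos_pos) linarith+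
    have cardP: "2 * real (card P) \<le> exp L"
    proof -
      have "P \<subseteq> \<kappa> (Suc k) ` J \<times> \<kappa> k ` J" unfolding P_def by blast
      then have "card P \<le> card (\<kappa> (Suc k) ` J) * card (\<kappa> k ` J)"
        using J by (subst card_cartesian_product[symmetric]) (intro card_mono, simp_all)
      then have "real (card P) \<le> real (card (\<kappa> (Suc k) ` J)) * real (card (\<kappa> k ` J))"
        by (simp flip: of_nat_mult)
      also have "\<dots> \<le> exp (H / r (Suc k)) * exp (H / r k)" using \<kappa>c by (intro mult_mono) simp_all
      finally have "2 * real (card P) \<le> exp 1 * (exp (H / r (Suc k)) * exp (H / r k))"
        using e2 by (intro mult_mono) simp_all
      also have "\<dots> = exp (1 + (H / r (Suc k) + H / r k))" by (simp add: exp_add)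
      also have "\<dots> \<le> exp L"
      proof -
        have a: "H / r (Suc k) = q * (H / D)" "H / r k = q / 4 * (H / D)" unfolding r_def q_def by simp_all
        have "1 \<le> q / 4 * (H / D)" using q(1) HD mult_mono[of 1 "q/4" 1 "H/D"] by simp
        then show ?thesis unfolding a L_def by (simp add: algebra_simps)
      qed
      finally show ?thesis .
    qed
    \<comment> \<open>Two points linked across consecutive scales are at distance at most
      \<open>D / q + 4 * (D / q)\<close>.\<close>
    have "radem I (\<lambda>s. fmax P (\<lambda>p. \<Sum>i\<in>I. s i * (t (fst p) i - t (snd p) i))) \<le> (5 * (D / q)) * sqrt (2 * L)"
    proof (rule radem_fmax[OF I P cardP L])
      fix p assume "p \<in> P"
      then obtain j where j: "j \<in> J" "p = (\<kappa> (Suc k) j, \<kappa> k j)" unfolding P_def by blast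
      have "L2_set (\<lambda>i. t (fst p) i - t (snd p) i) I = L2_set (\<lambda>i. - (t j i - t (\<kappa> (Suc k) j) i) + (t j i - t (\<kappa> k j) i)) I"
        using j by simp
      also have "\<dots> \<le> L2_set (\<lambda>i. - (t j i - t (\<kappa> (Suc k) j) i)) I + L2_set (\<lambda>i. t j i - t (\<kappa> k j) i) I"
        by (rule L2_set_triangle_ineq)
      also have "L2_set (\<lambda>i. - (t j i - t (\<kappa> (Suc k) j) i)) I = L2_set (\<lambda>i. t j i - t (\<kappa> (Suc k) j) i) I"
        unfolding L2_set_def by (simp only: power2_minus)
      also have "\<dots> + L2_set (\<lambda>i. t j i - t (\<kappa> k j) i) I \<le> r (Suc k) + r k" by (intro add_mono \<kappa>d j)
      also have "\<dots> = 5 * (D / q)" unfolding r_def q(2) by simp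
      finally show "(\<Sum>i\<in>I. (t (fst p) i - t (snd p) i)\<^sup>2) \<le> (5 * (D / q))\<^sup>2" by (rule sq)
    qed (use Dp q in simp)
    also have "(5 * (D / q)) * sqrt (2 * L) \<le> 9 * h * (1/2) ^ Suc k"
    proof -
      have "(5 * (D / q)) * sqrt (2 * L) = sqrt ((5 * (D / q))\<^sup>2 * (2 * L))"
        using Dp q by (intro sqrt_in) simp
      also have "(5 * (D / q))\<^sup>2 * (2 * L) = 75 * (H * D) / q"
      proof -
        have alg: "(5 * (d / q'))\<^sup>2 * (2 * (3 / 2 * q' * (u / d))) = 75 * (u * d) / q'" if "d \<noteq> 0" "q' \<noteq> 0" for d q' u :: real
          using that by (simp add: power2_eq_square)
        show ?thesis unfolding L_def by (rule alg) (use Dp q(1) in simp_all)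
      qed
      \<comment> \<open>75 is rounded up to the square 81, whose root is the 9 of the claim.\<close>
      also have "sqrt (75 * (H * D) / q) \<le> sqrt (81 * (H * D) / q)"
        using D Dp q by (intro real_sqrt_le_mono divide_right_mono mult_right_mono) simp_all
      also have "81 * (H * D) / q = (9 * (1/2) ^ Suc k)\<^sup>2 * (H * D)"
      proof -
        have "((1/2::real) ^ Suc k)\<^sup>2 = 1 / q" unfolding q_def
          by (simp add: power_divide power2_eq_square flip: power_mult_distrib)
        then show ?thesis by (simp only: power_mult_distrib) simp
      qed
      also have "sqrt ((9 * (1/2) ^ Suc k)\<^sup>2 * (H * D)) = 9 * h * (1/2) ^ Suc k"
        unfolding h_def by (simp add: real_sqrt_mult)
      finally show ?thesis .
    qed
    finally have "radem I (\<lambda>s. fmax P (\<lambda>p. \<Sum>i\<in>I. s i * (t (fst p) i - t (snd p) i))) \<le> 9 * h * (1/2) ^ Suc k" .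
    then show ?thesis unfolding P_def fmax_image S_def by (simp add: right_diff_distrib sum_subtractf)
  qed
  \<comment> \<open>The final constant 11 is 2 for the base level plus 9 for the geometric series of
    links.\<close>
  have level: "radem I (\<lambda>s. fmax J (\<lambda>j. S (\<kappa> k j) s)) \<le> 2 * h + 9 * h * (1 - (1/2) ^ k)" for k
  proof (induction k)
    case 0 then show ?case using base by simp
  next
    case (Suc k)
    have "radem I (\<lambda>s. fmax J (\<lambda>j. S (\<kappa> (Suc k) j) s)) \<le>
      radem I (\<lambda>s. fmax J (\<lambda>j. S (\<kappa> k j) s) + fmax J (\<lambda>j. S (\<kappa> (Suc k) j) s - S (\<kappa> k j) s))"
    proof (rule radem_mono)
      show "fmax J (\<lambda>j. S (\<kappa> (Suc k) j) s) \<le> fmax J (\<lambda>j. S (\<kappa> k j) s) + fmax J (\<lambda>j. S (\<kappa> (Suc k) j) s - S (\<kappa> k j) s)" for s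
        using fmax_add[OF J, of "\<lambda>j. S (\<kappa> k j) s" "\<lambda>j. S (\<kappa> (Suc k) j) s - S (\<kappa> k j) s"] by simp
    qed
    also have "\<dots> \<le> (2 * h + 9 * h * (1 - (1/2) ^ k)) + 9 * h * (1/2) ^ Suc k"
      unfolding radem_add by (rule add_mono[OF Suc step])
    also have "\<dots> = 2 * h + 9 * h * (1 - (1/2) ^ Suc k)" by (simp add: algebra_simps)
    finally show ?case .
  qed
  \<comment> \<open>The unlinked remainder is bounded crudely through the number of indices, which
    stays fixed while the scale tends to 0.\<close>
  have fine: "radem I (\<lambda>s. fmax J (\<lambda>j. S j s)) \<le> 11 * h + real (card I) * r k" for k
  proof -
    have small: "fmax J (\<lambda>j. S j s - S (\<kappa> k j) s) \<le> real (card I) * r k" if s: "s \<in> signs I" for s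
    proof (rule fmax_le[OF J])
      fix j assume j: "j \<in> J"
      have "\<bar>S j s - S (\<kappa> k j) s\<bar> = \<bar>\<Sum>i\<in>I. s i * (t j i - t (\<kappa> k j) i)\<bar>"
        unfolding S_def by (simp add: right_diff_distrib sum_subtractf)
      also have "\<dots> \<le> (\<Sum>i\<in>I. r k)"
      proof (rule order_trans[OF sum_abs sum_mono])
        fix i assume i: "i \<in> I"
        have s1: "\<bar>s i\<bar> = 1" using signs_cases[OF s i] by auto
        have "(t j i - t (\<kappa> k j) i)\<^sup>2 \<le> (\<Sum>i\<in>I. (t j i - t (\<kappa> k j) i)\<^sup>2)" by (rule member_le_sum[OF i _ I]) simp
        also have "\<dots> \<le> (r k)\<^sup>2" by (rule sq[OF \<kappa>d[OF j]])
        finally have "\<bar>t j i - t (\<kappa> k j) i\<bar> \<le> r k" using r(1)[of k] by (simp add: abs_le_square_iff[symmetric])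
        then show "\<bar>s i * (t j i - t (\<kappa> k j) i)\<bar> \<le> r k" by (simp add: abs_mult s1)
      qed
      finally show "\<bar>S j s - S (\<kappa> k j) s\<bar> \<le> real (card I) * r k" by simp
    qed (simp add: r(1) less_imp_le)
    have "radem I (\<lambda>s. fmax J (\<lambda>j. S j s)) \<le> radem I (\<lambda>s. fmax J (\<lambda>j. S (\<kappa> k j) s) + real (card I) * r k)"
    proof (rule radem_mono)
      fix s assume "s \<in> signs I"
      have "fmax J (\<lambda>j. S j s) \<le> fmax J (\<lambda>j. S (\<kappa> k j) s) + fmax J (\<lambda>j. S j s - S (\<kappa> k j) s)"
        using fmax_add[OF J, of "\<lambda>j. S (\<kappa> k j) s" "\<lambda>j. S j s - S (\<kappa> k j) s"] by simp
      then show "fmax J (\<lambda>j. S j s) \<le> fmax J (\<lambda>j. S (\<kappa> k j) s) + real (card I) * r k"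
        using small[OF \<open>s \<in> signs I\<close>] by linarith
    qed
    also have "\<dots> = radem I (\<lambda>s. fmax J (\<lambda>j. S (\<kappa> k j) s)) + real (card I) * r k"
      by (simp add: radem_add radem_const[OF I])
    also have "\<dots> \<le> 11 * h + real (card I) * r k"
    proof -
      have "0 \<le> 9 * h * (1/2) ^ k" using h by simp
      then show ?thesis using level[of k] by (simp add: algebra_simps)
    qed
    finally show ?thesis .
  qed
  have "(\<lambda>k. 11 * h + real (card I) * r k) \<longlonglongrightarrow> 11 * h + real (card I) * 0"
  proof (intro tendsto_intros)
    have "(\<lambda>k. D * (1/4) ^ k) \<longlonglongrightarrow> 0" by (intro tendsto_mult_right_zero LIMSEQ_power_zero) simp
    then show "r \<longlonglongrightarrow> 0" unfolding r_def by (simp add: power_divide)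
  qed
  then have "radem I (\<lambda>s. fmax J (\<lambda>j. S j s)) \<le> 11 * h + real (card I) * 0"
    by (rule LIMSEQ_le_const) (use fine in blast)
  then have "radem I (\<lambda>s. fmax J (\<lambda>j. S j s)) \<le> 11 * h" by simp
  then show ?thesis unfolding S_def h_def .
qed

subsection \<open>Symmetrization\<close>

text \<open>For fixed \<open>x\<close> each \<open>a j x\<close> is the mean of
  \<open>a j x + b j y\<close>, so independent noise of mean 0 can only enlarge the expected
  maximum.\<close>

lemma fmax_mean_zero_le:
  fixes a :: "'j \<Rightarrow> 'x \<Rightarrow> real" and b :: "'j \<Rightarrow> 'y \<Rightarrow> real"
  assumes M1: "prob_space M1" and M2: "prob_space M2" and J: "finite J"
    and a: "\<And>j. j \<in> J \<Longrightarrow> integrable M1 (a j)" and b: "\<And>j. j \<in> J \<Longrightarrow> integrable M2 (b j)"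
    and z: "\<And>j. j \<in> J \<Longrightarrow> (\<integral>y. b j y \<partial>M2) = 0"
  shows "(\<integral>x. fmax J (\<lambda>j. a j x) \<partial>M1) \<le> (\<integral>(x, y). fmax J (\<lambda>j. a j x + b j y) \<partial>(M1 \<Otimes>\<^sub>M M2))"
proof -
  interpret M1: prob_space M1 by fact
  interpret M2: prob_space M2 by fact
  interpret pair_prob_space M1 M2 ..
  have ai: "integrable (M1 \<Otimes>\<^sub>M M2) (\<lambda>p. a j (fst p))" if "j \<in> J" for j
  proof -
    have "integrable (distr (M1 \<Otimes>\<^sub>M M2) M1 fst) (a j)" unfolding M2.distr_pair_fst using a[OF that] .
    then show ?thesis by (rule integrable_distr[OF measurable_fst])
  qed
  have bi: "integrable (M1 \<Otimes>\<^sub>M M2) (\<lambda>p. b j (snd p))" if "j \<in> J" for j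
  proof -
    have "integrable (M2 \<Otimes>\<^sub>M M1) (\<lambda>p. b j (fst p))"
    proof (rule integrable_distr[OF measurable_fst])
      show "integrable (distr (M2 \<Otimes>\<^sub>M M1) M2 fst) (b j)" unfolding M1.distr_pair_fst using b[OF that] .
    qed
    moreover have "(\<lambda>p. b j (fst p)) = (\<lambda>(y, x). (\<lambda>p. b j (snd p)) (x, y))" by (simp add: fun_eq_iff)
    ultimately show ?thesis using integrable_product_swap_iff[of "\<lambda>p. b j (snd p)"] by metis
  qed
  have int: "integrable (M1 \<Otimes>\<^sub>M M2) (\<lambda>(x, y). fmax J (\<lambda>j. a j x + b j y))"
    unfolding case_prod_beta by (rule fmax_integrable[OF J]) (simp add: ai bi)
  have "(\<integral>x. fmax J (\<lambda>j. a j x) \<partial>M1) \<le> (\<integral>x. (\<integral>y. fmax J (\<lambda>j. a j x + b j y) \<partial>M2) \<partial>M1)"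
  proof (rule integral_mono)
    show "integrable M1 (\<lambda>x. fmax J (\<lambda>j. a j x))" by (rule fmax_integrable[OF J a])
    show "integrable M1 (\<lambda>x. \<integral>y. fmax J (\<lambda>j. a j x + b j y) \<partial>M2)" by (rule integrable_fst[OF int])
    fix x
    have i: "integrable M2 (\<lambda>y. a j x + b j y)" if "j \<in> J" for j using b[OF that] by simp
    have fi: "integrable M2 (\<lambda>y. fmax J (\<lambda>j. a j x + b j y))" by (rule fmax_integrable[OF J i])
    show "fmax J (\<lambda>j. a j x) \<le> (\<integral>y. fmax J (\<lambda>j. a j x + b j y) \<partial>M2)"
    proof (rule fmax_le[OF J])
      show "0 \<le> (\<integral>y. fmax J (\<lambda>j. a j x + b j y) \<partial>M2)" by (rule Bochner_Integration.integral_nonneg) (simp add: fmax_nonneg J)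
      fix j assume j: "j \<in> J"
      have "a j x = (\<integral>y. a j x + b j y \<partial>M2)" using b[OF j] z[OF j] by (simp add: M2.prob_space)
      then have "\<bar>a j x\<bar> = \<bar>\<integral>y. a j x + b j y \<partial>M2\<bar>" by simp
      also have "\<dots> \<le> (\<integral>y. \<bar>a j x + b j y\<bar> \<partial>M2)" by (rule integral_abs_bound)
      also have "\<dots> \<le> (\<integral>y. fmax J (\<lambda>j. a j x + b j y) \<partial>M2)"
        by (rule integral_mono[OF integrable_abs[OF i[OF j]] fi]) (rule fmax_ge[OF J j])
      finally show "\<bar>a j x\<bar> \<le> (\<integral>y. fmax J (\<lambda>j. a j x + b j y) \<partial>M2)" .
    qed
  qed
  also have "\<dots> = (\<integral>(x, y). fmax J (\<lambda>j. a j x + b j y) \<partial>(M1 \<Otimes>\<^sub>M M2))" by (rule integral_fst[OF int])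
  finally show ?thesis .
qed

lemma PiM_component_integral:
  fixes u :: "'z \<Rightarrow> real"
  assumes P: "prob_space P" and i: "i \<in> I"
  shows "integrable P u \<Longrightarrow> integrable (PiM I (\<lambda>_. P)) (\<lambda>x. u (x i))"
    and "u \<in> borel_measurable P \<Longrightarrow> (\<integral>x. u (x i) \<partial>PiM I (\<lambda>_. P)) = (\<integral>z. u z \<partial>P)"
proof -
  have d: "distr (PiM I (\<lambda>_. P)) P (\<lambda>x. x i) = P" by (rule distr_PiM_component[OF P i])
  have m: "(\<lambda>x. x i) \<in> measurable (PiM I (\<lambda>_. P)) P" using i by measurable
  show "integrable (PiM I (\<lambda>_. P)) (\<lambda>x. u (x i))" if "integrable P u"
    by (rule integrable_distr[OF m]) (simp add: d that)
  show "(\<integral>x. u (x i) \<partial>PiM I (\<lambda>_. P)) = (\<integral>z. u z \<partial>P)" if "u \<in> borel_measurable P"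
    using integral_distr[OF m that] by (simp add: d)
qed

text \<open>Jensen's inequality: the coordinates outside \<open>A\<close> can be integrated out, leaving mean 0.\<close>

lemma iid_partial_sum_le:
  fixes u :: "'j \<Rightarrow> 'z \<Rightarrow> real" and I :: "'i set"
  assumes P: "prob_space P" and I: "finite I" and J: "finite J" and A: "A \<subseteq> I"
    and u: "\<And>j. j \<in> J \<Longrightarrow> integrable P (u j)" and z: "\<And>j. j \<in> J \<Longrightarrow> (\<integral>y. u j y \<partial>P) = 0"
    and s: "\<And>i. i \<in> A \<Longrightarrow> s i = c" and c: "\<bar>c :: real\<bar> = 1"
  shows "(\<integral>x. fmax J (\<lambda>j. \<Sum>i\<in>A. u j (x i)) \<partial>PiM I (\<lambda>_. P)) \<le> (\<integral>x. fmax J (\<lambda>j. \<Sum>i\<in>I. s i * u j (x i)) \<partial>PiM I (\<lambda>_. P))"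
proof -
  interpret P: prob_space P by fact
  interpret product_sigma_finite "\<lambda>_. P" ..
  define B where "B = I - A"
  have AB: "A \<inter> B = {}" "A \<union> B = I" "finite A" "finite B"
    unfolding B_def using A I finite_subset by auto
  let ?A = "PiM A (\<lambda>_. P)" and ?B = "PiM B (\<lambda>_. P)" and ?I = "PiM I (\<lambda>_. P)"
  have pA: "prob_space ?A" and pB: "prob_space ?B" by (intro prob_space_PiM P)+
  interpret B: prob_space ?B by fact
  have um[measurable]: "j \<in> J \<Longrightarrow> u j \<in> borel_measurable P" for j using u by blast
  have iA: "integrable ?A (\<lambda>x. \<Sum>i\<in>A. d i * u j (x i))" if "j \<in> J" for j d
    by (intro Bochner_Integration.integrable_sum integrable_mult_right PiM_component_integral(1)[OF P] u that)
  have iB: "integrable ?B (\<lambda>x. \<Sum>i\<in>B. d i * u j (x i))" if "j \<in> J" for j d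
    by (intro Bochner_Integration.integrable_sum integrable_mult_right PiM_component_integral(1)[OF P] u that)
  have zB: "(\<integral>x. (\<Sum>i\<in>B. d i * u j (x i)) \<partial>?B) = 0" if j: "j \<in> J" for j d
  proof -
    have "(\<integral>x. (\<Sum>i\<in>B. d i * u j (x i)) \<partial>?B) = (\<Sum>i\<in>B. \<integral>x. d i * u j (x i) \<partial>?B)"
      by (rule Bochner_Integration.integral_sum) (intro integrable_mult_right PiM_component_integral(1)[OF P] u j)
    also have "\<dots> = (\<Sum>i\<in>B. 0)"
      by (rule sum.cong) (simp_all add: PiM_component_integral(2)[OF P] um j z)
    finally show ?thesis by simp
  qed
  have tr: "(\<integral>x. g x \<partial>?I) = (\<integral>p. g (merge A B p) \<partial>(?A \<Otimes>\<^sub>M ?B))" if "g \<in> borel_measurable ?I" for g :: "('i \<Rightarrow> 'z) \<Rightarrow> real"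
  proof -
    have "?I = distr (?A \<Otimes>\<^sub>M ?B) ?I (merge A B)" using distr_merge[OF AB(1,3,4)] unfolding AB(2) by simp
    then have "(\<integral>x. g x \<partial>?I) = (\<integral>x. g x \<partial>distr (?A \<Otimes>\<^sub>M ?B) ?I (merge A B))" by simp
    also have "\<dots> = (\<integral>p. g (merge A B p) \<partial>(?A \<Otimes>\<^sub>M ?B))"
      by (rule integral_distr) (use measurable_merge[of A B "\<lambda>_. P"] AB(2) that in simp_all)
    finally show ?thesis .
  qed
  have compI: "(\<lambda>x. u j (x i)) \<in> borel_measurable ?I" if "i \<in> I" "j \<in> J" for i j
    using that by measurable
  have compA: "(\<lambda>x. u j (x i)) \<in> borel_measurable ?A" if "j \<in> J" "i \<in> A" for i j
    using that by measurable
  have g1: "(\<lambda>x. fmax J (\<lambda>j. \<Sum>i\<in>A. u j (x i))) \<in> borel_measurable ?I"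
    using A by (intro fmax_measurable[OF J] borel_measurable_sum compI) blast
  have g2: "(\<lambda>x. fmax J (\<lambda>j. \<Sum>i\<in>I. s i * u j (x i))) \<in> borel_measurable ?I"
    by (intro fmax_measurable[OF J] borel_measurable_sum borel_measurable_times borel_measurable_const compI)
  have "(\<integral>x. fmax J (\<lambda>j. \<Sum>i\<in>A. u j (x i)) \<partial>?I) = (\<integral>p. fmax J (\<lambda>j. \<Sum>i\<in>A. u j (fst p i)) \<partial>(?A \<Otimes>\<^sub>M ?B))"
    unfolding tr[OF g1] by (intro Bochner_Integration.integral_cong refl arg_cong[where f="fmax J"] ext sum.cong) (auto simp: merge_def split: prod.splits)
  also have "\<dots> = (\<integral>x. fmax J (\<lambda>j. \<Sum>i\<in>A. u j (x i)) \<partial>distr (?A \<Otimes>\<^sub>M ?B) ?A fst)"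
    by (rule integral_distr[symmetric], rule measurable_fst, rule fmax_measurable[OF J], rule borel_measurable_sum, rule compA)
  also have "\<dots> = (\<integral>x. fmax J (\<lambda>j. \<Sum>i\<in>A. u j (x i)) \<partial>?A)" unfolding B.distr_pair_fst ..
  \<comment> \<open>The common sign of the block disappears under the absolute values.\<close>
  also have "\<dots> = (\<integral>x. fmax J (\<lambda>j. \<Sum>i\<in>A. c * u j (x i)) \<partial>?A)"
    using c by (intro Bochner_Integration.integral_cong refl fmax_cong) (simp add: sum_distrib_left[symmetric] abs_mult)
  also have "\<dots> \<le> (\<integral>(x, y). fmax J (\<lambda>j. (\<Sum>i\<in>A. c * u j (x i)) + (\<Sum>i\<in>B. s i * u j (y i))) \<partial>(?A \<Otimes>\<^sub>M ?B))"
    by (rule fmax_mean_zero_le[OF pA pB J iA iB zB])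
  also have "\<dots> = (\<integral>x. fmax J (\<lambda>j. \<Sum>i\<in>I. s i * u j (x i)) \<partial>?I)"
    unfolding tr[OF g2]
  proof (intro Bochner_Integration.integral_cong refl)
    fix p :: "('i \<Rightarrow> 'z) \<times> ('i \<Rightarrow> 'z)"
    have "(\<Sum>i\<in>I. s i * u j (merge A B p i)) = (\<Sum>i\<in>A. c * u j (fst p i)) + (\<Sum>i\<in>B. s i * u j (snd p i))" for j
    proof -
      have "(\<Sum>i\<in>I. s i * u j (merge A B p i)) = (\<Sum>i\<in>A. s i * u j (merge A B p i)) + (\<Sum>i\<in>B. s i * u j (merge A B p i))"
        using sum.union_disjoint[OF AB(3,4,1)] unfolding AB(2) .
      also have "(\<Sum>i\<in>A. s i * u j (merge A B p i)) = (\<Sum>i\<in>A. c * u j (fst p i))"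
        by (intro sum.cong refl) (simp add: s merge_def split: prod.splits)
      also have "(\<Sum>i\<in>B. s i * u j (merge A B p i)) = (\<Sum>i\<in>B. s i * u j (snd p i))"
        using AB(1) by (intro sum.cong refl) (auto simp: merge_def split: prod.splits)
      finally show ?thesis .
    qed
    then show "(case p of (x, y) \<Rightarrow> fmax J (\<lambda>j. (\<Sum>i\<in>A. c * u j (x i)) + (\<Sum>i\<in>B. s i * u j (y i)))) = fmax J (\<lambda>j. \<Sum>i\<in>I. s i * u j (merge A B p i))"
      by (simp add: case_prod_beta)
  qed
  finally show ?thesis .
qed

text \<open>Symmetrization for one fixed sign pattern, without a ghost sample: the sum splits into
  the indices of sign 1 and those of sign -1, and each block is dominated by the full signed
  sum.\<close>

lemma iid_sign_sum_le:
  fixes u :: "'j \<Rightarrow> 'z \<Rightarrow> real"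
  assumes P: "prob_space P" and I: "finite I" and J: "finite J"
    and u: "\<And>j. j \<in> J \<Longrightarrow> integrable P (u j)" and z: "\<And>j. j \<in> J \<Longrightarrow> (\<integral>y. u j y \<partial>P) = 0"
    and s: "s \<in> signs I"
  shows "(\<integral>x. fmax J (\<lambda>j. \<Sum>i\<in>I. u j (x i)) \<partial>PiM I (\<lambda>_. P)) \<le> 2 * (\<integral>x. fmax J (\<lambda>j. \<Sum>i\<in>I. s i * u j (x i)) \<partial>PiM I (\<lambda>_. P))"
proof -
  let ?I = "PiM I (\<lambda>_. P)"
  define A where "A = {i \<in> I. s i = 1}"
  define B where "B = {i \<in> I. s i = -1}"
  have AB: "I = A \<union> B" "A \<inter> B = {}" "finite A" "finite B" "A \<subseteq> I" "B \<subseteq> I"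
    unfolding A_def B_def using signs_cases[OF s] I by auto
  have i: "integrable ?I (\<lambda>x. fmax J (\<lambda>j. \<Sum>i\<in>C. u j (x i)))" if "C \<subseteq> I" for C
    by (intro fmax_integrable[OF J] Bochner_Integration.integrable_sum PiM_component_integral(1)[OF P] u) (use that in blast)
  have "(\<integral>x. fmax J (\<lambda>j. \<Sum>i\<in>I. u j (x i)) \<partial>?I) \<le> (\<integral>x. fmax J (\<lambda>j. \<Sum>i\<in>A. u j (x i)) + fmax J (\<lambda>j. \<Sum>i\<in>B. u j (x i)) \<partial>?I)"
  proof (rule integral_mono)
    show "integrable ?I (\<lambda>x. fmax J (\<lambda>j. \<Sum>i\<in>I. u j (x i)))" by (rule i) simp
    show "integrable ?I (\<lambda>x. fmax J (\<lambda>j. \<Sum>i\<in>A. u j (x i)) + fmax J (\<lambda>j. \<Sum>i\<in>B. u j (x i)))"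
      by (intro Bochner_Integration.integrable_add i AB)
    have eq: "(\<Sum>i\<in>I. u j (x i)) = (\<Sum>i\<in>A. u j (x i)) + (\<Sum>i\<in>B. u j (x i))" for j x
      unfolding sum.union_disjoint[OF AB(3,4,2), symmetric] by (rule sum.cong[OF AB(1) refl])
    show "fmax J (\<lambda>j. \<Sum>i\<in>I. u j (x i)) \<le> fmax J (\<lambda>j. \<Sum>i\<in>A. u j (x i)) + fmax J (\<lambda>j. \<Sum>i\<in>B. u j (x i))" for x
      unfolding eq by (rule fmax_add[OF J])
  qed
  also have "\<dots> = (\<integral>x. fmax J (\<lambda>j. \<Sum>i\<in>A. u j (x i)) \<partial>?I) + (\<integral>x. fmax J (\<lambda>j. \<Sum>i\<in>B. u j (x i)) \<partial>?I)"
    by (intro Bochner_Integration.integral_add i AB)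
  also have "\<dots> \<le> (\<integral>x. fmax J (\<lambda>j. \<Sum>i\<in>I. s i * u j (x i)) \<partial>?I) + (\<integral>x. fmax J (\<lambda>j. \<Sum>i\<in>I. s i * u j (x i)) \<partial>?I)"
  proof (rule add_mono)
    show "(\<integral>x. fmax J (\<lambda>j. \<Sum>i\<in>A. u j (x i)) \<partial>?I) \<le> (\<integral>x. fmax J (\<lambda>j. \<Sum>i\<in>I. s i * u j (x i)) \<partial>?I)"
      by (rule iid_partial_sum_le[OF P I J AB(5) u z, where c=1]) (simp_all add: A_def)
    show "(\<integral>x. fmax J (\<lambda>j. \<Sum>i\<in>B. u j (x i)) \<partial>?I) \<le> (\<integral>x. fmax J (\<lambda>j. \<Sum>i\<in>I. s i * u j (x i)) \<partial>?I)"
      by (rule iid_partial_sum_le[OF P I J AB(6) u z, where c="-1"]) (simp_all add: B_def)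
  qed
  finally show ?thesis by simp
qed

text \<open>A maximum over one element with \<open>L = 1\<close>, admissible since
  \<open>2 \<le> exp 1\<close>.\<close>

lemma radem_abs_sum_le:
  assumes I: "finite I" shows "radem I (\<lambda>s. \<bar>\<Sum>i\<in>I. s i\<bar>) \<le> sqrt 2 * sqrt (card I)"
proof -
  have e: "2 \<le> exp (1::real)" using exp_ge_add_one_self[of 1] by simp
  have "radem I (\<lambda>s. fmax {()} (\<lambda>j. \<Sum>i\<in>I. s i * (\<lambda>_ _. 1) j i)) \<le> sqrt (card I) * sqrt (2 * 1)"
    using e by (intro radem_fmax[OF I]) simp_all
  moreover have "fmax {()} (\<lambda>j. \<Sum>i\<in>I. s i * (\<lambda>_ _. 1) j i) = \<bar>\<Sum>i\<in>I. s i\<bar>" for s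
    unfolding fmax_def by simp
  ultimately show ?thesis by (simp add: mult.commute)
qed

text \<open>The entropy bounds concern the functions themselves, so the centering is taken out of
  the signed sums again. It leaves the means times \<open>\<bar>\<Sum>i\<in>I. s i\<bar>\<close>,
  whose average is of order \<open>sqrt (card I)\<close>; the 3 rounds up
  \<open>2 * sqrt 2\<close>.\<close>

lemma iid_radem_bound:
  fixes u :: "'j \<Rightarrow> 'z \<Rightarrow> real"
  assumes P: "prob_space P" and I: "finite I" and J: "finite J"
    and u: "\<And>j. j \<in> J \<Longrightarrow> integrable P (u j)"
  shows "(\<integral>x. fmax J (\<lambda>j. \<Sum>i\<in>I. (u j (x i) - (\<integral>y. u j y \<partial>P))) \<partial>PiM I (\<lambda>_. P))
    \<le> 2 * (\<integral>x. radem I (\<lambda>s. fmax J (\<lambda>j. \<Sum>i\<in>I. s i * u j (x i))) \<partial>PiM I (\<lambda>_. P))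
      + 3 * sqrt (card I) * fmax J (\<lambda>j. \<integral>y. u j y \<partial>P)"
proof -
  interpret P: prob_space P by fact
  let ?I = "PiM I (\<lambda>_. P)"
  interpret PI: prob_space ?I by (intro prob_space_PiM P)
  define m where "m = (\<lambda>j. \<integral>y. u j y \<partial>P)"
  define c where "c = (\<integral>x. fmax J (\<lambda>j. \<Sum>i\<in>I. (u j (x i) - m j)) \<partial>?I)"
  have ui: "integrable P (\<lambda>y. u j y - m j)" if "j \<in> J" for j using u[OF that] by simp
  have uz: "(\<integral>y. u j y - m j \<partial>P) = 0" if "j \<in> J" for j
    using u[OF that] by (simp add: m_def P.prob_space)
  have ir: "integrable ?I (\<lambda>x. fmax J (\<lambda>j. \<Sum>i\<in>I. s i * u j (x i)))" for s
    by (intro fmax_integrable[OF J] Bochner_Integration.integrable_sum integrable_mult_right PiM_component_integral(1)[OF P] u)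
  have ism: "integrable ?I (\<lambda>x. fmax J (\<lambda>j. \<Sum>i\<in>I. s i * (u j (x i) - m j)))" for s
    by (intro fmax_integrable[OF J] Bochner_Integration.integrable_sum integrable_mult_right PiM_component_integral(1)[OF P] ui)
  have "c \<le> 2 * (\<integral>x. fmax J (\<lambda>j. \<Sum>i\<in>I. s i * (u j (x i) - m j)) \<partial>?I)" if "s \<in> signs I" for s
    unfolding c_def by (rule iid_sign_sum_le[OF P I J ui uz that])
  then have step: "c \<le> 2 * (\<integral>x. fmax J (\<lambda>j. \<Sum>i\<in>I. s i * u j (x i)) \<partial>?I) + 2 * (fmax J m * \<bar>\<Sum>i\<in>I. s i\<bar>)" if "s \<in> signs I" for s
  proof -
    have "(\<integral>x. fmax J (\<lambda>j. \<Sum>i\<in>I. s i * (u j (x i) - m j)) \<partial>?I) \<le> (\<integral>x. fmax J (\<lambda>j. \<Sum>i\<in>I. s i * u j (x i)) + \<bar>\<Sum>i\<in>I. s i\<bar> * fmax J m \<partial>?I)"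
    proof (rule integral_mono[OF ism])
      show "integrable ?I (\<lambda>x. fmax J (\<lambda>j. \<Sum>i\<in>I. s i * u j (x i)) + \<bar>\<Sum>i\<in>I. s i\<bar> * fmax J m)"
        using ir by simp
      fix x
      have "(\<Sum>i\<in>I. s i * (u j (x i) - m j)) = (\<Sum>i\<in>I. s i * u j (x i)) + (- (\<Sum>i\<in>I. s i)) * m j" for j
        by (simp add: right_diff_distrib sum_subtractf sum_distrib_right)
      then have "fmax J (\<lambda>j. \<Sum>i\<in>I. s i * (u j (x i) - m j)) \<le> fmax J (\<lambda>j. \<Sum>i\<in>I. s i * u j (x i)) + fmax J (\<lambda>j. (- (\<Sum>i\<in>I. s i)) * m j)"
        using fmax_add[OF J, of "\<lambda>j. \<Sum>i\<in>I. s i * u j (x i)" "\<lambda>j. (- (\<Sum>i\<in>I. s i)) * m j"] by simp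
      also have "fmax J (\<lambda>j. (- (\<Sum>i\<in>I. s i)) * m j) \<le> \<bar>\<Sum>i\<in>I. s i\<bar> * fmax J m"
        using fmax_scale[OF J, of "- (\<Sum>i\<in>I. s i)" m] by simp
      finally show "fmax J (\<lambda>j. \<Sum>i\<in>I. s i * (u j (x i) - m j)) \<le> fmax J (\<lambda>j. \<Sum>i\<in>I. s i * u j (x i)) + \<bar>\<Sum>i\<in>I. s i\<bar> * fmax J m"
        by simp
    qed
    also have "\<dots> = (\<integral>x. fmax J (\<lambda>j. \<Sum>i\<in>I. s i * u j (x i)) \<partial>?I) + \<bar>\<Sum>i\<in>I. s i\<bar> * fmax J m"
      using ir by (simp add: PI.prob_space)
    finally show ?thesis using \<open>s \<in> signs I \<Longrightarrow> c \<le> 2 * (\<integral>x. fmax J (\<lambda>j. \<Sum>i\<in>I. s i * (u j (x i) - m j)) \<partial>?I)\<close>[OF that]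
      by (simp add: mult.commute)
  qed
  have "c = radem I (\<lambda>_. c)" by (simp add: radem_const[OF I])
  also have "\<dots> \<le> radem I (\<lambda>s. 2 * (\<integral>x. fmax J (\<lambda>j. \<Sum>i\<in>I. s i * u j (x i)) \<partial>?I) + 2 * (fmax J m * \<bar>\<Sum>i\<in>I. s i\<bar>))"
    by (rule radem_mono[OF step])
  also have "\<dots> = 2 * radem I (\<lambda>s. \<integral>x. fmax J (\<lambda>j. \<Sum>i\<in>I. s i * u j (x i)) \<partial>?I) + 2 * (fmax J m * radem I (\<lambda>s. \<bar>\<Sum>i\<in>I. s i\<bar>))"
    by (simp add: radem_add radem_cmult)
  also have "radem I (\<lambda>s. \<integral>x. fmax J (\<lambda>j. \<Sum>i\<in>I. s i * u j (x i)) \<partial>?I) = (\<integral>x. radem I (\<lambda>s. fmax J (\<lambda>j. \<Sum>i\<in>I. s i * u j (x i))) \<partial>?I)"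
    unfolding radem_def using ir by (simp add: Bochner_Integration.integral_sum)
  also have "2 * (fmax J m * radem I (\<lambda>s. \<bar>\<Sum>i\<in>I. s i\<bar>)) \<le> 3 * sqrt (card I) * fmax J m"
  proof -
    have "sqrt 2 \<le> (3/2 :: real)" by (rule real_le_lsqrt) (simp_all add: power2_eq_square)
    then have "sqrt 2 * sqrt (card I) \<le> 3/2 * sqrt (card I)" by (rule mult_right_mono) simp
    then have "radem I (\<lambda>s. \<bar>\<Sum>i\<in>I. s i\<bar>) \<le> 3/2 * sqrt (card I)" using radem_abs_sum_le[OF I] by linarith
    then have "fmax J m * radem I (\<lambda>s. \<bar>\<Sum>i\<in>I. s i\<bar>) \<le> fmax J m * (3/2 * sqrt (card I))"
      by (rule mult_left_mono) (rule fmax_nonneg[OF J])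
    also have "\<dots> = 3/2 * sqrt (card I) * fmax J m" by (rule mult.commute)
    finally show ?thesis by linarith
  qed
  finally show ?thesis unfolding c_def m_def by simp
qed

subsection \<open>Equicontinuity of i.i.d. sums\<close>

text \<open>The uniform law on the sample points, multiplicities included. Indices outside
  \<open>I\<close> carry no mass; they are sent to a sample point so that the map stays measurable
  into \<open>S\<close>.\<close>

definition empirical :: "'z measure \<Rightarrow> 'i set \<Rightarrow> ('i \<Rightarrow> 'z) \<Rightarrow> 'z measure" where
  "empirical S I x = distr (measure_pmf (pmf_of_set I)) S (\<lambda>i. if i \<in> I then x i else x (SOME i. i \<in> I))"

lemma empirical:
  assumes I: "finite I" "I \<noteq> {}" and x: "\<And>i. i \<in> I \<Longrightarrow> x i \<in> space S"
  shows "prob_space (empirical S I x)" "sets (empirical S I x) = sets S"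
    and "\<And>g. g \<in> borel_measurable S \<Longrightarrow> integrable (empirical S I x) (g :: _ \<Rightarrow> real)"
    and "\<And>g. g \<in> borel_measurable S \<Longrightarrow> L2_norm (empirical S I x) g = L2_set (\<lambda>i. g (x i)) I / sqrt (card I)"
proof -
  let ?x = "\<lambda>i. if i \<in> I then x i else x (SOME i. i \<in> I)"
  have m: "?x \<in> measurable (measure_pmf (pmf_of_set I)) S"
    using x someI_ex[of "\<lambda>i. i \<in> I"] I(2) by (intro measurableI) auto
  show "prob_space (empirical S I x)" unfolding empirical_def by (rule measure_pmf.prob_space_distr[OF m])
  show "sets (empirical S I x) = sets S" unfolding empirical_def by simp
  fix g :: "_ \<Rightarrow> real" assume g: "g \<in> borel_measurable S"
  have "integrable (measure_pmf (pmf_of_set I)) (\<lambda>i. g (?x i))"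
    by (rule integrable_measure_pmf_finite) (simp add: I)
  then show "integrable (empirical S I x) g" unfolding empirical_def by (subst integrable_distr_eq[OF m g])
  have g2: "(\<lambda>z. \<bar>g z\<bar>\<^sup>2) \<in> borel_measurable S" using g by measurable
  have "(\<integral>z. \<bar>g z\<bar>\<^sup>2 \<partial>empirical S I x) = (\<integral>i. \<bar>g (?x i)\<bar>\<^sup>2 \<partial>measure_pmf (pmf_of_set I))"
    unfolding empirical_def by (rule integral_distr[OF m g2])
  also have "\<dots> = (\<Sum>i\<in>I. \<bar>g (?x i)\<bar>\<^sup>2) / card I" by (rule integral_pmf_of_set[OF I(2,1)])
  also have "(\<Sum>i\<in>I. \<bar>g (?x i)\<bar>\<^sup>2) = (\<Sum>i\<in>I. (g (x i))\<^sup>2)" by (intro sum.cong) simp_all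
  finally show "L2_norm (empirical S I x) g = L2_set (\<lambda>i. g (x i)) I / sqrt (card I)"
    unfolding L2_norm_def L2_set_def by (simp add: real_sqrt_divide)
qed

lemma L2_set_abs_mono:
  assumes "\<And>i. i \<in> I \<Longrightarrow> \<bar>f i\<bar> \<le> \<bar>g i :: real\<bar>" shows "L2_set f I \<le> L2_set g I"
proof -
  have "L2_set (\<lambda>i. \<bar>f i\<bar>) I \<le> L2_set (\<lambda>i. \<bar>g i\<bar>) I" by (rule L2_set_mono) (simp_all add: assms)
  then show ?thesis unfolding L2_set_def by simp
qed

lemma L2_set_scaled_le:
  assumes "0 \<le> c" "\<And>i. i \<in> I \<Longrightarrow> \<bar>f i\<bar> \<le> c * \<bar>g i :: real\<bar>" shows "L2_set f I \<le> c * L2_set g I"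
  unfolding L2_set_right_distrib[OF assms(1)] using assms by (intro L2_set_abs_mono) (simp add: abs_mult)

lemma L2_set_diff_triangle: "L2_set (\<lambda>i. f i - g i) I \<le> L2_set f I + L2_set g (I :: 'i set)"
proof -
  have "L2_set (\<lambda>i. f i + (- g i)) I \<le> L2_set f I + L2_set (\<lambda>i. - g i) I" by (rule L2_set_triangle_ineq)
  moreover have "L2_set (\<lambda>i. - g i) I = L2_set g I" unfolding L2_set_def by simp
  ultimately show ?thesis by simp
qed

text \<open>AM-GM twice; the right-hand side is linear in the random quantities \<open>q\<close> and \<open>d\<close>, so that it
  can be integrated.\<close>

lemma sqrt_prod_le:
  assumes "0 \<le> q" "0 \<le> d" and pos: "0 < \<eta>" "0 < \<theta>" "0 < \<mu>"
  shows "sqrt (sqrt q * sqrt d) \<le> \<eta> * (\<mu> + q / \<mu>) / 4 + (\<theta> * \<mu> + d / (\<theta> * \<mu>)) / (4 * \<eta>)"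
proof -
  have am: "sqrt (x * y) \<le> (x + y) / 2" if "0 \<le> x" "0 \<le> y" for x y :: real
    using arith_geo_mean_sqrt[OF that] .
  have q: "sqrt q \<le> (\<mu> + q / \<mu>) / 2" using am[of \<mu> "q / \<mu>"] assms by simp
  have d: "sqrt d \<le> (\<theta> * \<mu> + d / (\<theta> * \<mu>)) / 2" using am[of "\<theta> * \<mu>" "d / (\<theta> * \<mu>)"] assms by simp
  have "sqrt (sqrt q * sqrt d) = sqrt ((\<eta> * sqrt q) * (sqrt d / \<eta>))" using pos by simp
  also have "\<dots> \<le> (\<eta> * sqrt q + sqrt d / \<eta>) / 2" using assms by (intro am) simp_all
  also have "\<dots> \<le> (\<eta> * ((\<mu> + q / \<mu>) / 2) + ((\<theta> * \<mu> + d / (\<theta> * \<mu>)) / 2) / \<eta>) / 2"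
    using q d pos by (intro divide_right_mono add_mono mult_left_mono) simp_all
  also have "\<dots> = \<eta> * (\<mu> + q / \<mu>) / 4 + (\<theta> * \<mu> + d / (\<theta> * \<mu>)) / (4 * \<eta>)"
    using pos by (simp add: field_simps)
  finally show ?thesis .
qed

text \<open>\<open>1 \<le> F\<close> keeps the norm of the envelope positive under every probability
  measure with integrable \<open>F\<^sup>2\<close>, so the covering condition has no exceptional
  cases. The bound \<open>exp (C0 / \<epsilon>)\<close> keeps its form when covers are rescaled or
  combined to covers of pairs.\<close>

locale vc_class =
  fixes S P :: "'z measure" and Fc :: "('z \<Rightarrow> real) set" and F :: "'z \<Rightarrow> real" and C0 :: real
  assumes P: "prob_space P" and sP: "sets P = sets S"
    and Fc: "Fc \<subseteq> borel_measurable S" and F_meas: "F \<in> borel_measurable S"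
    and F1: "\<And>z. z \<in> space S \<Longrightarrow> 1 \<le> F z"
    and env: "\<And>f z. f \<in> Fc \<Longrightarrow> z \<in> space S \<Longrightarrow> \<bar>f z\<bar> \<le> F z"
    and C0: "1 \<le> C0" and F2: "integrable P (\<lambda>z. (F z)\<^sup>2)"
    and entropy: "\<And>Q \<epsilon>. prob_space Q \<Longrightarrow> sets Q = sets S \<Longrightarrow> integrable Q (\<lambda>z. (F z)\<^sup>2) \<Longrightarrow> 0 < \<epsilon> \<Longrightarrow> \<epsilon> \<le> 1 \<Longrightarrow>
      \<exists>C. finite C \<and> real (card C) \<le> exp (C0 / \<epsilon>) \<and> C \<subseteq> L2_funs Q \<and>
        (\<forall>f\<in>Fc. \<exists>c\<in>C. L2_norm Q (\<lambda>z. f z - c z) < \<epsilon> * L2_norm Q F)"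
begin

lemma spP: "space P = space S" by (rule sets_eq_imp_space_eq[OF sP])

lemma measP: "g \<in> borel_measurable S \<Longrightarrow> g \<in> borel_measurable P"
  by (simp cong: measurable_cong_sets add: sP)

text \<open>Covers in the \<open>L2_norm\<close> of the sample measure, rescaled by
  \<open>sqrt (card I)\<close> to Euclidean distances between vectors of values. The relative radius
  is \<open>r\<close> divided by the Euclidean norm of the envelope values.\<close>

lemma empirical_cover:
  assumes I: "finite I" "I \<noteq> {}" and x: "\<And>i. i \<in> I \<Longrightarrow> x i \<in> space S"
    and r: "0 < r" "r \<le> L2_set (\<lambda>i. F (x i)) I"
  shows "\<exists>c :: ('z \<Rightarrow> real) \<Rightarrow> ('z \<Rightarrow> real). finite (c ` Fc) \<and> real (card (c ` Fc)) \<le> exp (C0 * L2_set (\<lambda>i. F (x i)) I / r) \<and>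
    (\<forall>f\<in>Fc. L2_set (\<lambda>i. f (x i) - c f (x i)) I \<le> r)"
proof -
  let ?Q = "empirical S I x" and ?F = "L2_set (\<lambda>i. F (x i)) I"
  have Q: "prob_space ?Q" "sets ?Q = sets S" "\<And>g. g \<in> borel_measurable S \<Longrightarrow> integrable ?Q (g :: _ \<Rightarrow> real)"
    "\<And>g. g \<in> borel_measurable S \<Longrightarrow> L2_norm ?Q g = L2_set (\<lambda>i. g (x i)) I / sqrt (card I)"
    by (rule empirical[OF I x]; assumption)+
  have Fp: "0 < ?F" using r by linarith
  have sq: "0 < sqrt (card I)" using I by (simp add: card_gt_0_iff)
  have i2: "integrable ?Q (\<lambda>z. (F z)\<^sup>2)" by (intro Q(3) borel_measurable_power F_meas)
  obtain C where C: "finite C" "real (card C) \<le> exp (C0 / (r / ?F))" "C \<subseteq> L2_funs ?Q"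
    "\<And>f. f \<in> Fc \<Longrightarrow> \<exists>c\<in>C. L2_norm ?Q (\<lambda>z. f z - c z) < (r / ?F) * L2_norm ?Q F"
    using entropy[OF Q(1,2) i2, of "r / ?F"] r Fp by auto
  have "\<forall>f. \<exists>c. f \<in> Fc \<longrightarrow> c \<in> C \<and> L2_norm ?Q (\<lambda>z. f z - c z) < (r / ?F) * L2_norm ?Q F"
    using C(4) by blast
  from choice[OF this] obtain c where c: "\<And>f. f \<in> Fc \<Longrightarrow> c f \<in> C"
    "\<And>f. f \<in> Fc \<Longrightarrow> L2_norm ?Q (\<lambda>z. f z - c f z) < (r / ?F) * L2_norm ?Q F" by blast
  have sub: "c ` Fc \<subseteq> C" using c(1) by blast
  have "L2_set (\<lambda>i. f (x i) - c f (x i)) I \<le> r" if f: "f \<in> Fc" for f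
  proof -
    have "c f \<in> borel_measurable ?Q" using c(1)[OF f] C(3) unfolding L2_funs_def by blast
    then have cm: "c f \<in> borel_measurable S" using Q(2) by (simp cong: measurable_cong_sets)
    have fm: "f \<in> borel_measurable S" using f Fc by blast
    have "L2_set (\<lambda>i. f (x i) - c f (x i)) I / sqrt (card I) = L2_norm ?Q (\<lambda>z. f z - c f z)"
      using cm fm by (intro Q(4)[symmetric]) measurable
    also have "\<dots> < (r / ?F) * L2_norm ?Q F" by (rule c(2)[OF f])
    also have "\<dots> = r / sqrt (card I)" unfolding Q(4)[OF F_meas] using Fp by simp
    finally have "L2_set (\<lambda>i. f (x i) - c f (x i)) I < r" using sq by (simp add: divide_less_cancel)
    then show ?thesis by simp
  qed
  moreover have "finite (c ` Fc)" using sub C(1) by (rule finite_subset)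
  moreover have "real (card (c ` Fc)) \<le> exp (C0 * ?F / r)"
    using card_mono[OF C(1) sub] C(2) by simp
  ultimately show ?thesis by blast
qed

text \<open>Serves differences and their truncated squares alike: the vectors \<open>t p\<close>
  only have to be Lipschitz in the differences, so covers of the class yield covers of the pairs, at
  the price of squaring the covering number.\<close>

lemma pair_radem:
  fixes t :: "('z \<Rightarrow> real) \<times> ('z \<Rightarrow> real) \<Rightarrow> 'i \<Rightarrow> real" and x :: "'i \<Rightarrow> 'z"
  assumes I: "finite I" "I \<noteq> {}" and x: "\<And>i. i \<in> I \<Longrightarrow> x i \<in> space S"
    and J: "finite J" "J \<subseteq> Fc \<times> Fc" and \<Lambda>: "0 < \<Lambda>"
    and lip: "\<And>p p' i. p \<in> J \<Longrightarrow> p' \<in> J \<Longrightarrow> i \<in> I \<Longrightarrow>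
      \<bar>t p i - t p' i\<bar> \<le> \<Lambda> * \<bar>(fst p (x i) - snd p (x i)) - (fst p' (x i) - snd p' (x i))\<bar>"
    and D: "0 \<le> D" "D \<le> 4 * \<Lambda> * L2_set (\<lambda>i. F (x i)) I" and tD: "\<And>p. p \<in> J \<Longrightarrow> L2_set (t p) I \<le> D"
  shows "radem I (\<lambda>s. fmax J (\<lambda>p. \<Sum>i\<in>I. s i * t p i)) \<le> 11 * sqrt (8 * C0 * \<Lambda> * L2_set (\<lambda>i. F (x i)) I * D)"
proof (rule chaining[OF I(1) J(1) D(1) _ tD])
  let ?F = "L2_set (\<lambda>i. F (x i)) I"
  have Fn: "0 \<le> ?F" by simp
  have "4 * \<Lambda> \<le> 8 * C0 * \<Lambda>" using C0 \<Lambda> by simp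
  then have "4 * \<Lambda> * ?F \<le> 8 * C0 * \<Lambda> * ?F" using Fn by (rule mult_right_mono)
  then show "D \<le> 8 * C0 * \<Lambda> * ?F" using D(2) by linarith
  fix r assume r: "0 < r" "r \<le> D"
  \<comment> \<open>Replacing \<open>p\<close> by \<open>\<kappa> p\<close> costs four errors of
    size \<open>\<rho>\<close>, one for each component of either pair, and each is multiplied by
    \<open>\<Lambda>\<close>.\<close>
  define \<rho> where "\<rho> = r / (4 * \<Lambda>)"
  have \<rho>: "0 < \<rho>" "\<rho> \<le> ?F" unfolding \<rho>_def using r D(2) \<Lambda> by (simp_all add: pos_divide_le_eq mult_ac)
  obtain c where c: "finite (c ` Fc)" "real (card (c ` Fc)) \<le> exp (C0 * ?F / \<rho>)"
    "\<And>f. f \<in> Fc \<Longrightarrow> L2_set (\<lambda>i. f (x i) - c f (x i)) I \<le> \<rho>"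
    using empirical_cover[of I x \<rho>, OF I x \<rho>] by blast
  \<comment> \<open>Centres need not lie in the class; a pair of \<open>J\<close> with the same two
    centres takes their place, because chaining wants its nets inside \<open>J\<close>.\<close>
  define g where "g = (\<lambda>ab. SOME p'. p' \<in> J \<and> c (fst p') = fst ab \<and> c (snd p') = snd ab)"
  define \<kappa> where "\<kappa> = (\<lambda>p. g (c (fst p), c (snd p)))"
  have \<kappa>: "\<kappa> p \<in> J" "c (fst (\<kappa> p)) = c (fst p)" "c (snd (\<kappa> p)) = c (snd p)" if "p \<in> J" for p
    using someI[of "\<lambda>p'. p' \<in> J \<and> c (fst p') = c (fst p) \<and> c (snd p') = c (snd p)" p] that
    unfolding \<kappa>_def g_def by simp_all
  have sub: "\<kappa> ` J \<subseteq> g ` (c ` Fc \<times> c ` Fc)" unfolding \<kappa>_def using J(2) by force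
  have fin: "finite (c ` Fc \<times> c ` Fc)" using c(1) by simp
  have "card (\<kappa> ` J) \<le> card (g ` (c ` Fc \<times> c ` Fc))" by (rule card_mono[OF finite_imageI[OF fin] sub])
  also have "\<dots> \<le> card (c ` Fc \<times> c ` Fc)" by (rule card_image_le[OF fin])
  also have "\<dots> = card (c ` Fc) * card (c ` Fc)" by (rule card_cartesian_product)
  finally have "real (card (\<kappa> ` J)) \<le> real (card (c ` Fc)) * real (card (c ` Fc))" by (simp flip: of_nat_mult)
  also have "\<dots> \<le> exp (C0 * ?F / \<rho>) * exp (C0 * ?F / \<rho>)" using c(2) by (intro mult_mono) simp_all
  also have "\<dots> = exp (8 * C0 * \<Lambda> * ?F / r)"
  proof -
    have "C0 * ?F / \<rho> + C0 * ?F / \<rho> = 8 * C0 * \<Lambda> * ?F / r" unfolding \<rho>_def using r(1) \<Lambda> by (simp add: field_simps)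
    then show ?thesis by (simp only: exp_add[symmetric])
  qed
  finally have card: "real (card (\<kappa> ` J)) \<le> exp (8 * C0 * \<Lambda> * ?F / r)" .
  have dist: "L2_set (\<lambda>i. t p i - t (\<kappa> p) i) I \<le> r" if p: "p \<in> J" for p
  proof -
    let ?e = "\<lambda>f i. f (x i) - c f (x i)"
    have mem: "fst p \<in> Fc" "snd p \<in> Fc" "fst (\<kappa> p) \<in> Fc" "snd (\<kappa> p) \<in> Fc"
      using p \<kappa>(1)[OF p] J(2) by auto
    have "L2_set (\<lambda>i. t p i - t (\<kappa> p) i) I
      \<le> \<Lambda> * L2_set (\<lambda>i. (fst p (x i) - snd p (x i)) - (fst (\<kappa> p) (x i) - snd (\<kappa> p) (x i))) I"
      using \<Lambda> lip[OF p \<kappa>(1)[OF p]] by (intro L2_set_scaled_le) simp_all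
    also have "L2_set (\<lambda>i. (fst p (x i) - snd p (x i)) - (fst (\<kappa> p) (x i) - snd (\<kappa> p) (x i))) I
      = L2_set (\<lambda>i. (?e (fst p) i - ?e (snd p) i) - (?e (fst (\<kappa> p)) i - ?e (snd (\<kappa> p)) i)) I"
      by (rule L2_set_cong) (simp_all add: \<kappa>[OF p])
    also have "\<dots> \<le> (L2_set (?e (fst p)) I + L2_set (?e (snd p)) I) + (L2_set (?e (fst (\<kappa> p))) I + L2_set (?e (snd (\<kappa> p))) I)"
      by (rule order_trans[OF L2_set_diff_triangle]) (intro add_mono L2_set_diff_triangle)
    also have "\<dots> \<le> (\<rho> + \<rho>) + (\<rho> + \<rho>)" by (intro add_mono c(3) mem)
    also have "\<Lambda> * ((\<rho> + \<rho>) + (\<rho> + \<rho>)) = r" unfolding \<rho>_def using \<Lambda> by simp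
    finally show ?thesis using \<Lambda> by simp
  qed
  show "\<exists>\<kappa>. \<kappa> ` J \<subseteq> J \<and> real (card (\<kappa> ` J)) \<le> exp (8 * C0 * \<Lambda> * ?F / r) \<and> (\<forall>j\<in>J. L2_set (\<lambda>i. t j i - t (\<kappa> j) i) I \<le> r)"
    using \<kappa>(1) card dist by (intro exI[of _ \<kappa>]) blast
qed

lemma diff_bound: "p \<in> Fc \<times> Fc \<Longrightarrow> z \<in> space S \<Longrightarrow> \<bar>fst p z - snd p z\<bar> \<le> 2 * F z"
  using env[of "fst p" z] env[of "snd p" z] by auto

text \<open>Chaining starts from the empirical radius, the root of the largest sum of squares. This
  makes the bound small for close pairs and leaves the mean of that random sum to be
  estimated.\<close>

lemma radem_differences:
  fixes x :: "'i \<Rightarrow> 'z"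
  assumes I: "finite I" "I \<noteq> {}" and x: "\<And>i. i \<in> I \<Longrightarrow> x i \<in> space S" and J: "finite J" "J \<subseteq> Fc \<times> Fc"
  shows "radem I (\<lambda>s. fmax J (\<lambda>p. \<Sum>i\<in>I. s i * (fst p (x i) - snd p (x i))))
    \<le> 11 * sqrt (8 * C0) * sqrt (sqrt (\<Sum>i\<in>I. (F (x i))\<^sup>2) * sqrt (fmax J (\<lambda>p. \<Sum>i\<in>I. (fst p (x i) - snd p (x i))\<^sup>2)))"
proof -
  let ?F = "L2_set (\<lambda>i. F (x i)) I" and ?d = "fmax J (\<lambda>p. \<Sum>i\<in>I. (fst p (x i) - snd p (x i))\<^sup>2)"
  have L2F: "L2_set (\<lambda>i. fst p (x i) - snd p (x i)) I \<le> 2 * ?F" if p: "p \<in> J" for p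
  proof (rule L2_set_scaled_le)
    show "\<bar>fst p (x i) - snd p (x i)\<bar> \<le> 2 * \<bar>F (x i)\<bar>" if i: "i \<in> I" for i
    proof -
      have "p \<in> Fc \<times> Fc" using p J(2) by blast
      from diff_bound[OF this x[OF i]] show ?thesis by linarith
    qed
  qed simp
  have dF: "sqrt ?d \<le> 2 * ?F"
  proof (rule real_le_lsqrt)
    show "?d \<le> (2 * ?F)\<^sup>2"
    proof (rule fmax_le[OF J(1)])
      fix p assume p: "p \<in> J"
      have "(L2_set (\<lambda>i. fst p (x i) - snd p (x i)) I)\<^sup>2 \<le> (2 * ?F)\<^sup>2" by (rule power_mono[OF L2F[OF p]]) simp
      then show "\<bar>\<Sum>i\<in>I. (fst p (x i) - snd p (x i))\<^sup>2\<bar> \<le> (2 * ?F)\<^sup>2" unfolding L2_set_def by (simp add: sum_nonneg)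
    qed simp
  qed (simp_all add: fmax_nonneg J)
  have "radem I (\<lambda>s. fmax J (\<lambda>p. \<Sum>i\<in>I. s i * (fst p (x i) - snd p (x i)))) \<le> 11 * sqrt (8 * C0 * 1 * ?F * sqrt ?d)"
  proof (rule pair_radem[OF I x J])
    show "sqrt ?d \<le> 4 * 1 * ?F" using dF by (rule order_trans) simp
    show "L2_set (\<lambda>i. fst p (x i) - snd p (x i)) I \<le> sqrt ?d" if "p \<in> J" for p
      unfolding L2_set_def using fmax_ge[OF J(1) that, of "\<lambda>p. \<Sum>i\<in>I. (fst p (x i) - snd p (x i))\<^sup>2"]
      by (intro real_sqrt_le_mono) linarith
  qed (simp_all add: fmax_nonneg J)
  also have "sqrt (8 * C0 * 1 * ?F * sqrt ?d) = sqrt (8 * C0) * sqrt (?F * sqrt ?d)"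
    by (simp add: real_sqrt_mult[symmetric] mult.assoc)
  finally show ?thesis unfolding L2_set_def by (simp add: mult.assoc)
qed

text \<open>The truncation makes the squares Lipschitz functions of the differences, so that covers of the
  class also cover the squares.\<close>

definition wf :: "real \<Rightarrow> ('z \<Rightarrow> real) \<times> ('z \<Rightarrow> real) \<Rightarrow> 'z \<Rightarrow> real" where
  "wf K p z = (if F z \<le> K then (fst p z - snd p z)\<^sup>2 else 0)"

text \<open>Where \<open>F z \<le> K\<close>, the factor \<open>t + t'\<close> of
  \<open>t\<^sup>2 - t'\<^sup>2\<close> is at most \<open>4 * K\<close> in absolute value, which is
  the Lipschitz constant for \<open>pair_radem\<close>.\<close>

lemma radem_squares:
  fixes x :: "'i \<Rightarrow> 'z"
  assumes I: "finite I" "I \<noteq> {}" and x: "\<And>i. i \<in> I \<Longrightarrow> x i \<in> space S" and J: "finite J" "J \<subseteq> Fc \<times> Fc" and K: "1 \<le> K"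
  shows "radem I (\<lambda>s. fmax J (\<lambda>p. \<Sum>i\<in>I. s i * wf K p (x i))) \<le> 132 * C0 * K * sqrt (\<Sum>i\<in>I. (F (x i))\<^sup>2)"
proof -
  let ?F = "L2_set (\<lambda>i. F (x i)) I"
  have b: "\<bar>fst p (x i) - snd p (x i)\<bar> \<le> 2 * F (x i)" if "p \<in> J" "i \<in> I" for p i
    using diff_bound[of p "x i"] x[OF that(2)] that(1) J(2) by blast
  have "radem I (\<lambda>s. fmax J (\<lambda>p. \<Sum>i\<in>I. s i * wf K p (x i))) \<le> 11 * sqrt (8 * C0 * (4 * K) * ?F * (4 * K * ?F))"
  proof (rule pair_radem[OF I x J])
    show "4 * K * ?F \<le> 4 * (4 * K) * ?F" using K by (intro mult_right_mono) simp_all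
    show "L2_set (\<lambda>i. wf K p (x i)) I \<le> 4 * K * ?F" if p: "p \<in> J" for p
    proof (rule L2_set_scaled_le)
      fix i assume i: "i \<in> I"
      show "\<bar>wf K p (x i)\<bar> \<le> 4 * K * \<bar>F (x i)\<bar>"
      proof (cases "F (x i) \<le> K")
        case True
        let ?t = "fst p (x i) - snd p (x i)"
        have "\<bar>?t\<^sup>2\<bar> = \<bar>?t\<bar> * \<bar>?t\<bar>" by (simp add: power2_eq_square abs_mult)
        also have "\<dots> \<le> (2 * K) * (2 * F (x i))" using b[OF p i] True K by (intro mult_mono) linarith+
        finally show ?thesis using True F1[OF x[OF i]] by (simp add: wf_def)
      qed (use K in \<open>simp add: wf_def\<close>)
    qed (use K in simp)
    show "\<bar>wf K p (x i) - wf K p' (x i)\<bar> \<le> 4 * K * \<bar>(fst p (x i) - snd p (x i)) - (fst p' (x i) - snd p' (x i))\<bar>"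
      if p: "p \<in> J" "p' \<in> J" and i: "i \<in> I" for p p' i
    proof (cases "F (x i) \<le> K")
      case True
      let ?t = "fst p (x i) - snd p (x i)" and ?t' = "fst p' (x i) - snd p' (x i)"
      have "\<bar>?t\<^sup>2 - ?t'\<^sup>2\<bar> = \<bar>?t + ?t'\<bar> * \<bar>?t - ?t'\<bar>" by (simp add: power2_eq_square square_diff_square_factored abs_mult)
      also have "\<dots> \<le> (4 * K) * \<bar>?t - ?t'\<bar>"
        using b[OF p(1) i] b[OF p(2) i] True by (intro mult_right_mono) linarith+
      finally show ?thesis using True by (simp add: wf_def)
    qed (use K in \<open>simp add: wf_def\<close>)
  qed (use K in simp_all)
  \<comment> \<open>The factor \<open>8 * 4 * 4 = 128\<close> is rounded up to
    \<open>144 = 12 * 12\<close>; times 11 this yields 132.\<close>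
  also have "sqrt (8 * C0 * (4 * K) * ?F * (4 * K * ?F)) \<le> 12 * C0 * K * ?F"
  proof (rule real_le_lsqrt)
    have "128 * C0 * (K * ?F)\<^sup>2 \<le> 144 * (C0 * C0) * (K * ?F)\<^sup>2"
    proof (rule mult_right_mono)
      show "128 * C0 \<le> 144 * (C0 * C0)" using mult_right_mono[of 1 C0 C0] C0 by linarith
    qed simp
    then show "8 * C0 * (4 * K) * ?F * (4 * K * ?F) \<le> (12 * C0 * K * ?F)\<^sup>2"
      by (simp add: power2_eq_square mult_ac)
  qed (use K C0 in simp_all)
  finally show ?thesis unfolding L2_set_def by simp
qed

lemma F_integrable: "integrable P F"
proof (rule Bochner_Integration.integrable_bound[OF F2 measP[OF F_meas]])
  show "AE z in P. norm (F z) \<le> norm ((F z)\<^sup>2)"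
  proof (rule AE_I2)
    fix z assume "z \<in> space P"
    then have "1 \<le> F z" using F1 spP by simp
    then show "norm (F z) \<le> norm ((F z)\<^sup>2)" by (simp add: power2_eq_square)
  qed
qed

lemma diff_measurable: "p \<in> Fc \<times> Fc \<Longrightarrow> (\<lambda>z. fst p z - snd p z) \<in> borel_measurable P"
proof -
  assume "p \<in> Fc \<times> Fc"
  then have "fst p \<in> borel_measurable S" "snd p \<in> borel_measurable S" using Fc by auto
  from this[THEN measP] have "fst p \<in> borel_measurable P" "snd p \<in> borel_measurable P" .
  then show ?thesis by (rule borel_measurable_diff)
qed

lemma diff_square_le: "p \<in> Fc \<times> Fc \<Longrightarrow> z \<in> space S \<Longrightarrow> (fst p z - snd p z)\<^sup>2 \<le> 4 * (F z)\<^sup>2"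
  using power_mono[OF diff_bound, of p z 2] by (simp add: power_mult_distrib)

lemma diff_integrable:
  assumes p: "p \<in> Fc \<times> Fc"
  shows "integrable P (\<lambda>z. fst p z - snd p z)" "integrable P (\<lambda>z. (fst p z - snd p z)\<^sup>2)"
proof -
  note m[measurable] = diff_measurable[OF p]
  show "integrable P (\<lambda>z. fst p z - snd p z)"
  proof (rule Bochner_Integration.integrable_bound[of P "\<lambda>z. 2 * F z"])
    show "AE z in P. norm (fst p z - snd p z) \<le> norm (2 * F z)"
      by (rule AE_I2, unfold spP real_norm_def, rule order_trans[OF diff_bound[OF p] abs_ge_self])
  qed (use F_integrable m in simp_all)
  show "integrable P (\<lambda>z. (fst p z - snd p z)\<^sup>2)"
  proof (rule Bochner_Integration.integrable_bound[of P "\<lambda>z. 4 * (F z)\<^sup>2"])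
    show "AE z in P. norm ((fst p z - snd p z)\<^sup>2) \<le> norm (4 * (F z)\<^sup>2)"
      using diff_square_le[OF p] by (intro AE_I2) (simp add: spP)
    show "(\<lambda>z. (fst p z - snd p z)\<^sup>2) \<in> borel_measurable P" by measurable
  qed (use F2 in simp)
qed

lemma wf_integrable: "p \<in> Fc \<times> Fc \<Longrightarrow> integrable P (wf K p)"
proof -
  assume p: "p \<in> Fc \<times> Fc"
  note [measurable] = diff_measurable[OF p] measP[OF F_meas]
  show ?thesis
  proof (rule Bochner_Integration.integrable_bound[OF diff_integrable(2)[OF p]])
    show "wf K p \<in> borel_measurable P" unfolding wf_def by measurable
  qed (simp add: wf_def)
qed

lemma wf_mean: "p \<in> Fc \<times> Fc \<Longrightarrow> 0 \<le> (\<integral>z. wf K p z \<partial>P) \<and> (\<integral>z. wf K p z \<partial>P) \<le> (\<integral>z. (fst p z - snd p z)\<^sup>2 \<partial>P)"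
proof
  assume p: "p \<in> Fc \<times> Fc"
  show "0 \<le> (\<integral>z. wf K p z \<partial>P)" by (rule Bochner_Integration.integral_nonneg) (simp add: wf_def)
  show "(\<integral>z. wf K p z \<partial>P) \<le> (\<integral>z. (fst p z - snd p z)\<^sup>2 \<partial>P)"
    by (rule integral_mono[OF wf_integrable[OF p] diff_integrable(2)[OF p]]) (simp add: wf_def)
qed

section \<open>Expected maxima over an i.i.d. sample\<close>

definition p2 :: real where "p2 = (\<integral>z. (F z)\<^sup>2 \<partial>P)"
definition tail :: "real \<Rightarrow> real" where "tail K = (\<integral>z. (if F z \<le> K then 0 else (F z)\<^sup>2) \<partial>P)"

lemma p2_nonneg: "0 \<le> p2" unfolding p2_def by (rule Bochner_Integration.integral_nonneg) simp

lemma tail_integrable: "integrable P (\<lambda>z. if F z \<le> K then 0 else (F z)\<^sup>2)"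
proof (rule Bochner_Integration.integrable_bound[OF F2])
  note [measurable] = measP[OF F_meas]
  show "(\<lambda>z. if F z \<le> K then 0 else (F z)\<^sup>2) \<in> borel_measurable P" by measurable
qed simp

lemma tail_limit: "(\<lambda>n. tail (real n)) \<longlonglongrightarrow> 0"
proof -
  note [measurable] = measP[OF F_meas]
  have "(\<lambda>n. \<integral>z. (if F z \<le> real n then 0 else (F z)\<^sup>2) \<partial>P) \<longlonglongrightarrow> (\<integral>z. 0 \<partial>P)"
  proof (rule integral_dominated_convergence[where w="\<lambda>z. (F z)\<^sup>2"])
    show "AE z in P. (\<lambda>n. if F z \<le> real n then 0 else (F z)\<^sup>2) \<longlonglongrightarrow> 0"
    proof (rule AE_I2)
      fix z
      obtain n0 :: nat where "F z \<le> real n0" using real_arch_simple by blast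
      then have "eventually (\<lambda>n. (if F z \<le> real n then 0 else (F z)\<^sup>2) = 0) sequentially"
        unfolding eventually_sequentially by (intro exI[of _ n0]) (auto intro: order_trans)
      then show "(\<lambda>n. if F z \<le> real n then 0 else (F z)\<^sup>2) \<longlonglongrightarrow> 0" by (rule tendsto_eventually)
    qed
    show "(\<lambda>z. if F z \<le> real n then 0 else (F z)\<^sup>2) \<in> borel_measurable P" for n by measurable
  qed (use F2 in simp_all)
  then show ?thesis unfolding tail_def by simp
qed

lemma expectation_sum_F2:
  "integrable (PiM I (\<lambda>_. P)) (\<lambda>x. \<Sum>i\<in>I. (F (x i))\<^sup>2)"
  "(\<integral>x. (\<Sum>i\<in>I. (F (x i))\<^sup>2) \<partial>PiM I (\<lambda>_. P)) = card I * p2"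
proof -
  have m: "(\<lambda>z. (F z)\<^sup>2) \<in> borel_measurable P" using F2 by blast
  have i: "integrable (PiM I (\<lambda>_. P)) (\<lambda>x. (F (x i))\<^sup>2)" if "i \<in> I" for i
    by (rule PiM_component_integral(1)[OF P that F2])
  show "integrable (PiM I (\<lambda>_. P)) (\<lambda>x. \<Sum>i\<in>I. (F (x i))\<^sup>2)" by (rule Bochner_Integration.integrable_sum[OF i])
  have "(\<integral>x. (\<Sum>i\<in>I. (F (x i))\<^sup>2) \<partial>PiM I (\<lambda>_. P)) = (\<Sum>i\<in>I. \<integral>x. (F (x i))\<^sup>2 \<partial>PiM I (\<lambda>_. P))"
    by (rule Bochner_Integration.integral_sum[OF i])
  also have "\<dots> = (\<Sum>i\<in>I. p2)" unfolding p2_def by (intro sum.cong refl PiM_component_integral(2)[OF P _ m])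
  finally show "(\<integral>x. (\<Sum>i\<in>I. (F (x i))\<^sup>2) \<partial>PiM I (\<lambda>_. P)) = card I * p2" by simp
qed

text \<open>A squared difference is bounded by its centred truncation (handled by symmetrization, of
  order \<open>K * sqrt (card I)\<close> in sum), plus the mean of the truncation (at most
  \<open>\<delta>\<^sup>2\<close>), plus a part living where \<open>F\<close> exceeds
  \<open>K\<close>. Only the last two grow like \<open>card I\<close>, and both can be made
  small.\<close>

lemma expectation_max_square:
  fixes I :: "'i set"
  assumes I: "finite I" "I \<noteq> {}" and J: "finite J" "J \<subseteq> Fc \<times> Fc" and K: "1 \<le> K" and \<delta>: "0 \<le> \<delta>"
    and close: "\<And>p. p \<in> J \<Longrightarrow> (\<integral>z. (fst p z - snd p z)\<^sup>2 \<partial>P) \<le> \<delta>\<^sup>2"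
  shows "integrable (PiM I (\<lambda>_. P)) (\<lambda>x. fmax J (\<lambda>p. \<Sum>i\<in>I. (fst p (x i) - snd p (x i))\<^sup>2))"
    and "(\<integral>x. fmax J (\<lambda>p. \<Sum>i\<in>I. (fst p (x i) - snd p (x i))\<^sup>2) \<partial>PiM I (\<lambda>_. P))
      \<le> card I * (\<delta>\<^sup>2 + 4 * tail K) + sqrt (card I) * (132 * C0 * K * (1 + p2) + 3 * \<delta>\<^sup>2)"
proof -
  let ?I = "PiM I (\<lambda>_. P)"
  interpret PI: prob_space ?I by (intro prob_space_PiM P)
  let ?m = "real (card I)"
  have m: "0 < ?m" using I by (simp add: card_gt_0_iff)
  have Jp: "p \<in> Fc \<times> Fc" if "p \<in> J" for p using J(2) that by blast
  have sqi: "integrable ?I (\<lambda>x. (fst p (x i) - snd p (x i))\<^sup>2)" if "p \<in> J" "i \<in> I" for p i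
    by (rule PiM_component_integral(1)[OF P that(2) diff_integrable(2)[OF Jp[OF that(1)]]])
  show i1: "integrable ?I (\<lambda>x. fmax J (\<lambda>p. \<Sum>i\<in>I. (fst p (x i) - snd p (x i))\<^sup>2))"
    by (intro fmax_integrable[OF J(1)] Bochner_Integration.integrable_sum sqi)
  define a where "a = (\<lambda>p. \<integral>z. wf K p z \<partial>P)"
  define \<Phi> where "\<Phi> = (\<lambda>x. fmax J (\<lambda>p. \<Sum>i\<in>I. (wf K p (x i) - a p)))"
  define \<Psi> where "\<Psi> = (\<lambda>x. \<Sum>i\<in>I. (if F (x i) \<le> K then 0 else (F (x i))\<^sup>2))"
  have P0: "prob_space P" by (rule P)
  interpret P: prob_space P by (rule P0)
  have \<Phi>i: "integrable ?I \<Phi>"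
    unfolding \<Phi>_def
  proof (intro fmax_integrable[OF J(1)] Bochner_Integration.integrable_sum)
    fix p i assume "p \<in> J" "i \<in> I"
    then show "integrable ?I (\<lambda>x. wf K p (x i) - a p)"
      using PiM_component_integral(1)[OF P0 _ wf_integrable[OF Jp], of i I p K] by simp
  qed
  have \<Psi>c: "integrable ?I (\<lambda>x. if F (x i) \<le> K then 0 else (F (x i))\<^sup>2)" if "i \<in> I" for i
    by (rule PiM_component_integral(1)[OF P0 that tail_integrable])
  have \<Psi>i: "integrable ?I \<Psi>" unfolding \<Psi>_def by (rule Bochner_Integration.integrable_sum[OF \<Psi>c])
  have "(\<integral>x. \<Psi> x \<partial>?I) = (\<Sum>i\<in>I. \<integral>x. (if F (x i) \<le> K then 0 else (F (x i))\<^sup>2) \<partial>?I)"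
    unfolding \<Psi>_def by (rule Bochner_Integration.integral_sum[OF \<Psi>c])
  also have "\<dots> = (\<Sum>i\<in>I. tail K)"
    unfolding tail_def by (intro sum.cong refl PiM_component_integral(2)[OF P0]) (use tail_integrable in blast)+
  finally have \<Psi>e: "(\<integral>x. \<Psi> x \<partial>?I) = ?m * tail K" by simp
  have xS: "x i \<in> space S" if "x \<in> space ?I" "i \<in> I" for x i
    using that unfolding space_PiM spP[symmetric] by (rule PiE_mem)
  have "(\<integral>x. fmax J (\<lambda>p. \<Sum>i\<in>I. (fst p (x i) - snd p (x i))\<^sup>2) \<partial>?I) \<le> (\<integral>x. \<Phi> x + ?m * \<delta>\<^sup>2 + 4 * \<Psi> x \<partial>?I)"
  proof (rule integral_mono[OF i1])
    show "integrable ?I (\<lambda>x. \<Phi> x + ?m * \<delta>\<^sup>2 + 4 * \<Psi> x)" using \<Phi>i \<Psi>i by simp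
    fix x assume x: "x \<in> space ?I"
    have \<Psi>0: "0 \<le> \<Psi> x" unfolding \<Psi>_def by (rule sum_nonneg) simp
    show "fmax J (\<lambda>p. \<Sum>i\<in>I. (fst p (x i) - snd p (x i))\<^sup>2) \<le> \<Phi> x + ?m * \<delta>\<^sup>2 + 4 * \<Psi> x"
    proof (rule fmax_le[OF J(1)])
      show "0 \<le> \<Phi> x + ?m * \<delta>\<^sup>2 + 4 * \<Psi> x" using \<Psi>0 fmax_nonneg[OF J(1)] unfolding \<Phi>_def by simp
      fix p assume p: "p \<in> J"
      have "(\<Sum>i\<in>I. (fst p (x i) - snd p (x i))\<^sup>2) \<le> (\<Sum>i\<in>I. (wf K p (x i) - a p) + a p + 4 * (if F (x i) \<le> K then 0 else (F (x i))\<^sup>2))"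
        by (rule sum_mono) (simp add: wf_def diff_square_le[OF Jp[OF p] xS[OF x]])
      also have "\<dots> = (\<Sum>i\<in>I. wf K p (x i) - a p) + ?m * a p + 4 * \<Psi> x"
        unfolding \<Psi>_def by (simp only: sum.distrib sum_distrib_left sum_constant)
      also have "\<dots> \<le> \<Phi> x + ?m * \<delta>\<^sup>2 + 4 * \<Psi> x"
      proof (intro add_mono order_refl mult_left_mono)
        show "(\<Sum>i\<in>I. wf K p (x i) - a p) \<le> \<Phi> x"
          unfolding \<Phi>_def using fmax_ge[OF J(1) p, of "\<lambda>p. \<Sum>i\<in>I. wf K p (x i) - a p"] by linarith
        show "a p \<le> \<delta>\<^sup>2" unfolding a_def using wf_mean[OF Jp[OF p], of K] close[OF p] by linarith
      qed simp
      finally show "\<bar>\<Sum>i\<in>I. (fst p (x i) - snd p (x i))\<^sup>2\<bar> \<le> \<Phi> x + ?m * \<delta>\<^sup>2 + 4 * \<Psi> x" by (simp add: sum_nonneg)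
    qed
  qed
  also have "\<dots> = (\<integral>x. \<Phi> x \<partial>?I) + ?m * \<delta>\<^sup>2 + 4 * (?m * tail K)"
    using \<Phi>i \<Psi>i by (simp add: PI.prob_space \<Psi>e)
  also have "(\<integral>x. \<Phi> x \<partial>?I) \<le> sqrt ?m * (132 * C0 * K * (1 + p2) + 3 * \<delta>\<^sup>2)"
  proof -
    have "(\<integral>x. \<Phi> x \<partial>?I) \<le> 2 * (\<integral>x. radem I (\<lambda>s. fmax J (\<lambda>p. \<Sum>i\<in>I. s i * wf K p (x i))) \<partial>?I) + 3 * sqrt ?m * fmax J a"
      unfolding \<Phi>_def a_def by (rule iid_radem_bound[OF P0 I(1) J(1) wf_integrable[OF Jp]])
    also have "(\<integral>x. radem I (\<lambda>s. fmax J (\<lambda>p. \<Sum>i\<in>I. s i * wf K p (x i))) \<partial>?I)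
      \<le> (\<integral>x. 132 * C0 * K * ((sqrt ?m + (\<Sum>i\<in>I. (F (x i))\<^sup>2) / sqrt ?m) / 2) \<partial>?I)"
    proof (rule integral_mono)
      show "integrable ?I (\<lambda>x. radem I (\<lambda>s. fmax J (\<lambda>p. \<Sum>i\<in>I. s i * wf K p (x i))))"
        unfolding radem_def
        by (intro integrable_divide Bochner_Integration.integrable_sum fmax_integrable[OF J(1)] integrable_mult_right
            PiM_component_integral(1)[OF P0 _ wf_integrable[OF Jp]])
      show "integrable ?I (\<lambda>x. 132 * C0 * K * ((sqrt ?m + (\<Sum>i\<in>I. (F (x i))\<^sup>2) / sqrt ?m) / 2))"
        by (intro integrable_mult_right integrable_divide Bochner_Integration.integrable_add expectation_sum_F2) simp
      fix x assume x: "x \<in> space ?I"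
      have "radem I (\<lambda>s. fmax J (\<lambda>p. \<Sum>i\<in>I. s i * wf K p (x i))) \<le> 132 * C0 * K * sqrt (\<Sum>i\<in>I. (F (x i))\<^sup>2)"
        by (rule radem_squares[OF I xS[OF x] J K])
      \<comment> \<open>The arithmetic-geometric mean inequality trades the root for a term linear
        in the sum, whose mean is \<open>card I * p2\<close>.\<close>
      also have "sqrt (\<Sum>i\<in>I. (F (x i))\<^sup>2) \<le> (sqrt ?m + (\<Sum>i\<in>I. (F (x i))\<^sup>2) / sqrt ?m) / 2"
        using arith_geo_mean_sqrt[of "sqrt ?m" "(\<Sum>i\<in>I. (F (x i))\<^sup>2) / sqrt ?m"] m by (simp add: sum_nonneg)
      finally show "radem I (\<lambda>s. fmax J (\<lambda>p. \<Sum>i\<in>I. s i * wf K p (x i))) \<le> 132 * C0 * K * ((sqrt ?m + (\<Sum>i\<in>I. (F (x i))\<^sup>2) / sqrt ?m) / 2)"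
        using C0 K by (simp add: mult_left_mono)
    qed
    also have "\<dots> = 132 * C0 * K * ((sqrt ?m + ?m * p2 / sqrt ?m) / 2)"
      using expectation_sum_F2(1)[of I] by (simp add: expectation_sum_F2(2) PI.prob_space)
    also have "?m * p2 / sqrt ?m = sqrt ?m * p2" using m by (simp add: real_div_sqrt flip: times_divide_eq_left)
    also have "3 * sqrt ?m * fmax J a \<le> 3 * sqrt ?m * \<delta>\<^sup>2"
    proof (intro mult_left_mono fmax_le[OF J(1)])
      show "\<bar>a p\<bar> \<le> \<delta>\<^sup>2" if "p \<in> J" for p
        unfolding a_def using wf_mean[OF Jp[OF that], of K] close[OF that] by linarith
    qed simp_all
    finally show ?thesis by (simp add: algebra_simps add_divide_distrib)
  qed
  finally show "(\<integral>x. fmax J (\<lambda>p. \<Sum>i\<in>I. (fst p (x i) - snd p (x i))\<^sup>2) \<partial>?I)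
      \<le> ?m * (\<delta>\<^sup>2 + 4 * tail K) + sqrt ?m * (132 * C0 * K * (1 + p2) + 3 * \<delta>\<^sup>2)"
    by (simp add: algebra_simps)
qed

text \<open>Nonnegativity of the variance.\<close>

lemma mean_diff_le:
  assumes p: "p \<in> Fc \<times> Fc" and \<delta>: "0 \<le> \<delta>" "(\<integral>z. (fst p z - snd p z)\<^sup>2 \<partial>P) \<le> \<delta>\<^sup>2"
  shows "\<bar>\<integral>z. fst p z - snd p z \<partial>P\<bar> \<le> \<delta>"
proof -
  have P0: "prob_space P" by (rule P)
  interpret P: prob_space P by (rule P0)
  have "0 \<le> P.variance (\<lambda>z. fst p z - snd p z)" by (rule P.variance_positive)
  then have "(\<integral>z. fst p z - snd p z \<partial>P)\<^sup>2 \<le> \<delta>\<^sup>2"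
    using P.variance_eq[OF diff_integrable[OF p]] \<delta>(2) by linarith
  then show ?thesis using \<delta>(1) by (simp add: abs_le_square_iff[symmetric])
qed

text \<open>\<open>sqrt_prod_le\<close>, used with \<open>\<mu> = sqrt (card I)\<close>, lets the
  two random sums enter through their means. \<open>\<eta>\<close> and \<open>\<theta>\<close> stay
  free, to be tuned in \<open>iid_equicontinuity\<close>.\<close>

lemma iid_maximal:
  fixes I :: "'i set"
  assumes I: "finite I" "I \<noteq> {}" and J: "finite J" "J \<subseteq> Fc \<times> Fc" and K: "1 \<le> K" and \<delta>: "0 \<le> \<delta>"
    and pos: "0 < \<eta>" "0 < \<theta>"
    and close: "\<And>p. p \<in> J \<Longrightarrow> (\<integral>z. (fst p z - snd p z)\<^sup>2 \<partial>P) \<le> \<delta>\<^sup>2"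
  shows "(\<integral>x. fmax J (\<lambda>p. \<Sum>i\<in>I. ((fst p (x i) - snd p (x i)) - (\<integral>z. fst p z - snd p z \<partial>P))) \<partial>PiM I (\<lambda>_. P))
    \<le> 22 * sqrt (8 * C0) * (\<eta> * (sqrt (card I) + sqrt (card I) * p2) / 4 +
        (\<theta> * sqrt (card I) + (sqrt (card I) * (\<delta>\<^sup>2 + 4 * tail K) + (132 * C0 * K * (1 + p2) + 3 * \<delta>\<^sup>2)) / \<theta>) / (4 * \<eta>))
      + 3 * sqrt (card I) * \<delta>"
proof -
  let ?I = "PiM I (\<lambda>_. P)" and ?m = "real (card I)"
  interpret PI: prob_space ?I by (intro prob_space_PiM P)
  have m: "0 < ?m" using I by (simp add: card_gt_0_iff)
  have Jp: "p \<in> Fc \<times> Fc" if "p \<in> J" for p using J(2) that by blast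
  have xS: "x i \<in> space S" if "x \<in> space ?I" "i \<in> I" for x i
    using that unfolding space_PiM spP[symmetric] by (rule PiE_mem)
  define q where "q = (\<lambda>x. \<Sum>i\<in>I. (F (x i :: 'z))\<^sup>2)"
  define d where "d = (\<lambda>x. fmax J (\<lambda>p. \<Sum>i\<in>I. (fst p (x i) - snd p (x i))\<^sup>2))"
  define c where "c = 11 * sqrt (8 * C0)"
  have c: "0 \<le> c" unfolding c_def using C0 by simp
  have qi: "integrable ?I q" "(\<integral>x. q x \<partial>?I) = ?m * p2" unfolding q_def by (rule expectation_sum_F2)+
  have di: "integrable ?I d" "(\<integral>x. d x \<partial>?I) \<le> ?m * (\<delta>\<^sup>2 + 4 * tail K) + sqrt ?m * (132 * C0 * K * (1 + p2) + 3 * \<delta>\<^sup>2)"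
    unfolding d_def by (rule expectation_max_square[OF I J K \<delta> close]; assumption)+
  \<comment> \<open>Dividing by \<open>sqrt (card I)\<close> leaves a leading part of order
    \<open>sqrt (card I)\<close> and a remainder that does not depend on the sample size.\<close>
  have dd: "(\<integral>x. d x \<partial>?I) / (\<theta> * sqrt ?m) \<le> (sqrt ?m * (\<delta>\<^sup>2 + 4 * tail K) + (132 * C0 * K * (1 + p2) + 3 * \<delta>\<^sup>2)) / \<theta>"
  proof -
    have mm: "?m = sqrt ?m * sqrt ?m" by simp
    have "(\<integral>x. d x \<partial>?I) / (\<theta> * sqrt ?m) \<le> (?m * (\<delta>\<^sup>2 + 4 * tail K) + sqrt ?m * (132 * C0 * K * (1 + p2) + 3 * \<delta>\<^sup>2)) / (\<theta> * sqrt ?m)"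
      using di(2) pos m by (intro divide_right_mono) simp_all
    also have "?m * (\<delta>\<^sup>2 + 4 * tail K) + sqrt ?m * (132 * C0 * K * (1 + p2) + 3 * \<delta>\<^sup>2)
      = (sqrt ?m * (\<delta>\<^sup>2 + 4 * tail K) + (132 * C0 * K * (1 + p2) + 3 * \<delta>\<^sup>2)) * sqrt ?m"
    proof -
      have "a * x + s * z = (s * x + z) * s" if "a = s * s" for a s x z :: real
        unfolding that by (simp add: algebra_simps)
      from this[OF mm] show ?thesis .
    qed
    also have "\<dots> / (\<theta> * sqrt ?m) = (sqrt ?m * (\<delta>\<^sup>2 + 4 * tail K) + (132 * C0 * K * (1 + p2) + 3 * \<delta>\<^sup>2)) / \<theta>"
      using m by (simp del: distrib_left)
    finally show ?thesis .
  qed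
  have "(\<integral>x. fmax J (\<lambda>p. \<Sum>i\<in>I. ((fst p (x i) - snd p (x i)) - (\<integral>z. fst p z - snd p z \<partial>P))) \<partial>?I)
    \<le> 2 * (\<integral>x. radem I (\<lambda>s. fmax J (\<lambda>p. \<Sum>i\<in>I. s i * (fst p (x i) - snd p (x i)))) \<partial>?I)
      + 3 * sqrt ?m * fmax J (\<lambda>p. \<integral>z. fst p z - snd p z \<partial>P)"
    by (rule iid_radem_bound[OF P I(1) J(1) diff_integrable(1)[OF Jp]])
  also have "fmax J (\<lambda>p. \<integral>z. fst p z - snd p z \<partial>P) \<le> \<delta>"
    by (rule fmax_le[OF J(1) \<delta> mean_diff_le[OF Jp \<delta> close]])
  also have "(\<integral>x. radem I (\<lambda>s. fmax J (\<lambda>p. \<Sum>i\<in>I. s i * (fst p (x i) - snd p (x i)))) \<partial>?I)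
    \<le> (\<integral>x. c * (\<eta> * (sqrt ?m + q x / sqrt ?m) / 4 + (\<theta> * sqrt ?m + d x / (\<theta> * sqrt ?m)) / (4 * \<eta>)) \<partial>?I)"
  proof (rule integral_mono)
    show "integrable ?I (\<lambda>x. radem I (\<lambda>s. fmax J (\<lambda>p. \<Sum>i\<in>I. s i * (fst p (x i) - snd p (x i)))))"
      unfolding radem_def
      by (intro integrable_divide Bochner_Integration.integrable_sum fmax_integrable[OF J(1)] integrable_mult_right
          PiM_component_integral(1)[OF P _ diff_integrable(1)[OF Jp]])
    show "integrable ?I (\<lambda>x. c * (\<eta> * (sqrt ?m + q x / sqrt ?m) / 4 + (\<theta> * sqrt ?m + d x / (\<theta> * sqrt ?m)) / (4 * \<eta>)))"
      by (intro integrable_mult_right integrable_divide Bochner_Integration.integrable_add qi di) simp_all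
    fix x assume x: "x \<in> space ?I"
    have "radem I (\<lambda>s. fmax J (\<lambda>p. \<Sum>i\<in>I. s i * (fst p (x i) - snd p (x i)))) \<le> c * sqrt (sqrt (q x) * sqrt (d x))"
      unfolding c_def q_def d_def by (rule radem_differences[OF I xS[OF x] J])
    also have "sqrt (sqrt (q x) * sqrt (d x)) \<le> \<eta> * (sqrt ?m + q x / sqrt ?m) / 4 + (\<theta> * sqrt ?m + d x / (\<theta> * sqrt ?m)) / (4 * \<eta>)"
      using m pos by (intro sqrt_prod_le) (simp_all add: q_def d_def sum_nonneg fmax_nonneg J)
    finally show "radem I (\<lambda>s. fmax J (\<lambda>p. \<Sum>i\<in>I. s i * (fst p (x i) - snd p (x i))))
      \<le> c * (\<eta> * (sqrt ?m + q x / sqrt ?m) / 4 + (\<theta> * sqrt ?m + d x / (\<theta> * sqrt ?m)) / (4 * \<eta>))"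
      using c by (simp add: mult_left_mono)
  qed
  also have "\<dots> = c * (\<eta> * (sqrt ?m + (?m * p2) / sqrt ?m) / 4 + (\<theta> * sqrt ?m + (\<integral>x. d x \<partial>?I) / (\<theta> * sqrt ?m)) / (4 * \<eta>))"
    using qi di(1) by (simp add: PI.prob_space)
  also have "(?m * p2) / sqrt ?m = sqrt ?m * p2" using m by (simp add: real_div_sqrt flip: times_divide_eq_left)
  also have "c * (\<eta> * (sqrt ?m + sqrt ?m * p2) / 4 + (\<theta> * sqrt ?m + (\<integral>x. d x \<partial>?I) / (\<theta> * sqrt ?m)) / (4 * \<eta>))
    \<le> c * (\<eta> * (sqrt ?m + sqrt ?m * p2) / 4 + (\<theta> * sqrt ?m + (sqrt ?m * (\<delta>\<^sup>2 + 4 * tail K) + (132 * C0 * K * (1 + p2) + 3 * \<delta>\<^sup>2)) / \<theta>) / (4 * \<eta>))"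
    using dd c pos by (intro mult_left_mono add_left_mono divide_right_mono) simp_all
  finally show ?thesis unfolding c_def by (simp add: mult_left_mono)
qed

text \<open>Each of four terms is made \<open>\<epsilon> / 4\<close> times
  \<open>sqrt (card I)\<close>; the parameters are fixed in the order \<open>\<eta>\<close>,
  \<open>\<theta>\<close>, \<open>b\<close>, \<open>K\<close>, \<open>\<delta>\<close>. What does
  not grow with the sample, notably the cost of the truncation level, goes into
  \<open>B\<close>.\<close>

theorem iid_equicontinuity:
  assumes \<epsilon>: "0 < \<epsilon>"
  shows "\<exists>\<delta>>0. \<exists>B\<ge>0. \<forall>(I :: 'i set) J. finite I \<longrightarrow> finite J \<longrightarrow> J \<subseteq> Fc \<times> Fc \<longrightarrow>
    (\<forall>p\<in>J. (\<integral>z. (fst p z - snd p z)\<^sup>2 \<partial>P) \<le> \<delta>\<^sup>2) \<longrightarrow>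
    (\<integral>x. fmax J (\<lambda>p. \<Sum>i\<in>I. ((fst p (x i) - snd p (x i)) - (\<integral>z. fst p z - snd p z \<partial>P))) \<partial>PiM I (\<lambda>_. P))
      \<le> \<epsilon> * sqrt (card I) + B"
proof -
  define c where "c = 22 * sqrt (8 * C0)"
  have c: "0 < c" unfolding c_def using C0 by simp
  \<comment> \<open>\<open>\<eta>\<close>, \<open>\<theta>\<close> and \<open>b\<close> solve
    \<open>c * \<eta> * (1 + p2) = \<epsilon>\<close>,
    \<open>c * \<theta> / \<eta> = \<epsilon>\<close> and
    \<open>c * (2 * b) / (\<theta> * \<eta>) = \<epsilon>\<close>. The 2 is there because
    \<open>b\<close> is to bound \<open>\<delta>\<^sup>2\<close> and \<open>4 * tail K\<close>
    separately.\<close>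
  define \<eta> where "\<eta> = \<epsilon> / (c * (1 + p2))"
  have \<eta>: "0 < \<eta>" unfolding \<eta>_def using \<epsilon> c p2_nonneg by simp
  define \<theta> where "\<theta> = \<eta> * \<epsilon> / c"
  have \<theta>: "0 < \<theta>" unfolding \<theta>_def using \<eta> \<epsilon> c by simp
  define b where "b = \<epsilon> * \<eta> * \<theta> / (2 * c)"
  have b: "0 < b" unfolding b_def using \<epsilon> \<eta> \<theta> c by simp
  have "eventually (\<lambda>n. tail (real n) < b / 4) sequentially" using order_tendstoD(2)[OF tail_limit, of "b/4"] b by simp
  then have "eventually (\<lambda>n. tail (real n) < b / 4 \<and> 1 \<le> n) sequentially"
    using eventually_ge_at_top[of "1::nat"] by (rule eventually_conj)
  then obtain n :: nat where n: "tail (real n) < b / 4" "1 \<le> n" unfolding eventually_sequentially by blast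
  define K where "K = real n"
  have K: "4 * tail K \<le> b" "1 \<le> K" using n unfolding K_def by simp_all
  define \<delta> where "\<delta> = min (\<epsilon> / 12) (sqrt b)"
  have \<delta>: "0 < \<delta>" "3 * \<delta> \<le> \<epsilon> / 4" unfolding \<delta>_def using \<epsilon> b by simp_all
  have \<delta>b: "\<delta>\<^sup>2 \<le> b"
  proof -
    have "\<delta>\<^sup>2 \<le> (sqrt b)\<^sup>2" using \<delta>(1) by (intro power_mono) (simp_all add: \<delta>_def)
    then show ?thesis using b by simp
  qed
  define R where "R = 132 * C0 * K * (1 + p2) + 3 * \<delta>\<^sup>2"
  have R: "0 \<le> R" unfolding R_def using C0 K p2_nonneg by simp
  define B where "B = c * (R / \<theta> / (4 * \<eta>))"
  have B: "0 \<le> B" unfolding B_def using c R \<theta> \<eta> by simp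
  have main: "(\<integral>x. fmax J (\<lambda>p. \<Sum>i\<in>I. ((fst p (x i) - snd p (x i)) - (\<integral>z. fst p z - snd p z \<partial>P))) \<partial>PiM I (\<lambda>_. P))
      \<le> \<epsilon> * sqrt (card I) + B"
    if IJ: "finite I" "finite J" "J \<subseteq> Fc \<times> Fc" "\<forall>p\<in>J. (\<integral>z. (fst p z - snd p z)\<^sup>2 \<partial>P) \<le> \<delta>\<^sup>2" for I :: "'i set" and J
  proof (cases "I = {}")
    case True
    have "fmax J (\<lambda>p. 0) \<le> 0" by (rule fmax_le[OF IJ(2)]) simp_all
    then have "fmax J (\<lambda>p. 0) = 0" using fmax_nonneg[OF IJ(2)] by (rule antisym)
    then show ?thesis using True B by simp
  next
    case False
    define \<mu> where "\<mu> = sqrt (card I)"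
    have \<mu>: "0 \<le> \<mu>" unfolding \<mu>_def by simp
    have "(\<integral>x. fmax J (\<lambda>p. \<Sum>i\<in>I. ((fst p (x i) - snd p (x i)) - (\<integral>z. fst p z - snd p z \<partial>P))) \<partial>PiM I (\<lambda>_. P))
      \<le> c * (\<eta> * (\<mu> + \<mu> * p2) / 4 + (\<theta> * \<mu> + (\<mu> * (\<delta>\<^sup>2 + 4 * tail K) + R) / \<theta>) / (4 * \<eta>)) + 3 * \<mu> * \<delta>"
      unfolding \<mu>_def c_def R_def
      by (rule iid_maximal[OF IJ(1) False IJ(2,3) K(2) less_imp_le[OF \<delta>(1)] \<eta> \<theta>]) (use IJ(4) in blast)
    also have "\<dots> \<le> c * (\<eta> * (\<mu> + \<mu> * p2) / 4 + (\<theta> * \<mu> + (\<mu> * (2 * b) + R) / \<theta>) / (4 * \<eta>)) + \<mu> * (\<epsilon> / 4)"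
    proof (intro add_mono mult_left_mono divide_right_mono add_left_mono add_right_mono)
      show "\<delta>\<^sup>2 + 4 * tail K \<le> 2 * b" using \<delta>b K(1) by simp
      show "3 * \<mu> * \<delta> \<le> \<mu> * (\<epsilon> / 4)" using mult_left_mono[OF \<delta>(2) \<mu>] by simp
    qed (use c \<eta> \<theta> \<mu> in simp_all)
    also have "\<dots> = \<mu> * (c * \<eta> * (1 + p2)) / 4 + \<mu> * (c * \<theta> / \<eta>) / 4 + \<mu> * (c * (2 * b) / (\<theta> * \<eta>)) / 4 + B + \<mu> * (\<epsilon> / 4)"
      unfolding B_def using \<eta> \<theta> by (simp add: field_simps)
    also have "c * \<eta> * (1 + p2) = \<epsilon>" unfolding \<eta>_def using c p2_nonneg by simp
    also have "c * \<theta> / \<eta> = \<epsilon>" unfolding \<theta>_def using c \<eta> by simp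
    also have "c * (2 * b) / (\<theta> * \<eta>) = \<epsilon>" unfolding b_def using c \<eta> \<theta> by simp
    finally show ?thesis unfolding \<mu>_def by simp
  qed
  show ?thesis using \<delta>(1) B main by blast
qed

end

subsection \<open>Dyadic arrays\<close>

locale dyadic = prob_space M for M :: "'w measure" +
  fixes SU :: "'u measure" and SV :: "'v measure" and S :: "'z measure"
    and U :: "nat \<Rightarrow> 'w \<Rightarrow> 'u" and V :: "nat \<Rightarrow> nat \<Rightarrow> 'w \<Rightarrow> 'v" and \<tau> :: "'u \<Rightarrow> 'u \<Rightarrow> 'v \<Rightarrow> 'z"
  assumes U_meas: "\<And>i. 1 \<le> i \<Longrightarrow> U i \<in> measurable M SU"
    and V_meas: "\<And>i j. 1 \<le> i \<Longrightarrow> i < j \<Longrightarrow> V i j \<in> measurable M SV"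
    and U_law: "\<And>i. 1 \<le> i \<Longrightarrow> distr M SU (U i) = distr M SU (U 1)"
    and V_law: "\<And>i j. 1 \<le> i \<Longrightarrow> i < j \<Longrightarrow> distr M SV (V i j) = distr M SV (V 1 2)"
    and indep: "indep_sets (variable_events M SU SV U V) (Inl ` {1..} \<union> Inr ` dyad_index)"
    and \<tau>_meas: "(\<lambda>(u, u', v). \<tau> u u' v) \<in> measurable (SU \<Otimes>\<^sub>M SU \<Otimes>\<^sub>M SV) S"
    and \<tau>_sym: "\<And>u u' v. u \<in> space SU \<Longrightarrow> u' \<in> space SU \<Longrightarrow> v \<in> space SV \<Longrightarrow> \<tau> u u' v = \<tau> u' u v"
begin

abbreviation "KI \<equiv> (Inl ` {1..} \<union> Inr ` dyad_index :: (nat + nat \<times> nat) set)"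
abbreviation "SW \<equiv> SU \<Otimes>\<^sub>M SV"

definition u0 :: 'u where "u0 = U 1 (SOME \<omega>. \<omega> \<in> space M)"
definition v0 :: 'v where "v0 = V 1 2 (SOME \<omega>. \<omega> \<in> space M)"

lemma u0: "u0 \<in> space SU" and v0: "v0 \<in> space SV"
proof -
  have \<omega>: "(SOME \<omega>. \<omega> \<in> space M) \<in> space M" using not_empty by (simp add: some_in_eq)
  show "u0 \<in> space SU" unfolding u0_def by (rule measurable_space[OF U_meas \<omega>]) simp
  show "v0 \<in> space SV" unfolding v0_def by (rule measurable_space[OF V_meas \<omega>]) simp_all
qed

text \<open>Node and dyad variables take values in different types; pairing each with a dummy
  component of the other type turns them into one independent family.\<close>

definition Wv :: "nat + nat \<times> nat \<Rightarrow> 'w \<Rightarrow> 'u \<times> 'v" where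
  "Wv k \<omega> = (case k of Inl i \<Rightarrow> (U i \<omega>, v0) | Inr e \<Rightarrow> (u0, V (fst e) (snd e) \<omega>))"

lemma Wv_simps: "Wv (Inl i) \<omega> = (U i \<omega>, v0)" "Wv (Inr e) \<omega> = (u0, V (fst e) (snd e) \<omega>)"
  unfolding Wv_def by simp_all

text \<open>An event about a padded pair is an event about its genuine component, because sections
  of measurable sets are measurable.\<close>

lemma Wv_indep: "indep_vars (\<lambda>_. SW) Wv KI"
  unfolding indep_vars_def2
proof (intro conjI ballI)
  fix k assume k: "k \<in> KI"
  show "Wv k \<in> measurable M SW"
  proof (cases k)
    case (Inl i)
    then have "1 \<le> i" using k by auto
    then have "(\<lambda>\<omega>. (U i \<omega>, v0)) \<in> measurable M SW"
      by (intro measurable_Pair U_meas measurable_const v0)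
    then show ?thesis unfolding Inl Wv_simps(1)[abs_def] by (simp add: Wv_simps(1)[abs_def])
  next
    case (Inr e)
    then have "1 \<le> fst e" "fst e < snd e" using k unfolding dyad_index_def by auto
    then have "(\<lambda>\<omega>. (u0, V (fst e) (snd e) \<omega>)) \<in> measurable M SW"
      by (intro measurable_Pair V_meas measurable_const u0)
    then show ?thesis unfolding Inr by (simp add: Wv_simps(2)[abs_def])
  qed
next
  show "indep_sets (\<lambda>k. {Wv k -` A \<inter> space M |A. A \<in> sets SW}) KI"
  proof (rule indep_sets_mono_sets[OF indep])
    fix k assume k: "k \<in> KI"
    show "{Wv k -` A \<inter> space M |A. A \<in> sets SW} \<subseteq> variable_events M SU SV U V k"
    proof
      fix B assume "B \<in> {Wv k -` A \<inter> space M |A. A \<in> sets SW}"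
      then obtain A where A: "A \<in> sets SW" "B = Wv k -` A \<inter> space M" by blast
      show "B \<in> variable_events M SU SV U V k"
      proof (cases k)
        case (Inl i)
        have "(\<lambda>u. (u, v0)) -` A \<in> sets SU" by (rule sets_Pair2[OF A(1)])
        moreover have "B = U i -` ((\<lambda>u. (u, v0)) -` A) \<inter> space M"
          unfolding A(2) Inl by (auto simp: Wv_simps)
        ultimately show ?thesis unfolding Inl variable_events_def by auto
      next
        case (Inr e)
        obtain i j where e: "e = (i, j)" by (cases e)
        have "Pair u0 -` A \<in> sets SV" by (rule sets_Pair1[OF A(1)])
        moreover have "B = V i j -` (Pair u0 -` A) \<inter> space M"
          unfolding A(2) Inr e by (auto simp: Wv_simps)
        ultimately show ?thesis unfolding Inr e variable_events_def by auto
      qed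
    qed
  qed
qed

definition WA :: "(nat + nat \<times> nat) set \<Rightarrow> 'w \<Rightarrow> nat + nat \<times> nat \<Rightarrow> 'u \<times> 'v" where
  "WA A \<omega> = (\<lambda>k\<in>A. Wv k \<omega>)"

lemma WA_measurable: "A \<subseteq> KI \<Longrightarrow> WA A \<in> measurable M (PiM A (\<lambda>_. SW))"
  unfolding WA_def using Wv_indep unfolding indep_vars_def2 by (intro measurable_restrict) blast

text \<open>The tool behind the product laws of \<open>law_UV\<close>, \<open>law_UUV\<close> and
  \<open>D_orthogonal\<close>: all reduce to disjoint blocks of node and dyad variables.\<close>

lemma indep_blocks:
  assumes AB: "A \<subseteq> KI" "B \<subseteq> KI" "A \<inter> B = {}"
    and \<phi>: "\<phi> \<in> measurable (PiM A (\<lambda>_. SW)) X" and \<psi>: "\<psi> \<in> measurable (PiM B (\<lambda>_. SW)) Y"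
  shows "distr M (X \<Otimes>\<^sub>M Y) (\<lambda>\<omega>. (\<phi> (WA A \<omega>), \<psi> (WA B \<omega>))) = distr M X (\<lambda>\<omega>. \<phi> (WA A \<omega>)) \<Otimes>\<^sub>M distr M Y (\<lambda>\<omega>. \<psi> (WA B \<omega>))"
proof -
  let ?A = "PiM A (\<lambda>_. SW)" and ?B = "PiM B (\<lambda>_. SW)"
  have mA: "WA A \<in> measurable M ?A" and mB: "WA B \<in> measurable M ?B" using AB WA_measurable by auto
  have "indep_var ?A (WA A) ?B (WA B)"
    unfolding WA_def[abs_def] using indep_var_restrict[OF Wv_indep AB(3,1,2)] .
  then have joint: "distr M ?A (WA A) \<Otimes>\<^sub>M distr M ?B (WA B) = distr M (?A \<Otimes>\<^sub>M ?B) (\<lambda>\<omega>. (WA A \<omega>, WA B \<omega>))"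
    unfolding indep_var_distribution_eq by blast
  have dX: "distr M X (\<lambda>\<omega>. \<phi> (WA A \<omega>)) = distr (distr M ?A (WA A)) X \<phi>"
    using distr_distr[OF \<phi> mA] by (simp add: comp_def)
  have dY: "distr M Y (\<lambda>\<omega>. \<psi> (WA B \<omega>)) = distr (distr M ?B (WA B)) Y \<psi>"
    using distr_distr[OF \<psi> mB] by (simp add: comp_def)
  have \<psi>': "\<psi> \<in> measurable (distr M ?B (WA B)) Y" and \<phi>': "\<phi> \<in> measurable (distr M ?A (WA A)) X"
    using \<phi> \<psi> by simp_all
  have "prob_space (distr (distr M ?B (WA B)) Y \<psi>)"
    by (rule prob_space.prob_space_distr[OF prob_space_distr[OF mB] \<psi>'])
  then have sf: "sigma_finite_measure (distr (distr M ?B (WA B)) Y \<psi>)"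
    by (rule prob_space_imp_sigma_finite)
  have "distr M X (\<lambda>\<omega>. \<phi> (WA A \<omega>)) \<Otimes>\<^sub>M distr M Y (\<lambda>\<omega>. \<psi> (WA B \<omega>))
    = distr (distr M ?A (WA A) \<Otimes>\<^sub>M distr M ?B (WA B)) (X \<Otimes>\<^sub>M Y) (\<lambda>(x, y). (\<phi> x, \<psi> y))"
    unfolding dX dY by (rule pair_measure_distr[OF \<phi>' \<psi>' sf])
  also have "\<dots> = distr M (X \<Otimes>\<^sub>M Y) ((\<lambda>(x, y). (\<phi> x, \<psi> y)) \<circ> (\<lambda>\<omega>. (WA A \<omega>, WA B \<omega>)))"
    unfolding joint
  proof (rule distr_distr)
    show "(\<lambda>(x, y). (\<phi> x, \<psi> y)) \<in> measurable (?A \<Otimes>\<^sub>M ?B) (X \<Otimes>\<^sub>M Y)" using \<phi> \<psi> by measurable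
    show "(\<lambda>\<omega>. (WA A \<omega>, WA B \<omega>)) \<in> measurable M (?A \<Otimes>\<^sub>M ?B)" using mA mB by measurable
  qed
  finally show ?thesis by (simp add: comp_def)
qed

definition PU :: "'u measure" where "PU = distr M SU (U 1)"
definition PV :: "'v measure" where "PV = distr M SV (V 1 2)"
text \<open>The law of what remains random in an observation once one endpoint is fixed: the other
  endpoint and the dyad variable. Integrating over \<open>PB\<close> is conditioning on a
  node.\<close>

definition PB :: "('u \<times> 'v) measure" where "PB = PU \<Otimes>\<^sub>M PV"
definition T3 :: "'u \<times> 'u \<times> 'v \<Rightarrow> 'z" where "T3 = (\<lambda>(u, u', v). \<tau> u u' v)"
definition PZ :: "'z measure" where "PZ = distr (PU \<Otimes>\<^sub>M PB) S T3"

lemma prob_PU: "prob_space PU" unfolding PU_def by (rule prob_space_distr[OF U_meas]) simp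
lemma prob_PV: "prob_space PV" unfolding PV_def by (rule prob_space_distr[OF V_meas]) simp_all
lemma prob_PB: "prob_space PB" unfolding PB_def by (rule prob_space_pair[OF prob_PU prob_PV])
lemma sets_PU [measurable_cong]: "sets PU = sets SU" unfolding PU_def by simp
lemma sets_PV [measurable_cong]: "sets PV = sets SV" unfolding PV_def by simp
lemma sets_PB [measurable_cong]: "sets PB = sets SW" unfolding PB_def by (rule sets_pair_measure_cong[OF sets_PU sets_PV])
lemma T3_meas: "T3 \<in> measurable (SU \<Otimes>\<^sub>M SW) S" unfolding T3_def by (rule \<tau>_meas)
lemma T3_meas': "T3 \<in> measurable (PU \<Otimes>\<^sub>M PB) S"
  using T3_meas by (simp cong: measurable_cong_sets add: sets_pair_measure_cong[OF sets_PU sets_PB])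
lemma prob_PUB: "prob_space (PU \<Otimes>\<^sub>M PB)" by (rule prob_space_pair[OF prob_PU prob_PB])
lemma prob_PZ: "prob_space PZ" unfolding PZ_def by (rule prob_space.prob_space_distr[OF prob_PUB T3_meas'])
lemma sets_PZ: "sets PZ = sets S" unfolding PZ_def by simp

lemma comp_meas:
  "k \<in> A \<Longrightarrow> (\<lambda>x. fst (x k)) \<in> measurable (PiM A (\<lambda>_. SW)) SU"
  "k \<in> A \<Longrightarrow> (\<lambda>x. snd (x k)) \<in> measurable (PiM A (\<lambda>_. SW)) SV"
  by measurable

text \<open>Symmetric indexing lets either endpoint of a dyad take the place of the first argument
  of \<open>\<tau>\<close>; \<open>sum_D_second_moment\<close> needs both orders.\<close>

definition Vs :: "nat \<Rightarrow> nat \<Rightarrow> 'w \<Rightarrow> 'v" where "Vs i j = V (min i j) (max i j)"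
definition dk :: "nat \<Rightarrow> nat \<Rightarrow> nat + nat \<times> nat" where "dk i j = Inr (min i j, max i j)"

lemma dk_KI: "1 \<le> i \<Longrightarrow> 1 \<le> j \<Longrightarrow> i \<noteq> j \<Longrightarrow> dk i j \<in> KI"
  unfolding dk_def dyad_index_def by auto

lemma Vs_sym: "Vs i j = Vs j i" unfolding Vs_def by (simp add: min.commute max.commute)

lemma Vs_meas: "1 \<le> i \<Longrightarrow> 1 \<le> j \<Longrightarrow> i \<noteq> j \<Longrightarrow> Vs i j \<in> measurable M SV"
  unfolding Vs_def by (rule V_meas) (auto simp: min_def max_def)

lemma law_UV:
  assumes ij: "1 \<le> i" "1 \<le> j" "i \<noteq> j" and a: "1 \<le> a"
  shows "distr M SW (\<lambda>\<omega>. (U a \<omega>, Vs i j \<omega>)) = PB"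
proof -
  have k: "dk i j \<in> KI" by (rule dk_KI[OF ij])
  have "distr M (SU \<Otimes>\<^sub>M SV) (\<lambda>\<omega>. (fst (WA {Inl a} \<omega> (Inl a)), snd (WA {dk i j} \<omega> (dk i j))))
    = distr M SU (\<lambda>\<omega>. fst (WA {Inl a} \<omega> (Inl a))) \<Otimes>\<^sub>M distr M SV (\<lambda>\<omega>. snd (WA {dk i j} \<omega> (dk i j)))"
    by (rule indep_blocks) (use a k comp_meas in \<open>auto simp: dk_def\<close>)
  moreover have "distr M SU (U a) = PU" unfolding PU_def by (rule U_law[OF a])
  moreover have "distr M SV (Vs i j) = PV" unfolding PV_def Vs_def by (rule V_law) (use ij in \<open>auto simp: min_def max_def\<close>)
  ultimately show ?thesis unfolding PB_def by (simp add: WA_def Wv_simps dk_def Vs_def)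
qed

lemma law_UUV:
  assumes ij: "1 \<le> i" "1 \<le> j" "i \<noteq> j"
  shows "distr M (SU \<Otimes>\<^sub>M SW) (\<lambda>\<omega>. (U i \<omega>, (U j \<omega>, Vs i j \<omega>))) = PU \<Otimes>\<^sub>M PB"
proof -
  have k: "dk i j \<in> KI" by (rule dk_KI[OF ij])
  let ?B = "{Inl j, dk i j}"
  have "distr M (SU \<Otimes>\<^sub>M SW) (\<lambda>\<omega>. (fst (WA {Inl i} \<omega> (Inl i)), (\<lambda>x. (fst (x (Inl j)), snd (x (dk i j)))) (WA ?B \<omega>)))
    = distr M SU (\<lambda>\<omega>. fst (WA {Inl i} \<omega> (Inl i))) \<Otimes>\<^sub>M distr M SW (\<lambda>\<omega>. (\<lambda>x. (fst (x (Inl j)), snd (x (dk i j)))) (WA ?B \<omega>))"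
  proof (rule indep_blocks)
    show "{Inl i} \<inter> ?B = {}" using ij by (auto simp: dk_def)
    show "(\<lambda>x. (fst (x (Inl j)), snd (x (dk i j)))) \<in> measurable (PiM ?B (\<lambda>_. SW)) SW"
      by (intro measurable_Pair comp_meas) simp_all
  qed (use ij k comp_meas in auto)
  moreover have "distr M SU (U i) = PU" unfolding PU_def by (rule U_law[OF ij(1)])
  ultimately show ?thesis using law_UV[OF ij ij(2)] by (simp add: WA_def Wv_simps dk_def Vs_def)
qed

definition Zs :: "nat \<Rightarrow> nat \<Rightarrow> 'w \<Rightarrow> 'z" where "Zs i j \<omega> = \<tau> (U i \<omega>) (U j \<omega>) (Vs i j \<omega>)"

lemma Zs_sym:
  assumes "1 \<le> i" "1 \<le> j" "i \<noteq> j" "\<omega> \<in> space M" shows "Zs i j \<omega> = Zs j i \<omega>"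
  unfolding Zs_def Vs_sym[of j i]
  by (rule \<tau>_sym[OF measurable_space[OF U_meas[OF assms(1)] assms(4)] measurable_space[OF U_meas[OF assms(2)] assms(4)]
    measurable_space[OF Vs_meas[OF assms(1-3)] assms(4)]])

lemma UUV_meas: "1 \<le> i \<Longrightarrow> 1 \<le> j \<Longrightarrow> i \<noteq> j \<Longrightarrow> (\<lambda>\<omega>. (U i \<omega>, (U j \<omega>, Vs i j \<omega>))) \<in> measurable M (SU \<Otimes>\<^sub>M SW)"
  by (intro measurable_Pair U_meas Vs_meas)

lemma Zs_T3: "Zs i j \<omega> = T3 (U i \<omega>, (U j \<omega>, Vs i j \<omega>))" unfolding Zs_def T3_def by simp

lemma Zs_meas: "1 \<le> i \<Longrightarrow> 1 \<le> j \<Longrightarrow> i \<noteq> j \<Longrightarrow> Zs i j \<in> measurable M S"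
  unfolding Zs_T3[abs_def] by (rule measurable_compose[OF UUV_meas T3_meas])

lemma law_Zs: "1 \<le> i \<Longrightarrow> 1 \<le> j \<Longrightarrow> i \<noteq> j \<Longrightarrow> distr M S (Zs i j) = PZ"
  unfolding PZ_def law_UUV[symmetric] by (subst distr_distr[OF T3_meas UUV_meas]) (simp_all add: comp_def Zs_T3[abs_def])

lemma Zs_eq_dyad_obs: "i < j \<Longrightarrow> Zs i j = dyad_obs U V \<tau> i j"
  by (rule ext) (simp add: Zs_def dyad_obs_def Vs_def)

text \<open>Dyads without common nodes depend on disjoint blocks of node and dyad variables.\<close>

lemma disjoint_dyads_iid:
  assumes E: "E \<subseteq> dyad_index"
    and disj: "\<And>e e'. e \<in> E \<Longrightarrow> e' \<in> E \<Longrightarrow> e \<noteq> e' \<Longrightarrow> {fst e, snd e} \<inter> {fst e', snd e'} = {}"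
  shows "distr M (PiM E (\<lambda>_. S)) (\<lambda>\<omega>. \<lambda>e\<in>E. Zs (fst e) (snd e) \<omega>) = PiM E (\<lambda>_. PZ)"
proof (cases "E = {}")
  \<comment> \<open>The empty product is treated by hand; the criterion for independence by product
    laws is applied to nonempty index sets.\<close>
  case True
  have "distr M (PiM {} (\<lambda>_. S)) (\<lambda>\<omega>. \<lambda>e\<in>{}. Zs (fst e) (snd e) \<omega>) = PiM {} (\<lambda>_. PZ)"
  proof (rule measure_eqI)
    interpret D: prob_space "distr M (PiM {} (\<lambda>_. S)) (\<lambda>\<omega>. \<lambda>e\<in>{}. Zs (fst e) (snd e) \<omega>)"
      by (rule prob_space_distr) (rule measurable_restrict, simp)
    fix A assume A: "A \<in> sets (distr M (PiM {} (\<lambda>_. S)) (\<lambda>\<omega>. \<lambda>e\<in>{}. Zs (fst e) (snd e) \<omega>))"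
    then have "A = {} \<or> A = {\<lambda>_. undefined}" by (auto simp: PiM_empty)
    then show "emeasure (distr M (PiM {} (\<lambda>_. S)) (\<lambda>\<omega>. \<lambda>e\<in>{}. Zs (fst e) (snd e) \<omega>)) A = emeasure (PiM {} (\<lambda>_. PZ)) A"
      using D.emeasure_space_1 by (auto simp: PiM_empty space_PiM)
  qed (simp add: PiM_empty)
  then show ?thesis using True by simp
next
  case False
  define K where "K = (\<lambda>e :: nat \<times> nat. {Inl (fst e), Inl (snd e), Inr e} :: (nat + nat \<times> nat) set)"
  have e: "1 \<le> fst e" "fst e < snd e" if "e \<in> E" for e using that E unfolding dyad_index_def by auto
  have KI: "K e \<subseteq> KI" if "e \<in> E" for e using e[OF that] that E unfolding K_def by auto
  have dj: "disjoint_family_on K E"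
    unfolding disjoint_family_on_def
  proof (intro ballI impI)
    fix e e' assume "e \<in> E" "e' \<in> E" "e \<noteq> e'"
    then show "K e \<inter> K e' = {}" using disj[of e e'] unfolding K_def by auto
  qed
  have "indep_vars (\<lambda>e. PiM (K e) (\<lambda>_. SW)) (\<lambda>e \<omega>. restrict (\<lambda>k. Wv k \<omega>) (K e)) E"
    by (rule indep_vars_restrict[OF Wv_indep KI dj])
  then have ind: "indep_vars (\<lambda>_. S) (\<lambda>e \<omega>. T3 (fst (restrict (\<lambda>k. Wv k \<omega>) (K e) (Inl (fst e))),
      (fst (restrict (\<lambda>k. Wv k \<omega>) (K e) (Inl (snd e))), snd (restrict (\<lambda>k. Wv k \<omega>) (K e) (Inr e))))) E"
  proof (rule indep_vars_compose2[where Y="\<lambda>e x. T3 (fst (x (Inl (fst e))), (fst (x (Inl (snd e))), snd (x (Inr e))))"])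
    fix e assume "e \<in> E"
    show "(\<lambda>x. T3 (fst (x (Inl (fst e))), (fst (x (Inl (snd e))), snd (x (Inr e))))) \<in> measurable (PiM (K e) (\<lambda>_. SW)) S"
      by (rule measurable_compose[OF _ T3_meas], intro measurable_Pair comp_meas) (simp_all add: K_def)
  qed
  have eq: "T3 (fst (restrict (\<lambda>k. Wv k \<omega>) (K e) (Inl (fst e))),
      (fst (restrict (\<lambda>k. Wv k \<omega>) (K e) (Inl (snd e))), snd (restrict (\<lambda>k. Wv k \<omega>) (K e) (Inr e)))) = Zs (fst e) (snd e) \<omega>" if "e \<in> E" for e \<omega>
    using e[OF that] by (simp add: K_def Wv_simps Zs_T3 Vs_def)
  have ind': "indep_vars (\<lambda>_. S) (\<lambda>e. Zs (fst e) (snd e)) E"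
    by (rule iffD1[OF indep_vars_cong ind]) ((rule refl | (rule ext, erule eq))+)
  have rv: "Zs (fst e) (snd e) \<in> measurable M S" if "e \<in> E" for e using e[OF that] by (intro Zs_meas) simp_all
  have "distr M (PiM E (\<lambda>_. S)) (\<lambda>\<omega>. \<lambda>e\<in>E. Zs (fst e) (snd e) \<omega>) = (\<Pi>\<^sub>M e\<in>E. distr M S (Zs (fst e) (snd e)))"
    by (rule iffD1[OF indep_vars_iff_distr_eq_PiM' ind']) (rule False, erule rv)
  also have "\<dots> = PiM E (\<lambda>_. PZ)"
  proof (rule PiM_cong[OF refl])
    fix e' assume "e' \<in> E"
    from e[OF this] show "distr M S (Zs (fst e') (snd e')) = PZ" by (intro law_Zs) simp_all
  qed
  finally show ?thesis .
qed

end

subsection \<open>Hoeffding decomposition\<close>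

lemma square_integrable_add:
  fixes a b :: "'x \<Rightarrow> real"
  assumes [measurable]: "a \<in> borel_measurable N" "b \<in> borel_measurable N"
    and i: "integrable N (\<lambda>x. (a x)\<^sup>2)" "integrable N (\<lambda>x. (b x)\<^sup>2)"
  shows "integrable N (\<lambda>x. (a x + b x)\<^sup>2)"
proof (rule Bochner_Integration.integrable_bound)
  show "integrable N (\<lambda>x. 2 * (a x)\<^sup>2 + 2 * (b x)\<^sup>2)" using i by simp
  show "AE x in N. norm ((a x + b x)\<^sup>2) \<le> norm (2 * (a x)\<^sup>2 + 2 * (b x)\<^sup>2)"
  proof (rule AE_I2)
    fix x
    have "0 \<le> (a x - b x)\<^sup>2" by simp
    then have "(a x + b x)\<^sup>2 \<le> 2 * (a x)\<^sup>2 + 2 * (b x)\<^sup>2" by (simp add: power2_eq_square algebra_simps)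
    then show "norm ((a x + b x)\<^sup>2) \<le> norm (2 * (a x)\<^sup>2 + 2 * (b x)\<^sup>2)" by simp
  qed
qed measurable

lemma square_integrable_cmult:
  fixes a :: "'x \<Rightarrow> real"
  assumes "integrable N (\<lambda>x. (a x)\<^sup>2)" shows "integrable N (\<lambda>x. (c * a x)\<^sup>2)"
  using assms by (simp add: power_mult_distrib)

lemma product_integrable:
  fixes a b :: "'x \<Rightarrow> real"
  assumes [measurable]: "a \<in> borel_measurable N" "b \<in> borel_measurable N"
    and i: "integrable N (\<lambda>x. (a x)\<^sup>2)" "integrable N (\<lambda>x. (b x)\<^sup>2)"
  shows "integrable N (\<lambda>x. a x * b x)"
proof (rule Bochner_Integration.integrable_bound)
  show "integrable N (\<lambda>x. (a x)\<^sup>2 + (b x)\<^sup>2)" using i by simp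
  show "AE x in N. norm (a x * b x) \<le> norm ((a x)\<^sup>2 + (b x)\<^sup>2)"
  proof (rule AE_I2)
    fix x
    have "2 * \<bar>a x\<bar> * \<bar>b x\<bar> \<le> \<bar>a x\<bar>\<^sup>2 + \<bar>b x\<bar>\<^sup>2" by (rule sum_squares_bound)
    moreover have "0 \<le> \<bar>a x\<bar> * \<bar>b x\<bar>" by simp
    ultimately have "\<bar>a x\<bar> * \<bar>b x\<bar> \<le> (a x)\<^sup>2 + (b x)\<^sup>2" unfolding power2_abs by linarith
    then show "norm (a x * b x) \<le> norm ((a x)\<^sup>2 + (b x)\<^sup>2)" by (simp add: abs_mult)
  qed
qed measurable

lemma square_integrable_sum:
  fixes a :: "'i \<Rightarrow> 'x \<Rightarrow> real"
  assumes "finite I" "\<And>i. i \<in> I \<Longrightarrow> a i \<in> borel_measurable N" "\<And>i. i \<in> I \<Longrightarrow> integrable N (\<lambda>x. (a i x)\<^sup>2)"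
  shows "integrable N (\<lambda>x. (\<Sum>i\<in>I. a i x)\<^sup>2)"
  using assms
proof (induction I rule: finite_induct)
  case (insert i I)
  have "integrable N (\<lambda>x. (a i x + (\<Sum>i\<in>I. a i x))\<^sup>2)"
    by (rule square_integrable_add) (use insert in simp_all)
  then show ?case using insert.hyps by simp
qed simp

lemma (in prob_space) integrable_of_square:
  fixes a :: "'a \<Rightarrow> real"
  assumes [measurable]: "a \<in> borel_measurable M" and i: "integrable M (\<lambda>x. (a x)\<^sup>2)"
  shows "integrable M a" "(expectation a)\<^sup>2 \<le> expectation (\<lambda>x. (a x)\<^sup>2)"
proof -
  show ia: "integrable M a" using product_integrable[of a M "\<lambda>_. 1"] i by simp
  have "0 \<le> variance a" by (rule variance_positive)
  then show "(expectation a)\<^sup>2 \<le> expectation (\<lambda>x. (a x)\<^sup>2)" using variance_eq[OF ia i] by linarith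
qed

definition pairs_upto :: "nat \<Rightarrow> (nat \<times> nat) set" where
  "pairs_upto n = {(i, j). 1 \<le> i \<and> i < j \<and> j \<le> n}"

lemma pairs_upto_finite: "finite (pairs_upto n)"
  by (rule finite_subset[of _ "{..n} \<times> {..n}"]) (auto simp: pairs_upto_def)

lemma pairs_upto_Suc: "pairs_upto (Suc n) = pairs_upto n \<union> (\<lambda>i. (i, Suc n)) ` {1..n}"
  unfolding pairs_upto_def by (auto simp: le_Suc_eq)

text \<open>Each node occurs in \<open>n - 1\<close> pairs; the induction adds the pairs whose
  larger node is \<open>Suc n\<close>.\<close>

lemma sum_pairs_upto: "(\<Sum>(i, j)\<in>pairs_upto n. x i + x j) = (real n - 1) * (\<Sum>a=1..n. x a :: real)"
proof (induction n)
  case 0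
  have "pairs_upto 0 = {}" unfolding pairs_upto_def by auto
  then show ?case by simp
next
  case (Suc n)
  have d: "pairs_upto n \<inter> (\<lambda>i. (i, Suc n)) ` {1..n} = {}" unfolding pairs_upto_def by auto
  have "(\<Sum>(i, j)\<in>pairs_upto (Suc n). x i + x j) = (\<Sum>(i, j)\<in>pairs_upto n. x i + x j) + (\<Sum>(i, j)\<in>(\<lambda>i. (i, Suc n)) ` {1..n}. x i + x j)"
    unfolding pairs_upto_Suc by (rule sum.union_disjoint[OF pairs_upto_finite _ d]) simp
  also have "(\<Sum>(i, j)\<in>(\<lambda>i. (i, Suc n)) ` {1..n}. x i + x j) = (\<Sum>i=1..n. x i + x (Suc n))"
    by (subst sum.reindex) (simp_all add: inj_on_def)
  also have "\<dots> = (\<Sum>i=1..n. x i) + n * x (Suc n)" by (simp add: sum.distrib)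
  finally show ?case unfolding Suc.IH by (simp add: algebra_simps)
qed

text \<open>With the constant value \<open>1/2\<close> every pair contributes 1 to
  \<open>sum_pairs_upto\<close>.\<close>

lemma card_pairs_upto: "real (card (pairs_upto n)) = real n * (real n - 1) / 2"
  using sum_pairs_upto[of "\<lambda>_. 1/2" n] by (simp add: case_prod_beta)

context dyadic
begin

definition L2Z :: "('z \<Rightarrow> real) set" where
  "L2Z = {f \<in> borel_measurable S. integrable PZ (\<lambda>z. (f z)\<^sup>2)}"

definition mf :: "('z \<Rightarrow> real) \<Rightarrow> real" where "mf f = (\<integral>z. f z \<partial>PZ)"
text \<open>A version of the conditional expectation of an observation given one of its nodes, as a
  function of the value of that node; \<open>cond_exp_ht\<close> makes the connection.\<close>

definition ht :: "('z \<Rightarrow> real) \<Rightarrow> 'u \<Rightarrow> real" where "ht f u = (\<integral>b. f (T3 (u, b)) \<partial>PB)"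
definition h :: "('z \<Rightarrow> real) \<Rightarrow> 'u \<Rightarrow> real" where "h f u = ht f u - mf f"
text \<open>The kernel of the degenerate remainder \<open>D\<close>, with one endpoint separated
  from the variables that are integrated out.\<close>

definition d3 :: "('z \<Rightarrow> real) \<Rightarrow> 'u \<Rightarrow> 'u \<times> 'v \<Rightarrow> real" where
  "d3 f u b = f (T3 (u, b)) - mf f - h f u - h f (fst b)"
definition D :: "('z \<Rightarrow> real) \<Rightarrow> nat \<Rightarrow> nat \<Rightarrow> 'w \<Rightarrow> real" where
  "D f i j \<omega> = f (Zs i j \<omega>) - mf f - h f (U i \<omega>) - h f (U j \<omega>)"

lemma fT3_meas: "f \<in> borel_measurable S \<Longrightarrow> (\<lambda>p. f (T3 p)) \<in> borel_measurable (PU \<Otimes>\<^sub>M PB)"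
  by (rule measurable_compose[OF T3_meas'])

lemma L2Z_facts:
  assumes f: "f \<in> L2Z"
  shows "f \<in> borel_measurable S" "integrable PZ f"
    "integrable (PU \<Otimes>\<^sub>M PB) (\<lambda>p. f (T3 p))" "integrable (PU \<Otimes>\<^sub>M PB) (\<lambda>p. (f (T3 p))\<^sup>2)"
    "(\<integral>p. f (T3 p) \<partial>(PU \<Otimes>\<^sub>M PB)) = mf f"
proof -
  interpret Z: prob_space PZ by (rule prob_PZ)
  show fm: "f \<in> borel_measurable S" using f unfolding L2Z_def by simp
  have fz: "f \<in> borel_measurable PZ" "integrable PZ (\<lambda>z. (f z)\<^sup>2)"
    using f unfolding L2Z_def by (simp_all cong: measurable_cong_sets add: sets_PZ)
  show fi: "integrable PZ f" by (rule Z.integrable_of_square(1)[OF fz])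
  show "integrable (PU \<Otimes>\<^sub>M PB) (\<lambda>p. f (T3 p))"
    by (rule integrable_distr[OF T3_meas']) (use fi in \<open>simp add: PZ_def\<close>)
  show "integrable (PU \<Otimes>\<^sub>M PB) (\<lambda>p. (f (T3 p))\<^sup>2)"
    by (rule integrable_distr[OF T3_meas', where f="\<lambda>z. (f z)\<^sup>2"]) (use fz(2) in \<open>simp add: PZ_def\<close>)
  show "(\<integral>p. f (T3 p) \<partial>(PU \<Otimes>\<^sub>M PB)) = mf f"
    unfolding mf_def PZ_def by (rule integral_distr[OF T3_meas' fm, symmetric])
qed

lemma h_facts:
  assumes f: "f \<in> L2Z"
  shows "h f \<in> borel_measurable PU" "integrable PU (\<lambda>u. (h f u)\<^sup>2)" "integrable PU (h f)" "(\<integral>u. h f u \<partial>PU) = 0"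
    "integrable PU (ht f)"
proof -
  interpret U: prob_space PU by (rule prob_PU)
  interpret B: prob_space PB by (rule prob_PB)
  interpret UB: pair_prob_space PU PB ..
  note F = L2Z_facts[OF f]
  have htm: "ht f \<in> borel_measurable PU"
  proof -
    have "(\<lambda>u. \<integral>b. (\<lambda>p. f (T3 p)) (u, b) \<partial>PB) \<in> borel_measurable PU"
      by (rule B.borel_measurable_lebesgue_integral) (use fT3_meas[OF F(1)] in simp)
    then show ?thesis unfolding ht_def[abs_def] .
  qed
  show hti: "integrable PU (ht f)" unfolding ht_def[abs_def] by (rule UB.integrable_fst'[OF F(3)])
  have hm: "(\<integral>u. ht f u \<partial>PU) = mf f" unfolding ht_def UB.integral_fst'[OF F(3)] by (rule F(5))
  show m: "h f \<in> borel_measurable PU" unfolding h_def[abs_def] using htm by measurable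
  show "integrable PU (h f)" unfolding h_def[abs_def] using hti by simp
  show "(\<integral>u. h f u \<partial>PU) = 0" unfolding h_def using hti hm by (simp add: U.prob_space)
  have ht2: "integrable PU (\<lambda>u. (ht f u)\<^sup>2)"
  proof (rule Bochner_Integration.integrable_bound[OF UB.integrable_fst'[OF F(4)]])
    show "(\<lambda>u. (ht f u)\<^sup>2) \<in> borel_measurable PU" using htm by measurable
    have meas: "(\<lambda>b. f (T3 (u, b))) \<in> borel_measurable PB" if "u \<in> space PU" for u
      using measurable_compose[OF measurable_Pair1'[OF that] fT3_meas[OF F(1)]] .
    \<comment> \<open>Jensen's inequality under \<open>PB\<close>, for almost every
      \<open>u\<close>, namely where the square is integrable.\<close>
    show "AE u in PU. norm ((ht f u)\<^sup>2) \<le> norm (\<integral>b. (f (T3 (u, b)))\<^sup>2 \<partial>PB)"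
      using UB.AE_integrable_fst'[OF F(4)] AE_space
    proof eventually_elim
      fix u assume "integrable PB (\<lambda>b. (f (T3 (u, b)))\<^sup>2)" "u \<in> space PU"
      then have "(ht f u)\<^sup>2 \<le> (\<integral>b. (f (T3 (u, b)))\<^sup>2 \<partial>PB)"
        unfolding ht_def by (intro B.integrable_of_square(2) meas)
      then show "norm ((ht f u)\<^sup>2) \<le> norm (\<integral>b. (f (T3 (u, b)))\<^sup>2 \<partial>PB)" by simp
    qed
  qed
  have "integrable PU (\<lambda>u. (ht f u + (- mf f))\<^sup>2)"
    by (rule square_integrable_add[OF htm _ ht2]) simp_all
  then show "integrable PU (\<lambda>u. (h f u)\<^sup>2)" unfolding h_def by simp
qed

lemma fst_PB:
  fixes g :: "'u \<Rightarrow> real"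
  assumes "integrable PU g"
  shows "integrable PB (\<lambda>b. g (fst b))" "(\<integral>b. g (fst b) \<partial>PB) = (\<integral>u. g u \<partial>PU)"
proof -
  interpret V: prob_space PV by (rule prob_PV)
  have d: "distr PB PU fst = PU" unfolding PB_def by (rule V.distr_pair_fst)
  have m: "fst \<in> measurable PB PU" unfolding PB_def by (rule measurable_fst)
  show "integrable PB (\<lambda>b. g (fst b))" by (rule integrable_distr[OF m]) (simp add: d assms)
  have "(\<integral>u. g u \<partial>PU) = (\<integral>u. g u \<partial>distr PB PU fst)" unfolding d ..
  also have "\<dots> = (\<integral>b. g (fst b) \<partial>PB)" by (rule integral_distr[OF m]) (use assms in blast)
  finally show "(\<integral>b. g (fst b) \<partial>PB) = (\<integral>u. g u \<partial>PU)" by simp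
qed

text \<open>Where \<open>f (T3 (u, b))\<close> fails to be integrable in \<open>b\<close>, both \<open>ht f u\<close> and the integral
  below are the junk value 0, so the identity needs no exceptional null set.\<close>

lemma d3_mean_zero:
  assumes f: "f \<in> L2Z" shows "(\<integral>b. d3 f u b \<partial>PB) = 0"
proof (cases "integrable PB (\<lambda>b. f (T3 (u, b)))")
  case True
  interpret B: prob_space PB by (rule prob_PB)
  note hb = fst_PB[OF h_facts(3)[OF f]]
  have "(\<integral>b. d3 f u b \<partial>PB) = ht f u - mf f - h f u - (\<integral>b. h f (fst b) \<partial>PB)"
    unfolding d3_def ht_def using True hb(1) by (simp add: B.prob_space)
  also have "\<dots> = ht f u - mf f - h f u" by (simp add: hb(2) h_facts(4)[OF f])
  finally show ?thesis by (simp add: h_def)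
next
  case False
  interpret B: prob_space PB by (rule prob_PB)
  note hb = fst_PB[OF h_facts(3)[OF f]]
  have "\<not> integrable PB (d3 f u)"
  proof
    assume "integrable PB (d3 f u)"
    then have "integrable PB (\<lambda>b. d3 f u b + (mf f + h f u) + h f (fst b))" using hb(1) by simp
    then show False using False unfolding d3_def by simp
  qed
  then show ?thesis by (rule not_integrable_integral_eq)
qed

lemma hU_facts:
  assumes f: "f \<in> L2Z" and i: "1 \<le> i"
  shows "(\<lambda>\<omega>. h f (U i \<omega>)) \<in> borel_measurable M" "integrable M (\<lambda>\<omega>. (h f (U i \<omega>))\<^sup>2)"
    "(\<integral>\<omega>. h f (U i \<omega>) \<partial>M) = 0" "(\<integral>\<omega>. (h f (U i \<omega>))\<^sup>2 \<partial>M) = (\<integral>u. (h f u)\<^sup>2 \<partial>PU)"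
proof -
  have d: "distr M SU (U i) = PU" unfolding PU_def by (rule U_law[OF i])
  note H = h_facts[OF f]
  have hm: "h f \<in> borel_measurable SU" using H(1) by (simp cong: measurable_cong_sets add: sets_PU)
  then have hm2: "(\<lambda>u. (h f u)\<^sup>2) \<in> borel_measurable SU" by measurable
  show "(\<lambda>\<omega>. h f (U i \<omega>)) \<in> borel_measurable M" by (rule measurable_compose[OF U_meas[OF i] hm])
  show "integrable M (\<lambda>\<omega>. (h f (U i \<omega>))\<^sup>2)"
    by (rule integrable_distr[OF U_meas[OF i], where f="\<lambda>u. (h f u)\<^sup>2"]) (simp add: d H(2))
  show "(\<integral>\<omega>. h f (U i \<omega>) \<partial>M) = 0" using integral_distr[OF U_meas[OF i] hm] by (simp add: d H(4))
  show "(\<integral>\<omega>. (h f (U i \<omega>))\<^sup>2 \<partial>M) = (\<integral>u. (h f u)\<^sup>2 \<partial>PU)" using integral_distr[OF U_meas[OF i] hm2] by (simp add: d)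
qed

lemma fZ_facts:
  assumes f: "f \<in> L2Z" and ij: "1 \<le> i" "1 \<le> j" "i \<noteq> j"
  shows "(\<lambda>\<omega>. f (Zs i j \<omega>)) \<in> borel_measurable M" "integrable M (\<lambda>\<omega>. (f (Zs i j \<omega>))\<^sup>2)" "integrable M (\<lambda>\<omega>. f (Zs i j \<omega>))"
    "(\<integral>\<omega>. f (Zs i j \<omega>) \<partial>M) = mf f"
proof -
  note F = L2Z_facts[OF f]
  note Zm = Zs_meas[OF ij]
  show "(\<lambda>\<omega>. f (Zs i j \<omega>)) \<in> borel_measurable M" by (rule measurable_compose[OF Zm F(1)])
  show "integrable M (\<lambda>\<omega>. (f (Zs i j \<omega>))\<^sup>2)"
    by (rule integrable_distr[OF Zm, where f="\<lambda>z. (f z)\<^sup>2"]) (use f in \<open>simp add: law_Zs[OF ij] L2Z_def\<close>)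
  show "integrable M (\<lambda>\<omega>. f (Zs i j \<omega>))"
    by (rule integrable_distr[OF Zm]) (use F(2) in \<open>simp add: law_Zs[OF ij]\<close>)
  show "(\<integral>\<omega>. f (Zs i j \<omega>) \<partial>M) = mf f" unfolding mf_def law_Zs[OF ij, symmetric] by (rule integral_distr[OF Zm F(1), symmetric])
qed

lemma D_square_integrable:
  assumes f: "f \<in> L2Z" and ij: "1 \<le> i" "1 \<le> j" "i \<noteq> j"
  shows "D f i j \<in> borel_measurable M" "integrable M (\<lambda>\<omega>. (D f i j \<omega>)\<^sup>2)"
proof -
  note Z = fZ_facts[OF f ij] and hi = hU_facts[OF f ij(1)] and hj = hU_facts[OF f ij(2)]
  have c: "(\<lambda>\<omega>. - mf f) \<in> borel_measurable M" "integrable M (\<lambda>\<omega>. (- mf f)\<^sup>2)" by simp_all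
  have mi: "(\<lambda>\<omega>. - h f (U i \<omega>)) \<in> borel_measurable M" "integrable M (\<lambda>\<omega>. (- h f (U i \<omega>))\<^sup>2)" using hi(1,2) by simp_all
  have mj: "(\<lambda>\<omega>. - h f (U j \<omega>)) \<in> borel_measurable M" "integrable M (\<lambda>\<omega>. (- h f (U j \<omega>))\<^sup>2)" using hj(1,2) by simp_all
  show "D f i j \<in> borel_measurable M" unfolding D_def[abs_def] using Z(1) hi(1) hj(1) by measurable
  have "integrable M (\<lambda>\<omega>. (((f (Zs i j \<omega>) + - mf f) + - h f (U i \<omega>)) + - h f (U j \<omega>))\<^sup>2)"
    by (intro square_integrable_add borel_measurable_add Z(1,2) c mi mj)
  then show "integrable M (\<lambda>\<omega>. (D f i j \<omega>)\<^sup>2)" unfolding D_def by simp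
qed

lemma d3_measurable:
  assumes f: "f \<in> L2Z" shows "(\<lambda>p. d3 f (fst p) (snd p)) \<in> borel_measurable (SU \<Otimes>\<^sub>M SW)"
proof -
  have [measurable]: "h f \<in> borel_measurable SU" using h_facts(1)[OF f] by (simp cong: measurable_cong_sets add: sets_PU)
  have [measurable]: "(\<lambda>p. f (T3 p)) \<in> borel_measurable (SU \<Otimes>\<^sub>M SW)"
    by (rule measurable_compose[OF T3_meas L2Z_facts(1)[OF f]])
  have "(\<lambda>p. f (T3 p) - mf f - h f (fst p) - h f (fst (snd p))) \<in> borel_measurable (SU \<Otimes>\<^sub>M SW)" by measurable
  then show ?thesis unfolding d3_def by simp
qed

lemma D_d3: "D f i j \<omega> = d3 f (U i \<omega>) (U j \<omega>, Vs i j \<omega>)"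
  unfolding D_def d3_def Zs_T3 by simp

lemma D_sym:
  assumes "1 \<le> i" "1 \<le> j" "i \<noteq> j" "\<omega> \<in> space M" shows "D f i j \<omega> = D f j i \<omega>"
  unfolding D_def Zs_sym[OF assms] by simp

text \<open>Node \<open>j\<close> and the dyad variable of \<open>{i, j}\<close> occur in the first
  factor only. Given all other variables, the first factor has mean 0 over these two by
  \<open>d3_mean_zero\<close>, whether or not \<open>i\<close> is shared.\<close>

lemma D_orthogonal:
  assumes f: "f \<in> L2Z" and ij: "1 \<le> i" "1 \<le> j" "i \<noteq> j" and kl: "1 \<le> k" "1 \<le> l" "k \<noteq> l"
    and priv: "j \<noteq> k" "j \<noteq> l"
  shows "(\<integral>\<omega>. D f i j \<omega> * D f k l \<omega> \<partial>M) = 0"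
proof -
  let ?A = "{Inl i, Inl k, Inl l, dk k l}" and ?B = "{Inl j, dk i j}"
  let ?X = "SU \<Otimes>\<^sub>M (borel :: real measure)"
  \<comment> \<open>\<open>U i\<close> is kept beside the second factor, because the first factor
    depends on it as well.\<close>
  define \<phi> where "\<phi> = (\<lambda>x :: nat + nat \<times> nat \<Rightarrow> 'u \<times> 'v. (fst (x (Inl i)), d3 f (fst (x (Inl k))) (fst (x (Inl l)), snd (x (dk k l)))))"
  define \<psi> where "\<psi> = (\<lambda>x :: nat + nat \<times> nat \<Rightarrow> 'u \<times> 'v. (fst (x (Inl j)), snd (x (dk i j))))"
  have AB: "?A \<subseteq> KI" "?B \<subseteq> KI" using ij kl dk_KI by auto
  have "dk i j \<noteq> dk k l" unfolding dk_def using priv by (auto simp: min_def max_def split: if_splits)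
  then have disj: "?A \<inter> ?B = {}" using ij priv unfolding dk_def by auto
  have \<phi>m: "\<phi> \<in> measurable (PiM ?A (\<lambda>_. SW)) ?X"
    unfolding \<phi>_def
  proof (rule measurable_Pair)
    have "(\<lambda>x. (fst (x (Inl k)), (fst (x (Inl l)), snd (x (dk k l))))) \<in> measurable (PiM ?A (\<lambda>_. SW)) (SU \<Otimes>\<^sub>M SW)"
      by (intro measurable_Pair comp_meas) simp_all
    from measurable_compose[OF this d3_measurable[OF f]]
    show "(\<lambda>x. d3 f (fst (x (Inl k))) (fst (x (Inl l)), snd (x (dk k l)))) \<in> borel_measurable (PiM ?A (\<lambda>_. SW))" by simp
  qed (rule comp_meas, simp)
  have \<psi>m: "\<psi> \<in> measurable (PiM ?B (\<lambda>_. SW)) SW" unfolding \<psi>_def by (intro measurable_Pair comp_meas) simp_all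
  have \<phi>W: "\<phi> (WA ?A \<omega>) = (U i \<omega>, D f k l \<omega>)" for \<omega> unfolding \<phi>_def D_d3 by (simp add: WA_def Wv_simps dk_def Vs_def)
  have \<psi>W: "\<psi> (WA ?B \<omega>) = (U j \<omega>, Vs i j \<omega>)" for \<omega> unfolding \<psi>_def by (simp add: WA_def Wv_simps dk_def Vs_def)
  have Dm: "D f k l \<in> borel_measurable M" by (rule D_square_integrable(1)[OF f kl])
  define Q where "Q = distr M ?X (\<lambda>\<omega>. (U i \<omega>, D f k l \<omega>))"
  have Qm: "(\<lambda>\<omega>. (U i \<omega>, D f k l \<omega>)) \<in> measurable M ?X" by (intro measurable_Pair U_meas[OF ij(1)] Dm)
  have law: "distr M (?X \<Otimes>\<^sub>M SW) (\<lambda>\<omega>. ((U i \<omega>, D f k l \<omega>), (U j \<omega>, Vs i j \<omega>))) = Q \<Otimes>\<^sub>M PB"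
    using indep_blocks[OF AB disj \<phi>m \<psi>m] unfolding \<phi>W \<psi>W Q_def law_UV[OF ij ij(2)] .
  have pQ: "prob_space Q" unfolding Q_def by (rule prob_space_distr[OF Qm])
  interpret Q: prob_space Q by (rule pQ)
  interpret B: prob_space PB by (rule prob_PB)
  interpret QB: pair_prob_space Q PB ..
  let ?g = "\<lambda>p :: ('u \<times> real) \<times> ('u \<times> 'v). d3 f (fst (fst p)) (snd p) * snd (fst p)"
  have gm: "?g \<in> borel_measurable (?X \<Otimes>\<^sub>M SW)"
  proof -
    have "(\<lambda>p :: ('u \<times> real) \<times> ('u \<times> 'v). (fst (fst p), snd p)) \<in> measurable (?X \<Otimes>\<^sub>M SW) (SU \<Otimes>\<^sub>M SW)" by measurable
    from measurable_compose[OF this d3_measurable[OF f]]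
    have "(\<lambda>p :: ('u \<times> real) \<times> ('u \<times> 'v). d3 f (fst (fst p)) (snd p)) \<in> borel_measurable (?X \<Otimes>\<^sub>M SW)" by simp
    then show ?thesis by measurable
  qed
  have jm: "(\<lambda>\<omega>. ((U i \<omega>, D f k l \<omega>), (U j \<omega>, Vs i j \<omega>))) \<in> measurable M (?X \<Otimes>\<^sub>M SW)"
    by (intro measurable_Pair U_meas ij Dm Vs_meas)
  have pi: "integrable M (\<lambda>\<omega>. D f i j \<omega> * D f k l \<omega>)"
    by (intro product_integrable D_square_integrable f ij kl)
  have gi: "integrable (Q \<Otimes>\<^sub>M PB) ?g"
    unfolding law[symmetric] by (subst integrable_distr_eq[OF jm gm]) (use pi in \<open>simp add: D_d3\<close>)
  have "(\<integral>\<omega>. D f i j \<omega> * D f k l \<omega> \<partial>M) = (\<integral>p. ?g p \<partial>(Q \<Otimes>\<^sub>M PB))"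
    unfolding law[symmetric] by (subst integral_distr[OF jm gm]) (simp add: D_d3)
  also have "\<dots> = (\<integral>x. (\<integral>b. ?g (x, b) \<partial>PB) \<partial>Q)" by (rule QB.integral_fst'[OF gi, symmetric])
  also have "\<dots> = (\<integral>x. 0 \<partial>Q)" by (simp add: d3_mean_zero[OF f])
  finally show ?thesis by simp
qed

definition CD :: "('z \<Rightarrow> real) \<Rightarrow> real" where
  "CD f = (\<integral>p. (d3 f (fst p) (snd p))\<^sup>2 \<partial>(PU \<Otimes>\<^sub>M PB))"

lemma CD_nonneg: "0 \<le> CD f" unfolding CD_def by (rule Bochner_Integration.integral_nonneg) simp

lemma D_second_moment:
  assumes f: "f \<in> L2Z" and ij: "1 \<le> i" "1 \<le> j" "i \<noteq> j"
  shows "(\<integral>\<omega>. (D f i j \<omega>)\<^sup>2 \<partial>M) = CD f"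
proof -
  have m: "(\<lambda>p. (d3 f (fst p) (snd p))\<^sup>2) \<in> borel_measurable (SU \<Otimes>\<^sub>M SW)" using d3_measurable[OF f] by measurable
  show ?thesis
    unfolding CD_def law_UUV[OF ij, symmetric] by (subst integral_distr[OF UUV_meas[OF ij] m]) (simp add: D_d3)
qed

text \<open>Two different pairs share at most one node, so each has a node of its own and all mixed
  terms vanish.\<close>

lemma sum_D_second_moment:
  assumes f: "f \<in> L2Z"
  shows "integrable M (\<lambda>\<omega>. (\<Sum>(i, j)\<in>pairs_upto n. D f i j \<omega>)\<^sup>2)"
    "(\<integral>\<omega>. (\<Sum>(i, j)\<in>pairs_upto n. D f i j \<omega>)\<^sup>2 \<partial>M) = card (pairs_upto n) * CD f"
proof -
  have p: "1 \<le> fst e" "1 \<le> snd e" "fst e < snd e" if "e \<in> pairs_upto n" for e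
    using that unfolding pairs_upto_def by auto
  define d where "d = (\<lambda>e. D f (fst e) (snd e))"
  have dm: "d e \<in> borel_measurable M" "integrable M (\<lambda>\<omega>. (d e \<omega>)\<^sup>2)" if "e \<in> pairs_upto n" for e
    unfolding d_def using p[OF that] by (intro D_square_integrable f; simp)+
  have orth: "(\<integral>\<omega>. d e \<omega> * d e' \<omega> \<partial>M) = 0" if e: "e \<in> pairs_upto n" "e' \<in> pairs_upto n" "e \<noteq> e'" for e e'
  proof (cases "snd e \<noteq> fst e' \<and> snd e \<noteq> snd e'")
    case True
    then show ?thesis unfolding d_def using p[OF e(1)] p[OF e(2)] by (intro D_orthogonal f) simp_all
  next
    case False
    \<comment> \<open>The larger node of \<open>e\<close> is shared, so the smaller one is private;
      the symmetry of \<open>D\<close> lets it play the role of \<open>j\<close>.\<close>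
    then have q: "fst e \<noteq> fst e'" "fst e \<noteq> snd e'" using p[OF e(1)] p[OF e(2)] e(3) by (auto simp: prod_eq_iff)
    have "(\<integral>\<omega>. d e \<omega> * d e' \<omega> \<partial>M) = (\<integral>\<omega>. D f (snd e) (fst e) \<omega> * D f (fst e') (snd e') \<omega> \<partial>M)"
      unfolding d_def using p[OF e(1)] by (intro Bochner_Integration.integral_cong refl arg_cong2[where f="(*)"] D_sym) simp_all
    also have "\<dots> = 0" using p[OF e(1)] p[OF e(2)] q by (intro D_orthogonal f) simp_all
    finally show ?thesis .
  qed
  have eq: "(\<Sum>(i, j)\<in>pairs_upto n. D f i j \<omega>) = (\<Sum>e\<in>pairs_upto n. d e \<omega>)" for \<omega>
    unfolding d_def by (simp add: case_prod_beta)
  show "integrable M (\<lambda>\<omega>. (\<Sum>(i, j)\<in>pairs_upto n. D f i j \<omega>)\<^sup>2)"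
    unfolding eq by (rule square_integrable_sum[OF pairs_upto_finite dm])
  have i2: "integrable M (\<lambda>\<omega>. d e \<omega> * d e' \<omega>)" if "e \<in> pairs_upto n" "e' \<in> pairs_upto n" for e e'
    by (intro product_integrable dm that)
  have "(\<integral>\<omega>. (\<Sum>e\<in>pairs_upto n. d e \<omega>)\<^sup>2 \<partial>M) = (\<integral>\<omega>. (\<Sum>e\<in>pairs_upto n. \<Sum>e'\<in>pairs_upto n. d e \<omega> * d e' \<omega>) \<partial>M)"
    by (simp add: power2_eq_square sum_product)
  also have "\<dots> = (\<Sum>e\<in>pairs_upto n. \<Sum>e'\<in>pairs_upto n. \<integral>\<omega>. d e \<omega> * d e' \<omega> \<partial>M)"
    using i2 by (subst Bochner_Integration.integral_sum) (simp_all add: Bochner_Integration.integral_sum)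
  also have "\<dots> = (\<Sum>e\<in>pairs_upto n. \<Sum>e'\<in>pairs_upto n. if e' = e then CD f else 0)"
  proof (intro sum.cong refl)
    fix e e' assume e: "e \<in> pairs_upto n" "e' \<in> pairs_upto n"
    show "(\<integral>\<omega>. d e \<omega> * d e' \<omega> \<partial>M) = (if e' = e then CD f else 0)"
    proof (cases "e' = e")
      case True
      then show ?thesis unfolding d_def using D_second_moment[OF f, of "fst e" "snd e"] p[OF e(1)] by (simp add: power2_eq_square)
    qed (use orth[OF e] in auto)
  qed
  also have "\<dots> = card (pairs_upto n) * CD f" by (simp add: pairs_upto_finite)
  finally show "(\<integral>\<omega>. (\<Sum>(i, j)\<in>pairs_upto n. D f i j \<omega>)\<^sup>2 \<partial>M) = card (pairs_upto n) * CD f" unfolding eq .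
qed

end

subsection \<open>Finite-dimensional limits of the dyadic process\<close>

lemma integral_sum_sum:
  fixes a :: "'i \<Rightarrow> 'j \<Rightarrow> 'x \<Rightarrow> real"
  assumes "\<And>i j. i \<in> I \<Longrightarrow> j \<in> J \<Longrightarrow> integrable N (a i j)"
  shows "(\<integral>x. (\<Sum>i\<in>I. \<Sum>j\<in>J. a i j x) \<partial>N) = (\<Sum>i\<in>I. \<Sum>j\<in>J. \<integral>x. a i j x \<partial>N)"
proof -
  have "(\<integral>x. (\<Sum>i\<in>I. \<Sum>j\<in>J. a i j x) \<partial>N) = (\<Sum>i\<in>I. \<integral>x. (\<Sum>j\<in>J. a i j x) \<partial>N)"
    by (rule Bochner_Integration.integral_sum) (intro Bochner_Integration.integrable_sum assms)
  also have "\<dots> = (\<Sum>i\<in>I. \<Sum>j\<in>J. \<integral>x. a i j x \<partial>N)"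
    by (intro sum.cong refl Bochner_Integration.integral_sum assms)
  finally show ?thesis .
qed

lemma (in prob_space) expectation_cos_diff_le:
  fixes f g w :: "'a \<Rightarrow> real"
  assumes [measurable]: "f \<in> borel_measurable M" "g \<in> borel_measurable M" and w: "integrable M w"
    and le: "\<And>\<omega>. \<omega> \<in> space M \<Longrightarrow> \<bar>f \<omega> - g \<omega>\<bar> \<le> w \<omega>"
  shows "\<bar>expectation (\<lambda>\<omega>. cos (f \<omega>)) - expectation (\<lambda>\<omega>. cos (g \<omega>))\<bar> \<le> expectation w"
    and "\<bar>expectation (\<lambda>\<omega>. sin (f \<omega>)) - expectation (\<lambda>\<omega>. sin (g \<omega>))\<bar> \<le> expectation w"
proof -
  have gen: "\<bar>expectation (\<lambda>\<omega>. F (f \<omega>)) - expectation (\<lambda>\<omega>. F (g \<omega>))\<bar> \<le> expectation w"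
    if [measurable]: "F \<in> borel_measurable borel" and b: "\<And>x. \<bar>F x\<bar> \<le> 1" and l: "\<And>x y. \<bar>F x - F y\<bar> \<le> \<bar>x - y\<bar>" for F :: "real \<Rightarrow> real"
  proof -
    have i: "integrable M (\<lambda>\<omega>. F (f \<omega>))" "integrable M (\<lambda>\<omega>. F (g \<omega>))"
      by (rule integrable_const_bound[where B=1]; simp add: b)+
    have "\<bar>expectation (\<lambda>\<omega>. F (f \<omega>)) - expectation (\<lambda>\<omega>. F (g \<omega>))\<bar> = \<bar>expectation (\<lambda>\<omega>. F (f \<omega>) - F (g \<omega>))\<bar>"
      using i by simp
    also have "\<dots> \<le> expectation (\<lambda>\<omega>. \<bar>F (f \<omega>) - F (g \<omega>)\<bar>)" by (rule integral_abs_bound)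
    also have "\<dots> \<le> expectation w"
      by (rule integral_mono[OF _ w]) (use i in simp, rule order_trans[OF l le])
    finally show ?thesis .
  qed
  show "\<bar>expectation (\<lambda>\<omega>. cos (f \<omega>)) - expectation (\<lambda>\<omega>. cos (g \<omega>))\<bar> \<le> expectation w"
    by (rule gen) (simp_all add: abs_cos_diff_le)
  have "\<bar>sin x - sin y\<bar> \<le> \<bar>x - y\<bar>" for x y :: real
    using abs_cos_diff_le[of "pi/2 - x" "pi/2 - y"] by (simp add: cos_diff abs_minus_commute)
  then show "\<bar>expectation (\<lambda>\<omega>. sin (f \<omega>)) - expectation (\<lambda>\<omega>. sin (g \<omega>))\<bar> \<le> expectation w"
    by (intro gen) simp_all
qed

context dyadic
begin

definition Xp :: "nat \<Rightarrow> 'w \<Rightarrow> ('z \<Rightarrow> real) \<Rightarrow> real" where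
  "Xp n \<omega> f = sqrt (real n) * (dyadic_mean (dyad_obs U V \<tau>) n f \<omega> - pop_mean M (dyad_obs U V \<tau>) f)"

definition Rn :: "nat \<Rightarrow> ('z \<Rightarrow> real) \<Rightarrow> 'w \<Rightarrow> real" where
  "Rn n f \<omega> = sqrt (real n) / (real n * (real n - 1) / 2) * (\<Sum>(i, j)\<in>pairs_upto n. D f i j \<omega>)"

lemma pop_mean_eq: "f \<in> L2Z \<Longrightarrow> pop_mean M (dyad_obs U V \<tau>) f = mf f"
  unfolding pop_mean_def using fZ_facts(4)[of f 1 2] by (simp add: Zs_eq_dyad_obs[symmetric])

lemma dyadic_mean_eq:
  "dyadic_mean (dyad_obs U V \<tau>) n f \<omega> = (\<Sum>(i, j)\<in>pairs_upto n. f (Zs i j \<omega>)) / (real n * (real n - 1) / 2)"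
proof -
  have "(\<Sum>(i, j)\<in>pairs_upto n. f (dyad_obs U V \<tau> i j \<omega>)) = (\<Sum>(i, j)\<in>pairs_upto n. f (Zs i j \<omega>))"
    by (intro sum.cong refl) (auto simp: pairs_upto_def Zs_eq_dyad_obs)
  then show ?thesis unfolding dyadic_mean_def pairs_upto_def by simp
qed

lemma hoeffding:
  assumes f: "f \<in> L2Z" and n: "2 \<le> n"
  shows "Xp n \<omega> f = 2 / sqrt n * (\<Sum>a=1..n. h f (U a \<omega>)) + Rn n f \<omega>"
proof -
  define N where "N = real n * (real n - 1) / 2"
  have np: "0 < real n" "0 < real n - 1" using n by simp_all
  then have N: "0 < N" unfolding N_def by simp
  have "(\<Sum>(i, j)\<in>pairs_upto n. f (Zs i j \<omega>)) = (\<Sum>(i, j)\<in>pairs_upto n. mf f + (h f (U i \<omega>) + h f (U j \<omega>)) + D f i j \<omega>)"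
    by (intro sum.cong refl) (auto simp: D_def)
  also have "\<dots> = card (pairs_upto n) * mf f + (\<Sum>(i, j)\<in>pairs_upto n. h f (U i \<omega>) + h f (U j \<omega>)) + (\<Sum>(i, j)\<in>pairs_upto n. D f i j \<omega>)"
    by (simp add: case_prod_beta sum.distrib)
  also have "(\<Sum>(i, j)\<in>pairs_upto n. h f (U i \<omega>) + h f (U j \<omega>)) = (real n - 1) * (\<Sum>a=1..n. h f (U a \<omega>))"
    by (rule sum_pairs_upto)
  also have "real (card (pairs_upto n)) = N" unfolding card_pairs_upto N_def ..
  finally have s: "(\<Sum>(i, j)\<in>pairs_upto n. f (Zs i j \<omega>)) / N - mf f = (real n - 1) / N * (\<Sum>a=1..n. h f (U a \<omega>)) + (\<Sum>(i, j)\<in>pairs_upto n. D f i j \<omega>) / N"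
    using N by (simp add: add_divide_distrib)
  \<comment> \<open>Each node lies in \<open>n - 1\<close> of the \<open>N\<close> dyads; the
    resulting factor 2 is the origin of the 4 in the limiting covariance.\<close>
  have k: "sqrt n * ((real n - 1) / N) = 2 / sqrt n"
  proof -
    have "(real n - 1) / N = 2 / real n" unfolding N_def using np by (simp add: field_simps)
    then have "sqrt n * ((real n - 1) / N) = 2 * (sqrt n / real n)" by simp
    also have "sqrt n / real n = 1 / sqrt n" using np by (simp add: field_simps)
    finally show ?thesis by simp
  qed
  have "sqrt n * ((real n - 1) / N * X + Y / N) = 2 / sqrt n * X + sqrt n / N * Y" for X Y
    unfolding distrib_left k[symmetric] by (simp only: mult.assoc times_divide_eq_left times_divide_eq_right)
  then show ?thesis
    unfolding Xp_def dyadic_mean_eq pop_mean_eq[OF f] N_def[symmetric] Rn_def s .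
qed

lemma D_sum_measurable:
  assumes f: "f \<in> L2Z" shows "(\<lambda>\<omega>. \<Sum>(i, j)\<in>pairs_upto n. D f i j \<omega>) \<in> borel_measurable M"
proof (rule borel_measurable_sum)
  fix e assume "e \<in> pairs_upto n"
  then show "(\<lambda>\<omega>. case e of (i, j) \<Rightarrow> D f i j \<omega>) \<in> borel_measurable M"
    using D_square_integrable(1)[OF f, of "fst e" "snd e"] by (auto simp: pairs_upto_def)
qed

text \<open>The terms are uncorrelated, so the second moment is \<open>n / N\<^sup>2\<close> times
  \<open>N * CD f\<close>. The bound on the first absolute moment is what the comparison of
  characteristic functions uses.\<close>

lemma Rn_facts:
  assumes f: "f \<in> L2Z" and n: "2 \<le> n"
  shows "Rn n f \<in> borel_measurable M" "integrable M (\<lambda>\<omega>. (Rn n f \<omega>)\<^sup>2)" "(\<integral>\<omega>. (Rn n f \<omega>)\<^sup>2 \<partial>M) = 2 * CD f / (real n - 1)"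
    "integrable M (\<lambda>\<omega>. \<bar>Rn n f \<omega>\<bar>)" "(\<integral>\<omega>. \<bar>Rn n f \<omega>\<bar> \<partial>M) \<le> sqrt (2 * CD f / (real n - 1))"
proof -
  define N where "N = real n * (real n - 1) / 2"
  have np: "0 < real n" "0 < real n - 1" using n by simp_all
  then have N: "0 < N" unfolding N_def by simp
  note S = sum_D_second_moment[OF f, of n]
  show m: "Rn n f \<in> borel_measurable M" unfolding Rn_def[abs_def] using D_sum_measurable[OF f] by measurable
  show i2: "integrable M (\<lambda>\<omega>. (Rn n f \<omega>)\<^sup>2)" unfolding Rn_def by (rule square_integrable_cmult[OF S(1)])
  have "(\<integral>\<omega>. (Rn n f \<omega>)\<^sup>2 \<partial>M) = (sqrt n / N)\<^sup>2 * (N * CD f)"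
    unfolding Rn_def N_def[symmetric] power_mult_distrib using S by (simp add: card_pairs_upto N_def[symmetric])
  also have "\<dots> = real n / N * CD f" using N np by (simp add: power_divide power2_eq_square)
  also have "real n / N = 2 / (real n - 1)" unfolding N_def using np by (simp add: field_simps)
  finally show e: "(\<integral>\<omega>. (Rn n f \<omega>)\<^sup>2 \<partial>M) = 2 * CD f / (real n - 1)" by simp
  have am: "(\<lambda>\<omega>. \<bar>Rn n f \<omega>\<bar>) \<in> borel_measurable M" "integrable M (\<lambda>\<omega>. \<bar>Rn n f \<omega>\<bar>\<^sup>2)" using m i2 by simp_all
  show "integrable M (\<lambda>\<omega>. \<bar>Rn n f \<omega>\<bar>)" by (rule integrable_of_square(1)[OF am])
  have "(\<integral>\<omega>. \<bar>Rn n f \<omega>\<bar> \<partial>M)\<^sup>2 \<le> 2 * CD f / (real n - 1)" using integrable_of_square(2)[OF am] e by simp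
  then show "(\<integral>\<omega>. \<bar>Rn n f \<omega>\<bar> \<partial>M) \<le> sqrt (2 * CD f / (real n - 1))" by (rule real_le_rsqrt)
qed

lemma hU_orthogonal:
  assumes f: "f \<in> L2Z" and ab: "1 \<le> a" "1 \<le> b" "a \<noteq> b"
  shows "(\<integral>\<omega>. h f (U a \<omega>) * h f (U b \<omega>) \<partial>M) = 0"
proof -
  have ind: "indep_var borel (\<lambda>\<omega>. h f (fst (WA {Inl a} \<omega> (Inl a)))) borel (\<lambda>\<omega>. h f (fst (WA {Inl b} \<omega> (Inl b))))"
  proof -
    have hm: "h f \<in> borel_measurable SU" using h_facts(1)[OF f] by (simp cong: measurable_cong_sets add: sets_PU)
    have m: "(\<lambda>x. h f (fst (x (Inl c)))) \<in> borel_measurable (PiM {Inl c} (\<lambda>_. SW))" for c :: nat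
      by (rule measurable_compose[OF comp_meas(1) hm]) simp
    have "indep_var (PiM {Inl a} (\<lambda>_. SW)) (WA {Inl a}) (PiM {Inl b} (\<lambda>_. SW)) (WA {Inl b})"
      unfolding WA_def[abs_def] by (rule indep_var_restrict[OF Wv_indep]) (use ab in auto)
    from indep_var_compose[OF this m m] show ?thesis by (simp add: comp_def)
  qed
  have i: "integrable M (\<lambda>\<omega>. h f (U c \<omega>))" if "1 \<le> c" for c
    by (rule integrable_of_square(1)[OF hU_facts(1,2)[OF f that]])
  show ?thesis
    using indep_var_lebesgue_integral[OF ind] i[OF ab(1)] i[OF ab(2)] hU_facts(3)[OF f ab(1)]
    by (simp add: WA_def Wv_simps)
qed

lemma linear_part_second_moment:
  assumes f: "f \<in> L2Z" and n: "1 \<le> n"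
  shows "integrable M (\<lambda>\<omega>. (2 / sqrt n * (\<Sum>a=1..n. h f (U a \<omega>)))\<^sup>2)"
    "(\<integral>\<omega>. (2 / sqrt n * (\<Sum>a=1..n. h f (U a \<omega>)))\<^sup>2 \<partial>M) = 4 * (\<integral>u. (h f u)\<^sup>2 \<partial>PU)"
proof -
  have hm: "(\<lambda>\<omega>. h f (U a \<omega>)) \<in> borel_measurable M" "integrable M (\<lambda>\<omega>. (h f (U a \<omega>))\<^sup>2)" if "a \<in> {1..n}" for a
    using hU_facts(1,2)[OF f, of a] that by simp_all
  have i2: "integrable M (\<lambda>\<omega>. h f (U a \<omega>) * h f (U b \<omega>))" if "a \<in> {1..n}" "b \<in> {1..n}" for a b
    by (intro product_integrable hm that)
  show "integrable M (\<lambda>\<omega>. (2 / sqrt n * (\<Sum>a=1..n. h f (U a \<omega>)))\<^sup>2)"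
    by (rule square_integrable_cmult, rule square_integrable_sum) (use hm in simp_all)
  have "(\<integral>\<omega>. (\<Sum>a=1..n. h f (U a \<omega>))\<^sup>2 \<partial>M) = (\<integral>\<omega>. (\<Sum>a=1..n. \<Sum>b=1..n. h f (U a \<omega>) * h f (U b \<omega>)) \<partial>M)"
    by (simp add: power2_eq_square sum_product)
  also have "\<dots> = (\<Sum>a=1..n. \<Sum>b=1..n. \<integral>\<omega>. h f (U a \<omega>) * h f (U b \<omega>) \<partial>M)"
    by (rule integral_sum_sum) (rule i2)
  also have "\<dots> = (\<Sum>a=1..n. \<Sum>b=1..n. if b = a then (\<integral>u. (h f u)\<^sup>2 \<partial>PU) else 0)"
  proof (intro sum.cong refl)
    fix a b assume "a \<in> {1..n}" "b \<in> {1..n}"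
    then show "(\<integral>\<omega>. h f (U a \<omega>) * h f (U b \<omega>) \<partial>M) = (if b = a then (\<integral>u. (h f u)\<^sup>2 \<partial>PU) else 0)"
      using hU_orthogonal[OF f, of a b] hU_facts(4)[OF f, of a] by (simp add: power2_eq_square)
  qed
  also have "\<dots> = real n * (\<integral>u. (h f u)\<^sup>2 \<partial>PU)" by simp
  finally show "(\<integral>\<omega>. (2 / sqrt n * (\<Sum>a=1..n. h f (U a \<omega>)))\<^sup>2 \<partial>M) = 4 * (\<integral>u. (h f u)\<^sup>2 \<partial>PU)"
    using n by (simp add: power_mult_distrib power_divide)
qed

lemma Xp_measurable: "f \<in> borel_measurable S \<Longrightarrow> (\<lambda>\<omega>. Xp n \<omega> f) \<in> borel_measurable M"
proof -
  assume f: "f \<in> borel_measurable S"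
  have "(\<lambda>\<omega>. \<Sum>(i, j)\<in>pairs_upto n. f (Zs i j \<omega>)) \<in> borel_measurable M"
  proof (rule borel_measurable_sum)
    fix e assume "e \<in> pairs_upto n"
    then show "(\<lambda>\<omega>. case e of (i, j) \<Rightarrow> f (Zs i j \<omega>)) \<in> borel_measurable M"
      using measurable_compose[OF Zs_meas f, of "fst e" "snd e"] by (auto simp: pairs_upto_def)
  qed
  then show ?thesis unfolding Xp_def dyadic_mean_eq by measurable
qed

text \<open>Boundedness is what the Chebyshev bound in \<open>weak_convergence_finite_dim\<close>
  asks for.\<close>

lemma Xp_second_moment:
  assumes f: "f \<in> L2Z"
  shows "\<exists>B. eventually (\<lambda>n. integrable M (\<lambda>\<omega>. (Xp n \<omega> f)\<^sup>2) \<and> (\<integral>\<omega>. (Xp n \<omega> f)\<^sup>2 \<partial>M) \<le> B) sequentially"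
proof (intro exI eventually_sequentiallyI[of 2] conjI)
  fix n :: nat assume n: "2 \<le> n"
  let ?L = "\<lambda>\<omega>. 2 / sqrt n * (\<Sum>a=1..n. h f (U a \<omega>))"
  note L = linear_part_second_moment[OF f, of n] and R = Rn_facts[OF f n]
  have Lm: "?L \<in> borel_measurable M" using hU_facts(1)[OF f] by (intro borel_measurable_times borel_measurable_sum) simp_all
  show i: "integrable M (\<lambda>\<omega>. (Xp n \<omega> f)\<^sup>2)"
    unfolding hoeffding[OF f n] by (rule square_integrable_add[OF Lm R(1) L(1) R(2)]) (use n in simp)
  have "(\<integral>\<omega>. (Xp n \<omega> f)\<^sup>2 \<partial>M) \<le> (\<integral>\<omega>. 2 * (?L \<omega>)\<^sup>2 + 2 * (Rn n f \<omega>)\<^sup>2 \<partial>M)"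
  proof (rule integral_mono[OF i])
    show "integrable M (\<lambda>\<omega>. 2 * (?L \<omega>)\<^sup>2 + 2 * (Rn n f \<omega>)\<^sup>2)" using L(1) R(2) n by simp
    fix \<omega>
    have "0 \<le> (?L \<omega> - Rn n f \<omega>)\<^sup>2" by simp
    then show "(Xp n \<omega> f)\<^sup>2 \<le> 2 * (?L \<omega>)\<^sup>2 + 2 * (Rn n f \<omega>)\<^sup>2"
      unfolding hoeffding[OF f n] power2_sum power2_diff by linarith
  qed
  also have "\<dots> = 2 * (\<integral>\<omega>. (?L \<omega>)\<^sup>2 \<partial>M) + 2 * (\<integral>\<omega>. (Rn n f \<omega>)\<^sup>2 \<partial>M)"
    using L(1) R(2) n by (subst Bochner_Integration.integral_add) simp_all
  also have "\<dots> = 2 * (4 * (\<integral>u. (h f u)\<^sup>2 \<partial>PU)) + 2 * (2 * CD f / (real n - 1))"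
    using L(2) R(3) n by simp
  also have "\<dots> \<le> 2 * (4 * (\<integral>u. (h f u)\<^sup>2 \<partial>PU)) + 2 * (2 * CD f / 1)"
    using CD_nonneg[of f] n by (intro add_left_mono mult_left_mono divide_left_mono) simp_all
  finally show "(\<integral>\<omega>. (Xp n \<omega> f)\<^sup>2 \<partial>M) \<le> 2 * (4 * (\<integral>u. (h f u)\<^sup>2 \<partial>PU)) + 2 * (2 * CD f / 1)" .
qed

text \<open>The classical theorem needs positive variance; with variance 0 the summands vanish
  almost surely and both sequences are constant.\<close>

lemma clt_linear:
  assumes Hm: "H \<in> borel_measurable PU" and H2: "integrable PU (\<lambda>u. (H u)\<^sup>2)" and H0: "(\<integral>u. H u \<partial>PU) = 0"
  shows "(\<lambda>n. \<integral>\<omega>. cos (2 / sqrt n * (\<Sum>a=1..n. H (U a \<omega>))) \<partial>M) \<longlonglongrightarrow> exp (- (4 * (\<integral>u. (H u)\<^sup>2 \<partial>PU)) / 2)"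
    and "(\<lambda>n. \<integral>\<omega>. sin (2 / sqrt n * (\<Sum>a=1..n. H (U a \<omega>))) \<partial>M) \<longlonglongrightarrow> 0"
proof -
  define v where "v = (\<integral>u. (H u)\<^sup>2 \<partial>PU)"
  have v: "0 \<le> v" unfolding v_def by (rule Bochner_Integration.integral_nonneg) simp
  have HmS: "H \<in> borel_measurable SU" using Hm by (simp cong: measurable_cong_sets add: sets_PU)
  \<comment> \<open>Node indices start at 1, the sequence for the central limit theorem at
    0.\<close>
  define Y where "Y = (\<lambda>a \<omega>. H (U (Suc a) \<omega>))"
  have Ym: "Y a \<in> borel_measurable M" for a unfolding Y_def by (rule measurable_compose[OF U_meas HmS]) simp
  have law: "distr M SU (U (Suc a)) = PU" for a unfolding PU_def by (rule U_law) simp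
  have sumY: "(\<Sum>a=1..n. H (U a \<omega>)) = (\<Sum>a<n. Y a \<omega>)" for n \<omega>
    unfolding Y_def by (rule sum.reindex_bij_witness[of _ Suc "\<lambda>a. a - 1"]) auto
  have Lm[measurable]: "(\<lambda>\<omega>. 2 / sqrt n * (\<Sum>a<n. Y a \<omega>)) \<in> borel_measurable M" for n :: nat
    by (intro borel_measurable_times borel_measurable_sum Ym) simp
  have "(\<lambda>n. Complex (\<integral>\<omega>. cos (2 / sqrt n * (\<Sum>a<n. Y a \<omega>)) \<partial>M) (\<integral>\<omega>. sin (2 / sqrt n * (\<Sum>a<n. Y a \<omega>)) \<partial>M)) \<longlonglongrightarrow> complex_of_real (exp (- (4 * v) / 2))"
  proof (cases "v = 0")
    case True
    have "AE u in PU. (H u)\<^sup>2 = 0"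
      using integral_nonneg_eq_0_iff_AE[OF H2] True unfolding v_def by simp
    then have "AE u in distr M SU (U (Suc a)). H u = 0" for a unfolding law by eventually_elim simp
    then have Y0: "AE \<omega> in M. Y a \<omega> = 0" for a unfolding Y_def by (rule AE_distrD[OF U_meas, rotated]) simp
    have "AE \<omega> in M. \<forall>a. Y a \<omega> = 0" using Y0 by (simp add: AE_all_countable)
    then have s0: "AE \<omega> in M. 2 / sqrt n * (\<Sum>a<n. Y a \<omega>) = 0" for n :: nat by eventually_elim simp
    have "(\<integral>\<omega>. cos (2 / sqrt n * (\<Sum>a<n. Y a \<omega>)) \<partial>M) = (\<integral>\<omega>. cos 0 \<partial>M)" for n :: nat
    proof (rule integral_cong_AE)
      show "AE \<omega> in M. cos (2 / sqrt n * (\<Sum>a<n. Y a \<omega>)) = cos 0" using s0[of n] by eventually_elim (simp only:)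
    qed measurable
    moreover have "(\<integral>\<omega>. sin (2 / sqrt n * (\<Sum>a<n. Y a \<omega>)) \<partial>M) = (\<integral>\<omega>. sin 0 \<partial>M)" for n :: nat
    proof (rule integral_cong_AE)
      show "AE \<omega> in M. sin (2 / sqrt n * (\<Sum>a<n. Y a \<omega>)) = sin 0" using s0[of n] by eventually_elim (simp only:)
    qed measurable
    ultimately show ?thesis using True by (simp add: prob_space complex_of_real_def)
  next
    case False
    define \<sigma> where "\<sigma> = sqrt v"
    have \<sigma>: "0 < \<sigma>" "\<sigma>\<^sup>2 = v" unfolding \<sigma>_def using False v by simp_all
    have Yi: "integrable M (\<lambda>\<omega>. (Y a \<omega>)\<^sup>2)" "(\<integral>\<omega>. (Y a \<omega>)\<^sup>2 \<partial>M) = v" "expectation (Y a) = 0" for a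
    proof -
      have U: "U (Suc a) \<in> measurable M SU" by (rule U_meas) simp
      have H2m: "(\<lambda>u. (H u)\<^sup>2) \<in> borel_measurable SU" using HmS by measurable
      show "integrable M (\<lambda>\<omega>. (Y a \<omega>)\<^sup>2)"
        unfolding Y_def by (rule integrable_distr[OF U, where f="\<lambda>u. (H u)\<^sup>2"]) (simp add: law H2)
      show "(\<integral>\<omega>. (Y a \<omega>)\<^sup>2 \<partial>M) = v" unfolding Y_def v_def using integral_distr[OF U H2m] by (simp add: law)
      show "expectation (Y a) = 0" unfolding Y_def using integral_distr[OF U HmS] by (simp add: law H0)
    qed
    have ind: "indep_vars (\<lambda>_. borel) Y UNIV"
    proof -
      have "indep_vars (\<lambda>a::nat. PiM {Inl (Suc a)} (\<lambda>_. SW)) (\<lambda>a \<omega>. restrict (\<lambda>k. Wv k \<omega>) {Inl (Suc a)}) UNIV"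
        by (rule indep_vars_restrict[OF Wv_indep]) (auto simp: disjoint_family_on_def)
      then have "indep_vars (\<lambda>_. borel) (\<lambda>a \<omega>. H (fst (restrict (\<lambda>k. Wv k \<omega>) {Inl (Suc a)} (Inl (Suc a))))) (UNIV :: nat set)"
        by (rule indep_vars_compose2[where Y="\<lambda>a x. H (fst (x (Inl (Suc a))))"])
          (rule measurable_compose[OF comp_meas(1) HmS], simp)
      then show ?thesis by (simp add: Wv_simps Y_def[abs_def])
    qed
    have dist: "distr M borel (Y a) = distr PU borel H" for a
      unfolding Y_def law[of a, symmetric] using HmS by (subst distr_distr) (simp_all add: U_meas comp_def)
    have var: "variance (Y a) = \<sigma>\<^sup>2" for a using Yi[of a] \<sigma> by simp
    have wc: "weak_conv_m (\<lambda>n. distr M borel (\<lambda>\<omega>. (\<Sum>a<n. Y a \<omega>) / sqrt (n * \<sigma>\<^sup>2))) std_normal_distribution"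
      by (rule central_limit_theorem_zero_mean[OF ind Yi(3) \<sigma>(1) Yi(1) var dist])
    have rd: "real_distribution (distr M borel (\<lambda>\<omega>. (\<Sum>a<n. Y a \<omega>) / sqrt (n * \<sigma>\<^sup>2)))" for n :: nat
      by (rule real_distribution_distr) (intro borel_measurable_divide borel_measurable_sum Ym borel_measurable_const)
    \<comment> \<open>The standardized sums are divided by \<open>\<sigma> * sqrt n\<close>, so the
      factor \<open>2 / sqrt n\<close> corresponds to evaluation at
      \<open>2 * \<sigma>\<close>.\<close>
    have "(\<lambda>n. char (distr M borel (\<lambda>\<omega>. (\<Sum>a<n. Y a \<omega>) / sqrt (n * \<sigma>\<^sup>2))) (2 * \<sigma>)) \<longlonglongrightarrow> char std_normal_distribution (2 * \<sigma>)"
      by (rule levy_continuity1[OF rd real_dist_normal_dist wc])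
    moreover have "char (distr M borel (\<lambda>\<omega>. (\<Sum>a<n. Y a \<omega>) / sqrt (n * \<sigma>\<^sup>2))) (2 * \<sigma>) =
      Complex (\<integral>\<omega>. cos (2 / sqrt n * (\<Sum>a<n. Y a \<omega>)) \<partial>M) (\<integral>\<omega>. sin (2 / sqrt n * (\<Sum>a<n. Y a \<omega>)) \<partial>M)" for n :: nat
    proof -
      have ym: "(\<lambda>\<omega>. (\<Sum>a<n. Y a \<omega>) / sqrt (n * \<sigma>\<^sup>2)) \<in> borel_measurable M"
        by (intro borel_measurable_divide borel_measurable_sum Ym borel_measurable_const)
      have "char (distr M borel (\<lambda>\<omega>. (\<Sum>a<n. Y a \<omega>) / sqrt (n * \<sigma>\<^sup>2))) (2 * \<sigma>) = (\<integral>\<omega>. iexp (2 * \<sigma> * ((\<Sum>a<n. Y a \<omega>) / sqrt (n * \<sigma>\<^sup>2))) \<partial>M)"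
        unfolding char_def by (rule integral_distr[OF ym]) simp
      also have "\<dots> = (\<integral>\<omega>. iexp (2 / sqrt n * (\<Sum>a<n. Y a \<omega>)) \<partial>M)"
      proof (rule Bochner_Integration.integral_cong[OF refl])
        fix \<omega>
        have "sqrt (n * \<sigma>\<^sup>2) = sqrt n * \<sigma>" using \<sigma>(1) by (simp add: real_sqrt_mult)
        then have "2 * \<sigma> * ((\<Sum>a<n. Y a \<omega>) / sqrt (n * \<sigma>\<^sup>2)) = 2 / sqrt n * (\<Sum>a<n. Y a \<omega>)" using \<sigma>(1) by simp
        then show "iexp (2 * \<sigma> * ((\<Sum>a<n. Y a \<omega>) / sqrt (n * \<sigma>\<^sup>2))) = iexp (2 / sqrt n * (\<Sum>a<n. Y a \<omega>))" by (simp only:)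
      qed
      also have "\<dots> = Complex (\<integral>\<omega>. cos (2 / sqrt n * (\<Sum>a<n. Y a \<omega>)) \<partial>M) (\<integral>\<omega>. sin (2 / sqrt n * (\<Sum>a<n. Y a \<omega>)) \<partial>M)"
        by (rule integral_iexp[OF prob_space_axioms Lm])
      finally show ?thesis .
    qed
    moreover have "char std_normal_distribution (2 * \<sigma>) = complex_of_real (exp (- (4 * v) / 2))"
      unfolding char_std_normal_distribution using \<sigma> by (simp add: power_mult_distrib)
    ultimately show ?thesis by simp
  qed
  from tendsto_Re[OF this] tendsto_Im[OF this]
  show "(\<lambda>n. \<integral>\<omega>. cos (2 / sqrt n * (\<Sum>a=1..n. H (U a \<omega>))) \<partial>M) \<longlonglongrightarrow> exp (- (4 * (\<integral>u. (H u)\<^sup>2 \<partial>PU)) / 2)"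
    and "(\<lambda>n. \<integral>\<omega>. sin (2 / sqrt n * (\<Sum>a=1..n. H (U a \<omega>))) \<partial>M) \<longlonglongrightarrow> 0"
    unfolding sumY v_def by (simp_all only: complex.sel Re_complex_of_real Im_complex_of_real)
qed

definition Kov :: "('z \<Rightarrow> real) \<Rightarrow> ('z \<Rightarrow> real) \<Rightarrow> real" where
  "Kov f g = 4 * (\<integral>u. h f u * h g u \<partial>PU)"

text \<open>The quadratic form of \<open>Kov\<close> is the limiting variance of a linear
  combination, which yields positive semidefiniteness.\<close>

lemma Kov_quadratic:
  fixes f :: "nat \<Rightarrow> 'z \<Rightarrow> real"
  assumes f: "\<And>i. f i \<in> L2Z"
  shows "4 * (\<integral>u. (\<Sum>i<k. c i * h (f i) u)\<^sup>2 \<partial>PU) = (\<Sum>i<k. \<Sum>j<k. c i * c j * Kov (f i) (f j))"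
proof -
  have i: "integrable PU (\<lambda>u. h (f i) u * h (f j) u)" for i j
    by (intro product_integrable h_facts f)
  have "(\<integral>u. (\<Sum>i<k. c i * h (f i) u)\<^sup>2 \<partial>PU) = (\<integral>u. (\<Sum>i<k. \<Sum>j<k. c i * c j * (h (f i) u * h (f j) u)) \<partial>PU)"
    unfolding power2_eq_square sum_product by (intro Bochner_Integration.integral_cong refl sum.cong) simp
  also have "\<dots> = (\<Sum>i<k. \<Sum>j<k. c i * c j * (\<integral>u. h (f i) u * h (f j) u \<partial>PU))"
    by (subst integral_sum_sum) (simp_all add: i)
  finally show ?thesis unfolding Kov_def by (simp add: sum_distrib_left mult_ac)
qed

lemma Kov_psd: assumes f: "\<And>i. f i \<in> L2Z" shows "psd (\<lambda>i j. Kov (f i) (f j))"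
  unfolding psd_def
proof (intro conjI allI)
  show "Kov (f i) (f j) = Kov (f j) (f i)" for i j unfolding Kov_def by (simp add: mult.commute)
  show "0 \<le> (\<Sum>i<n. \<Sum>j<n. c i * c j * Kov (f i) (f j))" for n c
    unfolding Kov_quadratic[where f=f and k=n and c=c, OF f, symmetric] by (simp add: Bochner_Integration.integral_nonneg)
qed

text \<open>Cramer-Wold: a linear combination of the linear parts is again a sum over nodes, of the
  function \<open>H\<close>. The remainders change the expected cosine and sine by at most their
  weighted first absolute moments, which tend to 0.\<close>

lemma Xp_char:
  fixes f :: "nat \<Rightarrow> 'z \<Rightarrow> real"
  assumes f: "\<And>i. f i \<in> L2Z"
  shows "(\<lambda>n. \<integral>\<omega>. cos (\<Sum>i<k. c i * Xp n \<omega> (f i)) \<partial>M) \<longlonglongrightarrow> exp (- (\<Sum>i<k. \<Sum>j<k. c i * c j * Kov (f i) (f j)) / 2)"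
    and "(\<lambda>n. \<integral>\<omega>. sin (\<Sum>i<k. c i * Xp n \<omega> (f i)) \<partial>M) \<longlonglongrightarrow> 0"
proof -
  define H where "H = (\<lambda>u. \<Sum>i<k. c i * h (f i) u)"
  have Hm: "H \<in> borel_measurable PU" unfolding H_def
    by (intro borel_measurable_sum borel_measurable_times borel_measurable_const h_facts f)
  have H2: "integrable PU (\<lambda>u. (H u)\<^sup>2)" unfolding H_def
    by (intro square_integrable_sum square_integrable_cmult borel_measurable_times borel_measurable_const h_facts f finite_lessThan)
  have H0: "(\<integral>u. H u \<partial>PU) = 0"
  proof -
    have "(\<integral>u. H u \<partial>PU) = (\<Sum>i<k. \<integral>u. c i * h (f i) u \<partial>PU)"
      unfolding H_def by (rule Bochner_Integration.integral_sum) (intro integrable_mult_right h_facts f)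
    also have "\<dots> = 0" by (simp add: h_facts(4)[OF f])
    finally show ?thesis .
  qed
  have V: "4 * (\<integral>u. (H u)\<^sup>2 \<partial>PU) = (\<Sum>i<k. \<Sum>j<k. c i * c j * Kov (f i) (f j))"
    unfolding H_def by (rule Kov_quadratic[OF f])
  note clt = clt_linear[OF Hm H2 H0]
  have HmS: "H \<in> borel_measurable SU" using Hm by (simp cong: measurable_cong_sets add: sets_PU)
  define e where "e = (\<lambda>n::nat. \<Sum>i<k. \<bar>c i\<bar> * sqrt (2 * CD (f i) / (real n - 1)))"
  have e0: "e \<longlonglongrightarrow> 0"
  proof -
    have "(\<lambda>n::nat. \<bar>c i\<bar> * sqrt (2 * CD (f i) / (real n - 1))) \<longlonglongrightarrow> 0" for i
    proof -
      have "(\<lambda>n::nat. 2 * CD (f i) / (real n - 1)) \<longlonglongrightarrow> 0"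
        by (rule tendsto_divide_0[OF tendsto_const], rule filterlim_at_top_imp_at_infinity,
            rule filterlim_tendsto_add_at_top[OF tendsto_const[of "-1"], of real, simplified], rule filterlim_real_sequentially)
      from tendsto_real_sqrt[OF this] show ?thesis by (intro tendsto_mult_right_zero) simp
    qed
    then have "(\<lambda>n. \<Sum>i<k. \<bar>c i\<bar> * sqrt (2 * CD (f i) / (real n - 1))) \<longlonglongrightarrow> (\<Sum>i<k. 0)" by (rule tendsto_sum)
    then show ?thesis unfolding e_def by simp
  qed
  have close: "eventually (\<lambda>n. norm ((\<integral>\<omega>. F (\<Sum>i<k. c i * Xp n \<omega> (f i)) \<partial>M) - (\<integral>\<omega>. F (2 / sqrt n * (\<Sum>a=1..n. H (U a \<omega>))) \<partial>M)) \<le> e n) sequentially"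
    if F: "F = cos \<or> F = sin" for F :: "real \<Rightarrow> real"
    using eventually_ge_at_top[of "2::nat"]
  proof eventually_elim
    fix n :: nat assume n: "2 \<le> n"
    define A where "A = (\<lambda>\<omega>. \<Sum>i<k. c i * Xp n \<omega> (f i))"
    define L where "L = (\<lambda>\<omega>. 2 / sqrt n * (\<Sum>a=1..n. H (U a \<omega>)))"
    define w where "w = (\<lambda>\<omega>. \<Sum>i<k. \<bar>c i\<bar> * \<bar>Rn n (f i) \<omega>\<bar>)"
    have Am: "A \<in> borel_measurable M" unfolding A_def
      by (intro borel_measurable_sum borel_measurable_times borel_measurable_const Xp_measurable L2Z_facts(1) f)
    have Lm: "L \<in> borel_measurable M" unfolding L_def
      by (intro borel_measurable_sum borel_measurable_times borel_measurable_const measurable_compose[OF U_meas HmS]) simp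
    have wi: "integrable M w" unfolding w_def by (intro Bochner_Integration.integrable_sum integrable_mult_right Rn_facts(4) f n)
    have "A \<omega> - L \<omega> = (\<Sum>i<k. c i * Rn n (f i) \<omega>)" for \<omega>
    proof -
      have "L \<omega> = (\<Sum>i<k. c i * (2 / sqrt n * (\<Sum>a=1..n. h (f i) (U a \<omega>))))"
        unfolding L_def H_def by (subst sum.swap) (simp add: sum_distrib_left mult_ac)
      then show ?thesis unfolding A_def hoeffding[OF f n] by (simp add: distrib_left sum.distrib)
    qed
    then have le: "\<bar>A \<omega> - L \<omega>\<bar> \<le> w \<omega>" for \<omega> unfolding w_def abs_mult[symmetric] by (simp only: sum_abs)
    have we: "expectation w \<le> e n"
    proof -
      have "expectation w = (\<Sum>i<k. \<bar>c i\<bar> * (\<integral>\<omega>. \<bar>Rn n (f i) \<omega>\<bar> \<partial>M))"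
        unfolding w_def using Rn_facts(4)[OF f n] by (subst Bochner_Integration.integral_sum) simp_all
      also have "\<dots> \<le> e n" unfolding e_def by (intro sum_mono mult_left_mono Rn_facts(5) f n) simp
      finally show ?thesis .
    qed
    have "norm ((\<integral>\<omega>. F (A \<omega>) \<partial>M) - (\<integral>\<omega>. F (L \<omega>) \<partial>M)) \<le> expectation w"
      using F expectation_cos_diff_le[OF Am Lm wi le] unfolding real_norm_def by blast
    then show "norm ((\<integral>\<omega>. F (\<Sum>i<k. c i * Xp n \<omega> (f i)) \<partial>M) - (\<integral>\<omega>. F (2 / sqrt n * (\<Sum>a=1..n. H (U a \<omega>))) \<partial>M)) \<le> e n"
      using we unfolding A_def L_def by (rule order_trans)
  qed
  have lim: "(\<lambda>n. \<integral>\<omega>. F (\<Sum>i<k. c i * Xp n \<omega> (f i)) \<partial>M) \<longlonglongrightarrow> l"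
    if F: "F = cos \<or> F = sin" and l: "(\<lambda>n. \<integral>\<omega>. F (2 / sqrt n * (\<Sum>a=1..n. H (U a \<omega>))) \<partial>M) \<longlonglongrightarrow> l" for F l
    using tendsto_add[OF Lim_null_comparison[OF close[OF F] e0] l] by simp
  show "(\<lambda>n. \<integral>\<omega>. cos (\<Sum>i<k. c i * Xp n \<omega> (f i)) \<partial>M) \<longlonglongrightarrow> exp (- (\<Sum>i<k. \<Sum>j<k. c i * c j * Kov (f i) (f j)) / 2)"
    using lim[OF disjI1[OF refl] clt(1)] unfolding V .
  show "(\<lambda>n. \<integral>\<omega>. sin (\<Sum>i<k. c i * Xp n \<omega> (f i)) \<partial>M) \<longlonglongrightarrow> 0"
    by (rule lim[OF disjI2[OF refl] clt(2)])
qed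

end

subsection \<open>Entropy and conditional expectations\<close>

text \<open>\<open>ln (1 / \<epsilon>) \<le> 1 / \<epsilon>\<close> weakens the polynomial bound.
  The absolute values allow for negative \<open>v\<close> and for \<open>A < 1\<close>.\<close>

lemma powr_le_exp_inverse:
  fixes A v \<epsilon> :: real
  assumes "0 < A" "0 < \<epsilon>" "\<epsilon> \<le> 1"
  shows "(A / \<epsilon>) powr v \<le> exp (\<bar>v\<bar> * (\<bar>ln A\<bar> + 1) / \<epsilon>)"
proof -
  have e: "ln (1 / \<epsilon>) \<le> 1 / \<epsilon>" using ln_le_minus_one[of "1 / \<epsilon>"] assms by simp
  have e0: "0 \<le> ln (1 / \<epsilon>)" using assms by simp
  have "ln (A / \<epsilon>) = ln A + ln (1 / \<epsilon>)" using assms by (simp add: ln_div)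
  then have "\<bar>ln (A / \<epsilon>)\<bar> \<le> \<bar>ln A\<bar> + 1 / \<epsilon>" using e e0 by linarith
  also have "\<bar>ln A\<bar> \<le> \<bar>ln A\<bar> / \<epsilon>" using assms mult_left_mono[of 1 "1 / \<epsilon>" "\<bar>ln A\<bar>"] by simp
  finally have l: "\<bar>ln (A / \<epsilon>)\<bar> \<le> (\<bar>ln A\<bar> + 1) / \<epsilon>" by (simp add: add_divide_distrib)
  have "v * ln (A / \<epsilon>) \<le> \<bar>v * ln (A / \<epsilon>)\<bar>" by simp
  also have "\<dots> \<le> \<bar>v\<bar> * ((\<bar>ln A\<bar> + 1) / \<epsilon>)" unfolding abs_mult by (rule mult_left_mono[OF l]) simp
  finally show ?thesis using assms by (simp add: powr_def mult.commute)
qed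

text \<open>In \<open>enat\<close> the infimum of a nonempty set is its least element; a finite
  covering number rules out the empty set, whose infimum is \<open>\<infinity>\<close>.\<close>

lemma L2_covering_number_attained:
  assumes "L2_covering_number r Fc Q \<noteq> \<infinity>"
  shows "\<exists>C. finite C \<and> C \<subseteq> L2_funs Q \<and> (\<forall>f\<in>Fc. \<exists>c\<in>C. L2_norm Q (\<lambda>z. f z - c z) < r) \<and>
    enat (card C) = L2_covering_number r Fc Q"
proof -
  define K where "K = {enat (card C) | C. finite C \<and> C \<subseteq> L2_funs Q \<and> (\<forall>f\<in>Fc. \<exists>c\<in>C. L2_norm Q (\<lambda>z. f z - c z) < r)}"
  have e: "L2_covering_number r Fc Q = Inf K" unfolding L2_covering_number_def K_def ..
  have ne: "K \<noteq> {}" using assms unfolding e by (auto simp: top_enat_def)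
  then obtain k where k: "k \<in> K" by blast
  have "Inf K = (LEAST x. x \<in> K)" unfolding Inf_enat_def by (rule if_not_P[OF ne])
  then have "L2_covering_number r Fc Q \<in> K" unfolding e by (simp only:) (rule LeastI[of "\<lambda>x. x \<in> K", OF k])
  then obtain C where "L2_covering_number r Fc Q = enat (card C)" "finite C" "C \<subseteq> L2_funs Q"
    "\<forall>f\<in>Fc. \<exists>c\<in>C. L2_norm Q (\<lambda>z. f z - c z) < r" unfolding K_def by blast
  then show ?thesis by (intro exI[of _ C] conjI) (simp_all only:)
qed

lemma L2_norm_square: "(L2_norm Q g)\<^sup>2 = (\<integral>z. (g z)\<^sup>2 \<partial>Q)"
  unfolding L2_norm_def by (simp add: Bochner_Integration.integral_nonneg)

lemma L2_norm_nonneg: "0 \<le> L2_norm Q g"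
  unfolding L2_norm_def by (simp add: Bochner_Integration.integral_nonneg)

text \<open>The envelope is raised to \<open>F + 1\<close> so that measures with \<open>\<parallel>F\<parallel>\<^sub>Q = 0\<close>, about which \<^const>\<open>VC_type\<close>
  says nothing, are covered too.\<close>

lemma VC_type_entropy:
  assumes VC: "VC_type S Fc F" and ne: "Fc \<noteq> {}" and Fm: "Fc \<subseteq> borel_measurable S"
  shows "\<exists>C0\<ge>1. \<forall>Q \<epsilon>. prob_space Q \<longrightarrow> sets Q = sets S \<longrightarrow> integrable Q (\<lambda>z. (F z + 1)\<^sup>2) \<longrightarrow> 0 < \<epsilon> \<longrightarrow> \<epsilon> \<le> 1 \<longrightarrow>
    (\<exists>C. finite C \<and> real (card C) \<le> exp (C0 / \<epsilon>) \<and> C \<subseteq> L2_funs Q \<and>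
        (\<forall>f\<in>Fc. \<exists>c\<in>C. L2_norm Q (\<lambda>z. f z - c z) < \<epsilon> * L2_norm Q (\<lambda>z. F z + 1)))"
proof -
  from VC obtain A v :: real where A: "0 < A" and FS: "F \<in> borel_measurable S"
    and env: "\<And>f z. f \<in> Fc \<Longrightarrow> z \<in> space S \<Longrightarrow> \<bar>f z\<bar> \<le> F z"
    and cov: "\<And>\<epsilon>. 0 < \<epsilon> \<Longrightarrow> \<epsilon> \<le> 1 \<Longrightarrow>
           (SUP Q \<in> {Q. prob_space Q \<and> sets Q = sets S \<and> F \<in> L2_funs Q \<and> 0 < L2_norm Q F}.
              ereal_of_enat (L2_covering_number (\<epsilon> * L2_norm Q F) Fc Q)) \<le> ereal ((A / \<epsilon>) powr v)"
    unfolding VC_type_def by blast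
  define C0 where "C0 = max 1 (\<bar>v\<bar> * (\<bar>ln A\<bar> + 1))"
  have F0: "0 \<le> F z" if "z \<in> space S" for z using ne env[OF _ that] by force
  have "\<exists>C. finite C \<and> real (card C) \<le> exp (C0 / \<epsilon>) \<and> C \<subseteq> L2_funs Q \<and>
        (\<forall>f\<in>Fc. \<exists>c\<in>C. L2_norm Q (\<lambda>z. f z - c z) < \<epsilon> * L2_norm Q (\<lambda>z. F z + 1))"
    if Q: "prob_space Q" and sQ: "sets Q = sets S" and i: "integrable Q (\<lambda>z. (F z + 1)\<^sup>2)" and \<epsilon>: "0 < \<epsilon>" "\<epsilon> \<le> 1" for Q \<epsilon>
  proof -
    interpret Q: prob_space Q by (rule Q)
    have sp: "space Q = space S" by (rule sets_eq_imp_space_eq[OF sQ])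
    have FQ: "F \<in> borel_measurable Q" using FS by (simp cong: measurable_cong_sets add: sQ)
    have sq: "(F z)\<^sup>2 \<le> (F z + 1)\<^sup>2" if "z \<in> space S" for z using F0[OF that] by (intro power_mono) simp_all
    have iF: "integrable Q (\<lambda>z. (F z)\<^sup>2)"
      by (rule Bochner_Integration.integrable_bound[OF i]) (use FQ sq sp in \<open>auto intro!: AE_I2\<close>)
    have FL: "F \<in> L2_funs Q" unfolding L2_funs_def using FQ iF by simp
    have "(1::real) = (\<integral>z. 1 \<partial>Q)" by (simp add: Q.prob_space)
    also have "\<dots> \<le> (\<integral>z. (F z + 1)\<^sup>2 \<partial>Q)"
      by (rule integral_mono[OF _ i]) (use F0 sp in \<open>auto simp: power2_eq_square algebra_simps\<close>)
    finally have n1: "1 \<le> L2_norm Q (\<lambda>z. F z + 1)" unfolding L2_norm_def by simp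
    show ?thesis
    \<comment> \<open>If the envelope vanishes almost everywhere under \<open>Q\<close>, so does
      every member of the class, and the single centre 0 suffices. Otherwise a cover relative to
      \<open>F\<close> serves for \<open>F + 1\<close>, whose norm is at least as large.\<close>
    proof (cases "L2_norm Q F = 0")
      case True
      then have "(\<integral>z. (F z)\<^sup>2 \<partial>Q) = 0" using L2_norm_square[of Q F] by simp
      then have AE: "AE z in Q. (F z)\<^sup>2 = 0" using integral_nonneg_eq_0_iff_AE[OF iF] by simp
      have "L2_norm Q (\<lambda>z. f z - 0) = 0" if f: "f \<in> Fc" for f
      proof -
        have fQ: "f \<in> borel_measurable Q" using f Fm by (auto cong: measurable_cong_sets simp: sQ)
        have "AE z in Q. \<bar>f z - 0\<bar>\<^sup>2 = 0"
          using AE AE_space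
        proof eventually_elim
          fix z assume "(F z)\<^sup>2 = 0" "z \<in> space Q"
          then show "\<bar>f z - 0\<bar>\<^sup>2 = 0" using env[OF f, of z] sp by simp
        qed
        then have "(\<integral>z. \<bar>f z - 0\<bar>\<^sup>2 \<partial>Q) = (\<integral>z. 0 \<partial>Q)" by (intro integral_cong_AE) (use fQ in simp_all)
        then show ?thesis unfolding L2_norm_def by simp
      qed
      then have "\<forall>f\<in>Fc. \<exists>c\<in>{\<lambda>_. 0}. L2_norm Q (\<lambda>z. f z - c z) < \<epsilon> * L2_norm Q (\<lambda>z. F z + 1)" using \<epsilon> n1 by simp
      moreover have "real (card {\<lambda>_::'a. 0::real}) \<le> exp (C0 / \<epsilon>)" using \<epsilon> unfolding C0_def by simp
      moreover have "{\<lambda>_. 0} \<subseteq> L2_funs Q" unfolding L2_funs_def by simp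
      ultimately show ?thesis by (intro exI[of _ "{\<lambda>_. 0}"]) simp
    next
      case False
      then have pos: "0 < L2_norm Q F" using L2_norm_nonneg[of Q F] by simp
      have le: "ereal_of_enat (L2_covering_number (\<epsilon> * L2_norm Q F) Fc Q) \<le> ereal ((A / \<epsilon>) powr v)"
        by (rule order_trans[OF SUP_upper cov[OF \<epsilon>]]) (use Q sQ FL pos in simp)
      have "L2_covering_number (\<epsilon> * L2_norm Q F) Fc Q \<noteq> \<infinity>"
      proof
        assume "L2_covering_number (\<epsilon> * L2_norm Q F) Fc Q = \<infinity>"
        then show False using le by simp
      qed
      from L2_covering_number_attained[OF this] obtain C where C: "finite C" "C \<subseteq> L2_funs Q"
        "\<And>f. f \<in> Fc \<Longrightarrow> \<exists>c\<in>C. L2_norm Q (\<lambda>z. f z - c z) < \<epsilon> * L2_norm Q F"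
        "enat (card C) = L2_covering_number (\<epsilon> * L2_norm Q F) Fc Q" by blast
      have "real (card C) \<le> (A / \<epsilon>) powr v" using le unfolding C(4)[symmetric] by simp
      also have "\<dots> \<le> exp (\<bar>v\<bar> * (\<bar>ln A\<bar> + 1) / \<epsilon>)" by (rule powr_le_exp_inverse[OF A \<epsilon>])
      also have "\<dots> \<le> exp (C0 / \<epsilon>)" unfolding exp_le_cancel_iff C0_def using \<epsilon> by (intro divide_right_mono) simp_all
      finally have card: "real (card C) \<le> exp (C0 / \<epsilon>)" .
      have "L2_norm Q F \<le> L2_norm Q (\<lambda>z. F z + 1)"
        unfolding L2_norm_def power2_abs real_sqrt_le_iff by (rule integral_mono[OF iF i]) (use sq sp in simp)
      then have le: "\<epsilon> * L2_norm Q F \<le> \<epsilon> * L2_norm Q (\<lambda>z. F z + 1)" using \<epsilon> by simp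
      have "\<forall>f\<in>Fc. \<exists>c\<in>C. L2_norm Q (\<lambda>z. f z - c z) < \<epsilon> * L2_norm Q (\<lambda>z. F z + 1)"
        using C(3) less_le_trans[OF _ le] by blast
      then show ?thesis using C(1,2) card by blast
    qed
  qed
  moreover have "1 \<le> C0" unfolding C0_def by simp
  ultimately show ?thesis by blast
qed

context dyadic
begin

text \<open>Checked on the events \<open>U 1 \<in> B\<close>: the law of
  \<open>(U 1, (U 2, Vs 1 2))\<close> is a product, and Fubini integrates out the second
  factor.\<close>

lemma cond_exp_ht:
  assumes f: "f \<in> L2Z"
  shows "AE \<omega> in M. cond_exp_given M SU (U 1) (\<lambda>\<omega>. f (Zs 1 2 \<omega>)) \<omega> = ht f (U 1 \<omega>)"
proof -
  let ?A = "vimage_algebra (space M) (U 1) SU"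
  have U1: "U 1 \<in> measurable M SU" by (rule U_meas) simp
  have sub: "subalgebra M ?A"
    unfolding subalgebra_def using measurable_space[OF U1] measurable_sets[OF U1] by (auto simp: sets_vimage_algebra2)
  interpret A: finite_measure_subalgebra M ?A by (unfold_locales) (rule sub)
  have hU: "(\<lambda>\<omega>. h f (U 1 \<omega>)) \<in> borel_measurable M" "integrable M (\<lambda>\<omega>. h f (U 1 \<omega>))"
    using hU_facts(1)[OF f, of 1] integrable_of_square(1)[OF hU_facts(1,2)[OF f, of 1]] by simp_all
  have htS: "ht f \<in> borel_measurable SU"
  proof -
    have "(\<lambda>u. h f u + mf f) \<in> borel_measurable SU"
      using h_facts(1)[OF f] by (simp cong: measurable_cong_sets add: sets_PU)
    then show ?thesis by (simp add: h_def)
  qed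
  have hti: "integrable M (\<lambda>\<omega>. ht f (U 1 \<omega>))"
  proof -
    have "integrable M (\<lambda>\<omega>. h f (U 1 \<omega>) + mf f)" using hU(2) by simp
    then show ?thesis by (simp add: h_def)
  qed
  interpret U: prob_space PU by (rule prob_PU)
  interpret B: prob_space PB by (rule prob_PB)
  interpret UB: pair_prob_space PU PB ..
  have law: "distr M (SU \<Otimes>\<^sub>M SW) (\<lambda>\<omega>. (U 1 \<omega>, (U 2 \<omega>, Vs 1 2 \<omega>))) = PU \<Otimes>\<^sub>M PB"
    and jm: "(\<lambda>\<omega>. (U 1 \<omega>, (U 2 \<omega>, Vs 1 2 \<omega>))) \<in> measurable M (SU \<Otimes>\<^sub>M SW)"
    by (rule law_UUV UUV_meas; simp)+
  have "AE \<omega> in M. real_cond_exp M ?A (\<lambda>\<omega>. f (Zs 1 2 \<omega>)) \<omega> = ht f (U 1 \<omega>)"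
  proof (rule A.real_cond_exp_charact)
    show "integrable M (\<lambda>\<omega>. f (Zs 1 2 \<omega>))" by (rule fZ_facts(3)[OF f]) simp_all
    show "integrable M (\<lambda>\<omega>. ht f (U 1 \<omega>))" by (rule hti)
    have "U 1 \<in> measurable ?A SU" by (rule measurable_vimage_algebra1) (use measurable_space[OF U1] in blast)
    then show "(\<lambda>\<omega>. ht f (U 1 \<omega>)) \<in> borel_measurable ?A" by (rule measurable_compose[OF _ htS])
    fix X assume "X \<in> sets ?A"
    then obtain B where B: "B \<in> sets SU" "X = U 1 -` B \<inter> space M"
      using measurable_space[OF U1] by (auto simp: sets_vimage_algebra2)
    let ?g = "\<lambda>p :: 'u \<times> 'u \<times> 'v. indicator B (fst p) * f (T3 p)"
    have gm: "?g \<in> borel_measurable (SU \<Otimes>\<^sub>M SW)"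
    proof -
      have [measurable]: "B \<in> sets SU" by (rule B(1))
      have [measurable]: "(\<lambda>p. f (T3 p)) \<in> borel_measurable (SU \<Otimes>\<^sub>M SW)"
        by (rule measurable_compose[OF T3_meas L2Z_facts(1)[OF f]])
      show ?thesis by measurable
    qed
    have gm': "?g \<in> borel_measurable (PU \<Otimes>\<^sub>M PB)"
      using gm by (simp cong: measurable_cong_sets add: sets_pair_measure_cong[OF sets_PU sets_PB])
    have gi: "integrable (PU \<Otimes>\<^sub>M PB) ?g"
      by (rule Bochner_Integration.integrable_bound[OF L2Z_facts(3)[OF f] gm'])
        (auto intro!: AE_I2 split: split_indicator)
    have "(\<integral>\<omega>\<in>X. f (Zs 1 2 \<omega>) \<partial>M) = (\<integral>\<omega>. ?g (U 1 \<omega>, (U 2 \<omega>, Vs 1 2 \<omega>)) \<partial>M)"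
      unfolding set_lebesgue_integral_def B(2) Zs_T3
      by (intro Bochner_Integration.integral_cong refl) (simp split: split_indicator)
    also have "\<dots> = (\<integral>p. ?g p \<partial>(PU \<Otimes>\<^sub>M PB))"
      unfolding law[symmetric] by (rule integral_distr[OF jm gm, symmetric])
    also have "\<dots> = (\<integral>u. (\<integral>b. ?g (u, b) \<partial>PB) \<partial>PU)" by (rule UB.integral_fst'[OF gi, symmetric])
    also have "\<dots> = (\<integral>u. indicator B u * ht f u \<partial>PU)" by (simp add: ht_def)
    also have "\<dots> = (\<integral>\<omega>. indicator B (U 1 \<omega>) * ht f (U 1 \<omega>) \<partial>M)"
      unfolding PU_def by (rule integral_distr[OF U1]) (use htS B(1) in measurable)
    also have "\<dots> = (\<integral>\<omega>\<in>X. ht f (U 1 \<omega>) \<partial>M)"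
      unfolding set_lebesgue_integral_def B(2)
      by (intro Bochner_Integration.integral_cong refl) (simp split: split_indicator)
    finally show "(\<integral>\<omega>\<in>X. f (Zs 1 2 \<omega>) \<partial>M) = (\<integral>\<omega>\<in>X. ht f (U 1 \<omega>) \<partial>M)" .
  qed
  then show ?thesis unfolding cond_exp_given_def .
qed

text \<open>Subtracting its mean turns the conditional expectation into
  \<open>h f (U 1 \<omega>)\<close>, almost surely.\<close>

lemma Kov_eq_covariance:
  assumes f: "f \<in> L2Z" and g: "g \<in> L2Z"
  shows "Kov f g = 4 * covariance M (cond_exp_given M SU (U 1) (\<lambda>\<omega>. f (dyad_obs U V \<tau> 1 2 \<omega>)))
    (cond_exp_given M SU (U 1) (\<lambda>\<omega>. g (dyad_obs U V \<tau> 1 2 \<omega>)))"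
proof -
  let ?E = "\<lambda>f. cond_exp_given M SU (U 1) (\<lambda>\<omega>. f (Zs 1 2 \<omega>))"
  have Em [measurable]: "?E f \<in> borel_measurable M" for f :: "'z \<Rightarrow> real"
    unfolding cond_exp_given_def by measurable
  have hm: "(\<lambda>\<omega>. h f (U 1 \<omega>)) \<in> borel_measurable M" "integrable M (\<lambda>\<omega>. h f (U 1 \<omega>))" "(\<integral>\<omega>. h f (U 1 \<omega>) \<partial>M) = 0"
    if "f \<in> L2Z" for f
    using hU_facts(1,3)[OF that, of 1] integrable_of_square(1)[OF hU_facts(1,2)[OF that, of 1]] by simp_all
  have mean: "(\<integral>\<omega>. ?E f \<omega> \<partial>M) = mf f" if f: "f \<in> L2Z" for f
  proof -
    have "(\<integral>\<omega>. ?E f \<omega> \<partial>M) = (\<integral>\<omega>. h f (U 1 \<omega>) + mf f \<partial>M)"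
    proof (rule integral_cong_AE)
      show "AE \<omega> in M. ?E f \<omega> = h f (U 1 \<omega>) + mf f"
        using cond_exp_ht[OF f] by eventually_elim (simp add: h_def)
    qed (use hm(1)[OF f] in measurable)
    also have "\<dots> = mf f" using hm[OF f] by (simp add: prob_space)
    finally show ?thesis .
  qed
  have hS: "h f \<in> borel_measurable SU" if "f \<in> L2Z" for f
    using h_facts(1)[OF that] by (simp cong: measurable_cong_sets add: sets_PU)
  have "covariance M (?E f) (?E g) = (\<integral>\<omega>. h f (U 1 \<omega>) * h g (U 1 \<omega>) \<partial>M)"
    unfolding covariance_def mean[OF f] mean[OF g]
  proof (rule integral_cong_AE)
    show "AE \<omega> in M. (?E f \<omega> - mf f) * (?E g \<omega> - mf g) = h f (U 1 \<omega>) * h g (U 1 \<omega>)"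
      using cond_exp_ht[OF f] cond_exp_ht[OF g] by eventually_elim (simp add: h_def)
  qed (use hm(1)[OF f] hm(1)[OF g] in measurable)
  also have "\<dots> = (\<integral>u. h f u * h g u \<partial>PU)"
    unfolding PU_def by (rule integral_distr[symmetric, OF U_meas]) (use hS[OF f] hS[OF g] in \<open>simp_all\<close>)
  finally show ?thesis unfolding Kov_def by (simp add: Zs_eq_dyad_obs)
qed

end

subsection \<open>Equicontinuity of the dyadic process\<close>

definition matching :: "nat \<Rightarrow> nat \<Rightarrow> (nat \<times> nat) set" where
  "matching n c = {e \<in> pairs_upto n. (fst e + snd e) mod n = c}"

text \<open>\<open>{1..n}\<close> is a complete system of residues, so a sum modulo \<open>n\<close>
  and one summand determine the other.\<close>

lemma add_mod_inj:
  fixes s a b n :: nat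
  assumes ab: "a \<in> {1..n}" "b \<in> {1..n}" and eq: "(s + a) mod n = (s + b) mod n"
  shows "a = b"
proof (rule ccontr)
  have no: False if "x < y" "x \<in> {1..n}" "y \<in> {1..n}" "(s + x) mod n = (s + y) mod n" for x y
  proof -
    have "n dvd (s + y) - (s + x)" using mod_eq_dvd_iff_nat[of "s + x" "s + y" n] that by simp
    then have "n dvd y - x" by simp
    moreover have "0 < y - x" "y - x < n" using that by auto
    ultimately show False using nat_dvd_not_less by blast
  qed
  assume "a \<noteq> b"
  then consider "a < b" | "b < a" by linarith
  then show False using no[of a b] no[of b a] ab eq by cases simp_all
qed

lemma matching_disjoint:
  assumes "e \<in> matching n c" "e' \<in> matching n c" "e \<noteq> e'"
  shows "{fst e, snd e} \<inter> {fst e', snd e'} = {}"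
proof -
  obtain i j k l where e: "e = (i, j)" "e' = (k, l)" by (cases e; cases e')
  have ij: "i \<in> {1..n}" "j \<in> {1..n}" "i < j" and kl: "k \<in> {1..n}" "l \<in> {1..n}" "k < l"
    and m: "(i + j) mod n = (k + l) mod n"
    using assms(1,2) unfolding e matching_def pairs_upto_def by auto
  have "i \<noteq> k" using add_mod_inj[OF ij(2) kl(2), of i] m assms(3) unfolding e by auto
  moreover have "j \<noteq> l" using add_mod_inj[OF ij(1) kl(1), of j] m assms(3) unfolding e by (auto simp: add.commute)
  \<comment> \<open>\<open>i = l\<close> would force \<open>j = k\<close>, against
    \<open>i < j\<close> and \<open>k < l\<close>; the next case is symmetric.\<close>
  moreover have "i \<noteq> l" using add_mod_inj[OF ij(2) kl(1), of i] m ij(3) kl(3) by (auto simp: add.commute)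
  moreover have "j \<noteq> k" using add_mod_inj[OF ij(1) kl(2), of j] m ij(3) kl(3) by (auto simp: add.commute)
  ultimately show ?thesis unfolding e by auto
qed

lemma matching_finite: "finite (matching n c)"
  unfolding matching_def using pairs_upto_finite by simp

text \<open>The smaller endpoint determines the dyad. The bound is crude by a factor of 2, which
  affects constants only.\<close>

lemma card_matching: "card (matching n c) \<le> n"
proof -
  have "inj_on fst (matching n c)"
  proof (rule inj_onI, rule ccontr)
    fix e e' assume "e \<in> matching n c" "e' \<in> matching n c" "fst e = fst e'" "e \<noteq> e'"
    then show False using matching_disjoint[of e n c e'] by auto
  qed
  moreover have "fst ` matching n c \<subseteq> {1..n}" unfolding matching_def pairs_upto_def by auto
  ultimately have "card (matching n c) \<le> card {1..n}" by (rule card_inj_on_le) simp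
  then show ?thesis by simp
qed

lemma sum_matchings:
  assumes "0 < n" shows "(\<Sum>e\<in>pairs_upto n. \<phi> e :: real) = (\<Sum>c<n. \<Sum>e\<in>matching n c. \<phi> e)"
  unfolding matching_def using assms
  by (intro sum.group[symmetric] pairs_upto_finite finite_lessThan) auto

lemma matching_dyads: "matching n c \<subseteq> dyad_index"
  unfolding matching_def pairs_upto_def dyad_index_def by auto

locale dyadic_class = dyadic M SU SV S U V \<tau>
  for M :: "'w measure" and SU :: "'u measure" and SV :: "'v measure" and S :: "'z measure"
    and U :: "nat \<Rightarrow> 'w \<Rightarrow> 'u" and V :: "nat \<Rightarrow> nat \<Rightarrow> 'w \<Rightarrow> 'v" and \<tau> :: "'u \<Rightarrow> 'u \<Rightarrow> 'v \<Rightarrow> 'z" +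
  fixes Fc :: "('z \<Rightarrow> real) set" and F :: "'z \<Rightarrow> real" and C0 :: real
  assumes vc: "vc_class S PZ Fc F C0" and ptw: "pointwise_measurable_class S Fc" and ne: "Fc \<noteq> {}"
begin

sublocale vc: vc_class S PZ Fc F C0 by (rule vc)

lemma Fc_meas: "f \<in> Fc \<Longrightarrow> f \<in> borel_measurable S" using vc.Fc by blast

lemma Fc_L2Z: "f \<in> Fc \<Longrightarrow> f \<in> L2Z"
proof -
  assume f: "f \<in> Fc"
  have "(\<lambda>z. (f z)\<^sup>2) \<in> borel_measurable PZ" using vc.measP[OF Fc_meas[OF f]] by measurable
  moreover have "(f z)\<^sup>2 \<le> (F z)\<^sup>2" if "z \<in> space S" for z
    using power_mono[OF vc.env[OF f that], of 2] by simp
  ultimately have "integrable PZ (\<lambda>z. (f z)\<^sup>2)"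
    by (intro Bochner_Integration.integrable_bound[OF vc.F2]) (auto intro!: AE_I2 simp: vc.spP)
  then show ?thesis unfolding L2Z_def using Fc_meas[OF f] by simp
qed

lemma F_L2Z: "F \<in> L2Z" unfolding L2Z_def using vc.F_meas vc.F2 by simp

lemma Zs_space: "e \<in> pairs_upto n \<Longrightarrow> \<omega> \<in> space M \<Longrightarrow> Zs (fst e) (snd e) \<omega> \<in> space S"
  by (rule measurable_space[OF Zs_meas]) (auto simp: pairs_upto_def)

definition cp :: "('z \<Rightarrow> real) \<times> ('z \<Rightarrow> real) \<Rightarrow> 'z \<Rightarrow> real" where
  "cp p z = (fst p z - snd p z) - (\<integral>z. fst p z - snd p z \<partial>PZ)"

lemma cp_meas: "p \<in> Fc \<times> Fc \<Longrightarrow> cp p \<in> borel_measurable S"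
  unfolding cp_def[abs_def] using Fc_meas[of "fst p"] Fc_meas[of "snd p"] by (auto intro!: borel_measurable_diff)

lemma cp_integrable: "p \<in> Fc \<times> Fc \<Longrightarrow> e \<in> pairs_upto n \<Longrightarrow> integrable M (\<lambda>\<omega>. cp p (Zs (fst e) (snd e) \<omega>))"
  unfolding cp_def using fZ_facts(3)[OF Fc_L2Z, of "fst p" "fst e" "snd e"] fZ_facts(3)[OF Fc_L2Z, of "snd p" "fst e" "snd e"]
  by (auto simp: pairs_upto_def)

text \<open>A matching of the array has the law of an i.i.d. sample from \<open>PZ\<close>, which
  makes \<open>iid_equicontinuity\<close> applicable.\<close>

lemma matching_expectation:
  assumes J: "finite J" "J \<subseteq> Fc \<times> Fc"
  shows "(\<integral>\<omega>. fmax J (\<lambda>p. \<Sum>e\<in>matching n c. cp p (Zs (fst e) (snd e) \<omega>)) \<partial>M) =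
    (\<integral>x. fmax J (\<lambda>p. \<Sum>e\<in>matching n c. cp p (x e)) \<partial>PiM (matching n c) (\<lambda>_. PZ))"
proof -
  let ?E = "matching n c"
  let ?X = "\<lambda>\<omega>. \<lambda>e\<in>?E. Zs (fst e) (snd e) \<omega>"
  have Xm: "?X \<in> measurable M (PiM ?E (\<lambda>_. S))"
    by (rule measurable_restrict) (use matching_dyads[of n c] in \<open>auto simp: dyad_index_def intro!: Zs_meas\<close>)
  have gm: "(\<lambda>x. fmax J (\<lambda>p. \<Sum>e\<in>?E. cp p (x e))) \<in> borel_measurable (PiM ?E (\<lambda>_. S))"
  proof (rule fmax_measurable[OF J(1)], rule borel_measurable_sum)
    fix p e assume p: "p \<in> J" and e: "e \<in> ?E"
    show "(\<lambda>x. cp p (x e)) \<in> borel_measurable (PiM ?E (\<lambda>_. S))"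
      by (rule measurable_compose[OF measurable_component_singleton[OF e] cp_meas]) (use p J in blast)
  qed
  have law: "distr M (PiM ?E (\<lambda>_. S)) ?X = PiM ?E (\<lambda>_. PZ)"
    by (rule disjoint_dyads_iid[OF matching_dyads matching_disjoint])
  have "(\<integral>x. fmax J (\<lambda>p. \<Sum>e\<in>?E. cp p (x e)) \<partial>PiM ?E (\<lambda>_. PZ)) = (\<integral>\<omega>. fmax J (\<lambda>p. \<Sum>e\<in>?E. cp p (?X \<omega> e)) \<partial>M)"
    unfolding law[symmetric] by (rule integral_distr[OF Xm gm])
  also have "\<dots> = (\<integral>\<omega>. fmax J (\<lambda>p. \<Sum>e\<in>?E. cp p (Zs (fst e) (snd e) \<omega>)) \<partial>M)" by simp
  finally show ?thesis by simp
qed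

lemma Xp_diff:
  assumes n: "2 \<le> n" and p: "p \<in> Fc \<times> Fc"
  shows "Xp n \<omega> (fst p) - Xp n \<omega> (snd p) = sqrt n / (real n * (real n - 1) / 2) * (\<Sum>e\<in>pairs_upto n. cp p (Zs (fst e) (snd e) \<omega>))"
proof -
  define N where "N = real n * (real n - 1) / 2"
  have N: "0 < N" unfolding N_def using n by simp
  have L: "fst p \<in> L2Z" "snd p \<in> L2Z" using p Fc_L2Z by auto
  have m: "(\<integral>z. fst p z - snd p z \<partial>PZ) = mf (fst p) - mf (snd p)"
    unfolding mf_def by (rule Bochner_Integration.integral_diff) (rule L2Z_facts(2)[OF L(1)], rule L2Z_facts(2)[OF L(2)])
  have "(\<Sum>e\<in>pairs_upto n. cp p (Zs (fst e) (snd e) \<omega>)) = (\<Sum>e\<in>pairs_upto n. fst p (Zs (fst e) (snd e) \<omega>))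
      - (\<Sum>e\<in>pairs_upto n. snd p (Zs (fst e) (snd e) \<omega>)) - N * (mf (fst p) - mf (snd p))"
    unfolding cp_def m by (simp add: sum_subtractf card_pairs_upto N_def)
  moreover have "sqrt n * (a / N - b) - sqrt n * (c / N - d) = sqrt n / N * (a - c - N * (b - d))" for a b c d
    using N by (simp add: field_simps)
  ultimately show ?thesis
    unfolding Xp_def dyadic_mean_eq pop_mean_eq[OF L(1)] pop_mean_eq[OF L(2)] N_def[symmetric] by (simp add: case_prod_beta)
qed

lemma Xp_integrable: "f \<in> Fc \<Longrightarrow> integrable M (\<lambda>\<omega>. Xp n \<omega> f)"
proof -
  assume f: "f \<in> Fc"
  have "integrable M (\<lambda>\<omega>. \<Sum>e\<in>pairs_upto n. f (Zs (fst e) (snd e) \<omega>))"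
    by (intro Bochner_Integration.integrable_sum fZ_facts(3)[OF Fc_L2Z[OF f]]) (auto simp: pairs_upto_def)
  then show ?thesis unfolding Xp_def dyadic_mean_eq by (simp add: case_prod_beta)
qed

lemma Xp_finite_equicontinuity:
  assumes \<epsilon>: "0 < \<epsilon>"
  shows "\<exists>\<delta>>0. \<forall>\<^sub>F n in sequentially. \<forall>J. finite J \<longrightarrow> J \<subseteq> Fc \<times> Fc \<longrightarrow>
    (\<forall>p\<in>J. (\<integral>z. (fst p z - snd p z)\<^sup>2 \<partial>PZ) \<le> \<delta>\<^sup>2) \<longrightarrow>
    (\<integral>\<omega>. fmax J (\<lambda>p. Xp n \<omega> (fst p) - Xp n \<omega> (snd p)) \<partial>M) \<le> \<epsilon>"
proof -
  \<comment> \<open>The prefactor is at most \<open>4 / sqrt n\<close>, so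
    \<open>\<epsilon> / 8\<close> becomes \<open>\<epsilon> / 2\<close>. The other half absorbs
    \<open>B\<close> once \<open>8 * B / \<epsilon> \<le> sqrt n\<close>.\<close>
  have "0 < \<epsilon> / 8" using \<epsilon> by simp
  from vc.iid_equicontinuity[where 'i="nat \<times> nat", OF this] obtain \<delta> B where \<delta>: "0 < \<delta>" "0 \<le> B" and
    iid: "\<forall>(I :: (nat \<times> nat) set) J. finite I \<longrightarrow> finite J \<longrightarrow> J \<subseteq> Fc \<times> Fc \<longrightarrow>
      (\<forall>p\<in>J. (\<integral>z. (fst p z - snd p z)\<^sup>2 \<partial>PZ) \<le> \<delta>\<^sup>2) \<longrightarrow>
      (\<integral>x. fmax J (\<lambda>p. \<Sum>i\<in>I. ((fst p (x i) - snd p (x i)) - (\<integral>z. fst p z - snd p z \<partial>PZ))) \<partial>PiM I (\<lambda>_. PZ))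
      \<le> \<epsilon> / 8 * sqrt (card I) + B"
    by (elim exE conjE) (rule that)
  have "eventually (\<lambda>n::nat. max 2 ((8 * B / \<epsilon>)\<^sup>2) \<le> real n) sequentially"
    using filterlim_real_sequentially unfolding filterlim_at_top by blast
  then have "\<forall>\<^sub>F n in sequentially. \<forall>J. finite J \<longrightarrow> J \<subseteq> Fc \<times> Fc \<longrightarrow>
    (\<forall>p\<in>J. (\<integral>z. (fst p z - snd p z)\<^sup>2 \<partial>PZ) \<le> \<delta>\<^sup>2) \<longrightarrow>
    (\<integral>\<omega>. fmax J (\<lambda>p. Xp n \<omega> (fst p) - Xp n \<omega> (snd p)) \<partial>M) \<le> \<epsilon>"
  proof (eventually_elim, intro allI impI)
    fix n :: nat and J
    assume n': "max 2 ((8 * B / \<epsilon>)\<^sup>2) \<le> real n" and J: "finite J" "J \<subseteq> Fc \<times> Fc"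
      and d: "\<forall>p\<in>J. (\<integral>z. (fst p z - snd p z)\<^sup>2 \<partial>PZ) \<le> \<delta>\<^sup>2"
    have n: "2 \<le> n" using n' by simp
    define N where "N = real n * (real n - 1) / 2"
    have N: "0 < N" unfolding N_def using n by simp
    define G where "G = (\<lambda>c \<omega>. fmax J (\<lambda>p. \<Sum>e\<in>matching n c. cp p (Zs (fst e) (snd e) \<omega>)))"
    have Gi: "integrable M (G c)" for c
      unfolding G_def
    proof (rule fmax_integrable[OF J(1)], rule Bochner_Integration.integrable_sum)
      fix p e assume "p \<in> J" "e \<in> matching n c"
      then show "integrable M (\<lambda>\<omega>. cp p (Zs (fst e) (snd e) \<omega>))"
        using J by (intro cp_integrable[where n=n]) (auto simp: matching_def)
    qed
    have GB: "(\<integral>\<omega>. G c \<omega> \<partial>M) \<le> \<epsilon> / 8 * sqrt n + B" for c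
    proof -
      have "(\<integral>\<omega>. G c \<omega> \<partial>M) \<le> \<epsilon> / 8 * sqrt (card (matching n c)) + B"
        unfolding G_def matching_expectation[OF J] unfolding cp_def by (rule iid[rule_format, OF matching_finite J d[rule_format]])
      also have "\<dots> \<le> \<epsilon> / 8 * sqrt n + B"
        using card_matching[of n c] \<epsilon> by (intro add_right_mono mult_left_mono) simp_all
      finally show ?thesis .
    qed
    have le: "fmax J (\<lambda>p. Xp n \<omega> (fst p) - Xp n \<omega> (snd p)) \<le> sqrt n / N * (\<Sum>c<n. G c \<omega>)" for \<omega>
    proof -
      have "fmax J (\<lambda>p. Xp n \<omega> (fst p) - Xp n \<omega> (snd p)) =
        fmax J (\<lambda>p. sqrt n / N * (\<Sum>c<n. \<Sum>e\<in>matching n c. cp p (Zs (fst e) (snd e) \<omega>)))"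
      proof (rule fmax_cong, rule arg_cong[where f=abs])
        fix p assume "p \<in> J"
        then have p: "p \<in> Fc \<times> Fc" using J by blast
        show "Xp n \<omega> (fst p) - Xp n \<omega> (snd p) = sqrt n / N * (\<Sum>c<n. \<Sum>e\<in>matching n c. cp p (Zs (fst e) (snd e) \<omega>))"
          using Xp_diff[OF n p, of \<omega>] sum_matchings[of n "\<lambda>e. cp p (Zs (fst e) (snd e) \<omega>)"] n unfolding N_def by simp
      qed
      also have "\<dots> \<le> \<bar>sqrt n / N\<bar> * fmax J (\<lambda>p. \<Sum>c<n. \<Sum>e\<in>matching n c. cp p (Zs (fst e) (snd e) \<omega>))"
        by (rule fmax_scale[OF J(1)])
      also have "\<dots> \<le> \<bar>sqrt n / N\<bar> * (\<Sum>c<n. G c \<omega>)"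
        unfolding G_def by (intro mult_left_mono fmax_sum J(1)) simp_all
      finally show ?thesis using N by simp
    qed
    have "(\<integral>\<omega>. fmax J (\<lambda>p. Xp n \<omega> (fst p) - Xp n \<omega> (snd p)) \<partial>M) \<le> (\<integral>\<omega>. sqrt n / N * (\<Sum>c<n. G c \<omega>) \<partial>M)"
    proof (rule integral_mono)
      show "integrable M (\<lambda>\<omega>. fmax J (\<lambda>p. Xp n \<omega> (fst p) - Xp n \<omega> (snd p)))"
        by (rule fmax_integrable[OF J(1)]) (use J(2) Xp_integrable in \<open>auto intro!: Bochner_Integration.integrable_diff\<close>)
      show "integrable M (\<lambda>\<omega>. sqrt n / N * (\<Sum>c<n. G c \<omega>))" using Gi by simp
    qed (rule le)
    also have "\<dots> = sqrt n / N * (\<Sum>c<n. \<integral>\<omega>. G c \<omega> \<partial>M)" using Gi by simp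
    also have "\<dots> \<le> sqrt n / N * (\<Sum>c<n. \<epsilon> / 8 * sqrt n + B)"
      using N by (intro mult_left_mono sum_mono GB) simp
    also have "\<dots> = sqrt n * n / N * (\<epsilon> / 8 * sqrt n + B)" by simp
    also have "sqrt n * n / N \<le> 4 / sqrt n"
    proof -
      have "sqrt n * n / N = 2 * sqrt n / (real n - 1)" unfolding N_def using n by (simp add: field_simps)
      also have "\<dots> \<le> 2 * sqrt n / (real n / 2)" using n by (intro divide_left_mono) simp_all
      also have "\<dots> = 4 / sqrt n" using n by (simp add: field_simps)
      finally show ?thesis .
    qed
    then have "sqrt n * n / N * (\<epsilon> / 8 * sqrt n + B) \<le> 4 / sqrt n * (\<epsilon> / 8 * sqrt n + B)"
      using \<epsilon> \<delta> by (intro mult_right_mono) simp_all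
    also have "\<dots> = \<epsilon> / 2 + 4 * B / sqrt n" using n by (simp add: field_simps)
    also have "\<dots> \<le> \<epsilon> / 2 + \<epsilon> / 2"
    proof -
      have "8 * B / \<epsilon> \<le> sqrt n" using n' by (intro real_le_rsqrt) simp
      then have "4 * B \<le> \<epsilon> / 2 * sqrt n" using \<epsilon> by (simp add: field_simps)
      then show ?thesis using n by (simp add: field_simps)
    qed
    finally show "(\<integral>\<omega>. fmax J (\<lambda>p. Xp n \<omega> (fst p) - Xp n \<omega> (snd p)) \<partial>M) \<le> \<epsilon>" by simp
  qed
  then show ?thesis using \<delta>(1) by blast
qed

end

context dyadic_class
begin

section \<open>From finite families to the whole class\<close>

definition Env :: "nat \<Rightarrow> 'w \<Rightarrow> real" where
  "Env n \<omega> = sqrt n * ((\<Sum>e\<in>pairs_upto n. F (Zs (fst e) (snd e) \<omega>)) / (real n * (real n - 1) / 2) + mf F)"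

lemma Env_integrable: "integrable M (Env n)"
proof -
  have "integrable M (\<lambda>\<omega>. \<Sum>e\<in>pairs_upto n. F (Zs (fst e) (snd e) \<omega>))"
    by (intro Bochner_Integration.integrable_sum fZ_facts(3)[OF F_L2Z]) (auto simp: pairs_upto_def)
  then show ?thesis unfolding Env_def[abs_def] by simp
qed

text \<open>One integrable bound for all of \<open>Fc\<close>: it puts the process into the space of
  bounded functions and dominates the finite maxima in \<open>Xp_countable_sup\<close>.\<close>

lemma Xp_le_Env:
  assumes f: "f \<in> Fc" and \<omega>: "\<omega> \<in> space M" shows "\<bar>Xp n \<omega> f\<bar> \<le> Env n \<omega>"
proof -
  define N where "N = real n * (real n - 1) / 2"
  have N: "0 \<le> N" unfolding N_def by (cases n) simp_all
  have "\<bar>\<Sum>e\<in>pairs_upto n. f (Zs (fst e) (snd e) \<omega>)\<bar> \<le> (\<Sum>e\<in>pairs_upto n. F (Zs (fst e) (snd e) \<omega>))"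
    by (rule order_trans[OF sum_abs sum_mono]) (rule vc.env[OF f Zs_space[OF _ \<omega>]])
  then have a: "\<bar>(\<Sum>e\<in>pairs_upto n. f (Zs (fst e) (snd e) \<omega>)) / N\<bar> \<le> (\<Sum>e\<in>pairs_upto n. F (Zs (fst e) (snd e) \<omega>)) / N"
    using N by (simp add: abs_divide divide_right_mono)
  have "\<bar>mf f\<bar> \<le> (\<integral>z. \<bar>f z\<bar> \<partial>PZ)" unfolding mf_def by (rule integral_abs_bound)
  also have "\<dots> \<le> mf F" unfolding mf_def
    by (rule integral_mono) (use L2Z_facts(2)[OF Fc_L2Z[OF f]] L2Z_facts(2)[OF F_L2Z] vc.env[OF f] vc.spP in simp_all)
  finally have b: "\<bar>mf f\<bar> \<le> mf F" .
  have "\<bar>Xp n \<omega> f\<bar> = sqrt n * \<bar>(\<Sum>e\<in>pairs_upto n. f (Zs (fst e) (snd e) \<omega>)) / N - mf f\<bar>"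
    unfolding Xp_def dyadic_mean_eq pop_mean_eq[OF Fc_L2Z[OF f]] N_def by (simp add: abs_mult case_prod_beta)
  also have "\<dots> \<le> sqrt n * ((\<Sum>e\<in>pairs_upto n. F (Zs (fst e) (snd e) \<omega>)) / N + mf F)"
    using a b by (intro mult_left_mono) (linarith, simp)
  finally show ?thesis unfolding Env_def N_def .
qed

text \<open>Whatever enters the oscillation of the process passes to pointwise limits: means and
  distances by domination with the envelope, the sample part because it is a finite sum. This is how
  a countable subclass represents the whole class.\<close>

lemma pointwise_limits:
  assumes g: "\<And>m. g m \<in> Fc" and f: "f \<in> Fc" and lim: "\<And>z. z \<in> space S \<Longrightarrow> (\<lambda>m. g m z) \<longlonglongrightarrow> f z"
  shows "(\<lambda>m. mf (g m)) \<longlonglongrightarrow> mf f"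
    and "p \<in> Fc \<Longrightarrow> (\<lambda>m. \<integral>z. (g m z - p z)\<^sup>2 \<partial>PZ) \<longlonglongrightarrow> (\<integral>z. (f z - p z)\<^sup>2 \<partial>PZ)"
    and "\<omega> \<in> space M \<Longrightarrow> (\<lambda>m. Xp n \<omega> (g m)) \<longlonglongrightarrow> Xp n \<omega> f"
proof -
  have meas: "f \<in> borel_measurable PZ" if "f \<in> Fc" for f using vc.measP[OF Fc_meas[OF that]] .
  show mf: "(\<lambda>m. mf (g m)) \<longlonglongrightarrow> mf f"
    unfolding mf_def
  proof (rule integral_dominated_convergence)
    show "integrable PZ F" by (rule L2Z_facts(2)[OF F_L2Z])
    show "AE z in PZ. (\<lambda>m. g m z) \<longlonglongrightarrow> f z" using lim by (intro AE_I2) (simp add: vc.spP)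
    show "AE z in PZ. norm (g m z) \<le> F z" for m using vc.env[OF g] by (intro AE_I2) (simp add: vc.spP)
  qed (rule meas g f)+
  show "(\<lambda>m. \<integral>z. (g m z - p z)\<^sup>2 \<partial>PZ) \<longlonglongrightarrow> (\<integral>z. (f z - p z)\<^sup>2 \<partial>PZ)" if p: "p \<in> Fc"
  proof (rule integral_dominated_convergence)
    show "integrable PZ (\<lambda>z. 4 * (F z)\<^sup>2)" using vc.F2 by simp
    show "AE z in PZ. (\<lambda>m. (g m z - p z)\<^sup>2) \<longlonglongrightarrow> (f z - p z)\<^sup>2"
      using lim by (intro AE_I2 tendsto_intros) (simp add: vc.spP)
    show "AE z in PZ. norm ((g m z - p z)\<^sup>2) \<le> 4 * (F z)\<^sup>2" for m
      using vc.diff_square_le[of "(g m, p)"] g p by (intro AE_I2) (simp add: vc.spP)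
  qed (use meas[OF f] meas[OF g] meas[OF p] in measurable)
  show "(\<lambda>m. Xp n \<omega> (g m)) \<longlonglongrightarrow> Xp n \<omega> f" if \<omega>: "\<omega> \<in> space M"
  proof -
    have "(\<lambda>m. sqrt n * ((\<Sum>e\<in>pairs_upto n. g m (Zs (fst e) (snd e) \<omega>)) * inverse (real n * (real n - 1) / 2) - mf (g m)))
      \<longlonglongrightarrow> sqrt n * ((\<Sum>e\<in>pairs_upto n. f (Zs (fst e) (snd e) \<omega>)) * inverse (real n * (real n - 1) / 2) - mf f)"
      by (intro tendsto_mult tendsto_const tendsto_diff tendsto_sum mf lim Zs_space[OF _ \<omega>])
    then show ?thesis
      unfolding Xp_def dyadic_mean_eq pop_mean_eq[OF Fc_L2Z[OF f]] pop_mean_eq[OF Fc_L2Z[OF g]] case_prod_beta divide_inverse .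
  qed
qed

text \<open>The centres of a cover under \<open>PZ\<close> may lie outside the class; members with
  the same centre replace them, which doubles the distance.\<close>

lemma totally_bounded:
  assumes \<delta>: "0 < \<delta>"
  shows "\<exists>\<pi>. \<pi> ` Fc \<subseteq> Fc \<and> finite (\<pi> ` Fc) \<and> (\<forall>f\<in>Fc. (\<integral>z. (f z - \<pi> f z)\<^sup>2 \<partial>PZ) \<le> \<delta>\<^sup>2)"
proof -
  \<comment> \<open>Chosen so that \<open>\<epsilon> * L2_norm PZ F \<le> \<delta> / 2\<close>; the
    minimum keeps it within the range of the covering condition.\<close>
  define \<epsilon> where "\<epsilon> = min 1 (\<delta> / (2 * (L2_norm PZ F + 1)))"
  have nF: "0 \<le> L2_norm PZ F" by (rule L2_norm_nonneg)
  have \<epsilon>: "0 < \<epsilon>" "\<epsilon> \<le> 1" unfolding \<epsilon>_def using \<delta> nF by simp_all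
  have "\<epsilon> * L2_norm PZ F \<le> \<delta> / (2 * (L2_norm PZ F + 1)) * L2_norm PZ F"
    unfolding \<epsilon>_def using nF by (intro mult_right_mono) simp_all
  also have "\<dots> \<le> \<delta> / 2" using nF \<delta> by (simp add: field_simps)
  finally have \<epsilon>F: "\<epsilon> * L2_norm PZ F \<le> \<delta> / 2" .
  from vc.entropy[OF prob_PZ sets_PZ vc.F2 \<epsilon>] obtain C where C: "finite C" "C \<subseteq> L2_funs PZ"
    and cov: "\<forall>f\<in>Fc. \<exists>c\<in>C. L2_norm PZ (\<lambda>z. f z - c z) < \<epsilon> * L2_norm PZ F" by blast
  from bchoice[of Fc "\<lambda>f c. c \<in> C \<and> L2_norm PZ (\<lambda>z. f z - c z) < \<epsilon> * L2_norm PZ F"] cov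
  obtain c where c: "\<forall>f\<in>Fc. c f \<in> C \<and> L2_norm PZ (\<lambda>z. f z - c f z) < \<epsilon> * L2_norm PZ F" by blast
  define r where "r = (\<lambda>k. SOME g. g \<in> Fc \<and> c g = k)"
  have r: "r (c f) \<in> Fc \<and> c (r (c f)) = c f" if "f \<in> Fc" for f
    unfolding r_def by (rule someI[of "\<lambda>g. g \<in> Fc \<and> c g = c f"]) (use that in simp)
  have close: "(\<integral>z. (f z - c f z)\<^sup>2 \<partial>PZ) \<le> \<delta>\<^sup>2 / 4" if f: "f \<in> Fc" for f
  proof -
    have "L2_norm PZ (\<lambda>z. f z - c f z) \<le> \<delta> / 2" using c f \<epsilon>F by force
    from power_mono[OF this L2_norm_nonneg, of 2] show ?thesis unfolding L2_norm_square by (simp add: power_divide)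
  qed
  have sq: "integrable PZ (\<lambda>z. (f z - c f z)\<^sup>2)" if f: "f \<in> Fc" for f
  proof -
    have k: "c f \<in> borel_measurable PZ" "integrable PZ (\<lambda>z. (c f z)\<^sup>2)" using c f C(2) unfolding L2_funs_def by auto
    have ff: "f \<in> borel_measurable PZ" "integrable PZ (\<lambda>z. (f z)\<^sup>2)"
      using vc.measP[OF Fc_meas[OF f]] Fc_L2Z[OF f] unfolding L2Z_def by simp_all
    have "integrable PZ (\<lambda>z. (f z + - c f z)\<^sup>2)" by (rule square_integrable_add) (use k ff in simp_all)
    then show ?thesis by simp
  qed
  have "(\<integral>z. (f z - r (c f) z)\<^sup>2 \<partial>PZ) \<le> \<delta>\<^sup>2" if f: "f \<in> Fc" for f
  proof -
    let ?g = "r (c f)"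
    have g: "?g \<in> Fc" "c ?g = c f" using r[OF f] by simp_all
    have i: "integrable PZ (\<lambda>z. (f z - c f z)\<^sup>2)" "integrable PZ (\<lambda>z. (?g z - c f z)\<^sup>2)"
      using sq[OF f] sq[OF g(1)] unfolding g(2) by simp_all
    have "(\<integral>z. (f z - ?g z)\<^sup>2 \<partial>PZ) \<le> (\<integral>z. 2 * (f z - c f z)\<^sup>2 + 2 * (?g z - c f z)\<^sup>2 \<partial>PZ)"
    proof (rule integral_mono)
      show "integrable PZ (\<lambda>z. (f z - ?g z)\<^sup>2)" using vc.diff_integrable(2)[of "(f, ?g)"] f g(1) by simp
      show "integrable PZ (\<lambda>z. 2 * (f z - c f z)\<^sup>2 + 2 * (?g z - c f z)\<^sup>2)" using i by simp
      fix z
      have "0 \<le> ((f z - c f z) + (?g z - c f z))\<^sup>2" by simp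
      then show "(f z - ?g z)\<^sup>2 \<le> 2 * (f z - c f z)\<^sup>2 + 2 * (?g z - c f z)\<^sup>2"
        by (simp add: power2_eq_square algebra_simps)
    qed
    also have "\<dots> = 2 * (\<integral>z. (f z - c f z)\<^sup>2 \<partial>PZ) + 2 * (\<integral>z. (?g z - c ?g z)\<^sup>2 \<partial>PZ)" using i unfolding g(2) by simp
    also have "\<dots> \<le> \<delta>\<^sup>2" using close[OF f] close[OF g(1)] by linarith
    finally show ?thesis .
  qed
  moreover have "(\<lambda>f. r (c f)) ` Fc \<subseteq> Fc" using r by auto
  moreover have "finite ((\<lambda>f. r (c f)) ` Fc)" by (rule finite_subset[of _ "r ` C"]) (use c C(1) in auto)
  ultimately show ?thesis by (intro exI[of _ "\<lambda>f. r (c f)"]) simp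
qed

text \<open>The supremum over a countable family is an increasing limit of finite maxima, hence
  measurable, and dominated convergence preserves the bound on the mean. This supplies the majorant
  required by \<open>approx_process\<close>.\<close>

lemma Xp_countable_sup:
  assumes P: "countable P" "P \<subseteq> Fc \<times> Fc"
    and bound: "\<And>J. finite J \<Longrightarrow> J \<subseteq> P \<Longrightarrow> (\<integral>\<omega>. fmax J (\<lambda>p. Xp n \<omega> (fst p) - Xp n \<omega> (snd p)) \<partial>M) \<le> \<epsilon>"
  shows "\<exists>W. integrable M W \<and> (\<integral>\<omega>. W \<omega> \<partial>M) \<le> \<epsilon> \<and>
    (\<forall>\<omega>\<in>space M. \<forall>p\<in>P. \<bar>Xp n \<omega> (fst p) - Xp n \<omega> (snd p)\<bar> \<le> W \<omega>)"
proof -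
  \<comment> \<open>The intersection with \<open>P\<close> discards the default value of the
    enumeration when \<open>P\<close> is empty.\<close>
  define J where "J = (\<lambda>k::nat. from_nat_into P ` {..k} \<inter> P)"
  define d where "d = (\<lambda>p \<omega>. Xp n \<omega> (fst p) - Xp n \<omega> (snd p))"
  define Wk where "Wk = (\<lambda>k \<omega>. fmax (J k) (\<lambda>p. d p \<omega>))"
  define W where "W = (\<lambda>\<omega>. lim (\<lambda>k. Wk k \<omega>))"
  have J: "finite (J k)" "J k \<subseteq> P" "k \<le> l \<Longrightarrow> J k \<subseteq> J l" for k l unfolding J_def by auto
  have di: "integrable M (d p)" if "p \<in> P" for p
    unfolding d_def using that P(2) by (intro Bochner_Integration.integrable_diff Xp_integrable) auto
  have Wi: "integrable M (Wk k)" for k unfolding Wk_def by (intro fmax_integrable J di) (use J in blast)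
  have dE: "\<bar>d p \<omega>\<bar> \<le> 2 * Env n \<omega>" if "p \<in> P" "\<omega> \<in> space M" for p \<omega>
  proof -
    have "fst p \<in> Fc" "snd p \<in> Fc" using that P(2) by auto
    from Xp_le_Env[OF this(1) that(2), of n] Xp_le_Env[OF this(2) that(2), of n] show ?thesis unfolding d_def by linarith
  qed
  have E0: "0 \<le> 2 * Env n \<omega>" if "\<omega> \<in> space M" for \<omega>
  proof -
    obtain f where "f \<in> Fc" using ne by blast
    from Xp_le_Env[OF this that, of n] show ?thesis by linarith
  qed
  have WE: "\<bar>Wk k \<omega>\<bar> \<le> 2 * Env n \<omega>" if "\<omega> \<in> space M" for k \<omega>
  proof -
    have "Wk k \<omega> \<le> 2 * Env n \<omega>" unfolding Wk_def by (intro fmax_le J E0 that dE) (use J(2) in blast)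
    moreover have "0 \<le> Wk k \<omega>" unfolding Wk_def by (rule fmax_nonneg[OF J(1)])
    ultimately show ?thesis by simp
  qed
  have inc: "incseq (\<lambda>k. Wk k \<omega>)" for \<omega>
    unfolding Wk_def
  proof (rule incseq_SucI, rule fmax_le[OF J(1) fmax_nonneg[OF J(1)]])
    fix k p assume "p \<in> J k"
    then have "p \<in> J (Suc k)" using J(3)[of k "Suc k"] by auto
    then show "\<bar>d p \<omega>\<bar> \<le> fmax (J (Suc k)) (\<lambda>p. d p \<omega>)" by (rule fmax_ge[OF J(1)])
  qed
  have lim: "(\<lambda>k. Wk k \<omega>) \<longlonglongrightarrow> W \<omega>" if \<omega>: "\<omega> \<in> space M" for \<omega>
  proof -
    have "bdd_above (range (\<lambda>k. Wk k \<omega>))"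
      using WE[OF \<omega>] by (intro bdd_aboveI[of _ "2 * Env n \<omega>"]) (auto simp: abs_le_iff)
    from LIMSEQ_incseq_SUP[OF this inc] have "convergent (\<lambda>k. Wk k \<omega>)" by (rule convergentI)
    then show ?thesis unfolding W_def by (simp add: convergent_LIMSEQ_iff)
  qed
  have Wm: "W \<in> borel_measurable M"
    by (rule borel_measurable_LIMSEQ_real[OF lim]) (use Wi in auto)
  have Ei: "integrable M (\<lambda>\<omega>. 2 * Env n \<omega>)" using Env_integrable by simp
  have AE1: "AE \<omega> in M. (\<lambda>k. Wk k \<omega>) \<longlonglongrightarrow> W \<omega>" by (rule AE_I2) (rule lim)
  have AE2: "AE \<omega> in M. norm (Wk k \<omega>) \<le> 2 * Env n \<omega>" for k by (rule AE_I2) (simp add: WE)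
  note dc = Wm borel_measurable_integrable[OF Wi] Ei AE1 AE2
  have "(\<lambda>k. \<integral>\<omega>. Wk k \<omega> \<partial>M) \<longlonglongrightarrow> (\<integral>\<omega>. W \<omega> \<partial>M)" by (rule integral_dominated_convergence[OF dc])
  then have "(\<integral>\<omega>. W \<omega> \<partial>M) \<le> \<epsilon>"
    by (rule LIMSEQ_le_const2) (use bound[OF J(1,2)] in \<open>simp add: Wk_def d_def\<close>)
  moreover have "integrable M W" by (rule integrable_dominated_convergence[OF dc])
  moreover have "\<bar>d p \<omega>\<bar> \<le> W \<omega>" if \<omega>: "\<omega> \<in> space M" and p: "p \<in> P" for p \<omega>
  proof -
    obtain k where "from_nat_into P k = p" using from_nat_into_surj[OF P(1) p] by blast
    then have "p \<in> J k" unfolding J_def using p by auto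
    from fmax_ge[OF J(1) this, of "\<lambda>p. d p \<omega>"] have "\<bar>d p \<omega>\<bar> \<le> Wk k \<omega>" unfolding Wk_def .
    also have "\<dots> \<le> W \<omega>" by (rule incseq_le[OF inc lim[OF \<omega>]])
    finally show ?thesis .
  qed
  ultimately show ?thesis unfolding d_def by blast
qed

text \<open>The majorant controls only pairs whose first component is in the countable subclass. An
  arbitrary \<open>f\<close> is approached by such functions; its distance to the net is at most
  \<open>\<delta> / 2\<close>, strictly less than \<open>\<delta>\<close>, so the approximating
  pairs eventually belong to \<open>P\<close>.\<close>

lemma Xp_approx:
  assumes \<epsilon>: "0 < \<epsilon>"
  shows "\<exists>\<pi>. \<pi> ` Fc \<subseteq> Fc \<and> finite (\<pi> ` Fc) \<and>
    eventually (\<lambda>n. \<exists>W. integrable M W \<and> (\<integral>\<omega>. W \<omega> \<partial>M) \<le> \<epsilon> \<and>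
      (\<forall>\<omega>\<in>space M. \<forall>f\<in>Fc. \<bar>Xp n \<omega> f - Xp n \<omega> (\<pi> f)\<bar> \<le> W \<omega>)) sequentially"
proof -
  from Xp_finite_equicontinuity[OF \<epsilon>] obtain \<delta> where \<delta>: "0 < \<delta>"
    and ev: "\<forall>\<^sub>F n in sequentially. \<forall>J. finite J \<longrightarrow> J \<subseteq> Fc \<times> Fc \<longrightarrow>
    (\<forall>p\<in>J. (\<integral>z. (fst p z - snd p z)\<^sup>2 \<partial>PZ) \<le> \<delta>\<^sup>2) \<longrightarrow>
    (\<integral>\<omega>. fmax J (\<lambda>p. Xp n \<omega> (fst p) - Xp n \<omega> (snd p)) \<partial>M) \<le> \<epsilon>" by (elim exE conjE) (rule that)
  have "0 < \<delta> / 2" using \<delta> by simp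
  from totally_bounded[OF this] obtain \<pi> where \<pi>: "\<pi> ` Fc \<subseteq> Fc" "finite (\<pi> ` Fc)"
    and close: "\<forall>f\<in>Fc. (\<integral>z. (f z - \<pi> f z)\<^sup>2 \<partial>PZ) \<le> (\<delta> / 2)\<^sup>2" by (elim exE conjE) (rule that)
  from ptw obtain \<G> where G: "\<G> \<subseteq> Fc" "countable \<G>"
    and appr: "\<And>f. f \<in> Fc \<Longrightarrow> \<exists>g :: nat \<Rightarrow> 'z \<Rightarrow> real. range g \<subseteq> \<G> \<and> (\<forall>z\<in>space S. (\<lambda>m. g m z) \<longlonglongrightarrow> f z)"
    unfolding pointwise_measurable_class_def by (elim exE conjE) (rule that, assumption, assumption, blast)
  define P where "P = {p \<in> \<G> \<times> \<pi> ` Fc. (\<integral>z. (fst p z - snd p z)\<^sup>2 \<partial>PZ) \<le> \<delta>\<^sup>2}"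
  have "countable (\<G> \<times> \<pi> ` Fc)" by (rule countable_SIGMA[OF G(2)]) (rule countable_finite[OF \<pi>(2)])
  then have Pc: "countable P" by (rule countable_subset[rotated]) (auto simp: P_def)
  have PF: "P \<subseteq> Fc \<times> Fc" unfolding P_def using G(1) \<pi>(1) by auto
  have "eventually (\<lambda>n. \<exists>W. integrable M W \<and> (\<integral>\<omega>. W \<omega> \<partial>M) \<le> \<epsilon> \<and>
      (\<forall>\<omega>\<in>space M. \<forall>f\<in>Fc. \<bar>Xp n \<omega> f - Xp n \<omega> (\<pi> f)\<bar> \<le> W \<omega>)) sequentially"
    using ev
  proof eventually_elim
    fix n assume n: "\<forall>J. finite J \<longrightarrow> J \<subseteq> Fc \<times> Fc \<longrightarrow>
      (\<forall>p\<in>J. (\<integral>z. (fst p z - snd p z)\<^sup>2 \<partial>PZ) \<le> \<delta>\<^sup>2) \<longrightarrow>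
      (\<integral>\<omega>. fmax J (\<lambda>p. Xp n \<omega> (fst p) - Xp n \<omega> (snd p)) \<partial>M) \<le> \<epsilon>"
    have bd: "(\<integral>\<omega>. fmax J (\<lambda>p. Xp n \<omega> (fst p) - Xp n \<omega> (snd p)) \<partial>M) \<le> \<epsilon>" if "finite J" "J \<subseteq> P" for J
      by (rule n[rule_format, OF that(1)]) (use that(2) PF in \<open>auto simp: P_def\<close>)
    have "\<exists>W. integrable M W \<and> (\<integral>\<omega>. W \<omega> \<partial>M) \<le> \<epsilon> \<and>
      (\<forall>\<omega>\<in>space M. \<forall>p\<in>P. \<bar>Xp n \<omega> (fst p) - Xp n \<omega> (snd p)\<bar> \<le> W \<omega>)"
      by (rule Xp_countable_sup[OF Pc PF]) (rule bd)
    then obtain W where W: "integrable M W" "(\<integral>\<omega>. W \<omega> \<partial>M) \<le> \<epsilon>"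
      and WP: "\<forall>\<omega>\<in>space M. \<forall>p\<in>P. \<bar>Xp n \<omega> (fst p) - Xp n \<omega> (snd p)\<bar> \<le> W \<omega>" by (elim exE conjE) (rule that)
    have "\<bar>Xp n \<omega> f - Xp n \<omega> (\<pi> f)\<bar> \<le> W \<omega>" if \<omega>: "\<omega> \<in> space M" and f: "f \<in> Fc" for \<omega> f
    proof -
      obtain g where g: "range g \<subseteq> \<G>" "\<forall>z\<in>space S. (\<lambda>m. g m z) \<longlonglongrightarrow> f z" using appr[OF f] by blast
      have gF: "g m \<in> Fc" and gG: "g m \<in> \<G>" for m using g(1) G(1) by auto
      have pf: "\<pi> f \<in> Fc" using \<pi>(1) f by auto
      have dlim: "(\<lambda>m. \<integral>z. (g m z - \<pi> f z)\<^sup>2 \<partial>PZ) \<longlonglongrightarrow> (\<integral>z. (f z - \<pi> f z)\<^sup>2 \<partial>PZ)"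
        by (rule pointwise_limits(2)[OF gF f _ pf]) (use g(2) in blast)
      have Xlim: "(\<lambda>m. Xp n \<omega> (g m)) \<longlonglongrightarrow> Xp n \<omega> f"
        by (rule pointwise_limits(3)[OF gF f _ \<omega>]) (use g(2) in blast)
      have "(\<integral>z. (f z - \<pi> f z)\<^sup>2 \<partial>PZ) \<le> (\<delta> / 2)\<^sup>2" using close f by simp
      also have "\<dots> < \<delta>\<^sup>2" using \<delta> by (intro power_strict_mono) simp_all
      finally have "eventually (\<lambda>m. (\<integral>z. (g m z - \<pi> f z)\<^sup>2 \<partial>PZ) < \<delta>\<^sup>2) sequentially"
        by (rule order_tendstoD(2)[OF dlim])
      then have ev: "eventually (\<lambda>m. \<bar>Xp n \<omega> (g m) - Xp n \<omega> (\<pi> f)\<bar> \<le> W \<omega>) sequentially"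
      proof eventually_elim
        fix m assume "(\<integral>z. (g m z - \<pi> f z)\<^sup>2 \<partial>PZ) < \<delta>\<^sup>2"
        then have "(g m, \<pi> f) \<in> P" unfolding P_def using gG f by auto
        then show "\<bar>Xp n \<omega> (g m) - Xp n \<omega> (\<pi> f)\<bar> \<le> W \<omega>" using WP \<omega> by force
      qed
      have "(\<lambda>m. \<bar>Xp n \<omega> (g m) - Xp n \<omega> (\<pi> f)\<bar>) \<longlonglongrightarrow> \<bar>Xp n \<omega> f - Xp n \<omega> (\<pi> f)\<bar>"
        by (intro tendsto_rabs tendsto_diff tendsto_const Xlim)
      then show ?thesis by (rule tendsto_upperbound[OF _ ev]) simp
    qed
    then show "\<exists>W. integrable M W \<and> (\<integral>\<omega>. W \<omega> \<partial>M) \<le> \<epsilon> \<and>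
      (\<forall>\<omega>\<in>space M. \<forall>f\<in>Fc. \<bar>Xp n \<omega> f - Xp n \<omega> (\<pi> f)\<bar> \<le> W \<omega>)"
      using W by (intro exI[of _ W]) simp
  qed
  then show ?thesis using \<pi> by (intro exI[of _ \<pi>]) simp
qed

lemma process_eq: "f \<in> Fc \<Longrightarrow> dyadic_process M (dyad_obs U V \<tau>) Fc n \<omega> f = Xp n \<omega> f"
  unfolding dyadic_process_def Xp_def by simp

sublocale approx: approx_process M Fc "dyadic_process M (dyad_obs U V \<tau>) Fc" Kov
proof
  fix n \<omega> assume \<omega>: "\<omega> \<in> space M"
  show "dyadic_process M (dyad_obs U V \<tau>) Fc n \<omega> \<in> mspace (linf Fc)"
    unfolding mspace_linf
  proof (intro conjI exI[of _ "Env n \<omega>"] ballI)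
    show "dyadic_process M (dyad_obs U V \<tau>) Fc n \<omega> \<in> extensional Fc" unfolding dyadic_process_def by simp
    show "\<bar>dyadic_process M (dyad_obs U V \<tau>) Fc n \<omega> f\<bar> \<le> Env n \<omega>" if "f \<in> Fc" for f
      unfolding process_eq[OF that] by (rule Xp_le_Env[OF that \<omega>])
  qed
next
  fix n f assume f: "f \<in> Fc"
  show "(\<lambda>\<omega>. dyadic_process M (dyad_obs U V \<tau>) Fc n \<omega> f) \<in> borel_measurable M"
    unfolding process_eq[OF f] by (rule Xp_measurable[OF Fc_meas[OF f]])
next
  fix f assume f: "f \<in> Fc"
  show "\<exists>B. \<forall>\<^sub>F n in sequentially. integrable M (\<lambda>\<omega>. (dyadic_process M (dyad_obs U V \<tau>) Fc n \<omega> f)\<^sup>2) \<and>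
      (\<integral>\<omega>. (dyadic_process M (dyad_obs U V \<tau>) Fc n \<omega> f)\<^sup>2 \<partial>M) \<le> B"
    unfolding process_eq[OF f] by (rule Xp_second_moment[OF Fc_L2Z[OF f]])
next
  fix \<epsilon> :: real assume "0 < \<epsilon>"
  from Xp_approx[OF this] obtain \<pi> where \<pi>: "\<pi> ` Fc \<subseteq> Fc" "finite (\<pi> ` Fc)"
    and ev: "eventually (\<lambda>n. \<exists>W. integrable M W \<and> (\<integral>\<omega>. W \<omega> \<partial>M) \<le> \<epsilon> \<and>
      (\<forall>\<omega>\<in>space M. \<forall>f\<in>Fc. \<bar>Xp n \<omega> f - Xp n \<omega> (\<pi> f)\<bar> \<le> W \<omega>)) sequentially" by (elim exE conjE) (rule that)
  have eq: "(\<forall>f\<in>Fc. \<bar>dyadic_process M (dyad_obs U V \<tau>) Fc n \<omega> f - dyadic_process M (dyad_obs U V \<tau>) Fc n \<omega> (\<pi> f)\<bar> \<le> w)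
    \<longleftrightarrow> (\<forall>f\<in>Fc. \<bar>Xp n \<omega> f - Xp n \<omega> (\<pi> f)\<bar> \<le> w)" for n \<omega> w
    using \<pi>(1) by (intro ball_cong refl) (auto simp: process_eq image_subset_iff)
  show "\<exists>\<pi>. \<pi> ` Fc \<subseteq> Fc \<and> finite (\<pi> ` Fc) \<and> (\<forall>\<^sub>F n in sequentially. \<exists>W. integrable M W \<and> (\<integral>\<omega>. W \<omega> \<partial>M) \<le> \<epsilon> \<and>
      (\<forall>\<omega>\<in>space M. \<forall>f\<in>Fc. \<bar>dyadic_process M (dyad_obs U V \<tau>) Fc n \<omega> f - dyadic_process M (dyad_obs U V \<tau>) Fc n \<omega> (\<pi> f)\<bar> \<le> W \<omega>))"
    by (rule exI[of _ \<pi>]) (use \<pi> ev in \<open>simp only: eq simp_thms\<close>)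
next
  fix e :: "nat \<Rightarrow> 'z \<Rightarrow> real" assume e: "range e \<subseteq> Fc"
  then have eF: "e i \<in> Fc" for i by auto
  show "psd (\<lambda>i j. Kov (e i) (e j))" by (rule Kov_psd[OF Fc_L2Z[OF eF]])
  show "(\<lambda>n. \<integral>\<omega>. cos (\<Sum>i<k. c i * dyadic_process M (dyad_obs U V \<tau>) Fc n \<omega> (e i)) \<partial>M)
      \<longlonglongrightarrow> exp (- (\<Sum>i<k. \<Sum>j<k. c i * c j * Kov (e i) (e j)) / 2)" for c k
    unfolding process_eq[OF eF] by (rule Xp_char(1)[OF Fc_L2Z[OF eF]])
  show "(\<lambda>n. \<integral>\<omega>. sin (\<Sum>i<k. c i * dyadic_process M (dyad_obs U V \<tau>) Fc n \<omega> (e i)) \<partial>M) \<longlonglongrightarrow> 0" for c k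
    unfolding process_eq[OF eF] by (rule Xp_char(2)[OF Fc_L2Z[OF eF]])
qed (rule ne)

end

text \<open>\<open>approx_process\<close> requires a nonempty index set. Over the empty one the
  function space is a single point, and the point mass on it is the limit.\<close>

lemma empty_class_limit:
  fixes M :: "'w measure" and X :: "nat \<Rightarrow> 'w \<Rightarrow> 't \<Rightarrow> real"
  assumes M: "prob_space M" and X: "\<And>n \<omega>. X n \<omega> = (\<lambda>_. undefined)"
  shows "\<exists>(N :: ('t \<Rightarrow> real) measure) G. prob_space N \<and> tight_random_element (linf {}) N G \<and>
    gaussian_process {} N G \<and> centered_process {} N G \<and> HJ_weakly_converges (linf {}) M X N G"
proof -
  let ?u = "\<lambda>_ :: 't. undefined :: real"
  let ?B = "borel_of_metric (linf ({} :: 't set))"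
  let ?N = "return ?B ?u"
  interpret M: prob_space M by (rule M)
  have sp: "space ?B = {?u}" unfolding space_borel_of_metric by (auto simp: mspace_linf fun_eq_iff extensional_def)
  then have ms: "mspace (linf ({} :: 't set)) = {?u}" unfolding space_borel_of_metric .
  interpret N: prob_space ?N by (rule prob_space_return) (simp add: sp)
  have spN: "space ?N = {?u}" by (simp add: sp)
  have id: "(\<lambda>x. x) \<in> measurable ?N ?B" by (rule measurable_ident_sets) simp
  have "tight_random_element (linf {}) ?N (\<lambda>x. x)"
    unfolding tight_random_element_def
  proof (intro conjI id allI impI exI[of _ "{?u}"])
    fix \<epsilon> :: real assume "0 < \<epsilon>"
    show "compactin (mtopology_of (linf {})) {?u}" by (rule finite_imp_compactin) (simp_all add: ms)
    have "(\<lambda>x. x) -` {?u} \<inter> space ?N = space ?N" unfolding spN by auto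
    then show "1 - \<epsilon> \<le> measure ?N ((\<lambda>x. x) -` {?u} \<inter> space ?N)" using N.prob_space \<open>0 < \<epsilon>\<close> by (simp only:)
  qed
  moreover have "gaussian_process {} ?N (\<lambda>x. x)"
    unfolding gaussian_process_def normal_law_def by (auto simp: N.distr_const)
  moreover have "centered_process {} ?N (\<lambda>x. x)" unfolding centered_process_def by simp
  moreover have "HJ_weakly_converges (linf {}) M X ?N (\<lambda>x. x)"
    unfolding HJ_weakly_converges_def
  proof (intro conjI id allI impI ballI)
    show "X n \<omega> \<in> mspace (linf {})" for n \<omega> unfolding X ms by simp
    fix h :: "('t \<Rightarrow> real) \<Rightarrow> real"
    have o: "outer_expectation M (\<lambda>\<omega>. h (X n \<omega>)) = h ?u" for n
    proof (rule antisym)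
      show "outer_expectation M (\<lambda>\<omega>. h (X n \<omega>)) \<le> h ?u"
        using outer_expectation_le[OF M, of "\<lambda>_. h ?u" "\<lambda>\<omega>. h (X n \<omega>)" "h ?u"] by (simp add: X M.prob_space)
      show "h ?u \<le> outer_expectation M (\<lambda>\<omega>. h (X n \<omega>))"
      proof (rule outer_expectation_ge[OF M, where c="h ?u"])
        fix W assume "integrable M W" "\<And>\<omega>. \<omega> \<in> space M \<Longrightarrow> h (X n \<omega>) \<le> W \<omega>"
        then have "(\<integral>\<omega>. h ?u \<partial>M) \<le> (\<integral>\<omega>. W \<omega> \<partial>M)" unfolding X by (intro integral_mono) simp_all
        then show "h ?u \<le> (\<integral>\<omega>. W \<omega> \<partial>M)" by (simp add: M.prob_space)
      qed (simp add: X)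
    qed
    have "(\<integral>x. h x \<partial>?N) = (\<integral>x. h ?u \<partial>?N)" by (rule Bochner_Integration.integral_cong[OF refl]) (simp add: sp)
    also have "\<dots> = h ?u" using N.prob_space by simp
    finally show "(\<lambda>n. outer_expectation M (\<lambda>\<omega>. h (X n \<omega>))) \<longlonglongrightarrow> (\<integral>x. h x \<partial>?N)"
      unfolding o by (simp only: tendsto_const)
  qed
  ultimately show ?thesis using N.prob_space_axioms by blast
qed

theorem lemma3:
  fixes M :: "'w measure" and SU :: "'u measure" and SV :: "'v measure"
    and U :: "nat \<Rightarrow> 'w \<Rightarrow> 'u" and V :: "nat \<Rightarrow> nat \<Rightarrow> 'w \<Rightarrow> 'v"
    and \<tau> :: "'u \<Rightarrow> 'u \<Rightarrow> 'v \<Rightarrow> real \<times> (real^'d)" and lo hi :: "real^'d"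
    and Z :: "nat \<Rightarrow> nat \<Rightarrow> 'w \<Rightarrow> real \<times> (real^'d)"
    and \<F> :: "(real \<times> (real^'d) \<Rightarrow> real) set" and F :: "real \<times> (real^'d) \<Rightarrow> real"
  assumes "dyadic_sampling M SU SV U V \<tau> lo hi"
    and "Z = dyad_obs U V \<tau>"
    and "\<F> \<subseteq> borel_measurable (obs_space lo hi)"
    and "pointwise_measurable_class (obs_space lo hi) \<F>"
    and "VC_type (obs_space lo hi) \<F> F"
    and "integrable M (\<lambda>\<omega>. (F (Z 1 2 \<omega>))\<^sup>2)"
  shows "\<exists>(N :: ((real \<times> (real^'d) \<Rightarrow> real) \<Rightarrow> real) measure) G.
    prob_space N \<and>
    tight_random_element (linf \<F>) N G \<and>
    gaussian_process \<F> N G \<and>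
    centered_process \<F> N G \<and>
    (\<forall>f\<in>\<F>. \<forall>g\<in>\<F>.
       (\<integral>\<omega>. G \<omega> f * G \<omega> g \<partial>N) =
       4 * covariance M (cond_exp_given M SU (U 1) (\<lambda>\<omega>. f (Z 1 2 \<omega>)))
                        (cond_exp_given M SU (U 1) (\<lambda>\<omega>. g (Z 1 2 \<omega>)))) \<and>
    HJ_weakly_converges (linf \<F>) M (dyadic_process M Z \<F>) N G"
proof -
  let ?S = "obs_space lo hi"
  note ds = assms(1)[unfolded dyadic_sampling_def]
  have M: "prob_space M" using ds by blast
  interpret dyadic M SU SV ?S U V \<tau>
  proof (rule dyadic.intro[OF M], unfold_locales)
    show "U i \<in> measurable M SU" if "1 \<le> i" for i using ds that by blast
    show "V i j \<in> measurable M SV" if "1 \<le> i" "i < j" for i j using ds that unfolding dyad_index_def by blast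
    show "distr M SU (U i) = distr M SU (U 1)" if "1 \<le> i" for i using ds that by blast
    show "distr M SV (V i j) = distr M SV (V 1 2)" if "1 \<le> i" "i < j" for i j using ds that unfolding dyad_index_def by blast
    show "prob_space.indep_sets M (variable_events M SU SV U V) (Inl ` {1..} \<union> Inr ` dyad_index)" using ds by blast
    show "(\<lambda>(u, u', v). \<tau> u u' v) \<in> measurable (SU \<Otimes>\<^sub>M SU \<Otimes>\<^sub>M SV) ?S" using ds by blast
    show "\<tau> u u' v = \<tau> u' u v" if "u \<in> space SU" "u' \<in> space SU" "v \<in> space SV" for u u' v using ds that by blast
  qed
  show ?thesis
  proof (cases "\<F> = {}")
    case True
    have X: "dyadic_process M Z \<F> n \<omega> = (\<lambda>_. undefined)" for n \<omega>
      unfolding dyadic_process_def True by (simp add: fun_eq_iff)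
    from empty_class_limit[where X="dyadic_process M Z \<F>", OF M X]
    show ?thesis unfolding True by simp
  next
    case False
    from VC_type_entropy[OF assms(5) False assms(3)] obtain C0 where C0: "1 \<le> C0" and
      ent: "\<forall>Q \<epsilon>. prob_space Q \<longrightarrow> sets Q = sets ?S \<longrightarrow> integrable Q (\<lambda>z. (F z + 1)\<^sup>2) \<longrightarrow> 0 < \<epsilon> \<longrightarrow> \<epsilon> \<le> 1 \<longrightarrow>
      (\<exists>C. finite C \<and> real (card C) \<le> exp (C0 / \<epsilon>) \<and> C \<subseteq> L2_funs Q \<and>
        (\<forall>f\<in>\<F>. \<exists>c\<in>C. L2_norm Q (\<lambda>z. f z - c z) < \<epsilon> * L2_norm Q (\<lambda>z. F z + 1)))"
      by (elim exE conjE) (rule that)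
    have Fm: "F \<in> borel_measurable ?S" and env: "\<And>f z. f \<in> \<F> \<Longrightarrow> z \<in> space ?S \<Longrightarrow> \<bar>f z\<bar> \<le> F z"
      using assms(5) unfolding VC_type_def by blast+
    obtain f0 where f0: "f0 \<in> \<F>" using False by blast
    have F0: "0 \<le> F z" if "z \<in> space ?S" for z using env[OF f0 that] by linarith
    have FZ: "F \<in> borel_measurable PZ" using Fm by (simp cong: measurable_cong_sets add: sets_PZ)
    \<comment> \<open>The moment hypothesis speaks of the observation on \<open>M\<close>; here it
      is moved to the law \<open>PZ\<close>.\<close>
    have "integrable PZ (\<lambda>z. (F z)\<^sup>2)"
    proof -
      have Z: "Zs 1 2 \<in> measurable M ?S" and law: "distr M ?S (Zs 1 2) = PZ" by (rule Zs_meas law_Zs; simp)+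
      have m: "(\<lambda>z. (F z)\<^sup>2) \<in> borel_measurable ?S" using Fm by measurable
      show ?thesis
        unfolding law[symmetric] integrable_distr_eq[OF Z m] using assms(6) unfolding assms(2) by (simp add: Zs_eq_dyad_obs)
    qed
    then have F2: "integrable PZ (\<lambda>z. (F z + 1)\<^sup>2)"
      using prob_PZ FZ by (intro square_integrable_add) (simp_all add: finite_measure.integrable_const prob_space_def)
    \<comment> \<open>\<open>F\<close> is nonnegative because it dominates a member of the class, so
      the raised envelope is at least 1, as \<open>vc_class\<close> demands.\<close>
    interpret dyadic_class M SU SV ?S U V \<tau> \<F> "\<lambda>z. F z + 1" C0
    proof (rule dyadic_class.intro[OF dyadic_axioms], rule dyadic_class_axioms.intro)
      show "vc_class ?S PZ \<F> (\<lambda>z. F z + 1) C0"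
      proof (rule vc_class.intro)
        show "prob_space PZ" by (rule prob_PZ)
        show "sets PZ = sets ?S" by (rule sets_PZ)
        show "\<F> \<subseteq> borel_measurable ?S" by (rule assms(3))
        show "(\<lambda>z. F z + 1) \<in> borel_measurable ?S" using Fm by measurable
        show "1 \<le> F z + 1" if "z \<in> space ?S" for z using F0[OF that] by simp
        show "\<bar>f z\<bar> \<le> F z + 1" if "f \<in> \<F>" "z \<in> space ?S" for f z using env[OF that] by simp
        show "1 \<le> C0" by (rule C0)
        show "integrable PZ (\<lambda>z. (F z + 1)\<^sup>2)" by (rule F2)
      qed (rule ent[rule_format])
    qed (use assms(4) False in simp_all)
    show ?thesis
      using approx.tight_gaussian_limit Kov_eq_covariance[OF Fc_L2Z Fc_L2Z] unfolding assms(2)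
      by (elim exE) (rule exI, rule exI, simp)
  qed
qed

end
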